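(* Let $k_G$ denote Grothendieck's constant. For all ordinals $\zeta<\xi<\omega_1$, $$\max\bigl\{\mathbf{s}_\xi(C_0(\omega^{\omega^\xi})\widehat{\otimes}_\pi C_0(\omega^{\omega^\zeta})),\ \mathbf{g}_{\xi,1+\zeta}(C_0(\omega^{\omega^\xi})\widehat{\otimes}_\pi C_0(\omega^{\omega^\zeta}))\bigr\}\leqslant k_G,$$ and for every ordinal $\xi<\omega_1$, $$\max\bigl\{\mathbf{s}_\xi(C_0(\omega^{\omega^\xi})\widehat{\otimes}_\pi C_0(\omega^{\omega^\xi})),\ \mathbf{g}_{\xi,1+\xi}(C_0(\omega^{\omega^\xi})\widehat{\otimes}_\pi C_0(\omega^{\omega^\xi}))\bigr\}\leqslant 2k_G.$$
   Context: General notation. $\mathbb{N}=\{1,2,\ldots\}$; $\omega_1$ is the first uncountable ordinal. Banach spaces are over $\mathbb{K}\in\{\mathbb{R},\mathbb{C}\}$; $B_X$ is the closed unit ball of $X$; operators are bounded and linear; $I_U$ is the identity of $U$. $[\mathbb{N}]^{<\omega}$ (resp. $[\mathbb{N}]$) is the set of finite (resp. infinite) subsets of $\mathbb{N}$; for $L\in[\mathbb{N}]$, $[L]^{<\omega}$ and $[L]$ are the finite and infinite subsets of $L$. Subsets of $\mathbb{N}$ are identified with strictly increasing sequences. $E\preceq F$ means $E$ is an initial segment of $F$, $E\prec F$ that it is a proper one. $E<F$ means $E=\varnothing$ or $F=\varnothing$ or $\max E<\min F$; $E<n$ means $E<\{n\}$ and $n\leqslant E$ means $n\leqslant\min E$.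 $E\frown F$ is concatenation. Schreier families. $\mathcal{S}_0=\{\varnothing\}\cup\{\{n\}:n\in\mathbb{N}\}$; $\mathcal{S}_{\xi+1}=\{\varnothing\}\cup\{\bigcup_{n=1}^mE_n:E_1<\cdots<E_m,\ \varnothing\neq E_n\in\mathcal{S}_\xi,\ m\leqslant E_1\}$; for each countable limit ordinal $\xi$ a sequence $\xi_n\uparrow\xi$ (the characteristic sequence of $\xi$) with $\mathcal{S}_{\xi_n+1}\subset\mathcal{S}_{\xi_{n+1}}$ for all $n$ is fixed, and $\mathcal{S}_\xi=\{\varnothing\}\cup\{E\neq\varnothing:E\in\mathcal{S}_{\xi_{\min E}+1}\}$. For $\xi,\zeta<\omega_1$, $\mathcal{S}_\zeta[\mathcal{S}_\xi]=\{\varnothing\}\cup\{\bigcup_{n=1}^mE_n:E_1<\cdots<E_m,\ \varnothing\neq E_n\in\mathcal{S}_\xi,\ (\min E_n)_{n=1}^m\in\mathcal{S}_\zeta\}$; one has $\mathcal{S}_{\zeta+1}[\mathcal{S}_\xi]=\mathcal{S}_1[\mathcal{S}_\zeta[\mathcal{S}_\xi]]$ (same formula as $\mathcal{S}_{\xi+1}$ with $\mathcal{S}_\zeta[\mathcal{S}_\xi]$ in place of $\mathcal{S}_\xi$). $MAX(\cdot)$ is the set of $\preceq$-maximal (equivalently, inclusion-maximal) members. For $\mathcal{F}=\mathcal{S}_\xi$ or $\mathcal{S}_\zeta[\mathcal{S}_\xi]$: every $M\in[\mathbb{N}]$ is uniquely $M=\bigcup_kF_k$ with $F_1<F_2<\cdots$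 in $MAX(\mathcal{F})$, and every non-empty finite $E$ is uniquely $E=\bigcup_{n=1}^lF_n$ with $F_1<\cdots<F_l$, $F_n\in MAX(\mathcal{F})$ for $n<l$, $\varnothing\ne F_l\in\mathcal{F}$ (the $\mathcal{F}$-decomposition). Write $M|_{\xi,n}$ (resp. $M|_{\xi,\zeta,n}$) for the union of the first $n$ sets of the $\mathcal{S}_\xi$- (resp. $\mathcal{S}_\zeta[\mathcal{S}_\xi]$-) decomposition of $M$, with $M|_{\xi,0}=M|_{\xi,\zeta,0}=\varnothing$. Weights. $p^0_E=1$ for $\varnothing\ne E\in\mathcal{S}_0$; if $\varnothing\neq E\in\mathcal{S}_{\xi+1}$ has $\mathcal{S}_\xi$-decomposition $F_1<\cdots<F_l$, $p^{\xi+1}_E=p^\xi_{F_l}/\min E$; for $\xi$ limit and $\varnothing\neq E\in\mathcal{S}_\xi$, $p^\xi_E=p^{\xi_{\min E}+1}_E$. For arbitrary non-empty finite $E$ with $\mathcal{S}_\xi$-decomposition $E_1<\cdots<E_n$, $p^\xi_E=p^\xi_{E_n}$. Next, $q^{\xi,0}_E=1$ for $\varnothing\neq E\in\mathcal{S}_\xi$; if $\varnothing\neq E\in\mathcal{S}_{\zeta+1}[\mathcal{S}_\xi]$ has $\mathcal{S}_\zeta[\mathcal{S}_\xi]$-decomposition $F_1<\cdots<F_l$, $q^{\xi,\zeta+1}_E=q^{\xi,\zeta}_{F_l}/\sqrt{\min E}$; for $\zeta$ limit with characteristic sequence $(\zeta_n)$ and $\varnothing\neq E\in\mathcal{S}_\zeta[\mathcal{S}_\xi]$,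 $q^{\xi,\zeta}_E=q^{\xi,\zeta_{\min E}+1}_E$. For arbitrary non-empty finite $E$ with $\mathcal{S}_\zeta[\mathcal{S}_\xi]$-decomposition $F_1<\cdots<F_l$, $q^{\xi,\zeta}_E=q^{\xi,\zeta}_{F_l}$. Averages. A collection $\mathbf{u}=(u_E)_{E\in[\mathbb{N}]^{<\omega}\setminus\{\varnothing\}}$ in a Banach space $U$ is weakly null if for each $E\in[\mathbb{N}]^{<\omega}$ the sequence $(u_{E\frown(k)})_{k>E}$ is weakly null. For $M\in[\mathbb{N}]$, $n\in\mathbb{N}$, $\mathbb{E}_{\xi,M}\mathbf{u}(n)=\sum_{M|_{\xi,n-1}\prec E\preceq M|_{\xi,n}}p^\xi_Eu_E$ and $\mathbb{E}^{(2)}_{\xi,\zeta,M}\mathbf{u}(n)=\sum_{M|_{\xi,\zeta,n-1}\prec E\preceq M|_{\xi,\zeta,n}}q^{\xi,\zeta}_Ep^\xi_Eu_E$; $\mathbb{E}_{\xi,M}\mathbf{u}$ and $\mathbb{E}^{(2)}_{\xi,\zeta,M}\mathbf{u}$ are the corresponding sequences, and $A\mathbb{E}_{\xi,M}\mathbf{u}$, $A\mathbb{E}^{(2)}_{\xi,\zeta,M}\mathbf{u}$ their termwise images under an operator $A$. For a sequence $(e_i)$ in a Banach space $E$, $\|(e_i)\|^w_p=\sup_{e^*\in B_{E^*}}(\sum_i|\langle e^*,e_i\rangle|^p)^{1/p}$. Properties. An operator $A:U\to V$ has the $\gamma$-$S_\xi$ Property ($\gamma\geqslant0$) if for every weakly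 null collection $\mathbf{u}$ in $B_U$ and every $L\in[\mathbb{N}]$ there is $M\in[L]$ with $\|A\mathbb{E}_{\xi,M}\mathbf{u}\|_2^w\leqslant\gamma$; it has the $\gamma$-$G_{\xi,\zeta}$ Property if for all such $\mathbf{u},L$ there is $M\in[L]$ with $\|A\mathbb{E}^{(2)}_{\xi,\zeta,M}\mathbf{u}\|_1^w\leqslant\gamma$. $\mathbf{s}_\xi(A)$ (resp. $\mathbf{g}_{\xi,\zeta}(A)$) is the infimum of those $\gamma\geqslant 0$ for which $A$ has the $\gamma$-$S_\xi$ (resp. $\gamma$-$G_{\xi,\zeta}$) Property, and $\infty$ if there is none. For a Banach space $U$, $\mathbf{s}_\xi(U)=\mathbf{s}_\xi(I_U)$ and $\mathbf{g}_{\xi,\zeta}(U)=\mathbf{g}_{\xi,\zeta}(I_U)$. Function spaces. $C(\alpha)$ is the sup-normed space of continuous scalar functions on the ordinal interval $[0,\alpha]$ (order topology); $C_0(\omega^{\omega^\xi})=\{f\in C(\omega^{\omega^\xi}):f(\omega^{\omega^\xi})=0\}$. $\widehat{\otimes}_\pi$ is the completed projective tensor product. $k_G$ is Grothendieck's constant for the scalar field $\mathbb{K}$; it has the property that if $(f_n)$ in $B_{C(K)}$ satisfies $\|(f_n)\|_2^w\leqslant1$, then for every $(g_n)$ in $B_{C(L)}$ the weakly $2$-summing norm of $(f_n\otimes g_n)$ in $C(K)\widehat{\otimes}_\pi C(L)$ is at most $k_G$ ($K,L$ compact Hausdorff). *)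

theory Defs
  imports "HOL-Analysis.Analysis" "HOL-Algebra.Module" "HOL-Library.Countable_Set_Type"
begin

section \<open>Countable ordinals\<close>

text \<open>
  The library well-order \<^term>\<open>cardSuc natLeq\<close> has order type \<open>\<omega>\<^sub>1\<close>, so the elements of its field
  serve as the ordinals below \<open>\<omega>\<^sub>1\<close>.
\<close>

typedef omega1 = "Field (cardSuc natLeq)"
proof -
  have "infinite (Field (cardSuc natLeq))"
    using cardSuc_finite[OF natLeq_Card_order] Field_natLeq by simp
  then show ?thesis
    by (metis ex_in_conv finite.emptyI)
qed

lemma Well_order_omega1: "Well_order (cardSuc natLeq)"
  using cardSuc_Card_order[OF natLeq_Card_order] card_order_on_well_order_on by blast

instantiation omega1 :: linorder
begin

definition less_eq_omega1 :: "omega1 \<Rightarrow> omega1 \<Rightarrow> bool" where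
  "\<xi> \<le> \<eta> \<longleftrightarrow> (Rep_omega1 \<xi>, Rep_omega1 \<eta>) \<in> cardSuc natLeq"

definition less_omega1 :: "omega1 \<Rightarrow> omega1 \<Rightarrow> bool" where
  "\<xi> < \<eta> \<longleftrightarrow> \<xi> \<le> \<eta> \<and> \<not> \<eta> \<le> (\<xi> :: omega1)"

instance
proof
  have wo: "wo_rel (cardSuc natLeq)"
    using Well_order_omega1 by (simp add: wo_rel_def)
  fix x y z :: omega1
  show "x \<le> x"
    using wo_rel.REFL[OF wo] Rep_omega1 unfolding refl_on_def less_eq_omega1_def by blast
  show "x \<le> y \<Longrightarrow> y \<le> z \<Longrightarrow> x \<le> z"
    using wo_rel.TRANS[OF wo] unfolding trans_def less_eq_omega1_def by blast
  show "x \<le> y \<Longrightarrow> y \<le> x \<Longrightarrow> x = y"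
    using wo_rel.ANTISYM[OF wo] unfolding antisym_def less_eq_omega1_def
    by (metis Rep_omega1_inject)
  show "x \<le> y \<or> y \<le> x"
    using wo_rel.TOTALS[OF wo] Rep_omega1 unfolding less_eq_omega1_def by blast
qed (simp add: less_omega1_def)

end

instance omega1 :: wellorder
proof
  fix P :: "omega1 \<Rightarrow> bool" and a
  assume step: "\<And>x. (\<And>y. y < x \<Longrightarrow> P y) \<Longrightarrow> P x"
  have "wf (cardSuc natLeq - Id)"
    using Well_order_omega1 by (simp add: well_order_on_def)
  then have wf: "wf (inv_image (cardSuc natLeq - Id) Rep_omega1)"
    by (rule wf_inv_image)
  have "{(x, y). x < y} \<subseteq> inv_image (cardSuc natLeq - Id) Rep_omega1"
    unfolding less_omega1_def less_eq_omega1_def by auto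
  then have "wf {(x :: omega1, y). x < y}"
    using wf wf_subset by blast
  then show "P a"
    by (induction a rule: wf_induct_rule) (use step in auto)
qed

text \<open>The order topology. Each interval \<open>[0,\<alpha>]\<close> is convex, so that its order topology
  is the subspace topology of \<^term>\<open>{..\<alpha>}\<close>.\<close>

instantiation omega1 :: linorder_topology
begin

definition open_omega1 :: "omega1 set \<Rightarrow> bool" where
  "open_omega1 = generate_topology (range (\<lambda>a. {..<a}) \<union> range (\<lambda>a. {a<..}))"

instance
  by standard (rule open_omega1_def)

end

lemma uncountable_omega1: "uncountable (UNIV :: omega1 set)"
proof
  include cardinal_syntax
  assume "countable (UNIV :: omega1 set)"
  then have "countable (range Rep_omega1)"
    by simp
  then have "countable (Field (cardSuc natLeq))"
    by (metis type_definition.Rep_range type_definition_omega1)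
  then have "|Field (cardSuc natLeq)| \<le>o natLeq"
    by (simp add: countable_card_le_natLeq)
  moreover have "natLeq <o cardSuc natLeq"
    by (rule cardSuc_greater[OF natLeq_Card_order])
  ultimately show False
    using card_of_Field_ordIso[OF cardSuc_Card_order[OF natLeq_Card_order]]
    by (meson not_ordLess_ordLeq ordIso_ordLeq_trans ordIso_symmetric)
qed

lemma countable_lessThan_omega1: "countable {..<\<xi> :: omega1}"
proof -
  include cardinal_syntax
  let ?r = "cardSuc natLeq"
  have "Rep_omega1 ` {..<\<xi>} \<subseteq> underS ?r (Rep_omega1 \<xi>)"
    by (auto simp: underS_def less_omega1_def less_eq_omega1_def Rep_omega1_inject)
  moreover have "|underS ?r (Rep_omega1 \<xi>)| <o ?r"
    by (rule card_of_underS[OF cardSuc_Card_order[OF natLeq_Card_order] Rep_omega1])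
  then have "|underS ?r (Rep_omega1 \<xi>)| \<le>o natLeq"
    using cardSuc_ordLess_ordLeq[OF natLeq_Card_order card_of_Card_order]
      cardSuc_ordLeq_ordLess[OF natLeq_Card_order card_of_Card_order] by blast
  then have "countable (underS ?r (Rep_omega1 \<xi>))"
    by (simp add: countable_card_le_natLeq)
  ultimately have "countable (Rep_omega1 ` {..<\<xi>})"
    using countable_subset by blast
  then show ?thesis
    by (rule countable_image_inj_on) (simp add: inj_on_def Rep_omega1_inject)
qed

lemma countable_bounded_omega1:
  assumes "countable (A :: omega1 set)"
  shows "\<exists>\<beta>. \<forall>\<alpha>\<in>A. \<alpha> < \<beta>"
proof (rule ccontr)
  assume "\<not> ?thesis"
  then have "\<forall>\<beta>. \<exists>\<alpha>\<in>A. \<beta> \<le> \<alpha>"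
    by (meson not_le)
  then have "UNIV = (\<Union>\<alpha>\<in>A. {..\<alpha>})"
    by (simp add: set_eq_iff Bex_def)
  moreover have "countable {..\<alpha>}" for \<alpha> :: omega1
    using countable_lessThan_omega1[of \<alpha>] by (simp add: ivl_disj_un_singleton(2)[symmetric])
  then have "countable (\<Union>\<alpha>\<in>A. {..\<alpha>})"
    using assms by simp
  ultimately show False
    using uncountable_omega1 by simp
qed

definition osuc :: "omega1 \<Rightarrow> omega1" where
  "osuc \<xi> = (LEAST \<eta>. \<xi> < \<eta>)"

definition osup :: "omega1 set \<Rightarrow> omega1" where
  "osup A = (LEAST \<beta>. \<forall>\<alpha>\<in>A. \<alpha> \<le> \<beta>)"

instantiation omega1 :: zero_neq_one
begin

definition zero_omega1 :: omega1 where "0 = (LEAST \<xi> :: omega1. True)"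
definition one_omega1 :: omega1 where "1 = osuc 0"

instance
proof
  have "\<exists>\<beta>. 0 < (\<beta> :: omega1)"
    using countable_bounded_omega1[of "{0}"] by auto
  then have "0 < osuc 0"
    unfolding osuc_def by (meson LeastI_ex)
  then show "0 \<noteq> (1 :: omega1)"
    by (simp add: one_omega1_def)
qed

end

lemma omega1_zero_le [simp]: "0 \<le> (\<xi> :: omega1)"
  by (simp add: zero_omega1_def Least_le)

lemma less_osuc [simp]: "\<xi> < osuc \<xi>"
  unfolding osuc_def using countable_bounded_omega1[of "{\<xi>}"] by (auto intro: LeastI_ex)

lemma osuc_le_iff: "osuc \<xi> \<le> \<eta> \<longleftrightarrow> \<xi> < \<eta>"
proof
  show "osuc \<xi> \<le> \<eta> \<Longrightarrow> \<xi> < \<eta>"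
    using less_osuc less_le_trans by blast
  show "\<xi> < \<eta> \<Longrightarrow> osuc \<xi> \<le> \<eta>"
    unfolding osuc_def by (rule Least_le)
qed

lemma osuc_inject [simp]: "osuc \<xi> = osuc \<eta> \<longleftrightarrow> \<xi> = \<eta>"
  by (metis less_osuc not_less_iff_gr_or_eq osuc_le_iff order_less_le_trans)

lemma osuc_neq_zero [simp]: "osuc \<xi> \<noteq> 0"
  by (metis less_osuc not_le omega1_zero_le)

lemma osup_upper: "countable A \<Longrightarrow> \<alpha> \<in> A \<Longrightarrow> \<alpha> \<le> osup A"
  unfolding osup_def
  by (rule LeastI2_ex) (use countable_bounded_omega1[of A] less_imp_le in blast, blast)

lemma osup_least: "(\<And>\<alpha>. \<alpha> \<in> A \<Longrightarrow> \<alpha> \<le> \<beta>) \<Longrightarrow> osup A \<le> \<beta>"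
  unfolding osup_def by (rule Least_le) blast

definition is_succ :: "omega1 \<Rightarrow> bool" where
  "is_succ \<xi> \<longleftrightarrow> (\<exists>\<eta>. \<xi> = osuc \<eta>)"

definition is_limit :: "omega1 \<Rightarrow> bool" where
  "is_limit \<xi> \<longleftrightarrow> \<xi> \<noteq> 0 \<and> \<not> is_succ \<xi>"

definition opred :: "omega1 \<Rightarrow> omega1" where
  "opred \<xi> = (THE \<eta>. \<xi> = osuc \<eta>)"

lemma opred_osuc [simp]: "opred (osuc \<xi>) = \<xi>"
  by (simp add: opred_def)

lemma is_succ_osuc [simp]: "is_succ (osuc \<xi>)"
  by (auto simp: is_succ_def)

lemma not_is_succ_zero [simp]: "\<not> is_succ 0"
  by (metis is_succ_def osuc_neq_zero)

text \<open>Transfinite recursion: \<open>z\<close> is the value at \<open>0\<close>, \<open>s \<eta>\<close> maps the value at \<open>\<eta>\<close> to the value at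
  \<open>\<eta> + 1\<close>, and \<open>l \<xi>\<close> maps the family of values below a limit \<open>\<xi>\<close> to the value at \<open>\<xi>\<close>.\<close>

function omega1_rec ::
  "'a \<Rightarrow> (omega1 \<Rightarrow> 'a \<Rightarrow> 'a) \<Rightarrow> (omega1 \<Rightarrow> (omega1 \<Rightarrow> 'a) \<Rightarrow> 'a) \<Rightarrow> omega1 \<Rightarrow> 'a" where
  "omega1_rec z s l \<xi> =
    (if \<xi> = 0 then z
     else if is_succ \<xi> then s (opred \<xi>) (omega1_rec z s l (opred \<xi>))
     else l \<xi> (\<lambda>\<eta>. if \<eta> < \<xi> then omega1_rec z s l \<eta> else undefined))"
  by pat_completeness auto
termination
  by (relation "inv_image {(x, y). x < y} (\<lambda>(z, s, l, \<xi>). \<xi>)") (auto simp: is_succ_def wf)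

declare omega1_rec.simps [simp del]

lemma omega1_rec_zero [simp]: "omega1_rec z s l 0 = z"
  by (simp add: omega1_rec.simps)

lemma omega1_rec_osuc [simp]: "omega1_rec z s l (osuc \<xi>) = s \<xi> (omega1_rec z s l \<xi>)"
  by (subst omega1_rec.simps) simp

lemma omega1_rec_limit:
  "is_limit \<xi> \<Longrightarrow>
    omega1_rec z s l \<xi> = l \<xi> (\<lambda>\<eta>. if \<eta> < \<xi> then omega1_rec z s l \<eta> else undefined)"
  by (subst omega1_rec.simps) (simp add: is_limit_def)

instantiation omega1 :: "{plus, times}"
begin

definition plus_omega1 :: "omega1 \<Rightarrow> omega1 \<Rightarrow> omega1" where
  "\<alpha> + \<beta> = omega1_rec \<alpha> (\<lambda>_. osuc) (\<lambda>\<xi> f. osup (f ` {..<\<xi>})) \<beta>"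

definition times_omega1 :: "omega1 \<Rightarrow> omega1 \<Rightarrow> omega1" where
  "\<alpha> * \<beta> = omega1_rec 0 (\<lambda>_ \<gamma>. \<gamma> + \<alpha>) (\<lambda>\<xi> f. osup (f ` {..<\<xi>})) \<beta>"

instance ..

end

text \<open>Ordinal exponentiation; only used for bases \<open>\<alpha> \<ge> 1\<close>, where the supremum clause is the
  usual one.\<close>

definition opow :: "omega1 \<Rightarrow> omega1 \<Rightarrow> omega1" where
  "opow \<alpha> \<beta> = omega1_rec 1 (\<lambda>_ \<gamma>. \<gamma> * \<alpha>) (\<lambda>\<xi> f. osup (f ` {..<\<xi>})) \<beta>"

definition omega :: omega1 where
  "omega = (LEAST \<xi>. is_limit \<xi>)"

lemma plus_omega1_simps:
  fixes \<alpha> \<beta> :: omega1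
  shows "\<alpha> + 0 = \<alpha>" "\<alpha> + osuc \<beta> = osuc (\<alpha> + \<beta>)"
    "is_limit \<beta> \<Longrightarrow> \<alpha> + \<beta> = osup ((\<lambda>\<eta>. \<alpha> + \<eta>) ` {..<\<beta>})"
  by (simp_all add: plus_omega1_def omega1_rec_limit cong: image_cong_simp)

lemma times_omega1_simps:
  fixes \<alpha> \<beta> :: omega1
  shows "\<alpha> * 0 = 0" "\<alpha> * osuc \<beta> = \<alpha> * \<beta> + \<alpha>"
    "is_limit \<beta> \<Longrightarrow> \<alpha> * \<beta> = osup ((\<lambda>\<eta>. \<alpha> * \<eta>) ` {..<\<beta>})"
  by (simp_all add: times_omega1_def omega1_rec_limit cong: image_cong_simp)

lemma opow_simps:
  "opow \<alpha> 0 = 1" "opow \<alpha> (osuc \<beta>) = opow \<alpha> \<beta> * \<alpha>"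
  "is_limit \<beta> \<Longrightarrow> opow \<alpha> \<beta> = osup (opow \<alpha> ` {..<\<beta>})"
  by (simp_all add: opow_def omega1_rec_limit cong: image_cong_simp)

lemma is_limit_omega: "is_limit omega"
proof -
  have "\<exists>\<xi>. is_limit \<xi>"
  proof (rule ccontr)
    assume none: "\<not> ?thesis"
    have "\<xi> \<in> range (\<lambda>n. (osuc ^^ n) 0)" for \<xi>
    proof (induction \<xi> rule: less_induct)
      case (less \<xi>)
      consider "\<xi> = 0" | \<eta> where "\<xi> = osuc \<eta>"
        using none by (auto simp: is_limit_def is_succ_def)
      then show ?case
      proof cases
        case 1
        then show ?thesis by (metis funpow_0 rangeI)
      next
        case 2
        then obtain n where "\<eta> = (osuc ^^ n) 0"
          using less[of \<eta>] by auto
        then have "\<xi> = (osuc ^^ Suc n) 0"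
          using 2 by simp
        then show ?thesis by blast
      qed
    qed
    then have "UNIV = range (\<lambda>n. (osuc ^^ n) 0)"
      by blast
    then show False
      using uncountable_omega1 by (metis countableI_type countable_image)
  qed
  then show ?thesis
    unfolding omega_def by (rule LeastI_ex)
qed

section \<open>Schreier families\<close>

text \<open>
  Subsets of \<open>\<nat> = {1,2,\<dots>}\<close> are sets of type \<^typ>\<open>nat set\<close> not containing \<open>0\<close>; likewise all
  sequences \<open>nat \<Rightarrow> _\<close> below are indexed from \<open>1\<close>, their value at \<open>0\<close> being irrelevant.
\<close>

definition fin_subsets :: "nat set \<Rightarrow> nat set set" where
  "fin_subsets L = {E. E \<subseteq> L \<and> finite E}"

definition inf_subsets :: "nat set \<Rightarrow> nat set set" where
  "inf_subsets L = {M. M \<subseteq> L \<and> infinite M}"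

definition set_less :: "nat set \<Rightarrow> nat set \<Rightarrow> bool" where
  "set_less E F \<longleftrightarrow> (\<forall>i\<in>E. \<forall>j\<in>F. i < j)"

definition init_seg :: "nat set \<Rightarrow> nat set \<Rightarrow> bool" where
  "init_seg E F \<longleftrightarrow> E \<subseteq> F \<and> (\<forall>i\<in>E. \<forall>j\<in>F. j \<le> i \<longrightarrow> j \<in> E)"

definition block_lists :: "nat set set \<Rightarrow> nat set list set" where
  "block_lists \<F> = {Es. Es \<noteq> [] \<and> sorted_wrt set_less Es \<and> (\<forall>E\<in>set Es. E \<noteq> {} \<and> E \<in> \<F>)}"

definition schreier_step :: "nat set set \<Rightarrow> nat set set" where
  "schreier_step \<F> = {{}} \<union> {\<Union>(set Es) |Es. Es \<in> block_lists \<F> \<and> length Es \<le> Min (hd Es)}"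

definition schreier :: "(omega1 \<Rightarrow> nat \<Rightarrow> omega1) \<Rightarrow> omega1 \<Rightarrow> nat set set" where
  "schreier cs =
    omega1_rec ({{}} \<union> {{n} |n. 1 \<le> n}) (\<lambda>_. schreier_step)
      (\<lambda>\<xi> S. {{}} \<union> {E \<in> fin_subsets {1..}. E \<noteq> {} \<and> E \<in> S (osuc (cs \<xi> (Min E)))})"

definition family_comp :: "nat set set \<Rightarrow> nat set set \<Rightarrow> nat set set" where
  "family_comp \<G> \<F> = {{}} \<union> {\<Union>(set Es) |Es. Es \<in> block_lists \<F> \<and> Min ` set Es \<in> \<G>}"

definition schreier2 ::
  "(omega1 \<Rightarrow> nat \<Rightarrow> omega1) \<Rightarrow> omega1 \<Rightarrow> omega1 \<Rightarrow> nat set set" where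
  "schreier2 cs \<xi> \<zeta> = family_comp (schreier cs \<zeta>) (schreier cs \<xi>)"

text \<open>\<open>cs \<xi>\<close> is the characteristic sequence of the limit ordinal \<open>\<xi>\<close>.\<close>

definition characteristic_sequences :: "(omega1 \<Rightarrow> nat \<Rightarrow> omega1) \<Rightarrow> bool" where
  "characteristic_sequences cs \<longleftrightarrow>
    (\<forall>\<xi>. is_limit \<xi> \<longrightarrow>
      (\<forall>n\<ge>1. cs \<xi> n < \<xi> \<and> cs \<xi> n < cs \<xi> (Suc n) \<and>
        schreier cs (osuc (cs \<xi> n)) \<subseteq> schreier cs (cs \<xi> (Suc n))) \<and>
      (\<forall>\<eta><\<xi>. \<exists>n\<ge>1. \<eta> < cs \<xi> n))"

definition maximal_sets :: "nat set set \<Rightarrow> nat set set" where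
  "maximal_sets \<F> = {E \<in> \<F>. \<forall>F\<in>\<F>. init_seg E F \<longrightarrow> F = E}"

text \<open>The definite descriptions are meant for families \<open>\<F>\<close> of Schreier type, for which
  \<open>\<F>\<close>-decompositions exist and are unique.\<close>

definition decomp :: "nat set set \<Rightarrow> nat set \<Rightarrow> nat \<Rightarrow> nat set" where
  "decomp \<F> M = (THE D. D 0 = {} \<and> (\<forall>k\<ge>1. D k \<in> maximal_sets \<F> \<and> set_less (D k) (D (Suc k))) \<and>
    (\<Union>k\<in>{1..}. D k) = M)"

definition decomp_upto :: "nat set set \<Rightarrow> nat set \<Rightarrow> nat \<Rightarrow> nat set" where
  "decomp_upto \<F> M n = (\<Union>k\<in>{1..n}. decomp \<F> M k)"

definition fin_decomp :: "nat set set \<Rightarrow> nat set \<Rightarrow> nat set list" where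
  "fin_decomp \<F> E =
    (THE Fs. Fs \<in> block_lists \<F> \<and> set (butlast Fs) \<subseteq> maximal_sets \<F> \<and> \<Union>(set Fs) = E)"

definition last_block :: "nat set set \<Rightarrow> nat set \<Rightarrow> nat set" where
  "last_block \<F> E = last (fin_decomp \<F> E)"

section \<open>Weights\<close>

text \<open>\<open>p_mem\<close> and \<open>q_mem\<close> are the weights of non-empty members of the respective family;
  \<open>p_weight\<close> and \<open>q_weight\<close> those of arbitrary non-empty finite sets.\<close>

definition p_mem :: "(omega1 \<Rightarrow> nat \<Rightarrow> omega1) \<Rightarrow> omega1 \<Rightarrow> nat set \<Rightarrow> real" where
  "p_mem cs =
    omega1_rec (\<lambda>E. 1)
      (\<lambda>\<xi> p E. p (last_block (schreier cs \<xi>) E) / real (Min E))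
      (\<lambda>\<xi> p E. p (osuc (cs \<xi> (Min E))) E)"

definition p_weight :: "(omega1 \<Rightarrow> nat \<Rightarrow> omega1) \<Rightarrow> omega1 \<Rightarrow> nat set \<Rightarrow> real" where
  "p_weight cs \<xi> E = p_mem cs \<xi> (last_block (schreier cs \<xi>) E)"

definition q_mem :: "(omega1 \<Rightarrow> nat \<Rightarrow> omega1) \<Rightarrow> omega1 \<Rightarrow> omega1 \<Rightarrow> nat set \<Rightarrow> real" where
  "q_mem cs \<xi> =
    omega1_rec (\<lambda>E. 1)
      (\<lambda>\<zeta> q E. q (last_block (schreier2 cs \<xi> \<zeta>) E) / sqrt (real (Min E)))
      (\<lambda>\<zeta> q E. q (osuc (cs \<zeta> (Min E))) E)"

definition q_weight :: "(omega1 \<Rightarrow> nat \<Rightarrow> omega1) \<Rightarrow> omega1 \<Rightarrow> omega1 \<Rightarrow> nat set \<Rightarrow> real" where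
  "q_weight cs \<xi> \<zeta> E = q_mem cs \<xi> \<zeta> (last_block (schreier2 cs \<xi> \<zeta>) E)"

lemma schreier_zero: "schreier cs 0 = {{}} \<union> {{n} |n. 1 \<le> n}"
  by (simp add: schreier_def)

lemma schreier_osuc: "schreier cs (osuc \<xi>) = schreier_step (schreier cs \<xi>)"
  by (simp add: schreier_def)

lemma p_mem_osuc:
  "p_mem cs (osuc \<xi>) E = p_mem cs \<xi> (last_block (schreier cs \<xi>) E) / real (Min E)"
  by (simp add: p_mem_def)

lemma q_mem_osuc:
  "q_mem cs \<xi> (osuc \<zeta>) E =
    q_mem cs \<xi> \<zeta> (last_block (schreier2 cs \<xi> \<zeta>) E) / sqrt (real (Min E))"
  by (simp add: q_mem_def)

lemma schreier_subset: "schreier cs \<xi> \<subseteq> fin_subsets {1..}"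
proof (induction \<xi> rule: less_induct)
  case (less \<xi>)
  consider "\<xi> = 0" | \<eta> where "\<xi> = osuc \<eta>" | "is_limit \<xi>"
    by (auto simp: is_limit_def is_succ_def)
  then show ?case
  proof cases
    case 1
    then show ?thesis by (auto simp: schreier_zero fin_subsets_def)
  next
    case 2
    then have "schreier cs \<eta> \<subseteq> fin_subsets {1..}"
      using less.IH[of \<eta>] by simp
    then show ?thesis
      unfolding 2 schreier_osuc schreier_step_def block_lists_def fin_subsets_def
      by fastforce
  next
    case 3
    then show ?thesis
      by (auto simp: schreier_def omega1_rec_limit fin_subsets_def)
  qed
qed

lemma osuc_char_less:
  assumes "characteristic_sequences cs" "is_limit \<xi>" "1 \<le> n"
  shows "osuc (cs \<xi> n) < \<xi>"
proof -
  have "cs \<xi> n < \<xi>"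
    using assms unfolding characteristic_sequences_def by blast
  then show ?thesis
    using assms(2) by (metis is_limit_def is_succ_osuc le_less osuc_le_iff)
qed

lemma Min_fin_subsets: "E \<in> fin_subsets {1..} \<Longrightarrow> E \<noteq> {} \<Longrightarrow> 1 \<le> Min E"
  by (auto simp: fin_subsets_def)

lemma schreier_limit:
  assumes "characteristic_sequences cs" "is_limit \<xi>"
  shows "schreier cs \<xi> = {{}} \<union> {E. E \<noteq> {} \<and> E \<in> schreier cs (osuc (cs \<xi> (Min E)))} \<inter> fin_subsets {1..}"
proof -
  have "E \<in> fin_subsets {1..} \<Longrightarrow> E \<noteq> {} \<Longrightarrow> osuc (cs \<xi> (Min E)) < \<xi>" for E
    using osuc_char_less[OF assms] Min_fin_subsets by blast
  then show ?thesis
    unfolding schreier_def omega1_rec_limit[OF assms(2)] by auto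
qed

lemma p_mem_limit:
  assumes "characteristic_sequences cs" "is_limit \<xi>" "E \<in> fin_subsets {1..}" "E \<noteq> {}"
  shows "p_mem cs \<xi> E = p_mem cs (osuc (cs \<xi> (Min E))) E"
  using osuc_char_less[OF assms(1,2)] Min_fin_subsets[OF assms(3,4)]
  unfolding p_mem_def omega1_rec_limit[OF assms(2)] by simp

lemma q_mem_limit:
  assumes "characteristic_sequences cs" "is_limit \<zeta>" "E \<in> fin_subsets {1..}" "E \<noteq> {}"
  shows "q_mem cs \<xi> \<zeta> E = q_mem cs \<xi> (osuc (cs \<zeta> (Min E))) E"
  using osuc_char_less[OF assms(1,2)] Min_fin_subsets[OF assms(3,4)]
  unfolding q_mem_def omega1_rec_limit[OF assms(2)] by simp

section \<open>Normed spaces\<close>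

text \<open>
  The scalar field is a type \<open>'k\<close> of class \<^class>\<open>real_normed_field\<close>, to be instantiated by \<^typ>\<open>real\<close>
  and \<^typ>\<open>complex\<close>. As the spaces of interest depend on ordinal parameters they are given by
  carriers; the ring multiplication and unit that \<^typ>\<open>('k, 'v) module\<close> inherits play no role.
\<close>

record ('k, 'v) normed_module = "('k, 'v) module" +
  vnorm :: "'v \<Rightarrow> real"

definition unit_ball :: "('k::real_normed_field, 'v) normed_module \<Rightarrow> 'v set" where
  "unit_ball U = {x \<in> carrier U. vnorm U x \<le> 1}"

definition linear_functional ::
  "('k::real_normed_field, 'v) normed_module \<Rightarrow> ('v \<Rightarrow> 'k) \<Rightarrow> bool" where
  "linear_functional U f \<longleftrightarrow>
    (\<forall>x\<in>carrier U. \<forall>y\<in>carrier U. f (x \<oplus>\<^bsub>U\<^esub> y) = f x + f y) \<and>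
    (\<forall>c. \<forall>x\<in>carrier U. f (c \<odot>\<^bsub>U\<^esub> x) = c * f x)"

text \<open>Functionals matter only through their values on the carrier.\<close>

definition dual :: "('k::real_normed_field, 'v) normed_module \<Rightarrow> ('v \<Rightarrow> 'k) set" where
  "dual U = {f. linear_functional U f \<and> (\<exists>B. \<forall>x\<in>carrier U. norm (f x) \<le> B * vnorm U x)}"

definition dual_ball :: "('k::real_normed_field, 'v) normed_module \<Rightarrow> ('v \<Rightarrow> 'k) set" where
  "dual_ball U = {f \<in> dual U. \<forall>x\<in>unit_ball U. norm (f x) \<le> 1}"

definition weakly_summing_norm ::
  "real \<Rightarrow> ('k::real_normed_field, 'v) normed_module \<Rightarrow> (nat \<Rightarrow> 'v) \<Rightarrow> ennreal" where
  "weakly_summing_norm p V e =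
    (SUP f\<in>dual_ball V. let s = (\<Sum>i. ennreal (norm (f (e (Suc i))) powr p))
      in if s = \<infinity> then \<infinity> else ennreal (enn2real s powr (1 / p)))"

section \<open>Averages and the two properties\<close>

definition weakly_null_collection ::
  "('k::real_normed_field, 'v) normed_module \<Rightarrow> (nat set \<Rightarrow> 'v) \<Rightarrow> bool" where
  "weakly_null_collection U u \<longleftrightarrow>
    (\<forall>E\<in>fin_subsets {1..}. \<forall>f\<in>dual U. (\<lambda>k. f (u (insert k E))) \<longlonglongrightarrow> 0)"

definition collections_in_ball ::
  "('k::real_normed_field, 'v) normed_module \<Rightarrow> (nat set \<Rightarrow> 'v) set" where
  "collections_in_ball U = {u. \<forall>E\<in>fin_subsets {1..} - {{}}. u E \<in> unit_ball U}"

definition segments_between :: "nat set \<Rightarrow> nat set \<Rightarrow> nat set set" where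
  "segments_between A B = {E. init_seg A E \<and> A \<noteq> E \<and> init_seg E B}"

definition average ::
  "(omega1 \<Rightarrow> nat \<Rightarrow> omega1) \<Rightarrow> omega1 \<Rightarrow> ('k::real_normed_field, 'v) normed_module \<Rightarrow>
    nat set \<Rightarrow> (nat set \<Rightarrow> 'v) \<Rightarrow> nat \<Rightarrow> 'v" where
  "average cs \<xi> U M u n =
    (\<Oplus>\<^bsub>U\<^esub>E\<in>segments_between (decomp_upto (schreier cs \<xi>) M (n - 1)) (decomp_upto (schreier cs \<xi>) M n).
      of_real (p_weight cs \<xi> E) \<odot>\<^bsub>U\<^esub> u E)"

definition average2 ::
  "(omega1 \<Rightarrow> nat \<Rightarrow> omega1) \<Rightarrow> omega1 \<Rightarrow> omega1 \<Rightarrow> ('k::real_normed_field, 'v) normed_module \<Rightarrow>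
    nat set \<Rightarrow> (nat set \<Rightarrow> 'v) \<Rightarrow> nat \<Rightarrow> 'v" where
  "average2 cs \<xi> \<zeta> U M u n =
    (\<Oplus>\<^bsub>U\<^esub>E\<in>segments_between (decomp_upto (schreier2 cs \<xi> \<zeta>) M (n - 1))
        (decomp_upto (schreier2 cs \<xi> \<zeta>) M n).
      of_real (q_weight cs \<xi> \<zeta> E * p_weight cs \<xi> E) \<odot>\<^bsub>U\<^esub> u E)"

definition S_property ::
  "(omega1 \<Rightarrow> nat \<Rightarrow> omega1) \<Rightarrow> omega1 \<Rightarrow> ('k::real_normed_field, 'u) normed_module \<Rightarrow>
    ('k, 'v) normed_module \<Rightarrow> ('u \<Rightarrow> 'v) \<Rightarrow> real \<Rightarrow> bool" where
  "S_property cs \<xi> U V A \<gamma> \<longleftrightarrow>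
    (\<forall>u\<in>collections_in_ball U. weakly_null_collection U u \<longrightarrow>
      (\<forall>L\<in>inf_subsets {1..}. \<exists>M\<in>inf_subsets L.
        weakly_summing_norm 2 V (\<lambda>n. A (average cs \<xi> U M u n)) \<le> ennreal \<gamma>))"

definition G_property ::
  "(omega1 \<Rightarrow> nat \<Rightarrow> omega1) \<Rightarrow> omega1 \<Rightarrow> omega1 \<Rightarrow> ('k::real_normed_field, 'u) normed_module \<Rightarrow>
    ('k, 'v) normed_module \<Rightarrow> ('u \<Rightarrow> 'v) \<Rightarrow> real \<Rightarrow> bool" where
  "G_property cs \<xi> \<zeta> U V A \<gamma> \<longleftrightarrow>
    (\<forall>u\<in>collections_in_ball U. weakly_null_collection U u \<longrightarrow>
      (\<forall>L\<in>inf_subsets {1..}. \<exists>M\<in>inf_subsets L.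
        weakly_summing_norm 1 V (\<lambda>n. A (average2 cs \<xi> \<zeta> U M u n)) \<le> ennreal \<gamma>))"

definition s_op ::
  "(omega1 \<Rightarrow> nat \<Rightarrow> omega1) \<Rightarrow> omega1 \<Rightarrow> ('k::real_normed_field, 'u) normed_module \<Rightarrow>
    ('k, 'v) normed_module \<Rightarrow> ('u \<Rightarrow> 'v) \<Rightarrow> ennreal" where
  "s_op cs \<xi> U V A = Inf (ennreal ` {\<gamma>. 0 \<le> \<gamma> \<and> S_property cs \<xi> U V A \<gamma>})"

definition g_op ::
  "(omega1 \<Rightarrow> nat \<Rightarrow> omega1) \<Rightarrow> omega1 \<Rightarrow> omega1 \<Rightarrow> ('k::real_normed_field, 'u) normed_module \<Rightarrow>
    ('k, 'v) normed_module \<Rightarrow> ('u \<Rightarrow> 'v) \<Rightarrow> ennreal" where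
  "g_op cs \<xi> \<zeta> U V A = Inf (ennreal ` {\<gamma>. 0 \<le> \<gamma> \<and> G_property cs \<xi> \<zeta> U V A \<gamma>})"

definition s_space ::
  "(omega1 \<Rightarrow> nat \<Rightarrow> omega1) \<Rightarrow> omega1 \<Rightarrow> ('k::real_normed_field, 'u) normed_module \<Rightarrow> ennreal" where
  "s_space cs \<xi> U = s_op cs \<xi> U U id"

definition g_space ::
  "(omega1 \<Rightarrow> nat \<Rightarrow> omega1) \<Rightarrow> omega1 \<Rightarrow> omega1 \<Rightarrow> ('k::real_normed_field, 'u) normed_module \<Rightarrow>
    ennreal" where
  "g_space cs \<xi> \<zeta> U = g_op cs \<xi> \<zeta> U U id"

section \<open>Spaces of continuous functions\<close>

text \<open>A function on \<open>[0,\<alpha>]\<close> is represented by its extension by \<open>0\<close> to all of \<^typ>\<open>omega1\<close>.\<close>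

definition C_space :: "omega1 \<Rightarrow> ('k::real_normed_field, omega1 \<Rightarrow> 'k) normed_module" where
  "C_space \<alpha> =
    \<lparr>carrier = {f. continuous_on {..\<alpha>} f \<and> (\<forall>\<eta>>\<alpha>. f \<eta> = 0)},
     mult = undefined, one = undefined,
     zero = (\<lambda>_. 0), add = (\<lambda>f g \<eta>. f \<eta> + g \<eta>),
     smult = (\<lambda>c f \<eta>. c * f \<eta>),
     vnorm = (\<lambda>f. SUP \<eta>\<in>{..\<alpha>}. norm (f \<eta>))\<rparr>"

definition C0_space :: "omega1 \<Rightarrow> ('k::real_normed_field, omega1 \<Rightarrow> 'k) normed_module" where
  "C0_space \<alpha> = C_space \<alpha>\<lparr>carrier := {f \<in> carrier (C_space \<alpha>). f \<alpha> = 0}\<rparr>"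

section \<open>The completed projective tensor product\<close>

definition bilinear_form ::
  "('k::real_normed_field, 'x) normed_module \<Rightarrow> ('k, 'y) normed_module \<Rightarrow> ('x \<Rightarrow> 'y \<Rightarrow> 'k) \<Rightarrow> bool"
  where
  "bilinear_form X Y \<phi> \<longleftrightarrow>
    (\<forall>x\<in>carrier X. linear_functional Y (\<phi> x)) \<and>
    (\<forall>y\<in>carrier Y. linear_functional X (\<lambda>x. \<phi> x y))"

text \<open>
  The algebraic tensor product is realised inside the linear functionals on the space of all
  bilinear forms, \<open>x \<otimes> y\<close> being evaluation at \<open>(x, y)\<close>; the list \<open>[(x\<^sub>1,y\<^sub>1),\<dots>,(x\<^sub>n,y\<^sub>n)]\<close> stands for
  the tensor \<open>x\<^sub>1 \<otimes> y\<^sub>1 + \<dots> + x\<^sub>n \<otimes> y\<^sub>n\<close>.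
\<close>

type_synonym ('k, 'x, 'y) tensor = "('x \<Rightarrow> 'y \<Rightarrow> 'k) \<Rightarrow> 'k"

definition tensor_of ::
  "('k::real_normed_field, 'x) normed_module \<Rightarrow> ('k, 'y) normed_module \<Rightarrow> ('x \<times> 'y) list \<Rightarrow>
    ('k, 'x, 'y) tensor" where
  "tensor_of X Y zs = (\<lambda>\<phi>. if bilinear_form X Y \<phi> then (\<Sum>(x, y)\<leftarrow>zs. \<phi> x y) else 0)"

definition tensor_reps ::
  "('k::real_normed_field, 'x) normed_module \<Rightarrow> ('k, 'y) normed_module \<Rightarrow> ('x \<times> 'y) list set" where
  "tensor_reps X Y = {zs. set zs \<subseteq> carrier X \<times> carrier Y}"

definition projective_tensor ::
  "('k::real_normed_field, 'x) normed_module \<Rightarrow> ('k, 'y) normed_module \<Rightarrow>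
    ('k, ('k, 'x, 'y) tensor) normed_module" where
  "projective_tensor X Y =
    \<lparr>carrier = tensor_of X Y ` tensor_reps X Y,
     mult = undefined, one = undefined,
     zero = (\<lambda>_. 0), add = (\<lambda>v w \<phi>. v \<phi> + w \<phi>),
     smult = (\<lambda>c v \<phi>. c * v \<phi>),
     vnorm = (\<lambda>v. INF zs\<in>{zs \<in> tensor_reps X Y. tensor_of X Y zs = v}.
       (\<Sum>(x, y)\<leftarrow>zs. vnorm X x * vnorm Y y))\<rparr>"

definition cauchy_seqs :: "('k::real_normed_field, 'v) normed_module \<Rightarrow> (nat \<Rightarrow> 'v) set" where
  "cauchy_seqs U = {s. range s \<subseteq> carrier U \<and>
    (\<forall>e>0. \<exists>N. \<forall>m\<ge>N. \<forall>n\<ge>N. vnorm U (s m \<ominus>\<^bsub>U\<^esub> s n) < e)}"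

definition cauchy_rel :: "('k::real_normed_field, 'v) normed_module \<Rightarrow> (nat \<Rightarrow> 'v) rel" where
  "cauchy_rel U = {(s, t). s \<in> cauchy_seqs U \<and> t \<in> cauchy_seqs U \<and>
    (\<lambda>n. vnorm U (s n \<ominus>\<^bsub>U\<^esub> t n)) \<longlonglongrightarrow> 0}"

definition completion ::
  "('k::real_normed_field, 'v) normed_module \<Rightarrow> ('k, (nat \<Rightarrow> 'v) set) normed_module" where
  "completion U =
    \<lparr>carrier = cauchy_seqs U // cauchy_rel U,
     mult = undefined, one = undefined,
     zero = cauchy_rel U `` {\<lambda>_. \<zero>\<^bsub>U\<^esub>},
     add = (\<lambda>P Q. \<Union>s\<in>P. \<Union>t\<in>Q. cauchy_rel U `` {\<lambda>n. s n \<oplus>\<^bsub>U\<^esub> t n}),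
     smult = (\<lambda>c P. \<Union>s\<in>P. cauchy_rel U `` {\<lambda>n. c \<odot>\<^bsub>U\<^esub> s n}),
     vnorm = (\<lambda>P. THE r. \<forall>s\<in>P. (\<lambda>n. vnorm U (s n)) \<longlonglongrightarrow> r)\<rparr>"

type_synonym ('k, 'x, 'y) ctensor = "(nat \<Rightarrow> ('k, 'x, 'y) tensor) set"

definition completed_projective_tensor ::
  "('k::real_normed_field, 'x) normed_module \<Rightarrow> ('k, 'y) normed_module \<Rightarrow>
    ('k, ('k, 'x, 'y) ctensor) normed_module" where
  "completed_projective_tensor X Y = completion (projective_tensor X Y)"

definition C0_tensor ::
  "'k::real_normed_field itself \<Rightarrow> omega1 \<Rightarrow> omega1 \<Rightarrow>
    ('k, ('k, omega1 \<Rightarrow> 'k, omega1 \<Rightarrow> 'k) ctensor) normed_module" where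
  "C0_tensor _ \<xi> \<zeta> =
    completed_projective_tensor (C0_space (opow omega (opow omega \<xi>)))
      (C0_space (opow omega (opow omega \<zeta>)))"

section \<open>Grothendieck's constant\<close>

definition conj_scalar :: "'k::real_normed_field \<Rightarrow> 'k" where
  "conj_scalar z = of_real ((norm z)\<^sup>2) / z"

lemma conj_scalar_real: "conj_scalar (x :: real) = x"
  by (simp add: conj_scalar_def power2_eq_square)

lemma conj_scalar_complex: "conj_scalar (z :: complex) = cnj z"
  by (cases "z = 0") (simp_all add: conj_scalar_def field_simps complex_norm_square[symmetric])

text \<open>The infimum below lives in \<open>[0,\<infinity>]\<close>; it is finite by Grothendieck's inequality.
  The vectors of the Hilbert space \<open>\<ell>\<^sub>2\<^sup>d\<close> are the functions \<open>nat \<Rightarrow> 'k\<close> restricted to \<^term>\<open>{..<d}\<close>;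
  finitely many vectors of a Hilbert space always lie in a copy of some \<open>\<ell>\<^sub>2\<^sup>d\<close>.\<close>

definition grothendieck_bound :: "'k::real_normed_field itself \<Rightarrow> real \<Rightarrow> bool" where
  "grothendieck_bound _ c \<longleftrightarrow>
    (\<forall>m n (a :: nat \<Rightarrow> nat \<Rightarrow> 'k).
      (\<forall>s t. (\<forall>i<m. norm (s i) \<le> 1) \<and> (\<forall>j<n. norm (t j) \<le> 1) \<longrightarrow>
        norm (\<Sum>i<m. \<Sum>j<n. a i j * s i * t j) \<le> 1) \<longrightarrow>
      (\<forall>d (x :: nat \<Rightarrow> nat \<Rightarrow> 'k) y.
        (\<forall>i<m. (\<Sum>k<d. (norm (x i k))\<^sup>2) \<le> 1) \<and> (\<forall>j<n. (\<Sum>k<d. (norm (y j k))\<^sup>2) \<le> 1) \<longrightarrow>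
        norm (\<Sum>i<m. \<Sum>j<n. a i j * (\<Sum>k<d. x i k * conj_scalar (y j k))) \<le> c))"

definition grothendieck_constant :: "'k::real_normed_field itself \<Rightarrow> ennreal" ("k'_G") where
  "grothendieck_constant K = Inf (ennreal ` {c. 0 \<le> c \<and> grothendieck_bound K c})"

end

(*
  Everything is tested against the bounded bilinear forms on C_0(omega^omega^xi) x C_0(omega^omega^zeta),
  the dual of the tensor product: a collection u becomes the family of functionals phi |-> phi(u_E), and
  choosing M becomes playing blocks whose elements grow fast compared with the elements played before.
  The spaces are uniform closures of simple functions over rings of clopen sets bounded below
  omega^omega^xi. Multiplication with the indicator of such a set is an operator of rank at most xi in
  a hierarchy, starting from the finite rank operators, that measures how often one has to localise.
  Averages of weakly null collections are asymptotically null when both factors have passed through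
  operators of rank at most xi. Up to a telescoping error only forms of the type phi(1_D x, y) and
  phi(x, 1_D' y) therefore act on a block, where D and D' are the increments of the supports; they are
  disjoint for different blocks, so the squares of the norms sum up to at most k_G^2 by Grothendieck's
  inequality, once for each factor (only for the first one if zeta < xi, as the identity of the second
  space then has rank xi). The weights 1/sqrt(min E) of the second game turn this l_2 bound into null
  sequences except for the diagonal part phi(1_D x, 1_D' y), whose norms are even summable.
*)
theory Submission
  imports Defs "HOL-Real_Asymp.Real_Asymp"
begin

section \<open>Ordinal arithmetic\<close>

text \<open>The obstacle is uniformity: \<open>M\<close> is fixed before the functional, so every
  estimate must hold for all forms of norm at most 1 at once. The approximate supports of the
  tensors \<open>u E\<close> do not depend on the form and may guide the choice of \<open>M\<close>.
  Weak nullness concerns one form at a time; it is used only for products of two functionals, since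
  rank one factors turn every form into a bounded multiple of one such product. A block of level
  zeta + 1 has as many pieces of level zeta as its minimum says, so plain bounds for the pieces are
  lost in the second game. Bounds by superadditive functions of history and block survive, and so do
  their square roots, by Cauchy-Schwarz. The hierarchy of operators follows omega^omega^(eta+1) =
  sup_n (omega^omega^eta)^n: a function on [0, theta gamma] splits into its values at the multiples
  of theta and a remainder on fibres of length below theta. The shift from zeta to 1 + zeta comes
  from the bottom of the hierarchy: against a rank one second factor the second game needs one step
  before it becomes null.\<close>

lemma omega1_cases:
  obtains "(\<xi>::omega1) = 0" | \<eta> where "\<xi> = osuc \<eta>" | "is_limit \<xi>"
  by (auto simp: is_limit_def is_succ_def)

lemma less_osuc_iff: "\<xi> < osuc \<eta> \<longleftrightarrow> \<xi> <= \<eta>"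
  by (metis linorder_not_le osuc_le_iff)

lemma osuc_less_osuc [simp]: "osuc \<xi> < osuc \<eta> \<longleftrightarrow> \<xi> < \<eta>"
  by (metis less_osuc_iff osuc_le_iff)

lemma atMost_osuc: "{..osuc \<eta>} = insert (osuc \<eta>) {..\<eta>}"
proof -
  have "\<xi> <= osuc \<eta> \<longleftrightarrow> \<xi> = osuc \<eta> \<or> \<xi> <= \<eta>" for \<xi>
    using less_osuc_iff[of \<xi> \<eta>] by (auto simp: le_less)
  thus ?thesis by auto
qed

lemma limit_osuc_less: "is_limit \<xi> ==> \<eta> < \<xi> ==> osuc \<eta> < \<xi>"
  by (metis is_limit_def is_succ_osuc le_less osuc_le_iff)

lemma limit_pos: "is_limit \<xi> ==> 0 < \<xi>"
  by (metis is_limit_def le_less omega1_zero_le)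

lemma less_osup_iff:
  assumes "countable A" shows "\<beta> < osup A \<longleftrightarrow> (\<exists>\<alpha>\<in>A. \<beta> < \<alpha>)"
  using osup_upper[OF assms] osup_least[of A \<beta>] by (meson leD le_less_linear less_le_trans)

lemma osup_lessThan: "is_limit \<xi> ==> osup {..<\<xi>} = \<xi>"
  by (metis (no_types, lifting) antisym countable_lessThan_omega1 lessThan_iff less_le less_osup_iff
      limit_osuc_less less_osuc linorder_not_le osup_least)

section \<open>Normal functions on the countable ordinals\<close>

definition normal :: "(omega1 => omega1) => bool" where
  "normal e \<longleftrightarrow> strict_mono e \<and> (\<forall>\<xi>. is_limit \<xi> --> e \<xi> = osup (e ` {..<\<xi>}))"

lemma normalI:
  assumes succ: "!!\<xi>. e \<xi> < e (osuc \<xi>)"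
    and lim: "!!\<xi>. is_limit \<xi> ==> e \<xi> = osup (e ` {..<\<xi>})"
  shows "normal e"
proof -
  have "e \<eta> < e \<xi>" if "\<eta> < \<xi>" for \<eta> \<xi>
    using that
  proof (induction \<xi> arbitrary: \<eta> rule: less_induct)
    case (less \<xi>)
    show ?case
    proof (cases \<xi> rule: omega1_cases)
      case 1
      thus ?thesis using less.prems by (simp add: leD)
    next
      case (2 \<gamma>)
      hence "\<eta> <= \<gamma>" using less.prems by (simp add: less_osuc_iff)
      thus ?thesis
        using less.IH[of \<gamma> \<eta>] succ[of \<gamma>] 2 by (cases "\<eta> = \<gamma>") (auto simp: le_less)
    next
      case 3
      hence "osuc \<eta> < \<xi>" using less.prems limit_osuc_less by blast
      hence "e (osuc \<eta>) <= osup (e ` {..<\<xi>})"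
        by (intro osup_upper) (auto simp: countable_lessThan_omega1)
      thus ?thesis using succ[of \<eta>] lim[OF 3] by simp
    qed
  qed
  thus ?thesis by (auto simp: normal_def strict_mono_def lim)
qed

lemma normal_less_iff: "normal e ==> e \<xi> < e \<eta> \<longleftrightarrow> \<xi> < \<eta>"
  by (simp add: normal_def strict_mono_less)

lemma normal_le_iff: "normal e ==> e \<xi> <= e \<eta> \<longleftrightarrow> \<xi> <= \<eta>"
  by (simp add: normal_def strict_mono_less_eq)

lemma normal_ge: assumes "normal e" shows "\<xi> <= e \<xi>"
proof (induction \<xi> rule: less_induct)
  case (less \<xi>)
  show ?case
  proof (rule ccontr)
    assume "\<not> \<xi> <= e \<xi>"
    hence "e \<xi> < \<xi>" "e (e \<xi>) < e \<xi>" using normal_less_iff[OF assms] by auto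
    thus False using less.IH[of "e \<xi>"] by (simp add: leD)
  qed
qed

lemma normal_limit_less:
  assumes "normal e" "is_limit \<xi>" shows "\<beta> < e \<xi> \<longleftrightarrow> (\<exists>\<eta><\<xi>. \<beta> < e \<eta>)"
proof -
  have "e \<xi> = osup (e ` {..<\<xi>})" using assms by (simp add: normal_def)
  thus ?thesis
    using less_osup_iff[of "e ` {..<\<xi>}" \<beta>] by (auto simp: countable_lessThan_omega1)
qed

lemma normal_is_limit:
  assumes "normal e" "is_limit \<xi>" shows "is_limit (e \<xi>)"
proof -
  have "e \<xi> ~= 0"
    using normal_less_iff[OF assms(1), of 0 \<xi>] limit_pos[OF assms(2)] by (auto simp: leD)
  moreover have "\<not> is_succ (e \<xi>)"
  proof
    assume "is_succ (e \<xi>)"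
    then obtain \<gamma> where \<gamma>: "e \<xi> = osuc \<gamma>" by (auto simp: is_succ_def)
    then obtain \<eta> where \<eta>: "\<eta> < \<xi>" "\<gamma> < e \<eta>"
      using normal_limit_less[OF assms] less_osuc by metis
    hence "e \<xi> <= e \<eta>" using \<gamma> by (simp add: osuc_le_iff)
    thus False using \<eta>(1) normal_le_iff[OF assms(1)] by (simp add: leD)
  qed
  ultimately show ?thesis by (simp add: is_limit_def)
qed

lemma normal_comp:
  assumes "normal e" "normal d" shows "normal (\<lambda>\<xi>. e (d \<xi>))"
proof -
  have "e (d \<xi>) = osup ((\<lambda>\<xi>. e (d \<xi>)) ` {..<\<xi>})" if lim: "is_limit \<xi>" for \<xi>
  proof (rule antisym)
    show "e (d \<xi>) <= osup ((\<lambda>\<xi>. e (d \<xi>)) ` {..<\<xi>})"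
    proof (rule ccontr)
      assume "\<not> ?thesis"
      hence "osup ((\<lambda>\<xi>. e (d \<xi>)) ` {..<\<xi>}) < e (d \<xi>)" (is "?s < _") by simp
      then obtain \<eta> where "\<eta> < d \<xi>" "?s < e \<eta>"
        using normal_limit_less[OF assms(1) normal_is_limit[OF assms(2) lim]] by blast
      moreover obtain \<gamma> where \<gamma>: "\<gamma> < \<xi>" "\<eta> < d \<gamma>"
        using normal_limit_less[OF assms(2) lim] calculation by blast
      ultimately have "?s < e (d \<gamma>)" using normal_less_iff[OF assms(1)] order.strict_trans by blast
      moreover have "e (d \<gamma>) <= ?s"
        using \<gamma>(1) by (intro osup_upper) (auto simp: countable_lessThan_omega1)
      ultimately show False by simp
    qed
    show "osup ((\<lambda>\<xi>. e (d \<xi>)) ` {..<\<xi>}) <= e (d \<xi>)"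
      by (rule osup_least) (auto simp: normal_le_iff[OF assms(1)] normal_le_iff[OF assms(2)])
  qed
  thus ?thesis
    using assms by (simp add: normal_def strict_mono_def)
qed

text \<open>Both sides of an identity of ordinal arithmetic are normal in the last variable, so it
  is enough to compare them at 0 and at successors. Associativity, distributivity and the power law
  below are all obtained in this way.\<close>

lemma normal_unique:
  assumes "normal e" "normal d" "e 0 = d 0"
    and step: "!!\<xi>. e \<xi> = d \<xi> ==> e (osuc \<xi>) = d (osuc \<xi>)"
  shows "e \<xi> = d \<xi>"
proof (induction \<xi> rule: less_induct)
  case (less \<xi>)
  show ?case
  proof (cases \<xi> rule: omega1_cases)
    case 3
    have "e ` {..<\<xi>} = d ` {..<\<xi>}" using less.IH by (intro image_cong) auto
    thus ?thesis using assms(1,2) 3 by (simp add: normal_def)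
  qed (use assms(3) step less.IH in auto)
qed

text \<open>By continuity the least argument whose value exceeds \<beta> is not a limit, and it is
  not 0 by assumption; its predecessor is the required \<eta>. Preimages of initial intervals under
  normal functions are therefore initial intervals.\<close>

lemma normal_Max:
  assumes "normal e" "e 0 <= \<beta>"
  obtains \<eta> where "!!\<xi>. e \<xi> <= \<beta> \<longleftrightarrow> \<xi> <= \<eta>"
proof -
  define \<gamma> where "\<gamma> = (LEAST \<gamma>. \<beta> < e \<gamma>)"
  have "\<beta> < e (osuc \<beta>)"
    using normal_ge[OF assms(1), of "osuc \<beta>"] less_osuc[of \<beta>] by (meson less_le_trans)
  hence g: "\<beta> < e \<gamma>" unfolding \<gamma>_def by (rule LeastI)
  have l: "e \<xi> <= \<beta>" if "\<xi> < \<gamma>" for \<xi>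
    using not_less_Least[of \<xi> "\<lambda>\<gamma>. \<beta> < e \<gamma>"] that by (simp add: \<gamma>_def)
  have iff: "e \<xi> <= \<beta> \<longleftrightarrow> \<xi> < \<gamma>" for \<xi>
    using l g normal_le_iff[OF assms(1), of \<gamma> \<xi>] by (meson le_less_linear leD le_less_trans)
  show thesis
  proof (cases \<gamma> rule: omega1_cases)
    case 1
    thus thesis using g assms(2) by simp
  next
    case (2 \<delta>)
    thus thesis using iff by (intro that[of \<delta>]) (simp add: less_osuc_iff)
  next
    case 3
    then obtain \<delta> where "\<delta> < \<gamma>" "\<beta> < e \<delta>" using g normal_limit_less[OF assms(1)] by blast
    thus thesis using iff by (meson leD)
  qed
qed

section \<open>Sums, products and powers\<close>

lemma normal_plus: "normal (\<lambda>\<beta>. \<alpha> + \<beta> :: omega1)"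
  by (rule normalI) (simp_all add: plus_omega1_simps)

lemma zero_plus_omega1 [simp]: "0 + \<beta> = (\<beta> :: omega1)"
proof -
  have "normal (\<lambda>\<beta>. \<beta>)" by (rule normalI) (simp_all add: osup_lessThan)
  thus ?thesis
    by (rule normal_unique[OF normal_plus]) (simp_all add: plus_omega1_simps)
qed

lemma plus_less_mono: "\<beta> < \<gamma> ==> \<alpha> + \<beta> < \<alpha> + (\<gamma> :: omega1)"
  by (simp add: normal_less_iff[OF normal_plus])

lemma plus_surj:
  assumes "\<alpha> <= (\<gamma> :: omega1)" obtains \<beta> where "\<gamma> = \<alpha> + \<beta>"
proof -
  obtain \<eta> where \<eta>: "!!\<xi>. \<alpha> + \<xi> <= \<gamma> \<longleftrightarrow> \<xi> <= \<eta>"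
    using normal_Max[OF normal_plus, of \<alpha> \<gamma>] assms by (auto simp: plus_omega1_simps)
  hence "\<alpha> + \<eta> <= \<gamma>" "\<not> \<alpha> + osuc \<eta> <= \<gamma>" by (auto simp: osuc_le_iff)
  thus thesis using that[of \<eta>] by (auto simp: plus_omega1_simps osuc_le_iff)
qed

lemma plus_assoc_omega1: "\<alpha> + \<beta> + \<gamma> = \<alpha> + (\<beta> + \<gamma> :: omega1)"
  by (rule normal_unique[OF normal_plus normal_comp[OF normal_plus normal_plus]])
     (simp_all add: plus_omega1_simps)

lemma normal_times: "0 < \<alpha> ==> normal (\<lambda>\<beta>. \<alpha> * \<beta> :: omega1)"
  by (rule normalI)
     (use plus_less_mono[of 0] in \<open>force simp: times_omega1_simps plus_omega1_simps\<close>)+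

lemma one_omega1: "(1::omega1) = osuc 0"
  by (simp add: one_omega1_def)

lemma times_one_omega1 [simp]: "\<alpha> * 1 = (\<alpha> :: omega1)"
  by (simp add: one_omega1 times_omega1_simps)

lemma one_times_omega1 [simp]: "1 * \<beta> = (\<beta> :: omega1)"
proof -
  have n: "normal (\<lambda>\<beta>. \<beta>)" by (rule normalI) (simp_all add: osup_lessThan)
  have "normal (\<lambda>\<beta>. 1 * \<beta> :: omega1)" by (rule normal_times) (simp add: one_omega1)
  thus ?thesis
    by (rule normal_unique[OF _ n]) (simp_all add: times_omega1_simps plus_omega1_simps one_omega1)
qed

lemma distrib_omega1: "0 < \<alpha> ==> \<alpha> * (\<beta> + \<gamma>) = \<alpha> * \<beta> + \<alpha> * (\<gamma> :: omega1)"
  by (rule normal_unique[OF normal_comp[OF normal_times normal_plus] normal_comp[OF normal_plus normal_times]])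
     (simp_all add: plus_omega1_simps times_omega1_simps plus_assoc_omega1)

lemma times_pos_omega1: "0 < \<alpha> ==> 0 < \<beta> ==> 0 < \<alpha> * (\<beta> :: omega1)"
  using normal_less_iff[OF normal_times, of \<alpha> 0 \<beta>] by (simp add: times_omega1_simps)

lemma times_assoc_omega1: "0 < \<alpha> ==> 0 < \<beta> ==> \<alpha> * \<beta> * \<gamma> = \<alpha> * (\<beta> * \<gamma> :: omega1)"
  by (rule normal_unique[OF normal_times normal_comp[OF normal_times normal_times]])
     (simp_all add: times_pos_omega1 times_omega1_simps distrib_omega1)

lemma one_less_omega: "1 < omega"
  using limit_osuc_less[OF is_limit_omega limit_pos[OF is_limit_omega]] by (simp add: one_omega1)

lemma opow_pos: "0 < opow omega \<beta>"
proof (induction \<beta> rule: less_induct)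
  case (less \<beta>)
  show ?case
  proof (cases \<beta> rule: omega1_cases)
    case (2 \<eta>)
    thus ?thesis
      using less.IH[of \<eta>] by (simp add: opow_simps times_pos_omega1 limit_pos is_limit_omega)
  next
    case 3
    hence "opow omega 0 \<in> opow omega ` {..<\<beta>}" using limit_pos by auto
    hence "opow omega 0 <= osup (opow omega ` {..<\<beta>})"
      by (intro osup_upper) (simp_all add: countable_lessThan_omega1)
    moreover have "0 < opow omega 0"
      by (simp add: opow_simps one_omega1)
    ultimately show ?thesis using 3 by (simp add: opow_simps)
  qed (simp add: opow_simps one_omega1)
qed

lemma normal_opow: "normal (opow omega)"
proof (rule normalI)
  show "opow omega \<xi> < opow omega (osuc \<xi>)" for \<xi>
    using normal_less_iff[OF normal_times[OF opow_pos], of \<xi> 1 omega] one_less_omega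
    by (simp add: opow_simps)
qed (simp add: opow_simps)

lemma opow_plus: "opow omega (\<alpha> + \<beta>) = opow omega \<alpha> * opow omega \<beta>"
  by (rule normal_unique[OF normal_comp[OF normal_opow normal_plus]
        normal_comp[OF normal_times[OF opow_pos] normal_opow]])
     (simp_all add: plus_omega1_simps opow_simps times_assoc_omega1 opow_pos)

lemma finite_below_omega: "\<alpha> < omega ==> finite {..\<alpha>}"
proof (induction \<alpha> rule: less_induct)
  case (less \<alpha>)
  show ?case
  proof (cases \<alpha> rule: omega1_cases)
    case 1
    hence "{..\<alpha>} = {0}" by (auto intro: antisym)
    thus ?thesis by simp
  next
    case (2 \<eta>)
    hence "finite {..\<eta>}" using less by (metis less_osuc less_trans)
    thus ?thesis by (simp add: 2 atMost_osuc)
  next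
    case 3
    thus ?thesis using less.prems unfolding omega_def by (metis not_less_Least)
  qed
qed

text \<open>The powers \<open>\<theta>\<^sup>n\<close> of \<open>\<theta>\<close>, associated to the right so that \<open>[0,\<theta>\<^sup>n\<^sup>+\<^sup>1]\<close> is fibred over
  \<open>[0,\<theta>\<^sup>n]\<close> with fibres of length \<open>\<theta>\<close>.\<close>

fun opower :: "omega1 => nat => omega1" where
  "opower \<theta> 0 = 1"
| "opower \<theta> (Suc n) = \<theta> * opower \<theta> n"

lemma opower_pos: "0 < \<theta> ==> 0 < opower \<theta> n"
  by (induction n) (simp_all add: times_pos_omega1 one_omega1)

lemma opower_commute: "0 < \<theta> ==> opower \<theta> n * \<theta> = \<theta> * opower \<theta> n"
  by (induction n) (simp_all add: times_assoc_omega1 opower_pos)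

lemma below_omega_funpow: "\<alpha> < omega ==> \<exists>n. \<alpha> = (osuc ^^ n) 0"
proof (induction \<alpha> rule: less_induct)
  case (less \<alpha>)
  show ?case
  proof (cases \<alpha> rule: omega1_cases)
    case 1
    thus ?thesis by (metis funpow_0)
  next
    case (2 \<eta>)
    then obtain n where "\<eta> = (osuc ^^ n) 0" using less by (metis less_osuc less_trans)
    hence "\<alpha> = (osuc ^^ Suc n) 0" using 2 by simp
    thus ?thesis by blast
  next
    case 3
    thus ?thesis using less.prems unfolding omega_def by (metis not_less_Least)
  qed
qed

section \<open>The ordinals omega^omega^xi\<close>

definition theta :: "omega1 => omega1" where
  "theta \<xi> = opow omega (opow omega \<xi>)"

lemma normal_theta: "normal theta"
  unfolding theta_def using normal_comp[OF normal_opow normal_opow] .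

lemma theta_pos: "0 < theta \<xi>"
  by (simp add: theta_def opow_pos)

lemma below_theta_zero: "\<alpha> < theta 0 ==> finite {..\<alpha>}"
  by (simp add: theta_def opow_simps one_omega1 finite_below_omega
      one_times_omega1[unfolded one_omega1])

text \<open>\<open>theta (osuc \<eta>)\<close> is omega to the power \<open>\<delta> * omega\<close>
  with \<open>\<delta> = opow omega \<eta>\<close>. By continuity it is the supremum of
  omega^(\<delta> n), and these are the finite powers of \<open>theta \<eta>\<close>.\<close>

lemma below_theta_osuc:
  assumes "\<alpha> < theta (osuc \<eta>)" shows "\<exists>n. \<alpha> <= opower (theta \<eta>) n"
proof -
  define \<delta> where "\<delta> = opow omega \<eta>"
  have d: "0 < \<delta>" by (simp add: \<delta>_def opow_pos)
  have pw: "opow omega (\<delta> * (osuc ^^ n) 0) = opower (theta \<eta>) n" for n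
  proof (induction n)
    case (Suc n)
    have "opow omega \<delta> = theta \<eta>" by (simp add: theta_def \<delta>_def)
    thus ?case
      using Suc by (simp add: times_omega1_simps opow_plus opower_commute[OF theta_pos])
  qed (simp add: times_omega1_simps opow_simps)
  have "\<alpha> < opow omega (\<delta> * omega)"
    using assms by (simp add: theta_def opow_simps \<delta>_def)
  then obtain \<gamma> where "\<gamma> < omega" "\<alpha> < opow omega (\<delta> * \<gamma>)"
    using normal_limit_less[OF normal_comp[OF normal_opow normal_times[OF d]] is_limit_omega]
    by blast
  thus ?thesis using below_omega_funpow pw by (metis less_imp_le)
qed

lemma below_theta_limit: "is_limit \<xi> ==> \<alpha> < theta \<xi> ==> \<exists>\<eta><\<xi>. \<alpha> < theta \<eta>"
  using normal_limit_less[OF normal_theta] by blast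

section \<open>Blocks of Schreier type families\<close>

lemma init_seg_refl: "init_seg E E"
  by (simp add: init_seg_def)

lemma init_seg_linear: "init_seg E M ==> init_seg F M ==> init_seg E F \<or> init_seg F E"
proof (rule ccontr)
  assume *: "init_seg E M" "init_seg F M" "\<not> (init_seg E F \<or> init_seg F E)"
  hence sub: "E \<subseteq> M" "F \<subseteq> M" unfolding init_seg_def by auto
  then obtain x y where xy: "x \<in> E" "x \<notin> F" "y \<in> F" "y \<notin> E"
    using * unfolding init_seg_def by blast
  show False
  proof (cases "x <= y")
    case True
    thus False using *(2) xy sub unfolding init_seg_def by blast
  next
    case False
    hence "y <= x" by simp
    thus False using *(1) xy sub unfolding init_seg_def by blast
  qed
qed

lemma set_less_disjoint: "set_less E F ==> E \<inter> F = {}"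
  by (fastforce simp: set_less_def)

lemma set_less_Un: "set_less (E \<union> F) G \<longleftrightarrow> set_less E G \<and> set_less F G"
  by (auto simp: set_less_def)

lemma set_less_Un2: "set_less E (F \<union> G) \<longleftrightarrow> set_less E F \<and> set_less E G"
  by (auto simp: set_less_def)

lemma set_less_Union: "set_less (\<Union>\<A>) G \<longleftrightarrow> (\<forall>A\<in>\<A>. set_less A G)"
  by (auto simp: set_less_def)

lemma set_less_Union2: "set_less G (\<Union>\<A>) \<longleftrightarrow> (\<forall>A\<in>\<A>. set_less G A)"
  by (auto simp: set_less_def)

lemma set_less_mono: "set_less E F ==> E' \<subseteq> E ==> F' \<subseteq> F ==> set_less E' F'"
  by (auto simp: set_less_def)

lemma set_less_empty [simp]: "set_less {} E" "set_less E {}"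
  by (auto simp: set_less_def)

lemma set_less_trans:
  assumes "set_less E F" "set_less F G" "F ~= {}" shows "set_less E G"
proof -
  obtain x where "x \<in> F" using assms(3) by blast
  thus ?thesis using assms(1,2) unfolding set_less_def by (meson less_trans)
qed

lemma init_seg_Un: "set_less E F ==> init_seg E (E \<union> F)"
  by (fastforce simp: init_seg_def set_less_def)

lemma init_seg_Un_mono:
  assumes "set_less h F" "init_seg G F" shows "init_seg (h \<union> G) (h \<union> F)"
  unfolding init_seg_def
proof (intro conjI ballI impI)
  show "h \<union> G \<subseteq> h \<union> F" using assms(2) by (auto simp: init_seg_def)
  fix i j assume ij: "i \<in> h \<union> G" "j \<in> h \<union> F" "j <= i"
  show "j \<in> h \<union> G"
  proof (cases "j \<in> h")
    case False
    hence "j \<in> F" using ij by blast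
    moreover have "i \<notin> h" using assms(1) \<open>j \<in> F\<close> ij(3) by (fastforce simp: set_less_def)
    ultimately show ?thesis using assms(2) ij unfolding init_seg_def by blast
  qed simp
qed

lemma init_seg_trans: "init_seg E F ==> init_seg F G ==> init_seg E G"
  unfolding init_seg_def by blast

lemma init_seg_Diff:
  assumes "init_seg (F \<union> R) U" "F \<inter> R = {}" shows "init_seg R (U - F)"
  using assms unfolding init_seg_def by blast

lemma init_seg_superset:
  assumes "init_seg E (F \<union> R)" "set_less F R" "\<not> E \<subseteq> F" shows "F \<subseteq> E"
proof
  fix y assume "y \<in> F"
  obtain x where "x \<in> E" "x \<in> R" using assms(1,3) by (auto simp: init_seg_def)
  moreover hence "y <= x" using \<open>y \<in> F\<close> assms(2) by (auto simp: set_less_def less_imp_le)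
  ultimately show "y \<in> E" using \<open>y \<in> F\<close> assms(1) by (auto simp: init_seg_def)
qed

lemma init_seg_Diff_less: "init_seg E M ==> set_less E (M - E)"
  unfolding init_seg_def set_less_def by (metis Diff_iff not_le)

lemma Min_Union_sorted:
  assumes "Fs ~= []" "sorted_wrt set_less Fs" "!!F. F \<in> set Fs ==> finite F \<and> F ~= {}"
  shows "Min (\<Union>(set Fs)) = Min (hd Fs)"
proof (rule Min_eqI)
  obtain F Gs where Fs: "Fs = F # Gs" using assms(1) by (cases Fs) auto
  show "finite (\<Union>(set Fs))" using assms(3) by auto
  show "Min (hd Fs) \<in> \<Union>(set Fs)" using assms(3)[of F] by (auto simp: Fs)
  show "Min (hd Fs) <= y" if "y \<in> \<Union>(set Fs)" for y
    using that assms(2) assms(3)[of F] Min_in[of F] Min_le[of F y]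
    by (fastforce simp: Fs set_less_def)
qed

section \<open>Members of successor families and their decompositions\<close>

lemma schreier_step_iff:
  assumes "\<F> \<subseteq> fin_subsets {1..}"
  shows "E \<in> schreier_step \<F> \<longleftrightarrow> E = {} \<or>
    (\<exists>Es. sorted_wrt set_less Es \<and> set Es \<subseteq> \<F> \<and> \<Union>(set Es) = E \<and> length Es <= Min E)"
proof (cases "E = {}")
  case False
  show ?thesis
  proof
    assume "E \<in> schreier_step \<F>"
    then obtain Es where Es: "Es \<in> block_lists \<F>" "length Es <= Min (hd Es)" "E = \<Union>(set Es)"
      using False by (auto simp: schreier_step_def)
    hence "Min E = Min (hd Es)"
      using assms by (auto simp: block_lists_def fin_subsets_def intro!: Min_Union_sorted)
    thus "E = {} \<or> (\<exists>Es. sorted_wrt set_less Es \<and> set Es \<subseteq> \<F> \<and> \<Union>(set Es) = E \<and> length Es <= Min E)"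
      using Es by (auto simp: block_lists_def)
  next
    assume "E = {} \<or> (\<exists>Es. sorted_wrt set_less Es \<and> set Es \<subseteq> \<F> \<and> \<Union>(set Es) = E \<and> length Es <= Min E)"
    then obtain Es where Es: "sorted_wrt set_less Es" "set Es \<subseteq> \<F>" "\<Union>(set Es) = E" "length Es <= Min E"
      using False by blast
    define Fs where "Fs = filter (\<lambda>A. A ~= {}) Es"
    have U: "\<Union>(set Fs) = E" using Es(3) by (auto simp: Fs_def)
    hence ne: "Fs ~= []" using False by auto
    have s: "sorted_wrt set_less Fs" by (simp add: Fs_def sorted_wrt_filter Es(1))
    have "Min E = Min (hd Fs)"
      using U Min_Union_sorted[OF ne s] Es(2) assms by (auto simp: Fs_def fin_subsets_def)
    moreover have "length Fs <= Min E"
      unfolding Fs_def by (rule order_trans[OF length_filter_le Es(4)])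
    moreover have "Fs \<in> block_lists \<F>"
      using ne s Es(2) by (auto simp: block_lists_def Fs_def)
    ultimately show "E \<in> schreier_step \<F>" using U by (auto simp: schreier_step_def)
  qed
qed (simp add: schreier_step_def)

text \<open>Maximal pieces are the most economical ones. The first pieces F and G are initial
  segments of the same set, and as F is maximal, G lies inside F. Removing F from the remaining
  members of \<open>Gs\<close> keeps them in the hereditary family, and the comparison goes on with
  shorter lists.\<close>

lemma maximal_sets_greedy:
  assumes "!!E E'. E \<in> \<F> ==> E' \<subseteq> E ==> E' \<in> \<F>"
    and "sorted_wrt set_less Fs" "set Fs \<subseteq> maximal_sets \<F>" "sorted_wrt set_less Gs" "set Gs \<subseteq> \<F>"
    and "length Gs <= length Fs" "init_seg (\<Union>(set Fs)) (\<Union>(set Gs))"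
  shows "\<Union>(set Gs) \<subseteq> \<Union>(set Fs)"
  using assms(2-)
proof (induction Fs arbitrary: Gs)
  case (Cons F Fs)
  show ?case
  proof (cases Gs)
    case (Cons G Hs)
    let ?R = "\<Union>(set Fs)" and ?U = "\<Union>(set Gs)"
    have less: "set_less F ?R" "set_less G (\<Union>(set Hs))"
      using Cons.prems by (auto simp: set_less_def \<open>Gs = G # Hs\<close>)
    have FU: "init_seg F ?U"
      using Cons.prems(6) less(1) unfolding init_seg_def set_less_def
      by (auto; metis UnionI Un_iff leD)
    have GU: "init_seg G ?U"
      using less(2) init_seg_Un[OF less(2)] by (simp add: \<open>Gs = G # Hs\<close>)
    have G: "G \<in> \<F>" and F: "F \<in> maximal_sets \<F>"
      using Cons.prems by (auto simp: \<open>Gs = G # Hs\<close>)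
    have GF: "G \<subseteq> F"
      using init_seg_linear[OF FU GU] F G by (auto simp: maximal_sets_def init_seg_def)
    define Hs' where "Hs' = map (\<lambda>A. A - F) Hs"
    have U': "\<Union>(set Hs') = ?U - F"
      using GF by (auto simp: Hs'_def \<open>Gs = G # Hs\<close>)
    have dis: "F \<inter> ?R = {}" using less(1) set_less_disjoint by blast
    have "\<Union>(set Hs') \<subseteq> ?R"
    proof (rule Cons.IH)
      show "sorted_wrt set_less Hs'"
        using Cons.prems(3) unfolding Hs'_def \<open>Gs = G # Hs\<close> sorted_wrt_map
        by (auto elim!: sorted_wrt_mono_rel[rotated] intro: set_less_mono)
      show "init_seg ?R (\<Union>(set Hs'))"
        unfolding U' using Cons.prems(6) dis by (intro init_seg_Diff) auto
      show "set Hs' \<subseteq> \<F>"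
        using Cons.prems(4) assms(1) by (auto simp: Hs'_def \<open>Gs = G # Hs\<close>)
    qed (use Cons.prems \<open>Gs = G # Hs\<close> Hs'_def in auto)
    thus ?thesis using U' by auto
  qed simp
qed simp

text \<open>The two first pieces are initial segments of the same union, hence comparable. The
  shorter one is maximal unless it is the only piece of its list; in that case it is the whole
  union. Either way the two pieces coincide.\<close>

lemma block_decomposition_unique:
  assumes "sorted_wrt set_less Fs" "!!F. F \<in> set Fs ==> F ~= {} \<and> F \<in> \<F>" "set (butlast Fs) \<subseteq> maximal_sets \<F>"
    and "sorted_wrt set_less Gs" "!!G. G \<in> set Gs ==> G ~= {} \<and> G \<in> \<F>" "set (butlast Gs) \<subseteq> maximal_sets \<F>"
    and "\<Union>(set Fs) = \<Union>(set Gs)"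
  shows "Fs = Gs"
  using assms
proof (induction Fs arbitrary: Gs)
  case Nil
  hence "set Gs = {}" by (metis Sup_empty empty_set equals0I Union_iff all_not_in_conv)
  thus ?case by simp
next
  case (Cons F Fs)
  have "Gs ~= []" using Cons.prems(2)[of F] Cons.prems(7) by auto
  then obtain G Hs where Gs: "Gs = G # Hs" by (cases Gs) auto
  have less: "set_less F (\<Union>(set Fs))" "set_less G (\<Union>(set Hs))"
    using Cons.prems by (auto simp: set_less_def Gs)
  have i: "init_seg F (\<Union>(set Gs))" "init_seg G (\<Union>(set Gs))"
    using init_seg_Un[OF less(1)] init_seg_Un[OF less(2)] Cons.prems(7) by (auto simp: Gs)
  have "F = G"
    using init_seg_linear[OF i]
  proof
    assume FG: "init_seg F G"
    show ?thesis
    proof (cases Fs)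
      case Nil
      thus ?thesis using FG Cons.prems(7) by (auto simp: Gs init_seg_def)
    next
      case (Cons)
      hence "F \<in> maximal_sets \<F>" using Cons.prems(3) by auto
      thus ?thesis using FG Cons.prems(5)[of G] by (auto simp: maximal_sets_def Gs)
    qed
  next
    assume GF: "init_seg G F"
    show ?thesis
    proof (cases Hs)
      case Nil
      thus ?thesis using GF Cons.prems(7) by (auto simp: Gs init_seg_def)
    next
      case (Cons)
      hence "G \<in> maximal_sets \<F>" using Cons.prems(6) by (auto simp: Gs)
      thus ?thesis using GF Cons.prems(2)[of F] by (auto simp: maximal_sets_def)
    qed
  qed
  moreover have "\<Union>(set Fs) = \<Union>(set Hs)"
  proof -
    have "\<Union>(set Fs) = \<Union>(set (F # Fs)) - F" "\<Union>(set Hs) = \<Union>(set Gs) - F"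
      using less[THEN set_less_disjoint] \<open>F = G\<close> by (auto simp: Gs)
    thus ?thesis using Cons.prems(7) by simp
  qed
  hence "Fs = Hs"
    using Cons.prems
    by (intro Cons.IH) (auto simp: Gs dest: in_set_butlastD split: if_splits)
  ultimately show ?case by (simp add: Gs)
qed

lemma last_block_eqI:
  assumes "sorted_wrt set_less Fs" "set Fs \<subseteq> maximal_sets \<F>" "{} \<notin> set Fs"
    and "E \<in> \<F>" "E ~= {}" "set_less (\<Union>(set Fs)) E"
  shows "last_block \<F> (\<Union>(set Fs) \<union> E) = E"
proof -
  have "fin_decomp \<F> (\<Union>(set Fs) \<union> E) = Fs @ [E]"
    unfolding fin_decomp_def
  proof (rule the_equality)
    show *: "Fs @ [E] \<in> block_lists \<F> \<and> set (butlast (Fs @ [E])) \<subseteq> maximal_sets \<F> \<and>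
        \<Union>(set (Fs @ [E])) = \<Union>(set Fs) \<union> E"
      using assms by (auto simp: block_lists_def sorted_wrt_append maximal_sets_def set_less_Union)
    show "Gs = Fs @ [E]"
      if "Gs \<in> block_lists \<F> \<and> set (butlast Gs) \<subseteq> maximal_sets \<F> \<and> \<Union>(set Gs) = \<Union>(set Fs) \<union> E" for Gs
      using that * by (intro block_decomposition_unique[of _ \<F>]) (auto simp: block_lists_def)
  qed
  thus ?thesis by (simp add: last_block_def)
qed

text \<open>The k-th set of any decomposition is an initial segment of what the earlier sets leave
  of M. Two such candidates are comparable, and comparable maximal sets are equal.\<close>

lemma decomp_eqI:
  assumes "D 0 = {}" "!!k. 1 <= k ==> D k \<in> maximal_sets \<F> \<and> set_less (D k) (D (Suc k))"
    and "(\<Union>k\<in>{1..}. D k) = M" "{} \<notin> maximal_sets \<F>"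
  shows "decomp \<F> M = D"
  unfolding decomp_def
proof (rule the_equality)
  show "D 0 = {} \<and> (\<forall>k\<ge>1. D k \<in> maximal_sets \<F> \<and> set_less (D k) (D (Suc k))) \<and> \<Union> (D ` {1..}) = M"
    using assms by auto
  have seg: "init_seg (D k) (M - (\<Union>j\<in>{1..<k}. D j))"
    if D: "D 0 = {}" "!!k. 1 <= k ==> D k \<in> maximal_sets \<F> \<and> set_less (D k) (D (Suc k))"
      "(\<Union>k\<in>{1..}. D k) = M" and k: "1 <= k" for D :: "nat => nat set" and k
  proof -
    have ne: "D k ~= {}" if "1 <= k" for k using D(2)[OF that] assms(4) by auto
    have less: "set_less (D i) (D j)" if "1 <= i" "i < j" for i j
      using that(2)
    proof (induction j)
      case (Suc j)
      show ?case
      proof (cases "i = j")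
        case False
        hence "set_less (D i) (D j)" "set_less (D j) (D (Suc j))"
          using Suc D(2)[of j] \<open>1 <= i\<close> by auto
        moreover have "D j ~= {}" using ne[of j] False Suc(2) \<open>1 <= i\<close> by simp
      ultimately show ?thesis by (rule set_less_trans)
      qed (use D(2)[of i] that in auto)
    qed simp
    have sub: "D k \<subseteq> M - (\<Union>j\<in>{1..<k}. D j)"
      using D(3) k less[THEN set_less_disjoint] by fastforce
    moreover have "x \<in> D k" if "y \<in> D k" "x \<in> M - (\<Union>j\<in>{1..<k}. D j)" "x <= y" for x y
    proof -
      note xy = that
      obtain j where j: "1 <= j" "x \<in> D j" using xy(2) D(3) by auto
      hence "\<not> j < k" using xy(2) by auto
      moreover have "\<not> k < j"
        using less[OF k, of j] j xy by (fastforce simp: set_less_def)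
      ultimately show ?thesis using j by (simp add: nat_neq_iff)
    qed
    ultimately show ?thesis unfolding init_seg_def by blast
  qed
  fix D' assume "D' 0 = {} \<and> (\<forall>k\<ge>1. D' k \<in> maximal_sets \<F> \<and> set_less (D' k) (D' (Suc k))) \<and> \<Union> (D' ` {1..}) = M"
  hence D': "D' 0 = {}" "!!k. 1 <= k ==> D' k \<in> maximal_sets \<F> \<and> set_less (D' k) (D' (Suc k))"
      "(\<Union>k\<in>{1..}. D' k) = M" by auto
  have "D' k = D k" for k
  proof (induction k rule: less_induct)
    case (less k)
    show ?case
    proof (cases "k = 0")
      case False
      hence k: "1 <= k" by simp
      have "(\<Union>j\<in>{1..<k}. D' j) = (\<Union>j\<in>{1..<k}. D j)" using less.IH by auto
      hence "init_seg (D' k) (D k) \<or> init_seg (D k) (D' k)"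
        using init_seg_linear[OF seg[OF D' k] ] seg[OF assms(1-3) k] by simp
      thus ?thesis using D'(2)[OF k] assms(2)[OF k] by (auto simp: maximal_sets_def)
    qed (simp add: assms(1) D'(1))
  qed
  thus "D' = D" by blast
qed

text \<open>Maximal members in constructive form: a successor block has exactly as many pieces as
  its minimum says. They are maximal (\<open>blk_maximal\<close>) and every infinite set starts with
  one (\<open>blk_init_seg_ex\<close>), so the decomposition of an infinite set consists of them.
  \<open>At\<close> leaves the bottom open: singletons in the first game, whole blocks of level
  \<xi> in the second.\<close>

inductive blk :: "(omega1 => nat => omega1) => (nat set => bool) => omega1 => nat set => bool"
  for cs At where
  base: "At F ==> blk cs At 0 F"
| succ: "Fs ~= [] ==> (!!F. F \<in> set Fs ==> blk cs At \<zeta> F) ==> sorted_wrt set_less Fs ==>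
    length Fs = Min (hd Fs) ==> blk cs At (osuc \<zeta>) (\<Union>(set Fs))"
| limit: "is_limit \<zeta> ==> blk cs At (osuc (cs \<zeta> (Min F))) F ==> blk cs At \<zeta> F"

text \<open>Each piece is evaluated at the history it finds. A weighted sum over a successor block
  becomes such a sum over its pieces.\<close>

fun ssum :: "(nat set => nat set => 'a::comm_monoid_add) => nat set => nat set list => 'a" where
  "ssum A h [] = 0"
| "ssum A h (F # Fs) = A h F + ssum A (h \<union> F) Fs"

definition segs :: "nat set => nat set set" where
  "segs F = {E. init_seg E F \<and> E ~= {}}"

lemma finite_segs: "finite F ==> finite (segs F)"
  by (rule finite_subset[of _ "Pow F"]) (auto simp: segs_def init_seg_def)

lemma segs_Un:
  assumes "set_less F R"
  shows "segs (F \<union> R) = segs F \<union> (\<union>) F ` segs R"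
proof (intro subset_antisym subsetI)
  fix E assume E: "E \<in> segs (F \<union> R)"
  show "E \<in> segs F \<union> (\<union>) F ` segs R"
  proof (cases "E \<subseteq> F")
    case False
    hence FE: "F \<subseteq> E"
      using E assms init_seg_superset by (auto simp: segs_def)
    moreover have "init_seg (E - F) R"
      unfolding init_seg_def
    proof (intro conjI ballI impI)
      have E': "E \<subseteq> F \<union> R" "!!i j. i \<in> E ==> j \<in> F \<union> R ==> j <= i ==> j \<in> E"
        using E by (simp_all add: segs_def init_seg_def)
      show "E - F \<subseteq> R" using E'(1) by blast
      fix i j assume ij: "i \<in> E - F" "j \<in> R" "j <= i"
      hence "j \<in> E" using E'(2)[of i j] by blast
      moreover have "j \<notin> F" using ij(2) set_less_disjoint[OF assms] by blast
      ultimately show "j \<in> E - F" by blast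
    qed
    hence "E - F \<in> segs R" using False by (auto simp: segs_def)
    ultimately show ?thesis by (intro UnI2 image_eqI[of _ _ "E - F"]) auto
  qed (use E in \<open>auto simp: segs_def init_seg_def\<close>)
next
  fix E assume "E \<in> segs F \<union> (\<union>) F ` segs R"
  then consider "E \<in> segs F" | G where "G \<in> segs R" "E = F \<union> G" by blast
  thus "E \<in> segs (F \<union> R)"
  proof cases
    case 1
    thus ?thesis
      using init_seg_trans[OF _ init_seg_Un[OF assms]] by (auto simp: segs_def)
  next
    case 2
    thus ?thesis
      using init_seg_Un_mono[OF assms] by (auto simp: segs_def)
  qed
qed

lemma sum_segs_Un:
  assumes "set_less F R" "finite F" "finite R"
  shows "sum k (segs (F \<union> R)) = sum k (segs F) + (\<Sum>E\<in>segs R. k (F \<union> E))"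
proof -
  have dis: "E \<inter> F = {}" if "E \<in> segs R" for E
    using that assms(1) set_less_disjoint by (auto simp: segs_def init_seg_def; blast)
  have "inj_on ((\<union>) F) (segs R)" using dis by (auto simp: inj_on_def; blast)
  moreover have "segs F \<inter> (\<union>) F ` segs R = {}"
    using dis by (auto simp: segs_def init_seg_def; blast)
  ultimately show ?thesis
    unfolding segs_Un[OF assms(1)] using assms finite_segs
    by (subst sum.union_disjoint) (auto simp: sum.reindex)
qed

lemma segments_between_Un:
  assumes "set_less h F" shows "segments_between h (h \<union> F) = (\<union>) h ` segs F"
proof (intro subset_antisym subsetI)
  fix E assume "E \<in> segments_between h (h \<union> F)"
  hence E: "init_seg h E" "h ~= E" "init_seg E (h \<union> F)"
    unfolding segments_between_def by auto
  hence "E = h \<union> (E - h)" unfolding init_seg_def by blast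
  moreover have "init_seg (E - h) F"
    unfolding init_seg_def
  proof (intro conjI ballI impI)
    have E': "E \<subseteq> h \<union> F" "!!i j. i \<in> E ==> j \<in> h \<union> F ==> j <= i ==> j \<in> E"
      using E(3) by (simp_all add: init_seg_def)
    show "E - h \<subseteq> F" using E'(1) by blast
    fix i j assume ij: "i \<in> E - h" "j \<in> F" "j <= i"
    hence "j \<in> E" using E'(2)[of i j] by blast
    moreover have "j \<notin> h" using assms ij(2) set_less_disjoint[OF assms] by blast
    ultimately show "j \<in> E - h" by blast
  qed
  moreover have "E - h ~= {}" using E(1,2) by (simp add: init_seg_def) blast
  ultimately have "E = h \<union> (E - h)" "E - h \<in> segs F" by (simp_all add: segs_def)
  thus "E \<in> (\<union>) h ` segs F" by (rule image_eqI)
next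
  fix E assume "E \<in> (\<union>) h ` segs F"
  then obtain G where G: "init_seg G F" "G ~= {}" "E = h \<union> G"
    unfolding segs_def by blast
  hence "set_less h G" using set_less_mono[OF assms, of h G] by (simp add: init_seg_def)
  hence "h ~= E" using G set_less_disjoint[of h G] by blast
  moreover have "init_seg h E" using init_seg_Un[OF \<open>set_less h G\<close>] G by simp
  moreover have "init_seg E (h \<union> F)"
    using G init_seg_Un_mono[OF assms] by simp
  ultimately show "E \<in> segments_between h (h \<union> F)"
    unfolding segments_between_def by blast
qed

lemma blk_osuc_cases:
  assumes "blk cs At (osuc \<zeta>) F"
  obtains Fs where "Fs ~= []" "!!F. F \<in> set Fs ==> blk cs At \<zeta> F" "sorted_wrt set_less Fs"
    "length Fs = Min (hd Fs)" "F = \<Union>(set Fs)"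
  using assms by (cases rule: blk.cases) (auto simp: is_limit_def)

lemma blk_limit_cases:
  assumes "blk cs At \<zeta> F" "is_limit \<zeta>"
  shows "blk cs At (osuc (cs \<zeta> (Min F))) F"
  using assms by (cases rule: blk.cases) (auto simp: is_limit_def)

text \<open>A hierarchy \<open>S\<close> built from \<open>S 0\<close> by the Schreier recursion; \<open>At\<close> holds of the maximal members
  of \<open>S 0\<close> admitted as atoms.\<close>

locale schreier_hierarchy =
  fixes cs :: "omega1 => nat => omega1" and S :: "omega1 => nat set set" and At :: "nat set => bool"
  assumes cs: "characteristic_sequences cs"
    and base_fin: "S 0 \<subseteq> fin_subsets {1..}"
    and base_sing: "1 <= n ==> {n} \<in> S 0"
    and base_her: "E \<in> S 0 ==> E' \<subseteq> E ==> E' \<in> S 0"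
    and At_max: "At F ==> F \<in> maximal_sets (S 0)"
    and At_ex: "M \<in> inf_subsets {1..} ==> \<exists>F. At F \<and> init_seg F M"
    and S_step: "S (osuc \<zeta>) = schreier_step (S \<zeta>)"
    and S_lim: "is_limit \<zeta> ==>
      S \<zeta> = {{}} \<union> {E \<in> fin_subsets {1..}. E ~= {} \<and> E \<in> S (osuc (cs \<zeta> (Min E)))}"
    and S_inc: "is_limit \<zeta> ==> 1 <= n ==> S (osuc (cs \<zeta> n)) \<subseteq> S (cs \<zeta> (Suc n))"
begin

lemma S_fin: "S \<zeta> \<subseteq> fin_subsets {1..}"
proof (induction \<zeta> rule: less_induct)
  case (less \<zeta>)
  consider "\<zeta> = 0" | \<eta> where "\<zeta> = osuc \<eta>" | "is_limit \<zeta>"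
    by (auto simp: is_limit_def is_succ_def)
  thus ?case
  proof cases
    case 2
    hence "S \<eta> \<subseteq> fin_subsets {1..}" using less.IH[of \<eta>] by simp
    thus ?thesis
      unfolding 2 S_step schreier_step_def block_lists_def fin_subsets_def by fastforce
  next
    case 3
    thus ?thesis using S_lim[OF 3] by (auto simp: fin_subsets_def)
  qed (use base_fin in simp)
qed

lemma S_subset_osuc: "S \<zeta> \<subseteq> S (osuc \<zeta>)"
proof
  fix E assume E: "E \<in> S \<zeta>"
  show "E \<in> S (osuc \<zeta>)"
  proof (cases "E = {}")
    case False
    hence "1 <= Min E" using E S_fin Min_fin_subsets by blast
    hence "sorted_wrt set_less [E] \<and> set [E] \<subseteq> S \<zeta> \<and> \<Union>(set [E]) = E \<and> length [E] <= Min E"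
      using E by simp
    thus ?thesis unfolding S_step schreier_step_iff[OF S_fin] by blast
  qed (simp add: S_step schreier_step_def)
qed

lemma S_char_mono:
  assumes "is_limit \<zeta>" "1 <= m" "m <= n" shows "S (osuc (cs \<zeta> m)) \<subseteq> S (osuc (cs \<zeta> n))"
  using assms(3)
proof (induction n rule: dec_induct)
  case (step n)
  hence "1 <= n" using assms(2) by simp
  thus ?case using step S_inc[OF assms(1), of n] S_subset_osuc by blast
qed simp

text \<open>Passing to a subset can raise the minimum. At a successor this only relaxes the bound on
  the number of pieces; at a limit it changes the level \<open>osuc (cs \<zeta> (Min E))\<close>,
  and monotonicity along the characteristic sequence (\<open>S_char_mono\<close>) makes up for
  it.\<close>

lemma S_hereditary: "E \<in> S \<zeta> ==> E' \<subseteq> E ==> E' \<in> S \<zeta>"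
proof (induction \<zeta> arbitrary: E E' rule: less_induct)
  case (less \<zeta>)
  have finE: "finite E" using less.prems S_fin by (auto simp: fin_subsets_def)
  consider "\<zeta> = 0" | \<eta> where "\<zeta> = osuc \<eta>" | "is_limit \<zeta>"
    by (auto simp: is_limit_def is_succ_def)
  thus ?case
  proof cases
    case 1
    thus ?thesis using base_her less.prems by blast
  next
    case 2
    show ?thesis
    proof (cases "E' = {}")
      case False
      then obtain Es where Es: "sorted_wrt set_less Es" "set Es \<subseteq> S \<eta>" "\<Union>(set Es) = E" "length Es <= Min E"
        using less.prems unfolding 2 S_step schreier_step_iff[OF S_fin] by auto
      define Fs where "Fs = map (\<lambda>A. A \<inter> E') Es"
      have "sorted_wrt set_less Fs"
        using Es(1) unfolding Fs_def sorted_wrt_map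
        by (rule sorted_wrt_mono_rel[rotated]) (auto intro: set_less_mono)
      moreover have "set Fs \<subseteq> S \<eta>" using Es(2) less.IH[of \<eta>] 2 by (auto simp: Fs_def)
      moreover have "\<Union>(set Fs) = E'" using Es(3) less.prems(2) by (auto simp: Fs_def)
      moreover have "length Fs <= Min E'"
        using Es(4) Min_antimono[OF less.prems(2) False finE] by (simp add: Fs_def)
      ultimately show ?thesis unfolding 2 S_step schreier_step_iff[OF S_fin] by blast
    qed (simp add: 2 S_step schreier_step_def)
  next
    case 3
    show ?thesis
    proof (cases "E' = {}")
      case False
      have E: "E \<in> fin_subsets {1..}" "E ~= {}" "E \<in> S (osuc (cs \<zeta> (Min E)))"
        using less.prems False S_lim[OF 3] by auto
      have "E' \<in> S (osuc (cs \<zeta> (Min E)))"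
        using less.IH[OF osuc_char_less[OF cs 3 Min_fin_subsets[OF E(1,2)]] E(3) less.prems(2)] .
      hence "E' \<in> S (osuc (cs \<zeta> (Min E')))"
        using S_char_mono[OF 3 Min_fin_subsets[OF E(1,2)] Min_antimono[OF less.prems(2) False finE]]
        by blast
      moreover have "E' \<in> fin_subsets {1..}"
        using E(1) less.prems(2) finite_subset by (auto simp: fin_subsets_def)
      ultimately show ?thesis using S_lim[OF 3] False by blast
    qed (simp add: S_lim[OF 3])
  qed
qed

lemma S_sing: "1 <= n ==> {n} \<in> S \<zeta>"
proof (induction \<zeta> rule: less_induct)
  case (less \<zeta>)
  consider "\<zeta> = 0" | \<eta> where "\<zeta> = osuc \<eta>" | "is_limit \<zeta>"
    by (auto simp: is_limit_def is_succ_def)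
  thus ?case
  proof cases
    case 2
    thus ?thesis using less S_subset_osuc[of \<eta>] by auto
  next
    case 3
    thus ?thesis using less osuc_char_less[OF cs 3, of n] S_lim[OF 3]
      by (auto simp: fin_subsets_def)
  qed (use base_sing less in simp)
qed

lemma maximal_sets_nonempty: "{} \<notin> maximal_sets (S \<zeta>)"
  using S_sing[of 1 \<zeta>] by (auto simp: maximal_sets_def init_seg_def)

lemma maximal_setsD: "F \<in> maximal_sets (S \<zeta>) ==> finite F \<and> F ~= {} \<and> F \<subseteq> {1..} \<and> F \<in> S \<zeta>"
  using maximal_sets_nonempty[of \<zeta>] S_fin[of \<zeta>] by (auto simp: maximal_sets_def fin_subsets_def)

abbreviation "block \<equiv> blk cs At"

text \<open>At a successor, an extension G of the block has no larger minimum, so it is a union of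
  at most as many members as the block has maximal pieces, and \<open>maximal_sets_greedy\<close>
  leaves no room for new elements. At a limit an extension has the same minimum and is thus compared
  on the same lower level.\<close>

lemma blk_maximal: "block \<zeta> F ==> F \<in> maximal_sets (S \<zeta>)"
proof (induction rule: blk.induct)
  case (base F)
  thus ?case by (rule At_max)
next
  case (succ Fs \<zeta>)
  have Fs: "set Fs \<subseteq> maximal_sets (S \<zeta>)" using succ.IH by auto
  have D: "finite F \<and> F ~= {} \<and> F \<subseteq> {1..} \<and> F \<in> S \<zeta>" if "F \<in> set Fs" for F
    using that Fs maximal_setsD by blast
  have M: "Min (\<Union>(set Fs)) = Min (hd Fs)"
    using succ.hyps D by (intro Min_Union_sorted) auto
  have "\<Union>(set Fs) \<in> S (osuc \<zeta>)"
    unfolding S_step schreier_step_iff[OF S_fin]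
    using succ.hyps M D by (intro disjI2 exI[of _ Fs]) auto
  moreover have "G = \<Union>(set Fs)" if G: "G \<in> S (osuc \<zeta>)" "init_seg (\<Union>(set Fs)) G" for G
  proof -
    have ne: "\<Union>(set Fs) ~= {}" using succ.hyps(1) D by (cases Fs) auto
    hence "G ~= {}" using G(2) by (auto simp: init_seg_def)
    then obtain Gs where Gs: "sorted_wrt set_less Gs" "set Gs \<subseteq> S \<zeta>" "\<Union>(set Gs) = G" "length Gs <= Min G"
      using G(1) unfolding S_step schreier_step_iff[OF S_fin] by auto
    have finG: "finite G" using G(1) S_fin[of "osuc \<zeta>"] by (auto simp: fin_subsets_def)
    have "Min G <= Min (\<Union>(set Fs))"
      using G(2) ne finG by (intro Min_antimono) (auto simp: init_seg_def)
    hence "length Gs <= length Fs" using Gs(4) M succ.hyps by simp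
    hence "G \<subseteq> \<Union>(set Fs)"
      using maximal_sets_greedy[OF S_hereditary succ.hyps(3) Fs Gs(1,2)] G(2) Gs(3) by simp
    thus ?thesis using G(2) by (auto simp: init_seg_def)
  qed
  ultimately show ?case by (auto simp: maximal_sets_def)
next
  case (limit \<zeta> F)
  hence F: "F \<in> S (osuc (cs \<zeta> (Min F)))" "finite F" "F ~= {}" "F \<subseteq> {1..}"
    using maximal_setsD by blast+
  hence "F \<in> S \<zeta>" using S_lim[OF limit.hyps(1)] by (auto simp: fin_subsets_def)
  moreover have "G = F" if G: "G \<in> S \<zeta>" "init_seg F G" for G
  proof -
    have G': "G ~= {}" "finite G" "G \<in> S (osuc (cs \<zeta> (Min G)))"
      using G F(3) S_lim[OF limit.hyps(1)] by (auto simp: init_seg_def fin_subsets_def)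
    have "Min G = Min F"
    proof (rule Min_eqI)
      show "Min F \<in> G" using G(2) Min_in[OF F(2,3)] by (auto simp: init_seg_def)
      show "Min F <= y" if "y \<in> G" for y
      proof (rule ccontr)
        assume "\<not> Min F <= y"
        hence "y \<in> F" using G(2) that Min_in[OF F(2,3)] unfolding init_seg_def by (meson nat_le_linear)
        thus False using \<open>\<not> Min F <= y\<close> Min_le[OF F(2)] by blast
      qed
    qed fact
    thus ?thesis using G' G(2) limit.IH by (auto simp: maximal_sets_def)
  qed
  ultimately show ?case by (auto simp: maximal_sets_def)
qed

lemma blkD: "block \<zeta> F ==> finite F \<and> F ~= {} \<and> F \<subseteq> {1..} \<and> F \<in> S \<zeta>"
  using blk_maximal maximal_setsD by blast

lemma Min_init_seg:
  assumes "init_seg F M" "F ~= {}" "finite F" shows "Min F = Inf M"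
proof (rule antisym)
  have "M ~= {}" using assms by (auto simp: init_seg_def)
  hence "Inf M \<in> M" by (rule Inf_nat_def1)
  show "Min F <= Inf M"
  proof (rule ccontr)
    assume "\<not> Min F <= Inf M"
    hence "Inf M \<in> F"
      using assms(1) \<open>Inf M \<in> M\<close> Min_in[OF assms(3,2)] unfolding init_seg_def by (meson nat_le_linear)
    thus False using \<open>\<not> Min F <= Inf M\<close> Min_le[OF assms(3)] by blast
  qed
  show "Inf M <= Min F"
    using Min_in[OF assms(3,2)] assms(1) unfolding init_seg_def by (intro cInf_lower) blast+
qed

text \<open>Pieces are cut off from M one after another. Their number, or the level at a limit, is
  known in advance because the minimum of the block under construction is
  \<open>Inf M\<close>.\<close>

lemma blk_init_seg_ex: "M \<in> inf_subsets {1..} ==> \<exists>F. block \<zeta> F \<and> init_seg F M"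
proof (induction \<zeta> arbitrary: M rule: less_induct)
  case (less \<zeta>)
  have M: "Inf M \<in> M" "1 <= Inf M"
    using Inf_nat_def1[of M] less.prems by (force simp: inf_subsets_def)+
  consider "\<zeta> = 0" | \<eta> where "\<zeta> = osuc \<eta>" | "is_limit \<zeta>"
    by (auto simp: is_limit_def is_succ_def)
  thus ?case
  proof cases
    case 1
    thus ?thesis using At_ex[OF less.prems] blk.base by blast
  next
    case 2
    have "\<exists>Fs. length Fs = n \<and> (\<forall>F\<in>set Fs. block \<eta> F) \<and> sorted_wrt set_less Fs \<and> init_seg (\<Union>(set Fs)) M" for n
    proof (induction n)
      case 0
      thus ?case by (simp add: init_seg_def)
    next
      case (Suc n)
      then obtain Fs where Fs: "length Fs = n" "\<forall>F\<in>set Fs. block \<eta> F" "sorted_wrt set_less Fs"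
        "init_seg (\<Union>(set Fs)) M" by blast
      let ?U = "\<Union>(set Fs)"
      have "finite ?U" using Fs(2) blkD by blast
      hence "M - ?U \<in> inf_subsets {1..}" using less.prems by (auto simp: inf_subsets_def)
      then obtain F where F: "block \<eta> F" "init_seg F (M - ?U)" using less.IH[of \<eta>] 2 by auto
      have lessU: "set_less ?U (M - ?U)" by (rule init_seg_Diff_less[OF Fs(4)])
      hence "set_less ?U F" using F(2) by (auto simp: init_seg_def intro: set_less_mono)
      hence "sorted_wrt set_less (Fs @ [F])" using Fs(3) by (simp add: sorted_wrt_append set_less_Union)
      moreover have "init_seg (?U \<union> F) (?U \<union> (M - ?U))" by (rule init_seg_Un_mono[OF lessU F(2)])
      moreover have "?U \<union> (M - ?U) = M" "\<Union>(set (Fs @ [F])) = ?U \<union> F"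
        using Fs(4) unfolding init_seg_def by auto
      ultimately have "sorted_wrt set_less (Fs @ [F])" "init_seg (\<Union>(set (Fs @ [F]))) M" by simp_all
      thus ?case using Fs F(1) by (intro exI[of _ "Fs @ [F]"]) auto
    qed
    then obtain Fs where Fs: "length Fs = Inf M" "\<forall>F\<in>set Fs. block \<eta> F" "sorted_wrt set_less Fs"
      "init_seg (\<Union>(set Fs)) M" by blast
    have ne: "Fs ~= []" using Fs(1) M by auto
    have D: "finite F \<and> F ~= {}" if "F \<in> set Fs" for F using that Fs(2) blkD by blast
    have "Min (hd Fs) = Min (\<Union>(set Fs))" using Min_Union_sorted[OF ne Fs(3) D] by simp
    also have "\<dots> = Inf M"
      using D ne by (intro Min_init_seg[OF Fs(4)]) (cases Fs; auto)+
    finally have "block \<zeta> (\<Union>(set Fs))" unfolding 2 using Fs ne by (intro blk.succ) auto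
    thus ?thesis using Fs(4) by blast
  next
    case 3
    then obtain F where F: "block (osuc (cs \<zeta> (Inf M))) F" "init_seg F M"
      using less.IH[OF osuc_char_less[OF cs 3 M(2)] less.prems] by blast
    hence "Min F = Inf M" using blkD[OF F(1)] by (intro Min_init_seg) auto
    hence "block (osuc (cs \<zeta> (Min F))) F" using F(1) by simp
    with 3 have "block \<zeta> F" by (rule blk.limit)
    thus ?thesis using F(2) by blast
  qed
qed

lemma last_block_append:
  assumes "sorted_wrt set_less Fs" "!!F. F \<in> set Fs ==> block \<zeta> F" "E \<in> S \<zeta>" "E ~= {}"
    and "set_less (\<Union>(set Fs)) E"
  shows "last_block (S \<zeta>) (\<Union>(set Fs) \<union> E) = E"
proof (rule last_block_eqI)
  show "set Fs \<subseteq> maximal_sets (S \<zeta>)" "{} \<notin> set Fs"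
    using assms(2) blk_maximal blkD by blast+
qed (use assms in auto)

lemma last_block_self: "E \<in> S \<zeta> ==> E ~= {} ==> last_block (S \<zeta>) E = E"
  using last_block_append[of "[]" \<zeta> E] by simp

text \<open>E is prolonged to an infinite set by all numbers beyond its maximum. The first block of
  that set either contains E, which then belongs to the family by heredity, or is an initial segment
  of E that can be split off.\<close>

lemma decomposition_ex:
  assumes "finite E" "E ~= {}" "E \<subseteq> {1..}"
  shows "\<exists>Fs E'. sorted_wrt set_less Fs \<and> (\<forall>F\<in>set Fs. block \<zeta> F) \<and> E' \<in> S \<zeta> \<and> E' ~= {} \<and>
    set_less (\<Union>(set Fs)) E' \<and> E = \<Union>(set Fs) \<union> E'"
  using assms
proof (induction "card E" arbitrary: E rule: less_induct)
  case less
  define M where "M = E \<union> {Suc (Max E)..}"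
  have EM: "set_less E {Suc (Max E)..}"
    unfolding set_less_def using Max_ge[OF less.prems(1)] by fastforce
  have "M \<in> inf_subsets {1..}" using less.prems by (auto simp: M_def inf_subsets_def infinite_Ici)
  then obtain F where F: "block \<zeta> F" "init_seg F M" using blk_init_seg_ex by blast
  have "init_seg E M" unfolding M_def by (rule init_seg_Un[OF EM])
  show ?case
  proof (cases "E \<subseteq> F")
    case True
    hence "E \<in> S \<zeta>" using F(1) blkD S_hereditary by blast
    thus ?thesis using less.prems by (intro exI[of _ "[]"] exI[of _ E]) auto
  next
    case False
    hence FE: "init_seg F E"
      using init_seg_linear[OF F(2) \<open>init_seg E M\<close>] by (auto simp: init_seg_def)
    have F': "F ~= {}" "F \<subseteq> E" using blkD[OF F(1)] FE by (auto simp: init_seg_def)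
    have FD: "set_less F (E - F)" by (rule init_seg_Diff_less[OF FE])
    have "card (E - F) < card E"
      using F' less.prems(1) by (intro psubset_card_mono) auto
    then obtain Fs E' where *: "sorted_wrt set_less Fs" "\<forall>F\<in>set Fs. block \<zeta> F" "E' \<in> S \<zeta>" "E' ~= {}"
      "set_less (\<Union>(set Fs)) E'" "E - F = \<Union>(set Fs) \<union> E'"
      using less.hyps[of "E - F"] less.prems False by auto
    have "set_less F (\<Union>(set Fs) \<union> E')" using FD *(6) by simp
    thus ?thesis
      using * F(1) F'(2) by (intro exI[of _ "F # Fs"] exI[of _ E'])
        (auto simp: set_less_Un2 set_less_Un set_less_Union2)
  qed
qed

text \<open>A full block in front does not change the last block. This makes the weights p invariant
  under prefixed atoms of the second hierarchy, as \<open>s_At\<close> demands.\<close>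

lemma last_block_Un:
  assumes "block \<zeta> F" "set_less F E" "finite E" "E ~= {}" "E \<subseteq> {1..}"
  shows "last_block (S \<zeta>) (F \<union> E) = last_block (S \<zeta>) E"
proof -
  obtain Fs E' where *: "sorted_wrt set_less Fs" "\<forall>F\<in>set Fs. block \<zeta> F" "E' \<in> S \<zeta>" "E' ~= {}"
      "set_less (\<Union>(set Fs)) E'" "E = \<Union>(set Fs) \<union> E'"
    using decomposition_ex[OF assms(3-5)] by blast
  have "last_block (S \<zeta>) (\<Union>(set (F # Fs)) \<union> E') = E'"
    using * assms by (intro last_block_append) (auto simp: set_less_Un set_less_Un2 set_less_Union2)
  moreover have "last_block (S \<zeta>) (\<Union>(set Fs) \<union> E') = E'"
    using * by (intro last_block_append) auto
  ultimately show ?thesis using *(6) by (simp add: Un_assoc)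
qed

lemma Union_block_segs:
  assumes "block \<zeta> F" "E \<in> segs F" shows "E \<in> S \<zeta>" "E ~= {}" "finite E" "E \<subseteq> {1..}" "E \<subseteq> F"
proof -
  show EF: "E \<subseteq> F" "E ~= {}" using assms(2) by (auto simp: segs_def init_seg_def)
  thus "E \<in> S \<zeta>" using blkD[OF assms(1)] S_hereditary by blast
  show "finite E" using EF(1) blkD[OF assms(1)] finite_subset by blast
  show "E \<subseteq> {1..}" using EF(1) blkD[OF assms(1)] by blast
qed

end

text \<open>\<open>t\<close> is the weight produced by the recursion, with factor \<rho> at each
  successor: 1/m in the first game and 1/sqrt m in the second. \<open>s\<close> is an additional
  weight that ignores atoms in front of its argument: it is 1 in the first game and the weight p in
  the second.\<close>

locale weighted_hierarchy = schreier_hierarchy +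
  fixes \<rho> :: "nat => real" and t :: "omega1 => nat set => real" and s :: "nat set => real"
  assumes t_zero: "t 0 E = 1"
    and t_osuc: "t (osuc \<zeta>) E = t \<zeta> (last_block (S \<zeta>) E) * \<rho> (Min E)"
    and t_lim: "is_limit \<zeta> ==> E \<in> fin_subsets {1..} ==> E ~= {} ==> t \<zeta> E = t (osuc (cs \<zeta> (Min E))) E"
    and s_At: "At A ==> set_less A E ==> finite E ==> E ~= {} ==> E \<subseteq> {1..} ==> s (A \<union> E) = s E"
begin

text \<open>The contribution of the block F to an average when h is what precedes it. The weights
  depend only on the part E inside the block, the vectors on the whole set
  \<open>h \<union> E\<close>.\<close>

definition wsum :: "(nat set => 'b::real_normed_field) => omega1 => nat set => nat set => 'b" where
  "wsum v \<zeta> h F = (\<Sum>E\<in>segs F. of_real (t \<zeta> E * s E) * v (h \<union> E))"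

lemma s_blk:
  "block \<zeta> A ==> set_less A E ==> finite E ==> E ~= {} ==> E \<subseteq> {1..} ==> s (A \<union> E) = s E"
proof (induction arbitrary: E rule: blk.induct)
  case (base F)
  thus ?case by (rule s_At)
next
  case (succ Fs \<zeta>)
  have D: "finite F \<and> F ~= {} \<and> F \<subseteq> {1..}" if "F \<in> set Fs" for F
    using that succ.hyps blkD by blast
  have "s (\<Union>(set Gs) \<union> E) = s E" if "set Gs \<subseteq> set Fs" "sorted_wrt set_less Gs" for Gs
    using that
  proof (induction Gs)
    case (Cons G Gs)
    have "finite (\<Union>(set Gs))" using Cons.prems D by auto
    hence "s (G \<union> (\<Union>(set Gs) \<union> E)) = s (\<Union>(set Gs) \<union> E)"
      using Cons.prems succ.prems D
      by (intro succ.IH) (auto simp: set_less_Un2 set_less_Union set_less_Union2)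
    thus ?case using Cons by (simp add: Un_assoc)
  qed simp
  thus ?case using succ.hyps(3) by blast
next
  case (limit \<zeta> F)
  thus ?case by blast
qed

lemma s_blocks:
  assumes "sorted_wrt set_less Gs" "!!F. F \<in> set Gs ==> block \<zeta> F"
    and "set_less (\<Union>(set Gs)) E" "finite E" "E ~= {}" "E \<subseteq> {1..}"
  shows "s (\<Union>(set Gs) \<union> E) = s E"
  using assms(1-3)
proof (induction Gs)
  case (Cons K Ks)
  have D: "finite F \<and> F \<subseteq> {1..}" if "F \<in> set Ks" for F
    using blkD[OF Cons.prems(2)[of F]] that by simp
  have "s (K \<union> (\<Union>(set Ks) \<union> E)) = s (\<Union>(set Ks) \<union> E)"
  proof (rule s_blk)
    show "block \<zeta> K" using Cons.prems(2) by simp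
    show "set_less K (\<Union>(set Ks) \<union> E)"
      using Cons.prems by (simp add: set_less_Un2 set_less_Un set_less_Union2)
    show "finite (\<Union>(set Ks) \<union> E)" using D assms(4) by blast
    show "\<Union>(set Ks) \<union> E \<subseteq> {1..}" using D assms(6) by blast
  qed (use assms(5) in blast)
  thus ?case using Cons by (simp add: Un_assoc set_less_Un)
qed simp

lemma wsum_zero: "wsum v 0 h F = (\<Sum>E\<in>segs F. of_real (s E) * v (h \<union> E))"
  by (simp add: wsum_def t_zero)

text \<open>An initial segment of the union that ends in a given piece has its part in that piece as
  last block, and its minimum is that of the union. Its weight is thus the lower weight of this part
  times one common factor \<rho>.\<close>

lemma wsum_osuc:
  assumes "Fs ~= []" "!!F. F \<in> set Fs ==> block \<zeta> F" "sorted_wrt set_less Fs"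
  shows "wsum v (osuc \<zeta>) h (\<Union>(set Fs)) = of_real (\<rho> (Min (\<Union>(set Fs)))) * ssum (wsum v \<zeta>) h Fs"
proof -
  define m where "m = Min (\<Union>(set Fs))"
  \<comment> \<open>Induction over the pieces still to come (\<open>Hs\<close>), while those already
    passed (\<open>Gs\<close>) are carried along in front of every segment.\<close>
  have main: "(\<Sum>E\<in>segs (\<Union>(set Hs)). of_real (t (osuc \<zeta>) (\<Union>(set Gs) \<union> E) * s (\<Union>(set Gs) \<union> E)) *
      v (h \<union> (\<Union>(set Gs) \<union> E))) = of_real (\<rho> m) * ssum (wsum v \<zeta>) (h \<union> \<Union>(set Gs)) Hs"
    if "!!F. F \<in> set (Gs @ Hs) ==> block \<zeta> F" "sorted_wrt set_less (Gs @ Hs)"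
      "\<Union>(set (Gs @ Hs)) = \<Union>(set Fs)" for Gs Hs
    using that
  proof (induction Hs arbitrary: Gs)
    case (Cons H Hs)
    note blocks = Cons.prems(1)
    let ?G = "\<Union>(set Gs)" and ?R = "\<Union>(set Hs)"
    let ?k = "\<lambda>E. of_real (t (osuc \<zeta>) (?G \<union> E) * s (?G \<union> E)) * v (h \<union> (?G \<union> E))"
    have D: "finite F \<and> F ~= {} \<and> F \<subseteq> {1..}" if "F \<in> set (Gs @ H # Hs)" for F
      using that Cons.prems(1) blkD by blast
    have less: "set_less ?G H" "set_less H ?R" "set_less ?G ?R" "sorted_wrt set_less Gs"
      using Cons.prems(2) by (auto simp: sorted_wrt_append set_less_Union set_less_Union2)
    have E: "?k E = of_real (\<rho> m) * (of_real (t \<zeta> E * s E) * v (h \<union> ?G \<union> E))" if E: "E \<in> segs H" for E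
    proof -
      have H: "block \<zeta> H" using Cons.prems(1) by simp
      note EH = Union_block_segs[OF H E]
      have GE: "set_less ?G E" using less(1) EH(5) by (auto intro: set_less_mono)
      have "last_block (S \<zeta>) (?G \<union> E) = E"
        using Cons.prems(1) EH GE less(4) by (intro last_block_append) auto
      moreover have "s (?G \<union> E) = s E"
        using blocks less(4) GE EH by (intro s_blocks) auto
      moreover have "Min (?G \<union> E) = m"
      proof -
        have "init_seg (?G \<union> E) (?G \<union> (H \<union> ?R))"
          using E less init_seg_trans[OF _ init_seg_Un[OF less(2)]]
          by (intro init_seg_Un_mono) (auto simp: segs_def set_less_Un2)
        moreover have "?G \<union> (H \<union> ?R) = \<Union>(set Fs)" using Cons.prems(3) by auto
        ultimately have i: "init_seg (?G \<union> E) (\<Union>(set Fs))" by simp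
        have fin: "finite (?G \<union> E)" "finite (\<Union>(set Fs))"
          using D EH unfolding Cons.prems(3)[symmetric] by auto
        have "?G \<union> E \<subseteq> \<Union>(set Fs)" using i unfolding init_seg_def by blast
        hence "\<Union>(set Fs) ~= {}" using EH(2) by blast
        thus ?thesis
          using Min_init_seg[OF i] Min_init_seg[OF init_seg_refl, of "\<Union>(set Fs)"] EH fin by (simp add: m_def)
      qed
      ultimately show ?thesis by (simp add: t_osuc Un_assoc mult_ac)
    qed
    have "(\<Sum>E\<in>segs (H \<union> ?R). ?k E) = sum ?k (segs H) + (\<Sum>E\<in>segs ?R. ?k (H \<union> E))"
      using less D by (intro sum_segs_Un) auto
    also have "sum ?k (segs H) = of_real (\<rho> m) * wsum v \<zeta> (h \<union> ?G) H"
      unfolding wsum_def sum_distrib_left by (rule sum.cong[OF refl E])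
    also have "(\<Sum>E\<in>segs ?R. ?k (H \<union> E)) = of_real (\<rho> m) * ssum (wsum v \<zeta>) (h \<union> ?G \<union> H) Hs"
    proof -
      have "\<Union>(set (Gs @ [H])) = ?G \<union> H" by auto
      thus ?thesis
        using Cons.IH[of "Gs @ [H]"] Cons.prems by (simp only: append_assoc append_Cons append_Nil Un_assoc)
    qed
    finally show ?case by (simp add: distrib_left)
  qed (simp add: segs_def init_seg_def)
  show ?thesis using main[of "[]" Fs] assms by (simp add: wsum_def m_def)
qed

lemma wsum_limit:
  assumes "is_limit \<zeta>" "block \<zeta> F"
  shows "wsum v \<zeta> h F = wsum v (osuc (cs \<zeta> (Min F))) h F"
proof -
  have "t \<zeta> E = t (osuc (cs \<zeta> (Min F))) E" if E: "E \<in> segs F" for E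
  proof -
    note EF = Union_block_segs[OF assms(2) E]
    have "Min E = Min F"
      using E EF blkD[OF assms(2)] Min_init_seg[of E F] Min_init_seg[OF init_seg_refl, of F]
      by (auto simp: segs_def)
    thus ?thesis using t_lim[OF assms(1), of E] EF by (simp add: fin_subsets_def)
  qed
  thus ?thesis by (simp add: wsum_def)
qed

end

context schreier_hierarchy
begin

text \<open>Blocks are cut off successively from M. Since these blocks are maximal sets, uniqueness
  identifies the resulting sequence with the definite description \<open>decomp\<close>.\<close>

lemma decomp_ex:
  assumes M: "M \<in> inf_subsets {1..}"
  obtains D where "!!n. block \<zeta> (D (Suc n))" "!!n. set_less (\<Union>k\<in>{1..n}. D k) (D (Suc n))"
    "!!n. D (Suc n) \<subseteq> M" "decomp (S \<zeta>) M = D"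
proof -
  define next_block where "next_block h = (SOME F. block \<zeta> F \<and> init_seg F (M - h))" for h
  define H where "H = rec_nat {} (\<lambda>_ h. h \<union> next_block h)"
  have H: "H 0 = {}" "H (Suc n) = H n \<union> next_block (H n)" for n by (simp_all add: H_def)
  have nb: "block \<zeta> (next_block h) \<and> init_seg (next_block h) (M - h)" if "finite h" for h
  proof -
    have "M - h \<in> inf_subsets {1..}" using M that by (auto simp: inf_subsets_def)
    thus ?thesis unfolding next_block_def by (rule someI_ex[OF blk_init_seg_ex])
  qed
  have finH: "finite (H n)" for n
  proof (induction n)
    case (Suc n)
    thus ?case using nb[of "H n"] blkD[of \<zeta> "next_block (H n)"] by (simp add: H)
  qed (simp add: H)
  have seg: "init_seg (H n) M" for n
  proof (induction n)
    case (Suc n)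
    have "init_seg (H n \<union> next_block (H n)) (H n \<union> (M - H n))"
      using nb[OF finH] by (intro init_seg_Un_mono init_seg_Diff_less Suc) auto
    moreover have "H n \<union> (M - H n) = M" using Suc unfolding init_seg_def by blast
    ultimately show ?case by (simp add: H)
  qed (simp add: H init_seg_def)
  define D where "D n = (case n of 0 => {} | Suc n => next_block (H n))" for n
  have D: "D 0 = {}" "D (Suc n) = next_block (H n)" for n by (simp_all add: D_def)
  have HD: "H n = (\<Union>k\<in>{1..n}. D k)" for n
    by (induction n) (auto simp: H D atLeastAtMostSuc_conv)
  have blkDn: "block \<zeta> (D (Suc n))" for n using nb[OF finH] by (simp add: D)
  have sub: "D (Suc n) \<subseteq> M - H n" for n
    using nb[OF finH] by (simp add: D init_seg_def)
  have less: "set_less (H n) (D (Suc n))" for n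
    using set_less_mono[OF init_seg_Diff_less[OF seg] _ sub] by blast
  \<comment> \<open>Non-emptiness of the blocks forces the histories to grow without bound, so that
    they exhaust M.\<close>
  have card: "n <= card (H n)" for n
  proof (induction n)
    case (Suc n)
    have "H n \<inter> D (Suc n) = {}" using sub by blast
    moreover have "D (Suc n) ~= {}" "finite (D (Suc n))" using blkD[OF blkDn] by auto
    moreover have "H (Suc n) = H n \<union> D (Suc n)" by (simp add: H D)
    moreover have "0 < card (D (Suc n))" using calculation by (simp add: card_gt_0_iff)
    ultimately show ?case using Suc finH[of n] by (simp add: card_Un_disjoint)
  qed simp
  have "decomp (S \<zeta>) M = D"
  proof (rule decomp_eqI)
    show "D k \<in> maximal_sets (S \<zeta>) \<and> set_less (D k) (D (Suc k))" if "1 <= k" for k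
    proof -
      define n where "n = k - 1"
      hence k: "k = Suc n" using that by simp
      have "D k \<subseteq> H k" using that by (auto simp: HD)
      thus ?thesis using blk_maximal[OF blkDn[of n]] set_less_mono[OF less[of k]] k by auto
    qed
    show "(\<Union>k\<in>{1..}. D k) = M"
    proof (intro subset_antisym subsetI)
      fix x assume "x \<in> (\<Union>k\<in>{1..}. D k)"
      then obtain k where "1 <= k" "x \<in> D k" by auto
      thus "x \<in> M" using sub[of "k - 1"] by auto
    next
      fix x assume x: "x \<in> M"
      have "x \<in> H (Suc x)"
      proof (rule ccontr)
        assume "x \<notin> H (Suc x)"
        hence "H (Suc x) \<subseteq> {..<x}"
          using init_seg_Diff_less[OF seg, of "Suc x"] x by (auto simp: set_less_def)
        hence "card (H (Suc x)) <= x" using card_mono[of "{..<x}"] by auto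
        thus False using card[of "Suc x"] by simp
      qed
      thus "x \<in> (\<Union>k\<in>{1..}. D k)" by (auto simp: HD)
    qed
  qed (use maximal_sets_nonempty D in auto)
  thus thesis using that[of D] blkDn less sub by (auto simp: HD)
qed

end

context weighted_hierarchy
begin

text \<open>The bridge from the sums in \<open>average\<close> and \<open>average2\<close> to
  \<open>wsum\<close>: behind complete blocks, the last block of a set is its part in the current
  block.\<close>

lemma sum_segments_between:
  assumes "!!n. block \<zeta> (D (Suc n))" "!!n. set_less (\<Union>k\<in>{1..n}. D k) (D (Suc n))"
  shows "(\<Sum>G\<in>segments_between (\<Union>k\<in>{1..n}. D k) (\<Union>k\<in>{1..Suc n}. D k).
      of_real (t \<zeta> (last_block (S \<zeta>) G) * s G) * v G) = wsum v \<zeta> (\<Union>k\<in>{1..n}. D k) (D (Suc n))"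
proof -
  define H where "H = (\<Union>k\<in>{1..n}. D k)"
  define Gs where "Gs = map (\<lambda>k. D (Suc k)) [0..<n]"
  have U: "\<Union>(set Gs) = H"
  proof -
    have "{1..n} = Suc ` {0..<n}" by (simp add: image_Suc_atLeastLessThan atLeastLessThanSuc_atLeastAtMost)
    hence "H = \<Union>((\<lambda>k. D (Suc k)) ` {0..<n})" unfolding H_def by (simp only: image_image)
    thus ?thesis unfolding Gs_def by simp
  qed
  have sorted: "sorted_wrt set_less Gs"
    unfolding Gs_def sorted_wrt_map
  proof (rule sorted_wrt_mono_rel[OF _ sorted_wrt_upt])
    fix i j :: nat assume "i < j"
    hence "Suc i \<in> {1..j}" by simp
    hence "D (Suc i) \<subseteq> (\<Union>k\<in>{1..j}. D k)" by blast
    thus "set_less (D (Suc i)) (D (Suc j))" using set_less_mono[OF assms(2)[of j]] by blast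
  qed
  have less: "set_less H (D (Suc n))" using assms(2) by (simp add: H_def)
  have "(\<Union>k\<in>{1..Suc n}. D k) = H \<union> D (Suc n)" by (auto simp: H_def atLeastAtMostSuc_conv)
  hence "segments_between (\<Union>k\<in>{1..n}. D k) (\<Union>k\<in>{1..Suc n}. D k) = (\<union>) H ` segs (D (Suc n))"
    using segments_between_Un[OF less] by (simp add: H_def)
  moreover have "inj_on ((\<union>) H) (segs (D (Suc n)))"
  proof (rule inj_onI)
    fix A B assume "A \<in> segs (D (Suc n))" "B \<in> segs (D (Suc n))" and eq: "H \<union> A = H \<union> B"
    hence "A \<inter> H = {}" "B \<inter> H = {}"
      using Union_block_segs(5)[OF assms(1)] set_less_disjoint[OF less] by blast+
    thus "A = B" using eq by blast
  qed
  moreover have tE: "t \<zeta> (last_block (S \<zeta>) (H \<union> E)) * s (H \<union> E) = t \<zeta> E * s E" if "E \<in> segs (D (Suc n))" for E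
  proof -
    note E = Union_block_segs[OF assms(1) that]
    have HE: "set_less (\<Union>(set Gs)) E" using less E(5) U set_less_mono by blast
    have Gs: "!!F. F \<in> set Gs ==> block \<zeta> F" using assms(1) by (auto simp: Gs_def)
    show ?thesis
      using last_block_append[OF sorted Gs E(1,2) HE] s_blocks[OF sorted Gs HE E(3,2,4)]
      by (simp add: U)
  qed
  moreover have "(\<Sum>E\<in>segs (D (Suc n)). of_real (t \<zeta> (last_block (S \<zeta>) (H \<union> E)) * s (H \<union> E)) * v (H \<union> E)) =
      wsum v \<zeta> H (D (Suc n))"
    unfolding wsum_def by (intro sum.cong refl arg_cong2[of _ _ _ _ "(*)"] arg_cong[of _ _ of_real] tE)
  ultimately show ?thesis
    unfolding H_def[symmetric] by (simp add: sum.reindex del: of_real_mult)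
qed

end

section \<open>The two Schreier hierarchies\<close>

definition atom :: "nat set => bool" where
  "atom F \<longleftrightarrow> (\<exists>n\<ge>1. F = {n})"

lemma family_comp_mono: "\<G> \<subseteq> \<G>' ==> family_comp \<G> \<F> \<subseteq> family_comp \<G>' \<F>"
  by (auto simp: family_comp_def)

lemma schreier_hierarchy_p:
  assumes "characteristic_sequences cs"
  shows "schreier_hierarchy cs (schreier cs) atom"
proof
  show "characteristic_sequences cs" by fact
  show "schreier cs 0 \<subseteq> fin_subsets {1..}" by (rule schreier_subset)
  show "{n} \<in> schreier cs 0" if "1 <= n" for n using that by (auto simp: schreier_zero)
  show "E' \<in> schreier cs 0" if "E \<in> schreier cs 0" "E' \<subseteq> E" for E E'
    using that by (auto simp: schreier_zero)
  show "F \<in> maximal_sets (schreier cs 0)" if "atom F" for F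
    using that by (auto simp: maximal_sets_def schreier_zero atom_def init_seg_def)
  show "\<exists>F. atom F \<and> init_seg F M" if M: "M \<in> inf_subsets {1..}" for M
  proof -
    have ne: "M ~= {}" using M by (auto simp: inf_subsets_def)
    have "Inf M \<in> M" using ne by (rule Inf_nat_def1)
    moreover hence "1 <= Inf M" using M by (auto simp: inf_subsets_def)
    moreover have "init_seg {Inf M} M"
      using \<open>Inf M \<in> M\<close> cInf_lower[of _ M] by (auto simp: init_seg_def intro: antisym)
    ultimately show ?thesis by (auto simp: atom_def)
  qed
  show "schreier cs (osuc \<zeta>) = schreier_step (schreier cs \<zeta>)" for \<zeta> by (rule schreier_osuc)
  show "schreier cs \<zeta> = {{}} \<union> {E \<in> fin_subsets {1..}. E ~= {} \<and> E \<in> schreier cs (osuc (cs \<zeta> (Min E)))}"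
    if "is_limit \<zeta>" for \<zeta> using schreier_limit[OF assms that] by auto
  show "schreier cs (osuc (cs \<zeta> n)) \<subseteq> schreier cs (cs \<zeta> (Suc n))" if "is_limit \<zeta>" "1 <= n" for \<zeta> n
    using assms that unfolding characteristic_sequences_def by blast
qed

text \<open>A set of minima that belongs to S_0 has at most one element, so only single blocks
  remain. This identifies the bottom of the second hierarchy with S_\<xi>.\<close>

lemma family_comp_zero:
  assumes "{} \<in> \<F>" "\<F> \<subseteq> fin_subsets {1..}"
  shows "family_comp (schreier cs 0) \<F> = \<F>"
proof (intro subset_antisym subsetI)
  fix E assume "E \<in> family_comp (schreier cs 0) \<F>"
  then consider "E = {}" | Es where "Es \<in> block_lists \<F>" "Min ` set Es \<in> schreier cs 0" "E = \<Union>(set Es)"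
    by (auto simp: family_comp_def)
  thus "E \<in> \<F>"
  proof cases
    case 2
    obtain A Bs where Es: "Es = A # Bs" using 2(1) by (cases Es) (auto simp: block_lists_def)
    have "Bs = []"
    proof (rule ccontr)
      assume "Bs ~= []"
      then obtain B Cs where "Bs = B # Cs" by (cases Bs) auto
      hence AB: "set_less A B" "A \<in> \<F>" "B \<in> \<F>" "A ~= {}" "B ~= {}" "{Min A, Min B} \<subseteq> Min ` set Es"
        using 2(1) by (auto simp: Es block_lists_def)
      hence "Min A \<in> A" "Min B \<in> B"
        using assms(2) by (auto simp: fin_subsets_def intro!: Min_in)
      hence "Min A < Min B"
        using AB(1) by (simp add: set_less_def)
      thus False using AB(6) 2(2) by (auto simp: schreier_zero Es)
    qed
    thus ?thesis using 2 by (auto simp: Es block_lists_def)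
  qed (use assms in simp)
next
  fix E assume E: "E \<in> \<F>"
  show "E \<in> family_comp (schreier cs 0) \<F>"
  proof (cases "E = {}")
    case False
    hence "[E] \<in> block_lists \<F>" "1 <= Min E"
      using E assms(2) Min_fin_subsets by (auto simp: block_lists_def)
    thus ?thesis
      unfolding family_comp_def schreier_zero by (intro UnI2 CollectI exI[of _ "[E]"]) auto
  qed (simp add: family_comp_def)
qed

lemma Min_Union_image:
  assumes "finite \<A>" "\<A> ~= {}" "!!A. A \<in> \<A> ==> finite A \<and> A ~= {}"
  shows "Min (\<Union>\<A>) = Min (Min ` \<A>)"
proof (rule Min_eqI)
  show "finite (\<Union>\<A>)" using assms by auto
  show "Min (Min ` \<A>) <= y" if "y \<in> \<Union>\<A>" for y
  proof -
    obtain A where "A \<in> \<A>" "y \<in> A" using \<open>y \<in> \<Union>\<A>\<close> by blast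
    hence "Min (Min ` \<A>) <= Min A" using assms(1) by (intro Min_le) auto
    also have "Min A <= y" using assms(3) \<open>A \<in> \<A>\<close> \<open>y \<in> A\<close> by (intro Min_le) auto
    finally show ?thesis .
  qed
  have "Min (Min ` \<A>) \<in> Min ` \<A>" using assms by (intro Min_in) auto
  then obtain A where "A \<in> \<A>" "Min (Min ` \<A>) = Min A" by blast
  thus "Min (Min ` \<A>) \<in> \<Union>\<A>" using assms(3)[of A] Min_in[of A]
    by (intro UnionI[of A]) auto
qed

lemma sorted_blocks_less:
  assumes "sorted_wrt set_less Es" "A \<in> set Es" "B \<in> set Es" "finite A" "A ~= {}" "finite B" "B ~= {}"
    and "Min A < Min B"
  shows "set_less A B"
proof -
  obtain i j where ij: "i < length Es" "Es ! i = A" "j < length Es" "Es ! j = B"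
    using assms(2,3) by (auto simp: in_set_conv_nth)
  have "\<not> j < i"
  proof
    assume "j < i"
    hence "set_less B A" using assms(1) ij sorted_wrt_nth_less by blast
    hence "Min B < Min A" using assms(4-7) by (auto simp: set_less_def)
    thus False using assms(8) by simp
  qed
  moreover have "i ~= j" using ij assms(8) by auto
  ultimately have "i < j" by simp
  thus ?thesis using assms(1) ij sorted_wrt_nth_less by blast
qed

text \<open>One list of blocks is grouped in two ways: a decomposition of its set of minima into
  members of \<G> groups the blocks, and conversely the lists inside the groups are concatenated.
  The first group has the same minimum as its set of minima, so both sides impose the same bound on
  the number of groups.\<close>

lemma family_comp_step:
  assumes "{} \<in> \<F>" "\<F> \<subseteq> fin_subsets {1..}" "\<G> \<subseteq> fin_subsets {1..}"
  shows "family_comp (schreier_step \<G>) \<F> = schreier_step (family_comp \<G> \<F>)"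
proof (intro subset_antisym subsetI)
  have finF: "finite A" if "A \<in> \<F>" for A using that assms(2) by (auto simp: fin_subsets_def)
  fix E assume "E \<in> family_comp (schreier_step \<G>) \<F>"
  then consider "E = {}" | Es where "Es \<in> block_lists \<F>" "Min ` set Es \<in> schreier_step \<G>" "E = \<Union>(set Es)"
    by (auto simp: family_comp_def)
  thus "E \<in> schreier_step (family_comp \<G> \<F>)"
  proof cases
    case 2
    have Es: "Es ~= []" "sorted_wrt set_less Es" "!!A. A \<in> set Es ==> A ~= {} \<and> A \<in> \<F>"
      using 2(1) by (auto simp: block_lists_def)
    obtain Gs where Gs: "Gs \<in> block_lists \<G>" "length Gs <= Min (hd Gs)" "Min ` set Es = \<Union>(set Gs)"
      using 2(2) Es(1) by (auto simp: schreier_step_def)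
    have GsD: "sorted_wrt set_less Gs" "Gs ~= []" "!!G. G \<in> set Gs ==> G ~= {} \<and> G \<in> \<G>"
      using Gs(1) by (auto simp: block_lists_def)
    \<comment> \<open>A member G of the decomposition of the minima collects the blocks whose
      minimum lies in G.\<close>
    define part where "part G = filter (\<lambda>A. Min A \<in> G) Es" for G
    have Mpart: "Min ` set (part G) = G" if "G \<in> set Gs" for G
      using that Gs(3) by (auto simp: part_def)
    have part: "part G \<in> block_lists \<F>" if "G \<in> set Gs" for G
    proof -
      have "part G ~= []" using GsD(3)[OF that] Mpart[OF that] by auto
      thus ?thesis
        using Es by (auto simp: block_lists_def part_def intro: sorted_wrt_filter)
    qed
    define Bs where "Bs = map (\<lambda>G. \<Union>(set (part G))) Gs"
    have "Bs \<in> block_lists (family_comp \<G> \<F>)"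
    proof -
      have "sorted_wrt set_less Bs"
        unfolding Bs_def sorted_wrt_map
      proof (rule sorted_wrt_mono_rel[OF _ GsD(1)])
        fix G H assume "G \<in> set Gs" "H \<in> set Gs" "set_less G H"
        thus "set_less (\<Union>(set (part G))) (\<Union>(set (part H)))"
          using Es finF
          by (auto simp: set_less_Union set_less_Union2 part_def set_less_def[of G H]
              intro!: sorted_blocks_less[OF Es(2)])
      qed
      moreover have "\<Union>(set (part G)) ~= {}" "\<Union>(set (part G)) \<in> family_comp \<G> \<F>" if "G \<in> set Gs" for G
      proof -
        show "\<Union>(set (part G)) \<in> family_comp \<G> \<F>"
          using part[OF that] Mpart[OF that] GsD(3)[OF that]
          unfolding family_comp_def by (intro UnI2 CollectI exI[of _ "part G"]) simp
        show "\<Union>(set (part G)) ~= {}"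
          using part[OF that] by (cases "part G") (auto simp: block_lists_def)
      qed
      ultimately show ?thesis using GsD(2) by (auto simp: block_lists_def Bs_def)
    qed
    moreover have "\<Union>(set Bs) = E"
      using Gs(3) 2(3) by (auto simp: Bs_def part_def; blast)
    moreover have "Min (hd Bs) = Min (hd Gs)"
    proof -
      have h: "hd Gs \<in> set Gs" using GsD(2) by simp
      have "Min (hd Bs) = Min (\<Union>(set (part (hd Gs))))" using GsD(2) by (simp add: Bs_def hd_map)
      also have "\<dots> = Min (Min ` set (part (hd Gs)))"
        using part[OF h] finF by (intro Min_Union_image) (auto simp: block_lists_def)
      finally show ?thesis using Mpart[OF h] by simp
    qed
    ultimately show ?thesis
      unfolding schreier_step_def using Gs(2)
      by (intro UnI2 CollectI exI[of _ Bs]) (auto simp: Bs_def)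
  qed (simp add: schreier_step_def)
next
  have finF: "finite A" if "A \<in> \<F>" for A using that assms(2) by (auto simp: fin_subsets_def)
  fix E assume "E \<in> schreier_step (family_comp \<G> \<F>)"
  then consider "E = {}" | Bs where "Bs \<in> block_lists (family_comp \<G> \<F>)" "length Bs <= Min (hd Bs)" "E = \<Union>(set Bs)"
    by (auto simp: schreier_step_def)
  thus "E \<in> family_comp (schreier_step \<G>) \<F>"
  proof cases
    case 2
    have Bs: "Bs ~= []" "sorted_wrt set_less Bs" "!!B. B \<in> set Bs ==> B ~= {} \<and> B \<in> family_comp \<G> \<F>"
      using 2(1) by (auto simp: block_lists_def)
    have "\<exists>Ls. Ls \<in> block_lists \<F> \<and> Min ` set Ls \<in> \<G> \<and> B = \<Union>(set Ls)" if "B \<in> set Bs" for B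
      using Bs(3)[OF that] by (auto simp: family_comp_def)
    then obtain L where L: "!!B. B \<in> set Bs ==> L B \<in> block_lists \<F> \<and> Min ` set (L B) \<in> \<G> \<and> B = \<Union>(set (L B))"
      by metis
    have LD: "A ~= {} \<and> A \<in> \<F> \<and> A \<subseteq> B \<and> finite A \<and> Min A \<in> B" if "B \<in> set Bs" "A \<in> set (L B)" for A B
    proof -
      have "A ~= {}" "A \<in> \<F>" "A \<subseteq> B" using L[OF that(1)] that(2) by (auto simp: block_lists_def)
      moreover have "Min A \<in> A" using Min_in[OF finF] calculation by blast
      ultimately show ?thesis using finF by blast
    qed
    define Es where "Es = concat (map L Bs)"
    define Gs where "Gs = map (\<lambda>B. Min ` set (L B)) Bs"
    have "sorted_wrt set_less Es"
      unfolding Es_def using Bs(2) L LD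
    proof (induction Bs)
      case (Cons B Bs)
      have "sorted_wrt set_less (L B)" using Cons.prems(2)[of B] by (simp add: block_lists_def)
      moreover have "set_less A C" if "A \<in> set (L B)" "D \<in> set Bs" "C \<in> set (L D)" for A C D
        using Cons.prems(1) Cons.prems(3)[of B A] Cons.prems(3)[of D C] that
        by (auto intro: set_less_mono)
      moreover have "sorted_wrt set_less (concat (map L Bs))"
      proof (rule Cons.IH)
        show "sorted_wrt set_less Bs" using Cons.prems(1) by simp
        show "L D \<in> block_lists \<F> \<and> Min ` set (L D) \<in> \<G> \<and> D = \<Union>(set (L D))" if "D \<in> set Bs" for D
          using Cons.prems(2)[of D] that by simp
        show "A ~= {} \<and> A \<in> \<F> \<and> A \<subseteq> D \<and> finite A \<and> Min A \<in> D" if "D \<in> set Bs" "A \<in> set (L D)" for A D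
          using Cons.prems(3)[of D A] that by simp
      qed
      ultimately show ?case by (auto simp: sorted_wrt_append)
    qed simp
    moreover have "set Es ~= {}"
    proof -
      have h: "hd Bs \<in> set Bs" using Bs(1) by simp
      hence "L (hd Bs) ~= []" using L[OF h] by (simp add: block_lists_def)
      thus ?thesis using h by (auto simp: Es_def)
    qed
    ultimately have "Es \<in> block_lists \<F>" using LD by (auto simp: block_lists_def Es_def)
    moreover have "\<Union>(set Es) = E"
    proof -
      have "\<Union>(set Es) = (\<Union>B\<in>set Bs. \<Union>(set (L B)))" by (auto simp: Es_def)
      also have "\<dots> = (\<Union>B\<in>set Bs. B)" using L by (intro SUP_cong) auto
      finally show ?thesis using 2(3) by simp
    qed
    moreover have "Min ` set Es \<in> schreier_step \<G>"
    proof -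
      have "sorted_wrt set_less Gs"
        unfolding Gs_def sorted_wrt_map
      proof (rule sorted_wrt_mono_rel[OF _ Bs(2)])
        fix A B assume "A \<in> set Bs" "B \<in> set Bs" "set_less A B"
        thus "set_less (Min ` set (L A)) (Min ` set (L B))"
          using LD by (auto intro: set_less_mono)
      qed
      moreover have "Min ` set (L B) ~= {}" if "B \<in> set Bs" for B
        using L[OF that] by (auto simp: block_lists_def)
      ultimately have "Gs \<in> block_lists \<G>" using L Bs(1) by (auto simp: block_lists_def Gs_def)
      moreover have "\<Union>(set Gs) = Min ` set Es" by (auto simp: Gs_def Es_def)
      moreover have "Min (hd Gs) = Min (hd Bs)"
      proof -
        have h: "hd Bs \<in> set Bs" using Bs(1) by simp
        have "Min (\<Union>(set (L (hd Bs)))) = Min (Min ` set (L (hd Bs)))"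
          using L[OF h] LD[OF h] by (intro Min_Union_image) (auto simp: block_lists_def)
        thus ?thesis using L[OF h] Bs(1) by (simp add: Gs_def hd_map)
      qed
      ultimately show ?thesis
        unfolding schreier_step_def using 2(2) by (intro UnI2 CollectI exI[of _ Gs]) (auto simp: Gs_def)
    qed
    ultimately show ?thesis
      unfolding family_comp_def by (intro UnI2 CollectI exI[of _ Es]) auto
  qed (simp add: family_comp_def)
qed

text \<open>The bottom level is S_\<xi>, so the blocks of level \<xi> of the first hierarchy can
  serve as atoms. At a limit, a union of blocks and its set of minima have the same minimum and
  therefore select the same level.\<close>

lemma schreier_hierarchy_q:
  assumes cs: "characteristic_sequences cs"
  shows "schreier_hierarchy cs (schreier2 cs \<xi>) (blk cs atom \<xi>)"
proof -
  interpret P: schreier_hierarchy cs "schreier cs" atom by (rule schreier_hierarchy_p[OF cs])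
  let ?F = "schreier cs \<xi>"
  have E: "{} \<in> ?F" using P.S_sing[of 1 \<xi>] P.S_hereditary[of "{1}" \<xi> "{}"] by simp
  have F: "?F \<subseteq> fin_subsets {1..}" by (rule schreier_subset)
  have Z: "schreier2 cs \<xi> 0 = ?F" unfolding schreier2_def by (rule family_comp_zero[OF E F])
  show ?thesis
  proof
    show "characteristic_sequences cs" by fact
    show "schreier2 cs \<xi> 0 \<subseteq> fin_subsets {1..}" using F Z by simp
    show "{n} \<in> schreier2 cs \<xi> 0" if "1 <= n" for n using that P.S_sing Z by simp
    show "E' \<in> schreier2 cs \<xi> 0" if "E \<in> schreier2 cs \<xi> 0" "E' \<subseteq> E" for E E'
      using that P.S_hereditary Z by simp
    show "F \<in> maximal_sets (schreier2 cs \<xi> 0)" if "blk cs atom \<xi> F" for F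
      using P.blk_maximal[OF that] Z by simp
    show "\<exists>F. blk cs atom \<xi> F \<and> init_seg F M" if "M \<in> inf_subsets {1..}" for M
      using P.blk_init_seg_ex[OF that] .
    show "schreier2 cs \<xi> (osuc \<zeta>) = schreier_step (schreier2 cs \<xi> \<zeta>)" for \<zeta>
      unfolding schreier2_def schreier_osuc by (rule family_comp_step[OF E F schreier_subset])
    show "schreier2 cs \<xi> (osuc (cs \<zeta> n)) \<subseteq> schreier2 cs \<xi> (cs \<zeta> (Suc n))" if "is_limit \<zeta>" "1 <= n" for \<zeta> n
      unfolding schreier2_def by (intro family_comp_mono P.S_inc[OF that])
    show "schreier2 cs \<xi> \<zeta> = {{}} \<union> {E \<in> fin_subsets {1..}. E ~= {} \<and> E \<in> schreier2 cs \<xi> (osuc (cs \<zeta> (Min E)))}"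
      if lim: "is_limit \<zeta>" for \<zeta>
    proof -
      have *: "Min ` set Es \<in> schreier cs \<zeta> \<longleftrightarrow> Min ` set Es \<in> schreier cs (osuc (cs \<zeta> (Min (\<Union>(set Es)))))"
        "\<Union>(set Es) \<in> fin_subsets {1..}" "\<Union>(set Es) ~= {}"
        if Es: "Es \<in> block_lists ?F" for Es
      proof -
        have D: "A ~= {} \<and> finite A \<and> A \<subseteq> {1..}" if "A \<in> set Es" for A
          using that Es F by (auto simp: block_lists_def fin_subsets_def)
        have ne: "Es ~= []" using Es by (simp add: block_lists_def)
        have "Min A \<in> {1..}" if "A \<in> set Es" for A using D[OF that] Min_in[of A] by blast
        hence fin: "Min ` set Es \<in> fin_subsets {1..}" by (auto simp: fin_subsets_def)
        have "Min (\<Union>(set Es)) = Min (Min ` set Es)" using D ne by (intro Min_Union_image) auto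
        thus "Min ` set Es \<in> schreier cs \<zeta> \<longleftrightarrow> Min ` set Es \<in> schreier cs (osuc (cs \<zeta> (Min (\<Union>(set Es)))))"
          using P.S_lim[OF lim] fin ne by simp
        show "\<Union>(set Es) \<in> fin_subsets {1..}" using D by (auto simp: fin_subsets_def)
        show "\<Union>(set Es) ~= {}" using D ne by (cases Es) auto
      qed
      show ?thesis unfolding schreier2_def family_comp_def using * by auto
    qed
  qed
qed

lemma weighted_hierarchy_p:
  assumes "characteristic_sequences cs"
  shows "weighted_hierarchy cs (schreier cs) atom (\<lambda>m. 1 / real m) (p_mem cs) (\<lambda>_. 1)"
proof -
  interpret schreier_hierarchy cs "schreier cs" atom by (rule schreier_hierarchy_p[OF assms])
  show ?thesis
  proof
    show "p_mem cs \<zeta> E = p_mem cs (osuc (cs \<zeta> (Min E))) E"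
      if "is_limit \<zeta>" "E \<in> fin_subsets {1..}" "E ~= {}" for \<zeta> E by (rule p_mem_limit[OF assms that])
    show "p_mem cs 0 E = 1" for E by (simp add: p_mem_def)
  qed (simp_all add: p_mem_osuc)
qed

lemma weighted_hierarchy_q:
  assumes cs: "characteristic_sequences cs"
  shows "weighted_hierarchy cs (schreier2 cs \<xi>) (blk cs atom \<xi>) (\<lambda>m. 1 / sqrt (real m)) (q_mem cs \<xi>)
    (p_weight cs \<xi>)"
proof -
  interpret P: schreier_hierarchy cs "schreier cs" atom by (rule schreier_hierarchy_p[OF cs])
  interpret schreier_hierarchy cs "schreier2 cs \<xi>" "blk cs atom \<xi>" by (rule schreier_hierarchy_q[OF cs])
  show ?thesis
  proof
    show "p_weight cs \<xi> (A \<union> E) = p_weight cs \<xi> E"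
      if "blk cs atom \<xi> A" "set_less A E" "finite E" "E ~= {}" "E \<subseteq> {1..}" for A E
      using P.last_block_Un[OF that] by (simp add: p_weight_def)
    show "q_mem cs \<xi> \<zeta> E = q_mem cs \<xi> (osuc (cs \<zeta> (Min E))) E"
      if "is_limit \<zeta>" "E \<in> fin_subsets {1..}" "E ~= {}" for \<zeta> E by (rule q_mem_limit[OF cs that])
    show "q_mem cs \<xi> 0 E = 1" for E by (simp add: q_mem_def)
  qed (simp_all add: q_mem_osuc)
qed

section \<open>Function spaces over rings of sets\<close>

type_synonym 'k fn = "omega1 => 'k"

definition sbd :: "('p => 'k::real_normed_field) => real => bool" where
  "sbd f a \<longleftrightarrow> (\<forall>x. norm (f x) <= a)"

definition fspace :: "('p => 'k::real_normed_field) set => bool" where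
  "fspace Z \<longleftrightarrow> (\<lambda>_. 0) \<in> Z \<and> (\<forall>f\<in>Z. \<forall>g\<in>Z. (\<lambda>x. f x + g x) \<in> Z) \<and>
    (\<forall>c. \<forall>f\<in>Z. (\<lambda>x. c * f x) \<in> Z) \<and> (\<forall>f\<in>Z. \<exists>a. sbd f a)"

definition op :: "('p => 'k::real_normed_field) set => ('q => 'k) set => (('p => 'k) => 'q => 'k) => real => bool" where
  "op Z Z' T C \<longleftrightarrow> 0 <= C \<and> (\<forall>f\<in>Z. T f \<in> Z') \<and>
    (\<forall>f\<in>Z. \<forall>g\<in>Z. T (\<lambda>x. f x + g x) = (\<lambda>y. T f y + T g y)) \<and>
    (\<forall>c. \<forall>f\<in>Z. T (\<lambda>x. c * f x) = (\<lambda>y. c * T f y)) \<and>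
    (\<forall>f\<in>Z. \<forall>a. sbd f a --> sbd (T f) (C * a))"

definition fnl :: "('p => 'k::real_normed_field) set => (('p => 'k) => 'k) => real => bool" where
  "fnl Z l C \<longleftrightarrow> 0 <= C \<and>
    (\<forall>f\<in>Z. \<forall>g\<in>Z. l (\<lambda>x. f x + g x) = l f + l g) \<and>
    (\<forall>c. \<forall>f\<in>Z. l (\<lambda>x. c * f x) = c * l f) \<and>
    (\<forall>f\<in>Z. \<forall>a. sbd f a --> norm (l f) <= C * a)"

definition cut :: "'p set => ('p => 'k::real_normed_field) => 'p => 'k" where
  "cut D f x = (if x \<in> D then f x else 0)"

text \<open>\<open>Sp R\<close> is the uniform closure of the simple functions over the ring \<open>R\<close>.\<close>

definition apx :: "'p set set => ('p => 'k::real_normed_field) => real => bool" where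
  "apx \<G> f e \<longleftrightarrow> (\<forall>x y. (\<forall>G\<in>\<G>. x \<in> G \<longleftrightarrow> y \<in> G) --> norm (f x - f y) <= e) \<and>
    (\<forall>x. x \<notin> \<Union>\<G> --> norm (f x) <= e)"

definition Sp :: "'p set set => ('p => 'k::real_normed_field) set" where
  "Sp R = {f. \<forall>e>0. \<exists>\<G>\<subseteq>R. finite \<G> \<and> apx \<G> f e}"

lemma sbd_nonneg: "sbd f a ==> 0 <= a"
  unfolding sbd_def using norm_ge_zero order_trans by blast

lemma sbd_mono: "sbd f a ==> a <= b ==> sbd f b"
  unfolding sbd_def using order_trans by blast

lemma sbd_cut: "sbd f a ==> sbd (cut D f) a"
  using sbd_nonneg by (auto simp: sbd_def cut_def)

lemma cut_add: "cut D (\<lambda>x. f x + g x) = (\<lambda>x. cut D f x + cut D g x)"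
  by (auto simp: cut_def)

lemma cut_scale: "cut D (\<lambda>x. c * f x) = (\<lambda>x. c * cut D f x)"
  by (auto simp: cut_def)

lemma cut_cut: "cut D (cut D' f) = cut (D \<inter> D') f"
  by (auto simp: cut_def)

lemma cut_Un_disjoint: "D \<inter> D' = {} ==> cut (D \<union> D') f = (\<lambda>x. cut D f x + cut D' f x)"
  by (rule ext) (auto simp: cut_def)

lemma apxD:
  assumes "apx \<G> f e"
  shows "(!!G. G \<in> \<G> ==> x \<in> G \<longleftrightarrow> y \<in> G) ==> norm (f x - f y) <= e"
    and "x \<notin> \<Union>\<G> ==> norm (f x) <= e"
  using assms unfolding apx_def by blast+

lemma apx_mono: "apx \<G> f e ==> \<G> \<subseteq> \<H> ==> e <= e' ==> apx \<H> f e'"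
  unfolding apx_def by (meson Union_mono order_trans subset_iff)

lemma SpD: "f \<in> Sp R ==> 0 < e ==> \<exists>\<G>\<subseteq>R. finite \<G> \<and> apx \<G> f e"
  by (auto simp: Sp_def)

lemma Sp_mono: "R \<subseteq> R' ==> Sp R \<subseteq> Sp R'"
  unfolding Sp_def Collect_mono_iff by (meson subset_trans)

lemma Sp_zero: "(\<lambda>_. 0) \<in> Sp R"
  unfolding Sp_def by (auto simp: apx_def intro!: exI[of _ "{}"])

lemma Sp_add:
  assumes "f \<in> Sp R" "g \<in> Sp R" shows "(\<lambda>x. f x + g x) \<in> Sp R"
  unfolding Sp_def
proof (intro CollectI allI impI)
  fix e :: real assume "0 < e"
  then obtain \<G> \<H> where G: "\<G> \<subseteq> R" "finite \<G>" "apx \<G> f (e/2)" and H: "\<H> \<subseteq> R" "finite \<H>" "apx \<H> g (e/2)"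
    using SpD[OF assms(1), of "e/2"] SpD[OF assms(2), of "e/2"] by auto
  have a: "apx (\<G> \<union> \<H>) f (e/2)" "apx (\<G> \<union> \<H>) g (e/2)"
    using apx_mono[OF G(3)] apx_mono[OF H(3)] by auto
  have "apx (\<G> \<union> \<H>) (\<lambda>x. f x + g x) e"
    unfolding apx_def
  proof (intro conjI allI impI)
    fix x y assume "\<forall>G\<in>\<G> \<union> \<H>. (x \<in> G) = (y \<in> G)"
    hence "norm (f x - f y) <= e/2" "norm (g x - g y) <= e/2"
      using apxD(1)[OF a(1)] apxD(1)[OF a(2)] by simp_all
    hence "norm ((f x - f y) + (g x - g y)) <= e/2 + e/2" by (rule norm_triangle_mono)
    thus "norm (f x + g x - (f y + g y)) <= e" by (simp add: algebra_simps)
  next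
    fix x assume "x \<notin> \<Union>(\<G> \<union> \<H>)"
    hence "norm (f x) <= e/2" "norm (g x) <= e/2" using apxD(2)[OF a(1)] apxD(2)[OF a(2)] by simp_all
    thus "norm (f x + g x) <= e" using norm_triangle_mono by fastforce
  qed
  thus "\<exists>\<G>\<subseteq>R. finite \<G> \<and> apx \<G> (\<lambda>x. f x + g x) e"
    using G H by (intro exI[of _ "\<G> \<union> \<H>"]) auto
qed

lemma Sp_scale:
  assumes "f \<in> Sp R" shows "(\<lambda>x. c * f x) \<in> Sp R"
  unfolding Sp_def
proof (intro CollectI allI impI)
  fix e :: real assume e: "0 < e"
  have c: "0 < norm c + 1" using norm_ge_zero[of c] by linarith
  then obtain \<G> where G: "\<G> \<subseteq> R" "finite \<G>" "apx \<G> f (e / (norm c + 1))"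
    using SpD[OF assms, of "e / (norm c + 1)"] e by auto
  have le: "norm c * t <= e" if "t <= e / (norm c + 1)" "0 <= t" for t
  proof -
    have "norm c * t <= (norm c + 1) * t" using that by (simp add: distrib_right)
    also have "\<dots> <= e" using that c by (simp add: field_simps)
    finally show ?thesis .
  qed
  have "apx \<G> (\<lambda>x. c * f x) e"
    using G(3) unfolding apx_def by (auto simp: norm_mult right_diff_distrib[symmetric] intro!: le)
  thus "\<exists>\<G>\<subseteq>R. finite \<G> \<and> apx \<G> (\<lambda>x. c * f x) e" using G by blast
qed

text \<open>Finitely many sets allow only finitely many membership patterns, and on each pattern the
  function stays within 1 of its value at one chosen point.\<close>

lemma Sp_bounded:
  assumes "f \<in> Sp R" shows "\<exists>a. sbd f a"
proof -
  obtain \<G> where G: "finite \<G>" "apx \<G> f 1" using SpD[OF assms, of 1] by auto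
  define sig where "sig x = {G\<in>\<G>. x \<in> G}" for x
  have "finite (range sig)" by (rule finite_subset[of _ "Pow \<G>"]) (auto simp: sig_def G(1))
  define pt where "pt s = (SOME x. sig x = s)" for s
  have "norm (f x) <= 1 + (\<Sum>s\<in>range sig. norm (f (pt s)))" for x
  proof -
    have "sig (pt (sig x)) = sig x" unfolding pt_def by (rule someI) simp
    hence "norm (f x - f (pt (sig x))) <= 1" using G(2) unfolding apx_def sig_def by blast
    moreover have "norm (f (pt (sig x))) <= (\<Sum>s\<in>range sig. norm (f (pt s)))"
      by (rule member_le_sum) (use \<open>finite (range sig)\<close> in auto)
    ultimately show ?thesis using norm_triangle_sub[of "f x" "f (pt (sig x))"] by linarith
  qed
  thus ?thesis unfolding sbd_def by blast
qed

lemma fspace_Sp: "fspace (Sp R)"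
  by (simp add: fspace_def Sp_zero Sp_add Sp_scale Sp_bounded)

lemma Sp_comp:
  assumes "f \<in> Sp R" "!!G. G \<in> R ==> r -` G \<in> R'" shows "(\<lambda>x. f (r x)) \<in> Sp R'"
  unfolding Sp_def
proof (intro CollectI allI impI)
  fix e :: real assume "0 < e"
  then obtain \<G> where G: "\<G> \<subseteq> R" "finite \<G>" "apx \<G> f e" using SpD[OF assms(1)] by auto
  have "apx ((-`) r ` \<G>) (\<lambda>x. f (r x)) e" using G(3) by (auto simp: apx_def)
  thus "\<exists>\<G>\<subseteq>R'. finite \<G> \<and> apx \<G> (\<lambda>x. f (r x)) e"
    using G(1,2) assms(2) by (intro exI[of _ "(-`) r ` \<G>"]) auto
qed

lemma Sp_cut:
  assumes R: "ring_of_sets UNIV R" and "f \<in> Sp R" "A \<in> R" shows "cut A f \<in> Sp {B\<in>R. B \<subseteq> A}"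
  unfolding Sp_def
proof (intro CollectI allI impI)
  interpret ring_of_sets UNIV R by fact
  fix e :: real assume "0 < e"
  then obtain \<G> where G: "\<G> \<subseteq> R" "finite \<G>" "apx \<G> f e" using SpD[OF assms(2)] by auto
  have "apx (insert A ((\<inter>) A ` \<G>)) (cut A f) e"
    unfolding apx_def
  proof (intro conjI allI impI)
    fix x y assume xy: "\<forall>G\<in>insert A ((\<inter>) A ` \<G>). (x \<in> G) = (y \<in> G)"
    show "norm (cut A f x - cut A f y) <= e"
    proof (cases "x \<in> A")
      case True
      hence "y \<in> A" "\<forall>G\<in>\<G>. (x \<in> G) = (y \<in> G)" using xy by auto
      thus ?thesis using G(3) True by (simp add: cut_def apx_def)
    next
      case False
      hence "y \<notin> A" using xy by auto
      thus ?thesis using False \<open>0 < e\<close> by (simp add: cut_def)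
    qed
  qed (use \<open>0 < e\<close> in \<open>auto simp: cut_def\<close>)
  thus "\<exists>\<G>\<subseteq>{B\<in>R. B \<subseteq> A}. finite \<G> \<and> apx \<G> (cut A f) e"
    using G assms(3) by (intro exI[of _ "insert A ((\<inter>) A ` \<G>)"]) auto
qed

lemma Sp_cut': "ring_of_sets UNIV R ==> f \<in> Sp R ==> A \<in> R ==> cut A f \<in> Sp R"
  using Sp_cut[of R f A] Sp_mono[of "{B\<in>R. B \<subseteq> A}" R] by blast

lemma Sp_tail:
  assumes R: "ring_of_sets UNIV R" and "f \<in> Sp R" "0 < e"
  shows "\<exists>D0\<in>R. \<forall>D. D0 \<subseteq> D --> sbd (\<lambda>x. f x - cut D f x) e"
proof -
  interpret ring_of_sets UNIV R by fact
  obtain \<G> where G: "\<G> \<subseteq> R" "finite \<G>" "apx \<G> f e" using SpD[OF assms(2,3)] by auto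
  have "\<Union>\<G> \<in> R" using G(1,2) by (rule finite_Union[rotated])
  moreover have "sbd (\<lambda>x. f x - cut D f x) e" if "\<Union>\<G> \<subseteq> D" for D
    unfolding sbd_def
  proof
    fix x show "norm (f x - cut D f x) <= e"
    proof (cases "x \<in> D")
      case False
      hence "x \<notin> \<Union>\<G>" using that by blast
      thus ?thesis using G(3) False unfolding apx_def cut_def by simp
    qed (use assms(3) in \<open>simp add: cut_def\<close>)
  qed
  ultimately show ?thesis by blast
qed

text \<open>Where x and s x lie in the same members of \<G>, the difference is small by the choice
  of \<G>. The exceptional points form finitely many differences of a set and its preimage, which
  belong to \<open>R2\<close>; on these the traces of \<G> and of the preimages of \<G> control both
  f x and f (s x).\<close>

lemma Sp_minus_retract:
  assumes f: "f \<in> Sp R"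
    and "!!G. G \<in> R ==> G - s -` G \<in> R2 \<and> s -` G - G \<in> R2"
    and "!!A G. A \<in> R2 ==> G \<in> R ==> A \<inter> G \<in> R2 \<and> A \<inter> s -` G \<in> R2"
  shows "(\<lambda>x. f x - f (s x)) \<in> Sp R2"
  unfolding Sp_def
proof (intro CollectI allI impI)
  fix e :: real assume e: "0 < e"
  then obtain \<G> where G: "\<G> \<subseteq> R" "finite \<G>" "apx \<G> f (e/2)" using SpD[OF f, of "e/2"] by auto
  define \<A> where "\<A> = (\<lambda>G. G - s -` G) ` \<G> \<union> (\<lambda>G. s -` G - G) ` \<G>"
  define \<H> where "\<H> = \<A> \<union> (\<lambda>(A, G). A \<inter> G) ` (\<A> \<times> \<G>) \<union> (\<lambda>(A, G). A \<inter> s -` G) ` (\<A> \<times> \<G>)"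
  have A: "\<A> \<subseteq> R2" "finite \<A>" using assms(2) G by (auto simp: \<A>_def)
  have "\<H> \<subseteq> R2" "finite \<H>" using A G assms(3) by (auto simp: \<H>_def)
  moreover have out: "norm (f x - f (s x)) <= e/2" if "x \<notin> \<Union>\<A>" for x
  proof -
    have "\<forall>G\<in>\<G>. x \<notin> G - s -` G \<and> x \<notin> s -` G - G" using that unfolding \<A>_def by blast
    hence "\<forall>G\<in>\<G>. x \<in> G \<longleftrightarrow> s x \<in> G" by blast
    thus ?thesis by (intro apxD(1)[OF G(3)]) simp
  qed
  have "apx \<H> (\<lambda>x. f x - f (s x)) e"
    unfolding apx_def
  proof (intro conjI allI impI)
    fix x y assume xy: "\<forall>H\<in>\<H>. (x \<in> H) = (y \<in> H)"
    show "norm (f x - f (s x) - (f y - f (s y))) <= e"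
    proof (cases "x \<in> \<Union>\<A>")
      case True
      then obtain A where A: "A \<in> \<A>" "x \<in> A" by blast
      hence "y \<in> A" using xy by (auto simp: \<H>_def)
      have "x \<in> G \<longleftrightarrow> y \<in> G" "s x \<in> G \<longleftrightarrow> s y \<in> G" if "G \<in> \<G>" for G
      proof -
        have AG: "A \<inter> G \<in> \<H>" "A \<inter> s -` G \<in> \<H>" using A that by (auto simp: \<H>_def)
        hence "x \<in> A \<inter> G \<longleftrightarrow> y \<in> A \<inter> G" "x \<in> A \<inter> s -` G \<longleftrightarrow> y \<in> A \<inter> s -` G"
          using bspec[OF xy AG(1)] bspec[OF xy AG(2)] by blast+
        thus "x \<in> G \<longleftrightarrow> y \<in> G" "s x \<in> G \<longleftrightarrow> s y \<in> G" using A(2) \<open>y \<in> A\<close> by simp_all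
      qed
      hence "norm (f x - f y) <= e/2" "norm (f (s x) - f (s y)) <= e/2"
        using apxD(1)[OF G(3)] by presburger+
      hence "norm ((f x - f y) - (f (s x) - f (s y))) <= e/2 + e/2"
        by (meson add_mono norm_triangle_ineq4 order_trans)
      thus ?thesis by (simp add: algebra_simps)
    next
      case False
      hence "y \<notin> \<Union>\<A>" using xy by (auto simp: \<H>_def)
      hence "norm ((f x - f (s x)) - (f y - f (s y))) <= e/2 + e/2"
        using out False by (meson add_mono norm_triangle_ineq4 order_trans)
      thus ?thesis by simp
    qed
  next
    fix x assume "x \<notin> \<Union>\<H>"
    hence "norm (f x - f (s x)) <= e/2" by (intro out) (auto simp: \<H>_def)
    thus "norm (f x - f (s x)) <= e" using e by simp
  qed
  ultimately show "\<exists>\<G>\<subseteq>R2. finite \<G> \<and> apx \<G> (\<lambda>x. f x - f (s x)) e" by blast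
qed

section \<open>Operators between function spaces\<close>

lemma opD:
  assumes "op Z Z' T C"
  shows "0 <= C" "f \<in> Z ==> T f \<in> Z'"
    "f \<in> Z ==> g \<in> Z ==> T (\<lambda>x. f x + g x) = (\<lambda>y. T f y + T g y)"
    "f \<in> Z ==> T (\<lambda>x. c * f x) = (\<lambda>y. c * T f y)"
    "f \<in> Z ==> sbd f a ==> sbd (T f) (C * a)"
  using assms unfolding op_def by blast+

lemma op_id: "op Z Z (\<lambda>f. f) 1"
  by (simp add: op_def)

lemma op_incl: "Z \<subseteq> Z' ==> op Z Z' (\<lambda>f. f) 1"
  by (auto simp: op_def)

lemma op_comp:
  assumes T: "op Z Z' T C" and S: "op Z' Z'' S C'" shows "op Z Z'' (\<lambda>f. S (T f)) (C' * C)"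
  unfolding op_def
  using opD[OF T] opD[OF S] by (auto simp: mult.assoc)

lemma op_cut:
  assumes "!!f. f \<in> Z ==> cut D f \<in> Z'" shows "op Z Z' (cut D) 1"
  using assms by (simp add: op_def cut_add cut_scale sbd_cut)

lemma op_add:
  assumes T: "op Z Z' T C" and S: "op Z Z' S C'" and Z': "fspace Z'"
  shows "op Z Z' (\<lambda>f y. T f y + S f y) (C + C')"
  unfolding op_def
proof (intro conjI ballI allI impI)
  show "0 <= C + C'" using opD(1)[OF T] opD(1)[OF S] by simp
  fix f assume f: "f \<in> Z"
  show "(\<lambda>y. T f y + S f y) \<in> Z'" using Z' opD(2)[OF T f] opD(2)[OF S f] by (simp add: fspace_def)
  show "(\<lambda>y. T (\<lambda>x. c * f x) y + S (\<lambda>x. c * f x) y) = (\<lambda>y. c * (T f y + S f y))" for c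
    using opD(4)[OF T f] opD(4)[OF S f] by (simp add: distrib_left)
  show "(\<lambda>y. T (\<lambda>x. f x + g x) y + S (\<lambda>x. f x + g x) y) = (\<lambda>y. T f y + S f y + (T g y + S g y))"
    if "g \<in> Z" for g
    using opD(3)[OF T f that] opD(3)[OF S f that] by (simp add: algebra_simps)
  show "sbd (\<lambda>y. T f y + S f y) ((C + C') * a)" if "sbd f a" for a
    using opD(5)[OF T f that] opD(5)[OF S f that]
    by (auto simp: sbd_def distrib_right intro: norm_triangle_mono)
qed

lemma fnl_op: "op X Z T C ==> fnl X (\<lambda>f. T f p) C"
  unfolding op_def fnl_def sbd_def by auto

lemma op_rank1:
  assumes "fnl X l C" "fspace Z" "z \<in> Z" "sbd z b" shows "op X Z (\<lambda>f p. l f * z p) (C * b)"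
  unfolding op_def
proof (intro conjI ballI allI impI)
  show "0 <= C * b" using assms(1) sbd_nonneg[OF assms(4)] by (simp add: fnl_def)
  fix f assume f: "f \<in> X"
  show "(\<lambda>p. l f * z p) \<in> Z" using assms(2,3) by (simp add: fspace_def)
  show "sbd (\<lambda>p. l f * z p) (C * b * a)" if "sbd f a" for a
  proof -
    have "norm (l f) <= C * a" using assms(1) f that by (auto simp: fnl_def)
    hence "norm (l f) * norm (z p) <= C * a * b" for p
      using assms(4) order_trans[OF norm_ge_zero, of "l f"] by (intro mult_mono) (auto simp: sbd_def)
    thus ?thesis by (simp add: sbd_def norm_mult mult_ac)
  qed
qed (use assms(1) in \<open>auto simp: fnl_def algebra_simps\<close>)

section \<open>The rings of clopen sets of ordinal intervals\<close>

text \<open>The ring generated by the intervals [0,b]; its members are clopen. Having generators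
  reduces statements about preimages to intervals (\<open>clp_vimage\<close>).\<close>

inductive_set clp :: "omega1 set set" where
  empty: "{} \<in> clp"
| init: "{..b} \<in> clp"
| un: "A \<in> clp ==> B \<in> clp ==> A \<union> B \<in> clp"
| diff: "A \<in> clp ==> B \<in> clp ==> A - B \<in> clp"

lemma clp_int: "A \<in> clp ==> B \<in> clp ==> A \<inter> B \<in> clp"
  using clp.diff[OF _ clp.diff] by (metis Diff_Diff_Int)

lemma ring_clp: "ring_of_sets UNIV clp"
  by (auto simp: ring_of_sets_iff intro: clp.intros)

lemma clp_Ioc: "{a<..b} \<in> clp"
proof -
  have "{a<..b} = {..b} - {..a}" by auto
  thus ?thesis by (simp add: clp.intros)
qed

lemma clp_vimage:
  assumes "!!b. r -` {..b} \<in> clp" "D \<in> clp" shows "r -` D \<in> clp"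
  using assms(2) by induction (auto simp: assms(1) vimage_Diff intro: clp.intros)

text \<open>\<open>Sp (RB \<theta>)\<close> is C_0(\<theta>) by \<open>C0_space_carrier\<close> for
  positive \<theta>; in particular \<open>Sp (RB (osuc \<alpha>))\<close> plays the role of
  C[0,\<alpha>].\<close>

definition RB :: "omega1 => omega1 set set" where
  "RB \<theta> = {D\<in>clp. \<exists>b<\<theta>. D \<subseteq> {..b}}"

lemma RB_osuc: "RB (osuc \<alpha>) = {D\<in>clp. D \<subseteq> {..\<alpha>}}"
  unfolding RB_def by (fastforce simp: less_osuc_iff)

lemma ring_RB:
  assumes "0 < \<theta>" shows "ring_of_sets UNIV (RB \<theta>)"
  unfolding ring_of_sets_iff
proof (intro conjI ballI)
  show "{} \<in> RB \<theta>" using assms by (auto simp: RB_def clp.empty)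
  fix A B assume "A \<in> RB \<theta>" "B \<in> RB \<theta>"
  then obtain a b where *: "A \<in> clp" "B \<in> clp" "a < \<theta>" "b < \<theta>" "A \<subseteq> {..a}" "B \<subseteq> {..b}" by (auto simp: RB_def)
  hence "A \<union> B \<subseteq> {..max a b}" "A - B \<subseteq> {..a}" "max a b < \<theta>" by (auto simp: le_max_iff_disj)
  thus "A \<union> B \<in> RB \<theta>" "A - B \<in> RB \<theta>" using * clp.un clp.diff unfolding RB_def by blast+
qed simp

lemma Sp_RB_outside:
  assumes "f \<in> Sp (RB \<theta>)" "\<theta> <= x" shows "f x = 0"
proof -
  have "norm (f x) <= e" if "0 < e" for e
  proof -
    obtain \<G> where "\<G> \<subseteq> RB \<theta>" "apx \<G> f e" using SpD[OF assms(1) \<open>0 < e\<close>] by auto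
    moreover have "x \<notin> \<Union>\<G>" using \<open>\<G> \<subseteq> RB \<theta>\<close> assms(2) by (fastforce simp: RB_def)
    ultimately show ?thesis by (simp add: apx_def)
  qed
  thus ?thesis by (metis dense_ge norm_le_zero_iff)
qed

lemma open_atMost_omega1: "open {..b :: omega1}"
proof -
  have "{..b} = {..<osuc b}" by (auto simp: less_osuc_iff)
  thus ?thesis by simp
qed

lemma clopen_clp: "D \<in> clp ==> open D \<and> closed D"
  by (induction rule: clp.induct) (auto simp: open_atMost_omega1)

lemma continuous_on_Sp:
  assumes "f \<in> Sp R" "R \<subseteq> clp" shows "continuous_on UNIV f"
  unfolding continuous_on_eq_continuous_at[OF open_UNIV]
proof
  fix x
  show "isCont f x"
    unfolding continuous_at tendsto_iff
  proof (intro allI impI)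
    fix e :: real assume "0 < e"
    then obtain \<G> where G: "\<G> \<subseteq> R" "finite \<G>" "apx \<G> f (e/2)" using SpD[OF assms(1), of "e/2"] by auto
    define U where "U = (\<Inter>G\<in>\<G>. if x \<in> G then G else - G)"
    have "open U" unfolding U_def
      using G assms(2) clopen_clp by (intro open_INT) auto
    moreover have "x \<in> U" unfolding U_def by auto
    moreover have "dist (f y) (f x) < e" if "y \<in> U" for y
    proof -
      have "\<forall>G\<in>\<G>. y \<in> G \<longleftrightarrow> x \<in> G" using that by (auto simp: U_def split: if_splits)
      hence "norm (f y - f x) <= e/2" by (intro apxD(1)[OF G(3)]) simp
      thus ?thesis using \<open>0 < e\<close> by (simp add: dist_norm)
    qed
    ultimately show "\<forall>\<^sub>F y in at x. dist (f y) (f x) < e"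
      unfolding eventually_at_topological by blast
  qed
qed

text \<open>Well-founded induction takes the place of compactness: continuity at b yields some a < b
  such that the interval (a,b] is a single piece, and [0,a] is covered by the induction
  hypothesis.\<close>

lemma apx_initial:
  fixes f :: "omega1 => 'k::real_normed_field"
  assumes "continuous_on {..\<theta>} f" "b <= \<theta>" "0 < e"
  shows "\<exists>\<G>\<subseteq>clp. finite \<G> \<and> \<Union>\<G> = {..b} \<and>
    (\<forall>x\<le>b. \<forall>y\<le>b. (\<forall>G\<in>\<G>. x \<in> G \<longleftrightarrow> y \<in> G) --> norm (f x - f y) <= e)"
  using assms(2)
proof (induction b rule: less_induct)
  case (less b)
  have "continuous_on {..b} f" by (rule continuous_on_subset[OF assms(1)]) (use less.prems in auto)
  hence "continuous (at b within {..b}) f" by (simp add: continuous_on_eq_continuous_within)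
  hence "\<forall>\<^sub>F x in at b within {..b}. dist (f x) (f b) < e/2"
    using half_gt_zero[OF assms(3)] unfolding continuous_within tendsto_iff by blast
  then obtain U where U: "open U" "b \<in> U" "!!x. x \<in> U ==> x <= b ==> dist (f x) (f b) < e/2"
    using assms(3) unfolding eventually_at_topological by (metis atMost_iff dist_self half_gt_zero)
  have close: "norm (f x - f y) <= e" if "x \<in> U" "y \<in> U" "x <= b" "y <= b" for x y
    using U(3)[of x] U(3)[of y] that dist_triangle2[of "f x" "f y" "f b"] by (simp add: dist_norm)
  show ?case
  proof (cases "b = 0")
    case True
    thus ?thesis
    proof (intro exI[of _ "{{..b}}"] conjI allI impI)
      fix x y assume "x <= b" "y <= b"
      hence "x = b" "y = b" using True by (auto intro: antisym)
      thus "norm (f x - f y) <= e" using assms(3) by simp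
    qed (auto simp: clp.init)
  next
    case False
    hence "0 < b" by (simp add: le_less[of 0, symmetric] less_le)
    then obtain a where a: "a < b" "{a<..b} \<subseteq> U" using open_left[OF U(1,2)] by blast
    hence "a <= \<theta>" using less.prems by simp
    from less.IH[OF a(1) this] obtain \<G> where G: "\<G> \<subseteq> clp" "finite \<G>" "\<Union>\<G> = {..a}"
      "\<forall>x\<le>a. \<forall>y\<le>a. (\<forall>G\<in>\<G>. x \<in> G \<longleftrightarrow> y \<in> G) --> norm (f x - f y) <= e"
      by (elim exE conjE)
    have "norm (f x - f y) <= e"
      if "x <= b" "y <= b" "\<forall>G\<in>insert {a<..b} \<G>. x \<in> G \<longleftrightarrow> y \<in> G" for x y
    proof (cases "x <= a")
      case True
      moreover have "x \<in> {a<..b} \<longleftrightarrow> y \<in> {a<..b}" by (rule bspec[OF that(3)]) simp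
      ultimately have "y <= a" using that(2) by (simp add: leD not_less)
      moreover have "\<forall>G\<in>\<G>. x \<in> G \<longleftrightarrow> y \<in> G" using that(3) by simp
      ultimately show ?thesis using True G(4) by simp
    next
      case False
      moreover have "x \<in> {a<..b} \<longleftrightarrow> y \<in> {a<..b}" by (rule bspec[OF that(3)]) simp
      ultimately have "x \<in> {a<..b}" "y \<in> {a<..b}" using that(1) by auto
      thus ?thesis using close[of x y] a(2) that(1,2) by (meson subsetD)
    qed
    thus ?thesis
      using G a by (intro exI[of _ "insert {a<..b} \<G>"]) (auto simp: clp_Ioc)
  qed
qed

text \<open>Since f is continuous and vanishes at \<theta>, it is small beyond some b < \<theta>,
  and [0,b] is treated by \<open>apx_initial\<close>. Conversely uniform limits of simple functions
  over clopen sets are continuous, and over \<open>RB \<theta>\<close> they vanish from \<theta>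
  on.\<close>

lemma C0_space_carrier:
  assumes "0 < \<theta>"
  shows "carrier (C0_space \<theta> :: ('k::real_normed_field, _) normed_module) = Sp (RB \<theta>)"
proof (intro subset_antisym subsetI)
  fix f :: "omega1 => 'k" assume "f \<in> carrier (C0_space \<theta>)"
  hence f: "continuous_on {..\<theta>} f" "!!x. \<theta> <= x ==> f x = 0"
    by (auto simp: C0_space_def C_space_def le_less)
  show "f \<in> Sp (RB \<theta>)"
    unfolding Sp_def
  proof (intro CollectI allI impI)
    fix e :: real assume e: "0 < e"
    have "continuous (at \<theta> within {..\<theta>}) f" using f(1) by (simp add: continuous_on_eq_continuous_within)
    hence "\<forall>\<^sub>F x in at \<theta> within {..\<theta>}. dist (f x) (f \<theta>) < e/2"
      using half_gt_zero[OF e] unfolding continuous_within tendsto_iff by blast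
    then obtain U where U: "open U" "\<theta> \<in> U" "!!x. x \<in> U ==> x <= \<theta> ==> dist (f x) (f \<theta>) < e/2"
      using e unfolding eventually_at_topological
      by (metis atMost_iff dist_self half_gt_zero)
    obtain b where b: "b < \<theta>" "{b<..\<theta>} \<subseteq> U" using open_left[OF U(1,2) assms] by blast
    have small: "norm (f x) <= e/2" if "b < x" for x
    proof (cases "x <= \<theta>")
      case True
      hence "x \<in> U" using b(2) that by auto
      thus ?thesis using U(3)[of x] True f(2)[of \<theta>] by simp
    next
      case False
      thus ?thesis using f(2)[of x] e by simp
    qed
    from apx_initial[OF f(1) less_imp_le[OF b(1)] half_gt_zero[OF e]]
    obtain \<G> where G: "\<G> \<subseteq> clp" "finite \<G>" "\<Union>\<G> = {..b}"
      "\<forall>x\<le>b. \<forall>y\<le>b. (\<forall>G\<in>\<G>. x \<in> G \<longleftrightarrow> y \<in> G) --> norm (f x - f y) <= e/2"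
      by (elim exE conjE)
    show "\<exists>\<G>\<subseteq>RB \<theta>. finite \<G> \<and> apx \<G> f e"
    proof (intro exI[of _ \<G>] conjI)
      show "\<G> \<subseteq> RB \<theta>" using G(1,3) b(1) by (auto simp: RB_def)
      show "apx \<G> f e"
        unfolding apx_def
      proof (intro conjI allI impI)
        fix x y assume xy: "\<forall>A\<in>\<G>. (x \<in> A) = (y \<in> A)"
        have "x <= b \<longleftrightarrow> y <= b" using xy G(3) by (metis Union_iff atMost_iff)
        then consider "x <= b" "y <= b" | "b < x" "b < y" by fastforce
        thus "norm (f x - f y) <= e"
        proof cases
          case 1
          hence "norm (f x - f y) <= e/2" using G(4) xy by blast
          thus ?thesis using e by simp
        next
          case 2
          thus ?thesis using small[of x] small[of y] norm_triangle_ineq4[of "f x" "f y"] by linarith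
        qed
      next
        fix x assume "x \<notin> \<Union>\<G>"
        thus "norm (f x) <= e" using small[of x] G(3) e by (simp add: not_le)
      qed
    qed fact
  qed
next
  fix f :: "omega1 => 'k" assume f: "f \<in> Sp (RB \<theta>)"
  hence "continuous_on {..\<theta>} f"
    by (rule continuous_on_subset[OF continuous_on_Sp]) (auto simp: RB_def)
  thus "f \<in> carrier (C0_space \<theta>)"
    using Sp_RB_outside[OF f] by (simp add: C0_space_def C_space_def)
qed

section \<open>Small operators\<close>

text \<open>A hierarchy of operators replacing the Szlenk index: level \<open>0\<close> consists of the finite rank
  operators, and an operator into \<open>Sp R\<close> is of level \<open>\<xi>\<close> if its restrictions to the members of \<open>R\<close>
  are of some level \<open>\<eta> < \<xi>\<close>.\<close>

inductive sm :: "(omega1 => 'k::real_normed_field) set => omega1 => 'k fn set =>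
    ((omega1 => 'k) => omega1 => 'k) => bool" for X where
  rank1: "fspace Z ==> z \<in> Z ==> fnl X l C ==> sm X 0 Z (\<lambda>f p. l f * z p)"
| sum: "sm X \<xi> Z T ==> sm X \<xi> Z S ==> sm X \<xi> Z (\<lambda>f p. T f p + S f p)"
| comp: "sm X \<xi> Z T ==> op Z Z' S C ==> fspace Z' ==> sm X \<xi> Z' (\<lambda>f. S (T f))"
| loc: "\<eta> < \<xi> ==> ring_of_sets UNIV R ==> op X (Sp R) T C ==>
    (!!D. D \<in> R ==> sm X \<eta> (Sp R) (\<lambda>f. cut D (T f))) ==> sm X \<xi> (Sp R) T"
| cong: "sm X \<xi> Z T ==> fspace X ==> (!!f. f \<in> X ==> T' f = T f) ==> sm X \<xi> Z T'"

lemma op_cong: "op X Z T C ==> fspace X ==> (!!f. f \<in> X ==> T' f = T f) ==> op X Z T' C"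
  by (simp add: op_def fspace_def)

lemma sm_op: "sm X \<xi> Z T ==> fspace Z \<and> (\<exists>C. op X Z T C)"
proof (induction rule: sm.induct)
  case (rank1 Z z l C)
  then obtain b where "sbd z b" by (auto simp: fspace_def)
  thus ?case using rank1 op_rank1 by blast
next
  case (cong \<xi> Z T T')
  thus ?case using op_cong[of X Z T _ T'] by blast
qed (use op_add op_comp fspace_Sp in blast)+

text \<open>For positive \<xi> the operator is factored through the scalar multiples of the
  indicator of {0}. Over the ring consisting of {} and {0} every localisation is again of rank one,
  hence of level 0.\<close>

lemma sm_rank1:
  fixes X :: "(omega1 => 'k::real_normed_field) set"
  assumes Z: "fspace Z" "z \<in> Z" and l: "fnl X l C" shows "sm X \<xi> Z (\<lambda>f p. l f * z p)"
proof (cases "\<xi> = 0")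
  case True
  thus ?thesis using sm.rank1[OF Z l] by simp
next
  case False
  hence pos: "0 < \<xi>" by (simp add: less_le)
  define R where "R = {{}, {0::omega1}}"
  have R: "ring_of_sets UNIV R" by (auto simp: R_def ring_of_sets_iff)
  define e :: "omega1 => 'k" where "e = cut {0} (\<lambda>_. 1)"
  have "apx {{0}} e t" if "0 < t" for t using that by (auto simp: apx_def e_def cut_def)
  hence eR: "e \<in> Sp R" unfolding Sp_def R_def by auto
  have "sbd e 1" by (simp add: sbd_def e_def cut_def)
  hence "op X (Sp R) (\<lambda>f p. l f * e p) (C * 1)" by (intro op_rank1 l fspace_Sp eR)
  moreover have "sm X 0 (Sp R) (\<lambda>f. cut D (\<lambda>p. l f * e p))" if "D \<in> R" for D
  proof -
    have "cut D e \<in> Sp R" using Sp_cut'[OF R eR that] .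
    hence "sm X 0 (Sp R) (\<lambda>f p. l f * cut D e p)" by (rule sm.rank1[OF fspace_Sp _ l])
    thus ?thesis by (simp add: cut_scale)
  qed
  ultimately have T: "sm X \<xi> (Sp R) (\<lambda>f p. l f * e p)" using sm.loc[OF pos R] by blast
  obtain b where b: "sbd z b" using Z by (auto simp: fspace_def)
  have "op (Sp R) Z (\<lambda>g p. g 0 * z p) (1 * b)"
    by (rule op_rank1[OF fnl_op[OF op_id] Z b])
  from sm.comp[OF T this Z(1)] show ?thesis by (simp add: e_def cut_def)
qed

lemma sm_mono: "sm X \<eta> Z T ==> \<eta> <= \<xi> ==> sm X \<xi> Z T"
proof (induction arbitrary: \<xi> rule: sm.induct)
  case (rank1 Z z l C)
  thus ?case using sm_rank1 by blast
next
  case (sum \<eta> Z T S)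
  thus ?case by (intro sm.sum) auto
next
  case (comp \<eta> Z T Z' S C)
  thus ?case using sm.comp by blast
next
  case (loc \<gamma> \<eta> R T C)
  thus ?case using sm.loc[of \<gamma> \<xi> R X T C] by auto
next
  case (cong \<eta> Z T T')
  thus ?case using sm.cong[of X \<xi> Z T T'] by blast
qed

lemma sm_sum:
  fixes X :: "(omega1 => 'k::real_normed_field) set"
  assumes "finite N" "fspace Z" "!!i. i \<in> N ==> sm X \<xi> Z (T i)"
  shows "sm X \<xi> Z (\<lambda>f p. \<Sum>i\<in>N. T i f p)"
  using assms(1,3)
proof (induction N)
  case empty
  have "fnl X (\<lambda>_. 0 :: 'k) 0" by (simp add: fnl_def)
  thus ?case
    using sm_rank1[of Z "\<lambda>_. 0" X "\<lambda>_. 0" 0 \<xi>] assms(2) by (simp add: fspace_def)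
next
  case (insert i N)
  hence "sm X \<xi> Z (\<lambda>f p. T i f p + (\<Sum>i\<in>N. T i f p))" by (intro sm.sum) auto
  thus ?case using insert by simp
qed

section \<open>Operators into C[0,alpha]\<close>

definition good :: "(omega1 => 'k::real_normed_field) set => omega1 => omega1 => bool" where
  "good X \<xi> \<alpha> \<longleftrightarrow> (\<forall>T C. op X (Sp (RB (osuc \<alpha>))) T C --> sm X \<xi> (Sp (RB (osuc \<alpha>))) T)"

lemma goodD:
  "good X \<xi> \<alpha> ==> op X (Sp (RB (osuc \<alpha>))) T C ==> sm X \<xi> (Sp (RB (osuc \<alpha>))) T"
  unfolding good_def by blast

lemma Sp_RB_cut_id: "f \<in> Sp (RB (osuc \<beta>)) ==> cut {..\<beta>} f = f"
  using Sp_RB_outside[of f "osuc \<beta>"] by (auto simp: cut_def fun_eq_iff osuc_le_iff)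

lemma osuc_pos: "0 < osuc \<alpha>"
  by (rule le_less_trans[OF omega1_zero_le less_osuc])

lemma good_antimono:
  fixes X :: "(omega1 => 'k::real_normed_field) set"
  assumes "fspace X" "good X \<xi> \<alpha>" "\<beta> <= \<alpha>" shows "good X \<xi> \<beta>"
  unfolding good_def
proof (intro allI impI)
  fix T C assume T: "op X (Sp (RB (osuc \<beta>))) T C"
  have sub: "RB (osuc \<beta>) \<subseteq> RB (osuc \<alpha>)" using assms(3) by (auto simp: RB_osuc)
  have "op X (Sp (RB (osuc \<alpha>))) T (1 * C)"
    using op_comp[OF T op_incl[OF Sp_mono[OF sub]]] .
  hence "sm X \<xi> (Sp (RB (osuc \<alpha>))) T" using assms(2) by (auto simp: good_def)
  moreover have "op (Sp (RB (osuc \<alpha>)) :: 'k fn set) (Sp (RB (osuc \<beta>))) (cut {..\<beta>}) 1"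
  proof (rule op_cut)
    fix f :: "omega1 => 'k" assume "f \<in> Sp (RB (osuc \<alpha>))"
    moreover have "{..\<beta>} \<in> RB (osuc \<alpha>)" using assms(3) by (auto simp: RB_osuc clp.init)
    ultimately have "cut {..\<beta>} f \<in> Sp {B \<in> RB (osuc \<alpha>). B \<subseteq> {..\<beta>}}"
      by (intro Sp_cut ring_RB osuc_pos)
    moreover have "{B \<in> RB (osuc \<alpha>). B \<subseteq> {..\<beta>}} \<subseteq> RB (osuc \<beta>)" by (auto simp: RB_osuc)
    ultimately show "cut {..\<beta>} f \<in> Sp (RB (osuc \<beta>))" using Sp_mono by blast
  qed
  ultimately have "sm X \<xi> (Sp (RB (osuc \<beta>))) (\<lambda>f. cut {..\<beta>} (T f))"
    using sm.comp fspace_Sp by blast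
  thus "sm X \<xi> (Sp (RB (osuc \<beta>))) T"
    using assms(1) by (rule sm.cong) (simp add: Sp_RB_cut_id opD(2)[OF T])
qed

lemma good_finite:
  fixes X :: "(omega1 => 'k::real_normed_field) set"
  assumes "finite {..\<alpha>}" "fspace X" shows "good X \<xi> \<alpha>"
  unfolding good_def
proof (intro allI impI)
  fix T C assume T: "op X (Sp (RB (osuc \<alpha>))) T C"
  have clp_un: "(\<Union>b\<in>N. {..b}) \<in> clp" if "finite N" for N
    using that by induction (auto intro: clp.intros)
  have sing: "{a} \<in> RB (osuc \<alpha>)" if "a <= \<alpha>" for a
  proof -
    have "x = a" if "x <= a" "x \<notin> (\<Union>b\<in>{..<a}. {..b})" for x
      using that by (cases "x < a") auto
    hence "{a} = {..a} - (\<Union>b\<in>{..<a}. {..b})" by auto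
    moreover have "finite {..<a}" using that by (intro finite_subset[OF _ assms(1)]) auto
    ultimately show ?thesis using clp_un[of "{..<a}"] that by (auto simp: RB_osuc intro: clp.intros)
  qed
  define e :: "omega1 => omega1 => 'k" where "e a = cut {a} (\<lambda>_. 1)" for a
  have e: "e a \<in> Sp (RB (osuc \<alpha>))" if "a <= \<alpha>" for a
  proof -
    have "apx {{a}} (e a) t" if "0 < t" for t using that by (auto simp: apx_def e_def cut_def)
    thus ?thesis unfolding Sp_def using sing[OF that] by (intro CollectI allI impI exI[of _ "{{a}}"]) auto
  qed
  have "sm X \<xi> (Sp (RB (osuc \<alpha>))) (\<lambda>f p. \<Sum>a\<in>{..\<alpha>}. T f a * e a p)"
    by (intro sm_sum[OF assms(1) fspace_Sp] sm_rank1[OF fspace_Sp e fnl_op[OF T]]) simp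
  thus "sm X \<xi> (Sp (RB (osuc \<alpha>))) T"
  proof (rule sm.cong[OF _ assms(2)])
    fix f assume "f \<in> X"
    show "T f = (\<lambda>p. \<Sum>a\<in>{..\<alpha>}. T f a * e a p)"
    proof
      fix p
      have "(\<Sum>a\<in>{..\<alpha>}. T f a * e a p) = (\<Sum>a\<in>{..\<alpha>}. if a = p then T f p else 0)"
        by (intro sum.cong) (auto simp: e_def cut_def)
      also have "\<dots> = cut {..\<alpha>} (T f) p" using assms(1) by (simp add: cut_def)
      finally show "T f p = (\<Sum>a\<in>{..\<alpha>}. T f a * e a p)"
        using Sp_RB_cut_id[OF opD(2)[OF T \<open>f \<in> X\<close>]] by simp
    qed
  qed
qed

text \<open>Finitely many closed fibres \<open>(\<theta> \<eta>, \<theta> \<eta> + b]\<close> of \<open>[0,\<theta> \<gamma>]\<close>.\<close>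

definition FB :: "omega1 => omega1 => omega1 set set" where
  "FB \<theta> \<gamma> = {D\<in>clp. \<exists>N b. finite N \<and> N \<subseteq> {..<\<gamma>} \<and> b < \<theta> \<and> D \<subseteq> (\<Union>\<eta>\<in>N. {\<theta> * \<eta><..\<theta> * \<eta> + b})}"

lemma FB_I:
  "D \<in> clp ==> finite N ==> N \<subseteq> {..<\<gamma>} ==> b < \<theta> ==> D \<subseteq> (\<Union>\<eta>\<in>N. {\<theta> * \<eta><..\<theta> * \<eta> + b}) ==>
    D \<in> FB \<theta> \<gamma>"
  unfolding FB_def by blast

lemma FB_E:
  assumes "D \<in> FB \<theta> \<gamma>"
  obtains N b where "D \<in> clp" "finite N" "N \<subseteq> {..<\<gamma>}" "b < \<theta>" "D \<subseteq> (\<Union>\<eta>\<in>N. {\<theta> * \<eta><..\<theta> * \<eta> + b})"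
  using assms unfolding FB_def by blast

lemma fibre_Un:
  assumes "A \<subseteq> (\<Union>\<eta>\<in>N. {\<theta> * \<eta><..\<theta> * \<eta> + b})" "B \<subseteq> (\<Union>\<eta>\<in>M. {\<theta> * \<eta><..\<theta> * \<eta> + c})"
  shows "A \<union> B \<subseteq> (\<Union>\<eta>\<in>N \<union> M. {\<theta> * \<eta><..\<theta> * \<eta> + max b c :: omega1})"
proof -
  have "\<theta> * \<eta> + b <= \<theta> * \<eta> + max b c" "\<theta> * \<eta> + c <= \<theta> * \<eta> + max b c" for \<eta>
    by (simp_all add: normal_le_iff[OF normal_plus])
  hence "{\<theta> * \<eta><..\<theta> * \<eta> + b} \<subseteq> {\<theta> * \<eta><..\<theta> * \<eta> + max b c}"
    "{\<theta> * \<eta><..\<theta> * \<eta> + c} \<subseteq> {\<theta> * \<eta><..\<theta> * \<eta> + max b c}" for \<eta>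
    by (meson Ioc_subset_iff order_refl)+
  hence "(\<Union>\<eta>\<in>N. {\<theta> * \<eta><..\<theta> * \<eta> + b}) \<subseteq> (\<Union>\<eta>\<in>N \<union> M. {\<theta> * \<eta><..\<theta> * \<eta> + max b c})"
    "(\<Union>\<eta>\<in>M. {\<theta> * \<eta><..\<theta> * \<eta> + c}) \<subseteq> (\<Union>\<eta>\<in>N \<union> M. {\<theta> * \<eta><..\<theta> * \<eta> + max b c})"
    by (intro UN_mono; simp)+
  thus ?thesis using assms by (meson Un_least subset_trans)
qed

lemma FB_un:
  assumes "A \<in> FB \<theta> \<gamma>" "B \<in> FB \<theta> \<gamma>" shows "A \<union> B \<in> FB \<theta> \<gamma>"
proof -
  obtain N b where A: "A \<in> clp" "finite N" "N \<subseteq> {..<\<gamma>}" "b < \<theta>" "A \<subseteq> (\<Union>\<eta>\<in>N. {\<theta> * \<eta><..\<theta> * \<eta> + b})"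
    using assms(1) by (rule FB_E)
  obtain M c where B: "B \<in> clp" "finite M" "M \<subseteq> {..<\<gamma>}" "c < \<theta>" "B \<subseteq> (\<Union>\<eta>\<in>M. {\<theta> * \<eta><..\<theta> * \<eta> + c})"
    using assms(2) by (rule FB_E)
  have "A \<union> B \<in> clp" using A B clp.un by blast
  moreover have "finite (N \<union> M)" "N \<union> M \<subseteq> {..<\<gamma>}" "max b c < \<theta>" using A B by auto
  ultimately show ?thesis using fibre_Un[OF A(5) B(5)] by (rule FB_I)
qed

lemma FB_subset: "A \<in> FB \<theta> \<gamma> ==> B \<in> clp ==> B \<subseteq> A ==> B \<in> FB \<theta> \<gamma>"
  by (elim FB_E, rule FB_I) (assumption+, blast)

lemma ring_FB:
  assumes "0 < \<theta>" shows "ring_of_sets UNIV (FB \<theta> \<gamma>)"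
  unfolding ring_of_sets_iff
proof (intro conjI ballI)
  show "{} \<in> FB \<theta> \<gamma>" by (rule FB_I[of _ "{}", OF clp.empty _ _ assms]) simp_all
  fix A B assume A: "A \<in> FB \<theta> \<gamma>" and B: "B \<in> FB \<theta> \<gamma>"
  show "A \<union> B \<in> FB \<theta> \<gamma>" by (rule FB_un[OF A B])
  have "A \<in> clp" "B \<in> clp" using A B unfolding FB_def by blast+
  thus "A - B \<in> FB \<theta> \<gamma>" by (intro FB_subset[OF A] clp.diff Diff_subset)
qed simp

text \<open>A Galois connection: the least index whose value is at least x is left adjoint to e.
  Preimages of initial intervals under it are thus initial intervals, which is what clopen preimages
  require.\<close>

lemma normal_adjoint:
  assumes "normal e" shows "(LEAST \<eta>. x <= e \<eta>) <= \<eta> \<longleftrightarrow> x <= e \<eta>"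
proof
  assume "x <= e \<eta>"
  thus "(LEAST \<eta>. x <= e \<eta>) <= \<eta>" by (rule Least_le)
next
  assume *: "(LEAST \<eta>. x <= e \<eta>) <= \<eta>"
  have "x <= e (LEAST \<eta>. x <= e \<eta>)" by (rule LeastI[of _ x]) (rule normal_ge[OF assms])
  also have "\<dots> <= e \<eta>" using * by (simp add: normal_le_iff[OF assms])
  finally show "x <= e \<eta>" .
qed

lemma clp_vimage_normal:
  assumes "normal e" "D \<in> clp" shows "e -` D \<in> clp"
proof (rule clp_vimage[OF _ assms(2)])
  fix b
  show "e -` {..b} \<in> clp"
  proof (cases "e 0 <= b")
    case True
    then obtain \<eta> where "!!\<xi>. e \<xi> <= b \<longleftrightarrow> \<xi> <= \<eta>" using normal_Max[OF assms(1)] by blast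
    hence "e -` {..b} = {..\<eta>}" by auto
    thus ?thesis by (simp add: clp.init)
  next
    case False
    hence "\<not> e x <= b" for x
      using normal_le_iff[OF assms(1), of 0 x] by (meson omega1_zero_le order_trans)
    hence "e -` {..b} = {}" by auto
    thus ?thesis by (simp add: clp.empty)
  qed
qed

lemma clp_vimage_adjoint:
  assumes "normal e" "D \<in> clp" shows "(\<lambda>x. LEAST \<eta>. x <= e \<eta>) -` D \<in> clp"
proof (rule clp_vimage[OF _ assms(2)])
  fix b
  have "(\<lambda>x. LEAST \<eta>. x <= e \<eta>) -` {..b} = {..e b}" using normal_adjoint[OF assms(1)] by auto
  thus "(\<lambda>x. LEAST \<eta>. x <= e \<eta>) -` {..b} \<in> clp" by (simp add: clp.init)
qed

text \<open>Translation by \<open>\<theta> * \<eta>\<close> carries [0,b] onto the fibre together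
  with its left end point, and \<open>mn\<close> inverts it on the fibre. Cutting to D therefore
  factors through C[0,b], where every operator from X has level \<xi>.\<close>

lemma sm_fibre:
  fixes X :: "(omega1 => 'k::real_normed_field) set"
  assumes X: "fspace X" and "0 < \<theta>" and b: "b < \<theta>" "good X \<xi> b" and \<eta>: "\<eta> < \<gamma>"
    and T: "op X (Sp (FB \<theta> \<gamma>)) T C" and D: "D \<in> FB \<theta> \<gamma>" "D \<subseteq> {\<theta> * \<eta><..\<theta> * \<eta> + b}"
  shows "sm X \<xi> (Sp (FB \<theta> \<gamma>)) (\<lambda>f. cut D (T f))"
proof -
  let ?I = "{\<theta> * \<eta><..\<theta> * \<eta> + b}" and ?tr = "\<lambda>a. \<theta> * \<eta> + a"
  define mn where "mn x = (LEAST a. x <= ?tr a)" for x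
  note nt = normal_plus[of "\<theta> * \<eta>"]
  have I: "?I \<in> FB \<theta> \<gamma>" by (rule FB_I[of _ "{\<eta>}", OF clp_Ioc _ _ b(1)]) (use \<eta> in auto)
  define U where "U g = (\<lambda>a. cut D g (?tr a))" for g :: "omega1 => 'k"
  have U: "op (Sp (FB \<theta> \<gamma>)) (Sp (RB (osuc b))) U 1"
    unfolding op_def
  proof (intro conjI ballI allI impI)
    fix g :: "omega1 => 'k" assume g: "g \<in> Sp (FB \<theta> \<gamma>)"
    have "cut D g \<in> Sp {B\<in>FB \<theta> \<gamma>. B \<subseteq> D}" by (rule Sp_cut[OF ring_FB[OF assms(2)] g D(1)])
    thus "U g \<in> Sp (RB (osuc b))"
      unfolding U_def
    proof (rule Sp_comp)
      fix G assume "G \<in> {B\<in>FB \<theta> \<gamma>. B \<subseteq> D}"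
      hence "G \<in> clp" "G \<subseteq> ?I" using D(2) by (auto simp: FB_def)
      hence "?tr -` G \<in> clp" "?tr -` G \<subseteq> {..b}"
        using clp_vimage_normal[OF nt] normal_le_iff[OF nt] by auto
      thus "?tr -` G \<in> RB (osuc b)" by (simp add: RB_osuc)
    qed
    show "sbd (U g) (1 * a)" if "sbd g a" for a
      using sbd_cut[OF that] by (simp add: U_def sbd_def)
  qed (simp_all add: U_def cut_add cut_scale)
  define V where "V g = cut ?I (\<lambda>x. g (mn x))" for g :: "omega1 => 'k"
  have V: "op (Sp (RB (osuc b))) (Sp (FB \<theta> \<gamma>)) V 1"
    unfolding op_def
  proof (intro conjI ballI allI impI)
    fix g :: "omega1 => 'k" assume g: "g \<in> Sp (RB (osuc b))"
    have "(\<lambda>x. g (mn x)) \<in> Sp clp"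
      using g by (rule Sp_comp) (auto simp: mn_def RB_def intro: clp_vimage_adjoint[OF nt])
    hence "V g \<in> Sp {B\<in>clp. B \<subseteq> ?I}" unfolding V_def by (rule Sp_cut[OF ring_clp]) (rule clp_Ioc)
    moreover have "{B\<in>clp. B \<subseteq> ?I} \<subseteq> FB \<theta> \<gamma>" using FB_subset[OF I] by auto
    ultimately show "V g \<in> Sp (FB \<theta> \<gamma>)" using Sp_mono by blast
    show "sbd (V g) (1 * a)" if "sbd g a" for a
      unfolding V_def mult_1 by (rule sbd_cut) (use that in \<open>simp add: sbd_def\<close>)
  qed (simp_all add: V_def cut_add cut_scale)
  have "sm X \<xi> (Sp (RB (osuc b))) (\<lambda>f. U (T f))"
    by (rule goodD[OF b(2) op_comp[OF T U]])
  hence "sm X \<xi> (Sp (FB \<theta> \<gamma>)) (\<lambda>f. V (U (T f)))" using V fspace_Sp by (rule sm.comp)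
  moreover have "V (U g) = cut D g" for g :: "omega1 => 'k"
  proof
    fix x
    show "V (U g) x = cut D g x"
    proof (cases "x \<in> ?I")
      case True
      then obtain a where a: "x = ?tr a" using plus_surj[of "\<theta> * \<eta>" x] by (auto simp: less_imp_le)
      have "mn x = a"
        unfolding mn_def a by (rule Least_equality) (auto simp: normal_le_iff[OF nt])
      thus ?thesis using True a by (simp add: V_def U_def cut_def)
    qed (use D(2) in \<open>auto simp: V_def cut_def\<close>)
  qed
  ultimately show ?thesis by simp
qed

lemma fibre_disjoint:
  fixes \<theta> :: omega1
  assumes "0 < \<theta>" "b < \<theta>" "x \<in> {\<theta> * \<eta><..\<theta> * \<eta> + b}" "x \<in> {\<theta> * \<eta>'<..\<theta> * \<eta>' + b}"
  shows "\<eta> = \<eta>'"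
proof -
  have False if "\<mu> < \<nu>" "x <= \<theta> * \<mu> + b" "\<theta> * \<nu> < x" for \<mu> \<nu>
  proof -
    have "x < \<theta> * \<mu> + \<theta>" using that(2) plus_less_mono[OF assms(2)] by (rule le_less_trans)
    also have "\<dots> = \<theta> * osuc \<mu>" by (simp add: times_omega1_simps)
    also have "\<dots> <= \<theta> * \<nu>" using that(1) by (simp add: normal_le_iff[OF normal_times[OF assms(1)]] osuc_le_iff)
    finally show False using that(3) by simp
  qed
  thus ?thesis using assms(3,4) by (metis greaterThanAtMost_iff linorder_neqE)
qed

text \<open>Let \<open>r x\<close> be the index of the first multiple of \<theta> not below x and
  let s x be that multiple. The composite of a function with s depends only on its values at
  multiples of \<theta> and factors through C[0,\<gamma>], which is covered by \<open>base\<close>.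
  The remainder f - f o s vanishes at these multiples and lies in the closure over
  \<open>FB\<close>; a member of \<open>FB\<close> meets only finitely many fibres, so its
  localisations have level \<eta> by \<open>fib\<close>, and the remainder has level \<xi>.\<close>

lemma good_step:
  fixes X :: "(omega1 => 'k::real_normed_field) set"
  assumes X: "fspace X" and th: "0 < \<theta>" and "\<eta> < \<xi>"
    and fib: "!!b. b < \<theta> ==> good X \<eta> b" and base: "good X \<xi> \<gamma>"
  shows "good X \<xi> (\<theta> * \<gamma>)"
  unfolding good_def
proof (intro allI impI)
  fix T C assume T: "op X (Sp (RB (osuc (\<theta> * \<gamma>)))) T C"
  let ?Z = "Sp (RB (osuc (\<theta> * \<gamma>))) :: 'k fn set"
  let ?e = "\<lambda>\<eta>. \<theta> * \<eta>"
  define r where "r x = (LEAST \<eta>. x <= ?e \<eta>)" for x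
  note ne = normal_times[OF th]
  have r: "r x <= \<eta> \<longleftrightarrow> x <= ?e \<eta>" for x \<eta> unfolding r_def by (rule normal_adjoint[OF ne])
  define U where "U g = (\<lambda>\<eta>. g (?e \<eta>))" for g :: "omega1 => 'k"
  have U: "op ?Z (Sp (RB (osuc \<gamma>))) U 1"
    unfolding op_def
  proof (intro conjI ballI allI impI)
    fix g assume "g \<in> ?Z"
    thus "U g \<in> Sp (RB (osuc \<gamma>))"
      unfolding U_def
    proof (rule Sp_comp)
      fix G assume "G \<in> RB (osuc (\<theta> * \<gamma>))"
      thus "?e -` G \<in> RB (osuc \<gamma>)"
        using clp_vimage_normal[OF ne] normal_le_iff[OF ne] by (auto simp: RB_osuc)
    qed
  qed (auto simp: U_def sbd_def)
  define V where "V g = (\<lambda>x. g (r x))" for g :: "omega1 => 'k"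
  have V: "op (Sp (RB (osuc \<gamma>))) ?Z V 1"
    unfolding op_def
  proof (intro conjI ballI allI impI)
    fix g :: "omega1 => 'k" assume "g \<in> Sp (RB (osuc \<gamma>))"
    thus "V g \<in> ?Z"
      unfolding V_def
    proof (rule Sp_comp)
      fix G assume "G \<in> RB (osuc \<gamma>)"
      hence G: "G \<in> clp" "G \<subseteq> {..\<gamma>}" by (auto simp: RB_osuc)
      have "r -` G \<in> clp" unfolding r_def using clp_vimage_adjoint[OF ne G(1)] by simp
      moreover have "r -` G \<subseteq> {..\<theta> * \<gamma>}" using G(2) r by auto
      ultimately show "r -` G \<in> RB (osuc (\<theta> * \<gamma>))" by (simp add: RB_osuc)
    qed
  qed (auto simp: V_def sbd_def)
  have "sm X \<xi> (Sp (RB (osuc \<gamma>))) (\<lambda>f. U (T f))"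
    by (rule goodD[OF base op_comp[OF T U]])
  hence T1: "sm X \<xi> ?Z (\<lambda>f. V (U (T f)))" using V fspace_Sp by (rule sm.comp)
  define W where "W g = (\<lambda>x. g x - g (?e (r x)))" for g :: "omega1 => 'k"
  let ?s = "\<lambda>x. ?e (r x)"
  \<comment> \<open>For G = [0,b] with b = \<theta> \<mu> + c, the points x and s x can be separated
    by G only if x lies in the single fibre segment (\<theta> \<mu>, \<theta> \<mu> + c]. Unions and
    differences of such sets G need only the union of the segments involved.\<close>
  have cover: "\<exists>N b. finite N \<and> N \<subseteq> {..<\<gamma>} \<and> b < \<theta> \<and>
      ((G - ?s -` G) \<union> (?s -` G - G)) \<inter> {..\<theta> * \<gamma>} \<subseteq> (\<Union>\<eta>\<in>N. {\<theta> * \<eta><..\<theta> * \<eta> + b})"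
    (is "\<exists>N b. ?P G N b") if "G \<in> clp" for G
    using that
  proof induction
    case empty
    thus ?case using th by (intro exI[of _ "{}"] exI[of _ 0]) simp
  next
    case (init b)
    obtain \<mu> where \<mu>: "!!\<xi>. \<theta> * \<xi> <= b \<longleftrightarrow> \<xi> <= \<mu>"
      using normal_Max[OF ne, of b] by (auto simp: times_omega1_simps)
    hence "\<theta> * \<mu> <= b" "b < \<theta> * osuc \<mu>" by (auto simp: not_le[symmetric] osuc_le_iff)
    then obtain c where c: "b = \<theta> * \<mu> + c" "c < \<theta>"
      using plus_surj[of "\<theta> * \<mu>" b] normal_less_iff[OF normal_plus] by (metis times_omega1_simps(2))
    have sub: "({..b} - ?s -` {..b}) \<union> (?s -` {..b} - {..b}) \<subseteq> {\<theta> * \<mu><..\<theta> * \<mu> + c}"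
    proof
      fix x assume x: "x \<in> ({..b} - ?s -` {..b}) \<union> (?s -` {..b} - {..b})"
      have "x <= ?s x" using r[of x "r x"] by simp
      hence "x <= b" "\<not> ?s x <= b" using x by auto
      hence "\<not> r x <= \<mu>" using \<mu> by simp
      hence "\<theta> * \<mu> < x" using r by (simp add: not_le[symmetric])
      thus "x \<in> {\<theta> * \<mu><..\<theta> * \<mu> + c}" using \<open>x <= b\<close> c(1) by simp
    qed
    show ?case
    proof (cases "\<mu> < \<gamma>")
      case True
      thus ?thesis using sub c(2) by (intro exI[of _ "{\<mu>}"] exI[of _ c]) auto
    next
      case False
      hence "\<theta> * \<gamma> <= \<theta> * \<mu>" by (simp add: normal_le_iff[OF ne])
      hence "{\<theta> * \<mu><..\<theta> * \<mu> + c} \<inter> {..\<theta> * \<gamma>} = {}" by auto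
      thus ?thesis using sub c(2) by (intro exI[of _ "{}"] exI[of _ c]) blast
    qed
  next
    case (un A B)
    from un.IH show ?case
    proof (elim exE conjE)
      fix N b M c
      assume "finite N" "N \<subseteq> {..<\<gamma>}" "b < \<theta>" "finite M" "M \<subseteq> {..<\<gamma>}" "c < \<theta>"
        "((A - ?s -` A) \<union> (?s -` A - A)) \<inter> {..\<theta> * \<gamma>} \<subseteq> (\<Union>\<eta>\<in>N. {\<theta> * \<eta><..\<theta> * \<eta> + b})"
        "((B - ?s -` B) \<union> (?s -` B - B)) \<inter> {..\<theta> * \<gamma>} \<subseteq> (\<Union>\<eta>\<in>M. {\<theta> * \<eta><..\<theta> * \<eta> + c})"
      thus ?thesis
        by (intro exI[of _ "N \<union> M"] exI[of _ "max b c"] conjI order_trans[OF _ fibre_Un]) auto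
    qed
  next
    case (diff A B)
    from diff.IH show ?case
    proof (elim exE conjE)
      fix N b M c
      assume "finite N" "N \<subseteq> {..<\<gamma>}" "b < \<theta>" "finite M" "M \<subseteq> {..<\<gamma>}" "c < \<theta>"
        "((A - ?s -` A) \<union> (?s -` A - A)) \<inter> {..\<theta> * \<gamma>} \<subseteq> (\<Union>\<eta>\<in>N. {\<theta> * \<eta><..\<theta> * \<eta> + b})"
        "((B - ?s -` B) \<union> (?s -` B - B)) \<inter> {..\<theta> * \<gamma>} \<subseteq> (\<Union>\<eta>\<in>M. {\<theta> * \<eta><..\<theta> * \<eta> + c})"
      thus ?thesis
        by (intro exI[of _ "N \<union> M"] exI[of _ "max b c"] conjI order_trans[OF _ fibre_Un]) auto
    qed
  qed
  have sG: "?s -` G \<in> clp" if "G \<in> clp" for G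
  proof -
    have "?s -` G = r -` (?e -` G)" by auto
    thus ?thesis
      unfolding r_def using clp_vimage_adjoint[OF ne clp_vimage_normal[OF ne that]] by simp
  qed
  have W_mem: "W g \<in> Sp (FB \<theta> \<gamma>)" if "g \<in> ?Z" for g
    unfolding W_def
  proof (rule Sp_minus_retract[OF that])
    fix G assume "G \<in> RB (osuc (\<theta> * \<gamma>))"
    hence G: "G \<in> clp" "G \<subseteq> {..\<theta> * \<gamma>}" by (auto simp: RB_osuc)
    have "?s -` G \<subseteq> {..\<theta> * \<gamma>}"
    proof
      fix x assume "x \<in> ?s -` G"
      hence "?s x <= \<theta> * \<gamma>" using G(2) by auto
      moreover have "x <= ?s x" using r[of x "r x"] by simp
      ultimately show "x \<in> {..\<theta> * \<gamma>}" by simp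
    qed
    hence sub: "G - ?s -` G \<subseteq> ((G - ?s -` G) \<union> (?s -` G - G)) \<inter> {..\<theta> * \<gamma>}"
      "?s -` G - G \<subseteq> ((G - ?s -` G) \<union> (?s -` G - G)) \<inter> {..\<theta> * \<gamma>}" using G(2) by auto
    obtain N b where N: "finite N" "N \<subseteq> {..<\<gamma>}" "b < \<theta>"
      "((G - ?s -` G) \<union> (?s -` G - G)) \<inter> {..\<theta> * \<gamma>} \<subseteq> (\<Union>\<eta>\<in>N. {\<theta> * \<eta><..\<theta> * \<eta> + b})"
      using cover[OF G(1)] by (elim exE conjE)
    show "G - ?s -` G \<in> FB \<theta> \<gamma> \<and> ?s -` G - G \<in> FB \<theta> \<gamma>"
      using G(1) sG[OF G(1)] sub[THEN order_trans[OF _ N(4)]]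
      by (intro conjI FB_I[OF _ N(1-3)] clp.diff)
    show "A \<inter> G \<in> FB \<theta> \<gamma> \<and> A \<inter> ?s -` G \<in> FB \<theta> \<gamma>" if "A \<in> FB \<theta> \<gamma>" for A
    proof -
      have "A \<in> clp" using that unfolding FB_def by blast
      thus ?thesis using G(1) sG[OF G(1)] by (intro conjI FB_subset[OF that] clp_int Int_lower1)
    qed
  qed
  have W: "op ?Z (Sp (FB \<theta> \<gamma>)) W 2"
    unfolding op_def
  proof (intro conjI ballI allI impI)
    fix g a assume "sbd (g :: omega1 => 'k) a"
    hence "norm (g x - g (?s x)) <= a + a" for x
      unfolding sbd_def by (meson add_mono norm_triangle_ineq4 order_trans)
    thus "sbd (W g) (2 * a)" by (simp add: W_def sbd_def)
  next
    fix g assume "g \<in> ?Z"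
    thus "W g \<in> Sp (FB \<theta> \<gamma>)" by (rule W_mem)
  qed (auto simp: W_def algebra_simps)
  have WT: "op X (Sp (FB \<theta> \<gamma>)) (\<lambda>f. W (T f)) (2 * C)" by (rule op_comp[OF T W])
  have "sm X \<xi> (Sp (FB \<theta> \<gamma>)) (\<lambda>f. W (T f))"
  proof (rule sm.loc[OF assms(3) ring_FB[OF th] WT])
    fix D assume D: "D \<in> FB \<theta> \<gamma>"
    then obtain N b where N: "D \<in> clp" "finite N" "N \<subseteq> {..<\<gamma>}" "b < \<theta>"
      "D \<subseteq> (\<Union>\<eta>\<in>N. {\<theta> * \<eta><..\<theta> * \<eta> + b})" by (rule FB_E)
    let ?D = "\<lambda>\<eta>. D \<inter> {\<theta> * \<eta><..\<theta> * \<eta> + b}"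
    have "sm X \<eta> (Sp (FB \<theta> \<gamma>)) (\<lambda>f p. \<Sum>\<eta>\<in>N. cut (?D \<eta>) (W (T f)) p)"
    proof (rule sm_sum[OF N(2) fspace_Sp])
      fix \<mu> assume "\<mu> \<in> N"
      thus "sm X \<eta> (Sp (FB \<theta> \<gamma>)) (\<lambda>f. cut (?D \<mu>) (W (T f)))"
      proof (intro sm_fibre[OF X th N(4) fib[OF N(4)] _ WT])
        show "\<mu> < \<gamma>" using N(3) \<open>\<mu> \<in> N\<close> by blast
        show "?D \<mu> \<in> FB \<theta> \<gamma>" by (intro FB_subset[OF D] clp_int N(1) clp_Ioc Int_lower1)
      qed simp
    qed
    moreover have "(\<Sum>\<eta>\<in>N. cut (?D \<eta>) g p) = cut D g p" for g :: "omega1 => 'k" and p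
    proof (cases "p \<in> D")
      case True
      then obtain \<mu> where \<mu>: "\<mu> \<in> N" "p \<in> {\<theta> * \<mu><..\<theta> * \<mu> + b}"
        using subsetD[OF N(5)] by (meson UN_E)
      have "(\<Sum>\<eta>\<in>N. cut (?D \<eta>) g p) = (\<Sum>\<eta>\<in>N. if \<eta> = \<mu> then g p else 0)"
      proof (rule sum.cong[OF refl])
        fix \<eta>
        show "cut (?D \<eta>) g p = (if \<eta> = \<mu> then g p else 0)"
        proof (cases "\<eta> = \<mu>")
          case False
          hence "p \<notin> {\<theta> * \<eta><..\<theta> * \<eta> + b}" using fibre_disjoint[OF th N(4) _ \<mu>(2)] by metis
          thus ?thesis using False by (simp add: cut_def del: greaterThanAtMost_iff)
        qed (use True \<mu>(2) in \<open>simp add: cut_def del: greaterThanAtMost_iff\<close>)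
      qed
      thus ?thesis using True \<mu>(1) N(2) by (simp add: cut_def)
    qed (simp add: cut_def)
    ultimately show "sm X \<eta> (Sp (FB \<theta> \<gamma>)) (\<lambda>f. cut D (W (T f)))" by simp
  qed
  moreover have "FB \<theta> \<gamma> \<subseteq> RB (osuc (\<theta> * \<gamma>))"
  proof
    fix D assume "D \<in> FB \<theta> \<gamma>"
    then obtain N b where N: "D \<in> clp" "finite N" "N \<subseteq> {..<\<gamma>}" "b < \<theta>"
      "D \<subseteq> (\<Union>\<eta>\<in>N. {\<theta> * \<eta><..\<theta> * \<eta> + b})" by (rule FB_E)
    have "\<theta> * \<eta> + b <= \<theta> * \<gamma>" if "\<eta> \<in> N" for \<eta>
    proof -
      have "\<theta> * \<eta> + b <= \<theta> * osuc \<eta>"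
        using plus_less_mono[OF N(4), of "\<theta> * \<eta>"] by (simp add: times_omega1_simps)
      also have "\<dots> <= \<theta> * \<gamma>" using N(3) that by (auto simp: normal_le_iff[OF ne] osuc_le_iff)
      finally show ?thesis .
    qed
    hence "(\<Union>\<eta>\<in>N. {\<theta> * \<eta><..\<theta> * \<eta> + b}) \<subseteq> {..\<theta> * \<gamma>}"
      by (meson UN_least atMost_iff greaterThanAtMost_iff order_trans subsetI)
    thus "D \<in> RB (osuc (\<theta> * \<gamma>))" using N(1,5) by (simp add: RB_osuc)
  qed
  hence "op (Sp (FB \<theta> \<gamma>)) ?Z (\<lambda>f. f) 1" by (intro op_incl Sp_mono)
  ultimately have T2: "sm X \<xi> ?Z (\<lambda>f. W (T f))" using sm.comp fspace_Sp by blast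
  have "sm X \<xi> ?Z (\<lambda>f p. W (T f) p + V (U (T f)) p)" by (rule sm.sum[OF T2 T1])
  thus "sm X \<xi> ?Z T" by (simp add: W_def V_def U_def)
qed

text \<open>Below \<open>theta 0\<close>, that is below omega, the intervals are finite. Below
  \<open>theta (osuc \<eta>)\<close> they are contained in [0, theta(\<eta>)^n] for some n, and each
  further factor is one application of \<open>good_step\<close> with fibres of level \<eta>. At a
  limit, continuity of \<open>theta\<close> leads back to a smaller index.\<close>

lemma good_below_theta:
  assumes "fspace X" "\<alpha> < theta \<xi>" shows "good X \<xi> \<alpha>"
  using assms(2)
proof (induction \<xi> arbitrary: \<alpha> rule: less_induct)
  case (less \<xi>)
  have mono: "good X \<xi> \<beta>" if "good X \<eta> \<beta>" "\<eta> <= \<xi>" for \<eta> \<beta>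
    using that sm_mono unfolding good_def by blast
  show ?case
  proof (cases \<xi> rule: omega1_cases)
    case 1
    thus ?thesis using less.prems below_theta_zero good_finite[OF _ assms(1)] by simp
  next
    case (2 \<eta>)
    have "good X \<xi> (opower (theta \<eta>) n)" for n
    proof (induction n)
      case 0
      have "finite {..1 :: omega1}" using finite_below_omega[OF one_less_omega] .
      thus ?case using good_finite[OF _ assms(1)] by simp
    next
      case (Suc n)
      thus ?case
        using good_step[OF assms(1) theta_pos _ _ Suc, of \<eta>] less.IH[of \<eta>] 2 by simp
    qed
    thus ?thesis
      using below_theta_osuc[of \<alpha> \<eta>] less.prems 2 good_antimono[OF assms(1)] by blast
  next
    case 3
    then obtain \<eta> where "\<eta> < \<xi>" "\<alpha> < theta \<eta>" using below_theta_limit less.prems by blast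
    thus ?thesis using less.IH[of \<eta> \<alpha>] mono[of \<eta> \<alpha>] by simp
  qed
qed

section \<open>Bounded bilinear forms and Grothendieck's inequality\<close>

definition form :: "('p => 'k::real_normed_field) set => ('q => 'k) set => (('p => 'k) => ('q => 'k) => 'k) => real => bool" where
  "form Z Z' \<phi> B \<longleftrightarrow> 0 <= B \<and>
    (\<forall>f\<in>Z. \<forall>g\<in>Z. \<forall>h\<in>Z'. \<phi> (\<lambda>x. f x + g x) h = \<phi> f h + \<phi> g h) \<and>
    (\<forall>c. \<forall>f\<in>Z. \<forall>h\<in>Z'. \<phi> (\<lambda>x. c * f x) h = c * \<phi> f h) \<and>
    (\<forall>f\<in>Z. \<forall>g\<in>Z'. \<forall>h\<in>Z'. \<phi> f (\<lambda>x. g x + h x) = \<phi> f g + \<phi> f h) \<and>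
    (\<forall>c. \<forall>f\<in>Z. \<forall>h\<in>Z'. \<phi> f (\<lambda>x. c * h x) = c * \<phi> f h) \<and>
    (\<forall>f\<in>Z. \<forall>h\<in>Z'. \<forall>a b. sbd f a --> sbd h b --> norm (\<phi> f h) <= B * a * b)"

lemma formD:
  assumes "form Z Z' \<phi> B"
  shows "0 <= B"
    "f \<in> Z ==> g \<in> Z ==> h \<in> Z' ==> \<phi> (\<lambda>x. f x + g x) h = \<phi> f h + \<phi> g h"
    "f \<in> Z ==> h \<in> Z' ==> \<phi> (\<lambda>x. c * f x) h = c * \<phi> f h"
    "f \<in> Z ==> h' \<in> Z' ==> h \<in> Z' ==> \<phi> f (\<lambda>x. h' x + h x) = \<phi> f h' + \<phi> f h"
    "f \<in> Z ==> h \<in> Z' ==> \<phi> f (\<lambda>x. c * h x) = c * \<phi> f h"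
    "f \<in> Z ==> h \<in> Z' ==> sbd f a ==> sbd h b ==> norm (\<phi> f h) <= B * a * b"
  using assms unfolding form_def by blast+

lemma formI:
  assumes "0 <= B"
    "!!f g h. f \<in> Z ==> g \<in> Z ==> h \<in> Z' ==> \<phi> (\<lambda>x. f x + g x) h = \<phi> f h + \<phi> g h"
    "!!c f h. f \<in> Z ==> h \<in> Z' ==> \<phi> (\<lambda>x. c * f x) h = c * \<phi> f h"
    "!!f h h'. f \<in> Z ==> h' \<in> Z' ==> h \<in> Z' ==> \<phi> f (\<lambda>x. h' x + h x) = \<phi> f h' + \<phi> f h"
    "!!c f h. f \<in> Z ==> h \<in> Z' ==> \<phi> f (\<lambda>x. c * h x) = c * \<phi> f h"
    "!!f h a b. f \<in> Z ==> h \<in> Z' ==> sbd f a ==> sbd h b ==> norm (\<phi> f h) <= B * a * b"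
  shows "form Z Z' \<phi> B"
  using assms unfolding form_def by blast

lemma form_flip: "form Z Z' \<phi> B ==> form Z' Z (\<lambda>g f. \<phi> f g) B"
  unfolding form_def by (simp add: mult_ac) (metis mult.commute mult.left_commute)

lemma form_mono:
  assumes "form Z Z' \<phi> B" "B <= B'" shows "form Z Z' \<phi> B'"
proof (rule formI)
  show "0 <= B'" using formD(1)[OF assms(1)] assms(2) by simp
  fix f h a b assume *: "f \<in> Z" "h \<in> Z'" "sbd f a" "sbd h b"
  have "B * a * b <= B' * a * b"
    using assms(2) sbd_nonneg[OF *(3)] sbd_nonneg[OF *(4)] by (intro mult_right_mono) auto
  thus "norm (\<phi> f h) <= B' * a * b" using formD(6)[OF assms(1) *] by simp
qed (use formD[OF assms(1)] in auto)

lemma form_add: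
  assumes "form Z Z' \<phi> B" "form Z Z' \<psi> C" shows "form Z Z' (\<lambda>f g. \<phi> f g + \<psi> f g) (B + C)"
proof (rule formI)
  fix f h a b assume *: "f \<in> Z" "h \<in> Z'" "sbd f a" "sbd h b"
  show "norm (\<phi> f h + \<psi> f h) <= (B + C) * a * b"
    using norm_triangle_mono[OF formD(6)[OF assms(1) *] formD(6)[OF assms(2) *]] by (simp add: distrib_right)
qed (use formD[OF assms(1)] formD[OF assms(2)] in \<open>auto simp: algebra_simps\<close>)

lemma form_scale:
  assumes "form Z Z' \<phi> B" shows "form Z Z' (\<lambda>f g. c * \<phi> f g) (norm c * B)"
proof (rule formI)
  fix f h a b assume *: "f \<in> Z" "h \<in> Z'" "sbd f a" "sbd h b"
  show "norm (c * \<phi> f h) <= norm c * B * a * b"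
    using mult_left_mono[OF formD(6)[OF assms(1) *], of "norm c"] by (simp add: norm_mult mult.assoc)
qed (use formD[OF assms(1)] in \<open>auto simp: algebra_simps\<close>)

lemma form_comp:
  assumes "form Z Z' \<psi> B" "op X Z T C" "op Y Z' T' C'"
  shows "form X Y (\<lambda>f g. \<psi> (T f) (T' g)) (B * C * C')"
proof (rule formI)
  note T = opD[OF assms(2)] and T' = opD[OF assms(3)] and F = formD[OF assms(1)]
  show "0 <= B * C * C'" using F(1) T(1) T'(1) by simp
  fix f h a b assume *: "f \<in> X" "h \<in> Y" "sbd f a" "sbd h b"
  show "norm (\<psi> (T f) (T' h)) <= B * C * C' * a * b"
    using F(6)[OF T(2)[OF *(1)] T'(2)[OF *(2)] T(5)[OF *(1,3)] T'(5)[OF *(2,4)]] by (simp add: mult_ac)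
qed (use opD[OF assms(2)] opD[OF assms(3)] formD[OF assms(1)] in auto)

lemma sbd_zero: "sbd (\<lambda>_. 0) 1"
  by (simp add: sbd_def)

lemma fspace_zero: "fspace Z ==> (\<lambda>_. 0) \<in> Z"
  by (simp add: fspace_def)

lemma fspace_scale: "fspace Z ==> f \<in> Z ==> (\<lambda>x. c * f x) \<in> Z"
  by (simp add: fspace_def)

lemma fspace_sum:
  assumes "fspace Z" "finite I" "!!i. i \<in> I ==> f i \<in> Z" shows "(\<lambda>x. \<Sum>i\<in>I. f i x) \<in> Z"
  using assms(2,3) by induction (use assms(1) in \<open>auto simp: fspace_def\<close>)

lemma form_zero:
  assumes "form Z Z' \<phi> B" "f \<in> Z" "h \<in> Z'" shows "\<phi> (\<lambda>_. 0) h = 0" "\<phi> f (\<lambda>_. 0) = 0"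
  using formD(3)[OF assms(1), of f h 0] formD(5)[OF assms(1), of f h 0] assms by auto

lemma form_sum_left:
  assumes "form Z Z' \<phi> B" "fspace Z" "h \<in> Z'" "finite I" "!!i. i \<in> I ==> f i \<in> Z"
  shows "\<phi> (\<lambda>x. \<Sum>i\<in>I. f i x) h = (\<Sum>i\<in>I. \<phi> (f i) h)"
  using assms(4,5)
proof induction
  case empty
  thus ?case using form_zero(1)[OF assms(1) fspace_zero[OF assms(2)] assms(3)] by simp
next
  case (insert i I)
  hence "(\<lambda>x. \<Sum>i\<in>I. f i x) \<in> Z" by (intro fspace_sum assms(2)) auto
  thus ?case using insert formD(2)[OF assms(1), of "f i" "\<lambda>x. \<Sum>i\<in>I. f i x" h] assms(3) by simp
qed

lemma form_sum_right:
  assumes "form Z Z' \<phi> B" "fspace Z'" "f \<in> Z" "finite I" "!!i. i \<in> I ==> h i \<in> Z'"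
  shows "\<phi> f (\<lambda>x. \<Sum>i\<in>I. h i x) = (\<Sum>i\<in>I. \<phi> f (h i))"
  using form_sum_left[OF form_flip[OF assms(1)] assms(2-5)] by simp

definition fnorm :: "('p => 'k::real_normed_field) set => ('q => 'k) set => (('p => 'k) => ('q => 'k) => 'k) => real" where
  "fnorm Z Z' \<phi> = (SUP (f, g)\<in>{f\<in>Z. sbd f 1} \<times> {g\<in>Z'. sbd g 1}. norm (\<phi> f g))"

context
  fixes Z Z' \<phi> B
  assumes F: "form Z Z' \<phi> B" and Z: "fspace Z" "fspace Z'"
begin

lemma fnorm_bdd: "bdd_above ((\<lambda>(f, g). norm (\<phi> f g)) ` ({f\<in>Z. sbd f 1} \<times> {g\<in>Z'. sbd g 1}))"
proof (rule bdd_aboveI2)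
  fix p assume "p \<in> {f\<in>Z. sbd f 1} \<times> {g\<in>Z'. sbd g 1}"
  thus "(\<lambda>(f, g). norm (\<phi> f g)) p <= B" using formD(6)[OF F, of "fst p" "snd p" 1 1] by auto
qed

lemma balls_nonempty: "{f\<in>Z. sbd f 1} \<times> {g\<in>Z'. sbd g 1} ~= {}"
proof -
  have "(\<lambda>_. 0, \<lambda>_. 0) \<in> {f\<in>Z. sbd f 1} \<times> {g\<in>Z'. sbd g 1}"
    using Z by (simp add: fspace_zero sbd_zero)
  thus ?thesis by blast
qed

lemma fnorm_upper: "f \<in> Z ==> g \<in> Z' ==> sbd f 1 ==> sbd g 1 ==> norm (\<phi> f g) <= fnorm Z Z' \<phi>"
  unfolding fnorm_def using cSUP_upper[OF _ fnorm_bdd, of "(f, g)"] by simp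

lemma fnorm_approx:
  assumes "0 < e"
  obtains f g where "f \<in> Z" "g \<in> Z'" "sbd f 1" "sbd g 1" "fnorm Z Z' \<phi> - e < norm (\<phi> f g)"
proof -
  note ne = balls_nonempty
  have "fnorm Z Z' \<phi> - e < fnorm Z Z' \<phi>" using assms by simp
  then obtain p where "p \<in> {f\<in>Z. sbd f 1} \<times> {g\<in>Z'. sbd g 1}" "fnorm Z Z' \<phi> - e < (\<lambda>(f, g). norm (\<phi> f g)) p"
    unfolding fnorm_def less_cSUP_iff[OF ne fnorm_bdd] by blast
  thus thesis using that by (cases p) auto
qed

lemma fnorm_nonneg: "0 <= fnorm Z Z' \<phi>"
  using order_trans[OF norm_ge_zero
      fnorm_upper[OF fspace_zero[OF Z(1)] fspace_zero[OF Z(2)] sbd_zero sbd_zero]] .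

lemma fnorm_le: "fnorm Z Z' \<phi> <= B"
proof -
  show ?thesis
    unfolding fnorm_def using balls_nonempty
  proof (rule cSUP_least)
    fix p assume "p \<in> {f\<in>Z. sbd f 1} \<times> {g\<in>Z'. sbd g 1}"
    thus "(\<lambda>(f, g). norm (\<phi> f g)) p <= B" using formD(6)[OF F, of "fst p" "snd p" 1 1] by auto
  qed
qed

lemma form_fnorm: "form Z Z' \<phi> (fnorm Z Z' \<phi>)"
proof (rule formI)
  fix f h a b assume *: "f \<in> Z" "h \<in> Z'" "sbd f a" "sbd h b"
  show "norm (\<phi> f h) <= fnorm Z Z' \<phi> * a * b"
  proof (cases "a = 0 \<or> b = 0")
    case True
    hence "norm (\<phi> f h) <= 0" using formD(6)[OF F *] by auto
    thus ?thesis using True by auto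
  next
    case False
    hence ab: "0 < a" "0 < b" using sbd_nonneg *(3,4) by (metis less_eq_real_def)+
    let ?f = "\<lambda>x. of_real (inverse a) * f x" and ?h = "\<lambda>x. of_real (inverse b) * h x"
    have m: "?f \<in> Z" "?h \<in> Z'" using Z * fspace_scale by blast+
    moreover have "sbd ?f 1" "sbd ?h 1"
      using *(3,4) ab by (simp_all add: sbd_def norm_mult norm_inverse norm_divide divide_simps)
    ultimately have "norm (\<phi> ?f ?h) <= fnorm Z Z' \<phi>" by (rule fnorm_upper)
    moreover have "\<phi> ?f ?h = of_real (inverse a) * (of_real (inverse b) * \<phi> f h)"
      using formD(3)[OF F *(1) m(2)] formD(5)[OF F *(1,2)] by simp
    ultimately have "norm (of_real (inverse a) * (of_real (inverse b) * \<phi> f h)) <= fnorm Z Z' \<phi>" by simp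
    thus ?thesis using ab by (simp add: norm_mult norm_divide field_simps)
  qed
qed (use formD[OF F] fnorm_nonneg in auto)

end

section \<open>Disjoint supports and Grothendieck's inequality\<close>

lemma sbd_sum_disjoint:
  assumes "finite I" "!!i j. i \<in> I ==> j \<in> I ==> i ~= j ==> D i \<inter> D j = {}" "!!i. i \<in> I ==> sbd (f i) 1"
  shows "sbd (\<lambda>x. \<Sum>i\<in>I. cut (D i) (f i) x) 1"
  unfolding sbd_def
proof
  fix x
  show "norm (\<Sum>i\<in>I. cut (D i) (f i) x) <= 1"
  proof (cases "\<exists>i\<in>I. x \<in> D i")
    case True
    then obtain i where i: "i \<in> I" "x \<in> D i" by blast
    hence "cut (D j) (f j) x = 0" if "j \<in> I - {i}" for j
      using assms(2)[of i j] that by (auto simp: cut_def)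
    hence "(\<Sum>j\<in>I. cut (D j) (f j) x) = f i x"
      using i assms(1) by (simp add: sum.remove cut_def)
    thus ?thesis using assms(3)[OF i(1)] by (simp add: sbd_def)
  next
    case False
    thus ?thesis by (simp add: cut_def)
  qed
qed

lemma sbd_scale: "sbd f 1 ==> norm c <= 1 ==> sbd (\<lambda>x. c * f x) 1"
  by (auto simp: sbd_def norm_mult intro: mult_le_one)

lemma norm_conj_scalar: "norm (conj_scalar z) = norm z"
  by (cases "z = 0") (simp_all add: conj_scalar_def norm_divide norm_mult power2_eq_square)

lemma conj_conj_scalar: "conj_scalar (conj_scalar z) = z"
proof (cases "z = 0")
  case False
  have "conj_scalar (conj_scalar z) = of_real ((norm z)\<^sup>2) / conj_scalar z"
    unfolding conj_scalar_def[of "conj_scalar z"] norm_conj_scalar ..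
  thus ?thesis using False by (simp add: conj_scalar_def)
qed (simp add: conj_scalar_def)

lemma conj_scalar_mult: "conj_scalar z * z = of_real ((norm z)\<^sup>2)"
  by (simp add: conj_scalar_def)

text \<open>One partition serves all functions \<open>g k\<close>: the atoms cut out by the union of
  their approximating families. The coefficients are values at sample points, so they inherit every
  pointwise bound on the functions.\<close>

lemma Sp_simple_approx:
  fixes g :: "nat => 'p => 'k::real_normed_field"
  assumes R: "ring_of_sets UNIV R" and g: "!!k. k < n ==> g k \<in> Sp R" and e: "0 < e"
  shows "\<exists>(N::nat) h t. (\<forall>j<N. h j \<in> R \<and> t j \<in> h j) \<and>
    (\<forall>i<N. \<forall>j<N. i ~= j --> h i \<inter> h j = {}) \<and>
    (\<forall>k<n. sbd (\<lambda>x. g k x - (\<Sum>j<N. cut (h j) (\<lambda>_. g k (t j)) x)) e)"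
proof -
  interpret ring_of_sets UNIV R by fact
  have "\<forall>k. \<exists>\<G>. k < n --> \<G> \<subseteq> R \<and> finite \<G> \<and> apx \<G> (g k) e" using SpD[OF g e] by blast
  then obtain Gk where Gk: "!!k. k < n ==> Gk k \<subseteq> R \<and> finite (Gk k) \<and> apx (Gk k) (g k) e" by metis
  define \<G> where "\<G> = (\<Union>k<n. Gk k)"
  have G: "\<G> \<subseteq> R" "finite \<G>" using Gk by (auto simp: \<G>_def)
  have apx: "apx \<G> (g k) e" if "k < n" for k
  proof (rule apx_mono)
    show "apx (Gk k) (g k) e" using Gk[OF that] by simp
    show "Gk k \<subseteq> \<G>" using that by (auto simp: \<G>_def)
  qed simp
  define atm where "atm s = {x. {G\<in>\<G>. x \<in> G} = s}" for s
  \<comment> \<open>The pattern {} is excluded: its points lie outside all sets of \<G>, where the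
    functions are already small, and they need not form a member of the ring.\<close>
  define \<A> where "\<A> = atm ` (Pow \<G> - {{}}) - {{}}"
  have "finite \<A>" using G(2) by (simp add: \<A>_def)
  have atmR: "atm s \<in> R" if "s \<subseteq> \<G>" "s ~= {}" for s
  proof -
    have "finite s" "finite (\<G> - s)" using that G(2) finite_subset by auto
    moreover have "atm s = \<Inter>s - \<Union>(\<G> - s)"
    proof (intro subset_antisym subsetI)
      fix x assume "x \<in> atm s"
      hence "{G\<in>\<G>. x \<in> G} = s" by (simp add: atm_def)
      thus "x \<in> \<Inter>s - \<Union>(\<G> - s)" by blast
    next
      fix x assume "x \<in> \<Inter>s - \<Union>(\<G> - s)"
      hence "{G\<in>\<G>. x \<in> G} = s" using that(1) by blast
      thus "x \<in> atm s" by (simp add: atm_def)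
    qed
    moreover have "\<Inter>s \<in> R" using that G(1) \<open>finite s\<close>
    proof -
      have "s' ~= {} ==> s' \<subseteq> R ==> \<Inter>s' \<in> R" if "finite s'" for s'
        using that
      proof (induction s')
        case (insert A s')
        thus ?case by (cases "s' = {}") auto
      qed simp
      thus ?thesis using that \<open>finite s\<close> G(1) by blast
    qed
    moreover have "\<Union>(\<G> - s) \<in> R" using G(1) calculation(2) by (intro finite_Union) auto
    ultimately show ?thesis using Diff by metis
  qed
  obtain h where h: "bij_betw h {..<card \<A>} \<A>"
    using ex_bij_betw_nat_finite[OF \<open>finite \<A>\<close>] by (auto simp: atLeast0LessThan)
  have hA: "h j \<in> \<A>" if "j < card \<A>" for j using h that by (auto simp: bij_betw_def)
  define t where "t j = (SOME x. x \<in> h j)" for j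
  have t: "t j \<in> h j" if "j < card \<A>" for j
    using hA[OF that] unfolding t_def by (auto simp: \<A>_def intro: someI_ex)
  have dis: "h i \<inter> h j = {}" if "i < card \<A>" "j < card \<A>" "i ~= j" for i j
  proof -
    have ij: "h i \<in> \<A>" "h j \<in> \<A>" using hA that by blast+
    have "h i ~= h j" using h that by (auto simp: bij_betw_def inj_on_def)
    moreover obtain s s' where "h i = atm s" "h j = atm s'" using ij by (auto simp: \<A>_def)
    ultimately show ?thesis by (auto simp: atm_def)
  qed
  show ?thesis
  proof (intro exI[of _ "card \<A>"] exI[of _ h] exI[of _ t] conjI[of "\<forall>j<card \<A>. _ j"] conjI[of "\<forall>i<card \<A>. _ i"] allI impI)
    show "h j \<in> R \<and> t j \<in> h j" if "j < card \<A>" for j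
    proof -
      have "h j \<in> \<A>" by (rule hA[OF that])
      then obtain s where "s \<subseteq> \<G>" "s ~= {}" "h j = atm s" unfolding \<A>_def by blast
      thus ?thesis using atmR t[OF that] by simp
    qed
    fix k assume k: "k < n"
    show "sbd (\<lambda>x. g k x - (\<Sum>j<card \<A>. cut (h j) (\<lambda>_. g k (t j)) x)) e"
      unfolding sbd_def
    proof
      fix x
      show "norm (g k x - (\<Sum>j<card \<A>. cut (h j) (\<lambda>_. g k (t j)) x)) <= e"
      proof (cases "x \<in> \<Union>\<G>")
        case True
        have "atm {G\<in>\<G>. x \<in> G} \<in> \<A>" using True by (auto simp: \<A>_def atm_def)
        hence "atm {G\<in>\<G>. x \<in> G} \<in> h ` {..<card \<A>}" using h by (simp add: bij_betw_def)
        then obtain j where j: "j < card \<A>" "h j = atm {G\<in>\<G>. x \<in> G}" by force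
        have "x \<in> h j" by (simp add: j(2) atm_def)
        hence "cut (h i) (\<lambda>_. g k (t i)) x = 0" if "i \<in> {..<card \<A>} - {j}" for i
          using dis[of i j] that j(1) by (auto simp: cut_def)
        hence "(\<Sum>j<card \<A>. cut (h j) (\<lambda>_. g k (t j)) x) = g k (t j)"
          using j(1) \<open>x \<in> h j\<close> by (simp add: sum.remove[of _ j] cut_def)
        moreover have "{G\<in>\<G>. t j \<in> G} = {G\<in>\<G>. x \<in> G}" using t[OF j(1)] by (simp add: j(2) atm_def)
        hence "norm (g k x - g k (t j)) <= e" by (intro apxD(1)[OF apx[OF k]]) blast
        ultimately show ?thesis by simp
      next
        case False
        have "cut (h j) (\<lambda>_. g k (t j)) x = 0" if "j < card \<A>" for j
        proof -
          have "x \<notin> h j" using hA[OF that] False by (auto simp: \<A>_def atm_def)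
          thus ?thesis by (simp add: cut_def)
        qed
        thus ?thesis using apxD(2)[OF apx[OF k] False] by simp
      qed
    qed
  qed (rule dis)
qed

text \<open>The matrix with entries \<psi>(1_(D_k) f_k, 1_(h_j)) / B is bounded by 1 on scalars of
  modulus at most 1, because the D_k and the h_j are disjoint and the resulting functions stay in
  the unit balls. Pairing the k-th unit vector with the vector (b_i g_i(t_j) / s)_i, where s is the
  l_2 norm of b, yields the sum for the simple approximations of the g_k; the approximation error
  tends to 0.\<close>

lemma grothendieck_disjoint:
  fixes \<psi> :: "('p => 'k::real_normed_field) => ('q => 'k) => 'k" and n :: nat
  assumes gb: "grothendieck_bound TYPE('k) c" "0 <= c"
    and R: "ring_of_sets UNIV R" and Z: "fspace Z" and F: "form Z (Sp R) \<psi> B"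
    and D: "!!i j. i < n ==> j < n ==> i ~= j ==> D i \<inter> D j = {}"
    and f: "!!k. k < n ==> cut (D k) (f k) \<in> Z \<and> sbd (f k) 1"
    and g: "!!k. k < n ==> g k \<in> Sp R \<and> sbd (g k) 1"
  shows "norm (\<Sum>k<n. b k * \<psi> (cut (D k) (f k)) (g k)) <= c * B * sqrt (\<Sum>k<n. (norm (b k))\<^sup>2)"
\<comment> \<open>Set apart because the main argument divides by B and by the l_2 norm of b.\<close>
proof (cases "B = 0 \<or> (\<Sum>k<n. (norm (b k))\<^sup>2) = 0")
  case True
  have "b k * \<psi> (cut (D k) (f k)) (g k) = 0" if "k < n" for k
  proof (cases "B = 0")
    case True
    hence "norm (\<psi> (cut (D k) (f k)) (g k)) <= 0"
      using formD(6)[OF F, of "cut (D k) (f k)" "g k" 1 1] f[OF that] g[OF that] sbd_cut by auto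
    thus ?thesis by simp
  next
    case False
    hence "(\<Sum>k<n. (norm (b k))\<^sup>2) = 0" using True by simp
    thus ?thesis using that by (subst (asm) sum_nonneg_eq_0_iff) auto
  qed
  hence "(\<Sum>k<n. b k * \<psi> (cut (D k) (f k)) (g k)) = 0" by (intro sum.neutral) simp
  thus ?thesis using gb(2) formD(1)[OF F] by (simp add: sum_nonneg)
next
  case False
  define s where "s = sqrt (\<Sum>k<n. (norm (b k))\<^sup>2)"
  have B: "0 < B" using formD(1)[OF F] False by simp
  have s: "0 < s" using False sum_nonneg[of "{..<n}" "\<lambda>k. (norm (b k))\<^sup>2"] by (simp add: s_def less_le)
  have s2: "s\<^sup>2 = (\<Sum>k<n. (norm (b k))\<^sup>2)" by (simp add: s_def sum_nonneg)
  let ?f = "\<lambda>k. cut (D k) (f k)"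
  have gR: "g k \<in> Sp R" if "k < n" for k using g that by blast
  have main: "norm (\<Sum>k<n. b k * \<psi> (?f k) (g k)) <= c * B * s + (\<Sum>k<n. norm (b k)) * B * e" if e: "0 < e" for e
  proof -
    have "\<exists>(N::nat) h t. (\<forall>j<N. h j \<in> R \<and> t j \<in> h j) \<and>
      (\<forall>i<N. \<forall>j<N. i ~= j --> h i \<inter> h j = {}) \<and>
      (\<forall>k<n. sbd (\<lambda>x. g k x - (\<Sum>j<N. cut (h j) (\<lambda>_. g k (t j)) x)) e)"
      by (rule Sp_simple_approx[OF R gR e])
    then obtain N :: nat and h t where h0: "\<forall>j<N. h j \<in> R \<and> t j \<in> h j"
      "\<forall>i<N. \<forall>j<N. i ~= j --> h i \<inter> h j = {}"
      "\<forall>k<n. sbd (\<lambda>x. g k x - (\<Sum>j<N. cut (h j) (\<lambda>_. g k (t j)) x)) e"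
      by (elim exE conjE)
    have h: "!!j. j < N ==> h j \<in> R \<and> t j \<in> h j"
      "!!i j. i < N ==> j < N ==> i ~= j ==> h i \<inter> h j = {}"
      "!!k. k < n ==> sbd (\<lambda>x. g k x - (\<Sum>j<N. cut (h j) (\<lambda>_. g k (t j)) x)) e"
      using h0 by simp_all
    define one :: "nat => 'q => 'k" where "one j = cut (h j) (\<lambda>_. 1)" for j
    have one: "one j \<in> Sp R" if "j < N" for j
    proof -
      have "apx {h j} (one j) d" if "0 < d" for d using that by (auto simp: apx_def one_def cut_def)
      thus ?thesis unfolding Sp_def using h(1)[OF that] by (intro CollectI allI impI exI[of _ "{h j}"]) auto
    qed
    have scale: "cut (h j) (\<lambda>_. z) = (\<lambda>x. z * one j x)" for j z by (auto simp: one_def cut_def)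
    define a where "a k j = \<psi> (?f k) (one j) / of_real B" for k j
    have "norm (\<Sum>k<n. \<Sum>j<N. a k j * p k * q j) <= 1"
      if pq: "\<forall>i<n. norm (p i) <= 1" "\<forall>j<N. norm (q j) <= 1" for p q
    proof -
      let ?u = "\<lambda>x. \<Sum>k<n. p k * ?f k x" and ?v = "\<lambda>x. \<Sum>j<N. q j * one j x"
      have fm: "(\<lambda>x. p k * ?f k x) \<in> Z" if "k < n" for k using f[OF that] fspace_scale[OF Z] by blast
      have om: "(\<lambda>x. q j * one j x) \<in> Sp R" if "j < N" for j using one[OF that] Sp_scale by blast
      have u: "?u \<in> Z" using fm by (intro fspace_sum Z) auto
      have v: "?v \<in> Sp R" using om by (intro fspace_sum fspace_Sp) auto
      have "sbd (\<lambda>x. \<Sum>k\<in>{..<n}. cut (D k) (\<lambda>x. p k * f k x) x) 1"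
        using D pq f by (intro sbd_sum_disjoint sbd_scale) auto
      hence su: "sbd ?u 1" by (simp add: cut_scale)
      have "sbd (\<lambda>x. \<Sum>j\<in>{..<N}. cut (h j) (\<lambda>_. q j) x) 1"
        using h(2) pq by (intro sbd_sum_disjoint) (auto simp: sbd_def)
      hence sv: "sbd ?v 1" by (simp add: scale)
      have "\<psi> ?u ?v = (\<Sum>k<n. \<psi> (\<lambda>x. p k * ?f k x) ?v)"
        using fm by (intro form_sum_left[OF F Z v]) auto
      also have "\<dots> = (\<Sum>k<n. \<Sum>j<N. p k * (q j * \<psi> (?f k) (one j)))"
      proof (intro sum.cong refl)
        fix k assume "k \<in> {..<n}"
        hence k: "?f k \<in> Z" using f by simp
        have "\<psi> (\<lambda>x. p k * ?f k x) ?v = p k * \<psi> (?f k) ?v" by (rule formD(3)[OF F k v])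
        also have "\<psi> (?f k) ?v = (\<Sum>j<N. \<psi> (?f k) (\<lambda>x. q j * one j x))"
          using om by (intro form_sum_right[OF F fspace_Sp k]) auto
        also have "\<dots> = (\<Sum>j<N. q j * \<psi> (?f k) (one j))"
          using one by (intro sum.cong refl formD(5)[OF F k]) auto
        finally show "\<psi> (\<lambda>x. p k * ?f k x) ?v = (\<Sum>j<N. p k * (q j * \<psi> (?f k) (one j)))"
          by (simp add: sum_distrib_left)
      qed
      finally have "(\<Sum>k<n. \<Sum>j<N. a k j * p k * q j) = \<psi> ?u ?v / of_real B"
        by (simp add: a_def sum_divide_distrib mult_ac)
      moreover have "norm (\<psi> ?u ?v) <= B * 1 * 1" by (rule formD(6)[OF F u v su sv])
      ultimately show ?thesis using B by (simp add: norm_divide)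
    qed
    \<comment> \<open>\<open>x k\<close> is the k-th unit vector. \<open>y j\<close> carries a
      conjugation to cancel the one in the inner product of \<open>grothendieck_bound\<close>; its
      norm is at most 1 since the values of the g_i are.\<close>
    moreover define x :: "nat => nat => 'k" where "x k i = (if i = k then 1 else 0)" for k i
    define y where "y j i = conj_scalar (b i * g i (t j) / of_real s)" for j i
    have "(\<Sum>i<n. (norm (x k i))\<^sup>2) <= 1" if "k < n" for k
    proof -
      have "(\<Sum>i<n. (norm (x k i))\<^sup>2) = (\<Sum>i<n. if i = k then 1 else 0)" by (intro sum.cong) (auto simp: x_def)
      thus ?thesis using that by simp
    qed
    moreover have "(\<Sum>i<n. (norm (y j i))\<^sup>2) <= 1" if "j < N" for j
    proof -
      have "(\<Sum>i<n. (norm (y j i))\<^sup>2) <= (\<Sum>i<n. (norm (b i))\<^sup>2 / s\<^sup>2)"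
      proof (rule sum_mono)
        fix i assume "i \<in> {..<n}"
        hence "norm (g i (t j)) <= 1" using g by (simp add: sbd_def)
        hence "norm (b i) * norm (g i (t j)) / s <= norm (b i) / s"
          using s by (intro divide_right_mono mult_left_le) auto
        hence "(norm (b i) * norm (g i (t j)) / s)\<^sup>2 <= (norm (b i) / s)\<^sup>2"
          using s by (intro power_mono) auto
        thus "(norm (y j i))\<^sup>2 <= (norm (b i))\<^sup>2 / s\<^sup>2"
          using s by (simp add: y_def norm_conj_scalar norm_mult norm_divide power_divide)
      qed
      also have "\<dots> = 1" using s by (simp add: sum_divide_distrib[symmetric] s2[symmetric])
      finally show ?thesis .
    qed
    ultimately have "norm (\<Sum>k<n. \<Sum>j<N. a k j * (\<Sum>i<n. x k i * conj_scalar (y j i))) <= c"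
      using gb(1) unfolding grothendieck_bound_def by blast
    moreover have "(\<Sum>i<n. x k i * conj_scalar (y j i)) = b k * g k (t j) / of_real s" if "k < n" for k j
    proof -
      have "(\<Sum>i<n. x k i * conj_scalar (y j i)) = (\<Sum>i<n. if i = k then b k * g k (t j) / of_real s else 0)"
        by (intro sum.cong) (auto simp: x_def y_def conj_conj_scalar)
      thus ?thesis using that by simp
    qed
    ultimately have gr: "norm (\<Sum>k<n. \<Sum>j<N. a k j * (b k * g k (t j) / of_real s)) <= c" by simp
    define gs where "gs k = (\<lambda>x. \<Sum>j<N. g k (t j) * one j x)" for k
    have gs: "gs k \<in> Sp R" for k
      unfolding gs_def using one Sp_scale by (intro fspace_sum fspace_Sp) auto
    have "(\<Sum>k<n. b k * \<psi> (?f k) (gs k)) = (\<Sum>k<n. \<Sum>j<N. b k * (g k (t j) * \<psi> (?f k) (one j)))"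
    proof (intro sum.cong refl)
      fix k assume "k \<in> {..<n}"
      hence k: "?f k \<in> Z" using f by simp
      have "\<psi> (?f k) (gs k) = (\<Sum>j<N. \<psi> (?f k) (\<lambda>x. g k (t j) * one j x))"
        unfolding gs_def using one Sp_scale by (intro form_sum_right[OF F fspace_Sp k]) auto
      also have "\<dots> = (\<Sum>j<N. g k (t j) * \<psi> (?f k) (one j))"
        using one by (intro sum.cong refl formD(5)[OF F k]) auto
      finally show "b k * \<psi> (?f k) (gs k) = (\<Sum>j<N. b k * (g k (t j) * \<psi> (?f k) (one j)))"
        by (simp add: sum_distrib_left)
    qed
    also have "\<dots> = of_real (B * s) * (\<Sum>k<n. \<Sum>j<N. a k j * (b k * g k (t j) / of_real s))"
      using B s by (simp add: a_def sum_distrib_left mult_ac)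
    finally have 1: "norm (\<Sum>k<n. b k * \<psi> (?f k) (gs k)) <= B * s * c"
      using mult_left_mono[OF gr, of "B * s"] B s by (simp add: norm_mult)
    have "norm (b k * \<psi> (?f k) (\<lambda>x. g k x + (-1) * gs k x)) <= norm (b k) * B * e" if "k < n" for k
    proof -
      have k: "?f k \<in> Z" "sbd (?f k) 1" "g k \<in> Sp R" using f g that sbd_cut by blast+
      have "(\<lambda>x. g k x + (-1) * gs k x) \<in> Sp R" using k(3) gs by (intro Sp_add Sp_scale)
      moreover have "sbd (\<lambda>x. g k x + (-1) * gs k x) e" using h(3)[OF that] by (simp add: gs_def scale)
      ultimately have "norm (\<psi> (?f k) (\<lambda>x. g k x + (-1) * gs k x)) <= B * 1 * e"
        using formD(6)[OF F k(1) _ k(2)] by blast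
      thus ?thesis using mult_left_mono[of _ "B * e" "norm (b k)"] by (simp add: norm_mult mult.assoc)
    qed
    hence 2: "norm (\<Sum>k<n. b k * \<psi> (?f k) (\<lambda>x. g k x + (-1) * gs k x)) <= (\<Sum>k<n. norm (b k)) * B * e"
      unfolding sum_distrib_right by (intro sum_norm_le) auto
    have "b k * \<psi> (?f k) (\<lambda>x. g k x + (-1) * gs k x) = b k * \<psi> (?f k) (g k) - b k * \<psi> (?f k) (gs k)"
      if "k < n" for k
    proof -
      have k: "?f k \<in> Z" "g k \<in> Sp R" using f g that by blast+
      have "\<psi> (?f k) (\<lambda>x. g k x + (-1) * gs k x) = \<psi> (?f k) (g k) + \<psi> (?f k) (\<lambda>x. (-1) * gs k x)"
        by (rule formD(4)[OF F k Sp_scale[OF gs]])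
      moreover have "\<psi> (?f k) (\<lambda>x. (-1) * gs k x) = (-1) * \<psi> (?f k) (gs k)" by (rule formD(5)[OF F k(1) gs])
      ultimately show ?thesis by (simp add: right_diff_distrib)
    qed
    hence "(\<Sum>k<n. b k * \<psi> (?f k) (\<lambda>x. g k x + (-1) * gs k x)) =
        (\<Sum>k<n. b k * \<psi> (?f k) (g k)) - (\<Sum>k<n. b k * \<psi> (?f k) (gs k))"
      unfolding sum_subtractf[symmetric] by (intro sum.cong) auto
    thus ?thesis
      using 1 2 norm_triangle_sub[of "\<Sum>k<n. b k * \<psi> (?f k) (g k)" "\<Sum>k<n. b k * \<psi> (?f k) (gs k)"]
      by (simp add: mult_ac)
  qed
  define K where "K = (\<Sum>k<n. norm (b k)) * B"
  have K: "0 <= K" using B by (simp add: K_def sum_nonneg)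
  show ?thesis
    unfolding s_def[symmetric]
  proof (rule field_le_epsilon)
    fix e :: real assume "0 < e"
    hence "norm (\<Sum>k<n. b k * \<psi> (?f k) (g k)) <= c * B * s + K * (e / (K + 1))"
      using main[of "e / (K + 1)"] K by (simp add: K_def)
    also have "K * (e / (K + 1)) <= e" using K \<open>0 < e\<close> by (simp add: field_simps)
    finally show "norm (\<Sum>k<n. b k * \<psi> (?f k) (g k)) <= c * B * s + e" by simp
  qed
qed

lemma form_comp_left:
  assumes "form Z Z' \<psi> B" "op Z Z T C" shows "form Z Z' (\<lambda>f g. \<psi> (T f) g) (B * C)"
  using form_comp[OF assms(1,2) op_id[of Z']] by simp

text \<open>Duality in l_2: for almost norming functions with values z_k, the coefficients conj z_k
  turn the previous estimate into S \<le> c B sqrt S for the sum S of the squared moduli. The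
  norming error e enters by Minkowski's inequality as sqrt n * e, which vanishes as n is
  fixed.\<close>

lemma grothendieck_l2_aux:
  fixes \<psi> :: "('p => 'k::real_normed_field) => ('q => 'k) => 'k" and n :: nat
  assumes gb: "grothendieck_bound TYPE('k) c" "0 <= c"
    and R: "ring_of_sets UNIV R" and Z: "fspace Z" and F: "form Z (Sp R) \<psi> B"
    and D: "!!i j. i < n ==> j < n ==> i ~= j ==> D i \<inter> D j = {}"
    and DZ: "!!k f. k < n ==> f \<in> Z ==> cut (D k) f \<in> Z"
  shows "(\<Sum>k<n. (fnorm Z (Sp R) (\<lambda>f g. \<psi> (cut (D k) f) g))\<^sup>2) <= (c * B)\<^sup>2"
proof -
  let ?N = "\<lambda>k. fnorm Z (Sp R) (\<lambda>f g. \<psi> (cut (D k) f) g)"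
  have Fk: "form Z (Sp R) (\<lambda>f g. \<psi> (cut (D k) f) g) (B * 1)" if "k < n" for k
    by (rule form_comp_left[OF F op_cut]) (rule DZ[OF that])
  have cB: "0 <= c * B" using gb(2) formD(1)[OF F] by simp
  have "L2_set ?N {..<n} <= c * B + sqrt (real n) * e" if e: "0 < e" for e
  proof -
    have "\<forall>k. \<exists>f g. k < n --> f \<in> Z \<and> g \<in> Sp R \<and> sbd f 1 \<and> sbd g 1 \<and> ?N k - e < norm (\<psi> (cut (D k) f) g)"
      using fnorm_approx[OF Fk Z fspace_Sp e] by metis
    then obtain f g where fg: "!!k. k < n ==> f k \<in> Z \<and> g k \<in> Sp R \<and> sbd (f k) 1 \<and> sbd (g k) 1 \<and>
        ?N k - e < norm (\<psi> (cut (D k) (f k)) (g k))"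
      by metis
    define z where "z k = \<psi> (cut (D k) (f k)) (g k)" for k
    let ?S = "\<Sum>k<n. (norm (z k))\<^sup>2"
    have "norm (\<Sum>k<n. conj_scalar (z k) * \<psi> (cut (D k) (f k)) (g k)) <= c * B * sqrt (\<Sum>k<n. (norm (conj_scalar (z k)))\<^sup>2)"
      using D DZ fg by (intro grothendieck_disjoint[OF gb R Z F]) auto
    moreover have "(\<Sum>k<n. conj_scalar (z k) * \<psi> (cut (D k) (f k)) (g k)) = of_real ?S"
      by (simp add: z_def[symmetric] conj_scalar_mult)
    moreover have "norm (of_real ?S :: 'k) = ?S" unfolding norm_of_real by (simp add: sum_nonneg)
    ultimately have le: "?S <= c * B * sqrt ?S" by (simp only: norm_conj_scalar)
    have "sqrt ?S <= c * B"
    proof (cases "?S = 0")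
      case False
      hence "0 < sqrt ?S" by (simp add: sum_nonneg less_le)
      moreover have "sqrt ?S * sqrt ?S <= c * B * sqrt ?S" using le by (simp add: sum_nonneg)
      ultimately show ?thesis using mult_le_cancel_right_pos by blast
    qed (use cB in simp)
    hence 1: "L2_set (\<lambda>k. norm (z k)) {..<n} <= c * B" by (simp add: L2_set_def)
    have "L2_set ?N {..<n} <= L2_set (\<lambda>k. norm (z k) + e) {..<n}"
    proof (rule L2_set_mono)
      fix k assume "k \<in> {..<n}"
      thus "?N k <= norm (z k) + e" using fg[of k] by (simp add: z_def)
      show "0 <= ?N k" using \<open>k \<in> {..<n}\<close> fnorm_nonneg[OF Fk Z fspace_Sp] by simp
    qed
    also have "\<dots> <= L2_set (\<lambda>k. norm (z k)) {..<n} + L2_set (\<lambda>_. e) {..<n}" by (rule L2_set_triangle_ineq)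
    also have "L2_set (\<lambda>_. e) {..<n} = sqrt (real n) * e" using e by (simp add: L2_set_def real_sqrt_mult)
    finally show ?thesis using 1 by simp
  qed
  moreover have "\<exists>e>0. sqrt (real n) * e <= d" if "0 < d" for d
    using that by (intro exI[of _ "d / (sqrt (real n) + 1)"]) (auto simp: field_simps add_pos_nonneg)
  ultimately have "L2_set ?N {..<n} <= c * B"
    by (meson add_left_mono field_le_epsilon order_trans)
  hence "(L2_set ?N {..<n})\<^sup>2 <= (c * B)\<^sup>2" by (intro power_mono) auto
  thus ?thesis by (simp add: L2_set_def sum_nonneg)
qed

lemma grothendieck_l2:
  fixes \<psi> :: "('p => 'k::real_normed_field) => ('q => 'k) => 'k"
  assumes gb: "grothendieck_bound TYPE('k) c" "0 <= c"
    and R: "ring_of_sets UNIV R" and Z: "fspace Z" and F: "form Z (Sp R) \<psi> B" and I: "finite I"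
    and D: "!!i j. i \<in> I ==> j \<in> I ==> i ~= j ==> D i \<inter> D j = {}"
    and DZ: "!!k f. k \<in> I ==> f \<in> Z ==> cut (D k) f \<in> Z"
  shows "(\<Sum>k\<in>I. (fnorm Z (Sp R) (\<lambda>f g. \<psi> (cut (D k) f) g))\<^sup>2) <= (c * B)\<^sup>2"
proof -
  obtain h where h: "bij_betw h {..<card I} I"
    using ex_bij_betw_nat_finite[OF I] by (auto simp: atLeast0LessThan)
  have hI: "h i \<in> I" if "i < card I" for i using h that by (auto simp: bij_betw_def)
  have "(\<Sum>k<card I. (fnorm Z (Sp R) (\<lambda>f g. \<psi> (cut (D (h k)) f) g))\<^sup>2) <= (c * B)\<^sup>2"
  proof (rule grothendieck_l2_aux[OF gb R Z F])
    fix i j assume "i < card I" "j < card I" "i ~= j"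
    thus "D (h i) \<inter> D (h j) = {}"
      using h hI by (intro D) (auto simp: bij_betw_def inj_on_def)
  qed (use hI DZ in auto)
  thus ?thesis using sum.reindex_bij_betw[OF h, of "\<lambda>k. (fnorm Z (Sp R) (\<lambda>f g. \<psi> (cut (D k) f) g))\<^sup>2"] by simp
qed

lemma fnorm_flip: "fnorm Z Z' \<phi> = fnorm Z' Z (\<lambda>g f. \<phi> f g)"
proof -
  have "(\<lambda>(f, g). norm (\<phi> f g)) ` ({f\<in>Z. sbd f 1} \<times> {g\<in>Z'. sbd g 1}) =
      (\<lambda>(g, f). norm (\<phi> f g)) ` ({g\<in>Z'. sbd g 1} \<times> {f\<in>Z. sbd f 1})" by auto
  thus ?thesis unfolding fnorm_def by simp
qed

text \<open>Averaging over signs: \<open>\<Sum> \<psi> f\<^sub>k g\<^sub>k\<close> is the mean of \<open>\<psi> (\<Sum> \<delta>\<^sub>k f\<^sub>k) (\<Sum> \<delta>\<^sub>k g\<^sub>k)\<close>.\<close>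

lemma sign_average:
  fixes n :: nat
  assumes F: "form Z Z' \<psi> B" and Z: "fspace Z" "fspace Z'"
    and fg: "!!k. k < n ==> f k \<in> Z \<and> g k \<in> Z'"
    and "u \<in> Z" "v \<in> Z'"
    and "!!\<delta>. (!!k. \<delta> k = 1 \<or> \<delta> k = -1) ==>
      norm (\<psi> (\<lambda>x. u x + (\<Sum>k<n. \<delta> k * f k x)) (\<lambda>x. v x + (\<Sum>k<n. \<delta> k * g k x))) <= K"
  shows "norm (\<psi> u v + (\<Sum>k<n. \<psi> (f k) (g k))) <= K"
  using assms(4-)
proof (induction n arbitrary: u v)
  case 0
  thus ?case using 0(4)[of "\<lambda>_. 1"] by simp
next
  case (Suc n)
  have fgn: "f n \<in> Z" "g n \<in> Z'" using Suc.prems(1) by auto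
  have step: "norm (\<psi> (\<lambda>x. u x + s * f n x) (\<lambda>x. v x + s * g n x) + (\<Sum>k<n. \<psi> (f k) (g k))) <= K"
    if s: "s = 1 \<or> s = -1" for s
  proof (rule Suc.IH)
    show "(\<lambda>x. u x + s * f n x) \<in> Z" "(\<lambda>x. v x + s * g n x) \<in> Z'"
      using Suc.prems fgn Z by (simp_all add: fspace_def)
    fix \<delta> :: "nat => 'b" assume \<delta>: "!!k. \<delta> k = 1 \<or> \<delta> k = -1"
    let ?d = "\<delta>(n := s)"
    have "(\<Sum>k<n. ?d k * h k x) = (\<Sum>k<n. \<delta> k * h k x)" for h :: "nat => 'z => 'b" and x by (intro sum.cong) auto
    moreover have "norm (\<psi> (\<lambda>x. u x + (\<Sum>k<Suc n. ?d k * f k x)) (\<lambda>x. v x + (\<Sum>k<Suc n. ?d k * g k x))) <= K"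
      using Suc.prems(4)[of ?d] \<delta> s by auto
    ultimately show "norm (\<psi> (\<lambda>x. u x + s * f n x + (\<Sum>k<n. \<delta> k * f k x)) (\<lambda>x. v x + s * g n x + (\<Sum>k<n. \<delta> k * g k x))) <= K"
      by (simp add: add_ac)
  qed (use Suc.prems in auto)
  have ex: "\<psi> (\<lambda>x. u x + s * f n x) (\<lambda>x. v x + s * g n x) =
      \<psi> u v + s * \<psi> u (g n) + s * \<psi> (f n) v + s * s * \<psi> (f n) (g n)" for s
  proof -
    have m: "(\<lambda>x. s * f n x) \<in> Z" "(\<lambda>x. s * g n x) \<in> Z'" "(\<lambda>x. v x + s * g n x) \<in> Z'"
      using Suc.prems fgn Z by (simp_all add: fspace_def)
    show ?thesis
      using formD(2)[OF F Suc.prems(2) m(1) m(3)] formD(3)[OF F fgn(1) m(3), of s]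
        formD(4)[OF F Suc.prems(2,3) m(2)] formD(5)[OF F Suc.prems(2) fgn(2), of s]
        formD(4)[OF F fgn(1) Suc.prems(3) m(2)] formD(5)[OF F fgn, of s]
      by (simp add: algebra_simps)
  qed
  let ?A = "\<psi> u v + (\<Sum>k<Suc n. \<psi> (f k) (g k))"
  have "?A + ?A = (\<psi> (\<lambda>x. u x + 1 * f n x) (\<lambda>x. v x + 1 * g n x) + (\<Sum>k<n. \<psi> (f k) (g k))) +
      (\<psi> (\<lambda>x. u x + (-1) * f n x) (\<lambda>x. v x + (-1) * g n x) + (\<Sum>k<n. \<psi> (f k) (g k)))"
    unfolding ex by simp
  also have "norm \<dots> <= K + K"
    by (rule norm_triangle_mono[OF step[OF disjI1[OF refl]] step[OF disjI2[OF refl]]])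
  finally have "norm (?A + ?A) <= K + K" .
  moreover have "norm (?A + ?A) = 2 * norm ?A" by (simp only: mult_2[symmetric] norm_mult norm_numeral)
  ultimately show ?case by simp
qed

text \<open>The mean over signs removes all off-diagonal terms, while disjointness of the supports
  keeps every signed sum in the unit ball.\<close>

lemma form_diagonal:
  fixes \<psi> :: "('p => 'k::real_normed_field) => ('q => 'k) => 'k" and n :: nat
  assumes F: "form Z Z' \<psi> B" and Z: "fspace Z" "fspace Z'"
    and D: "!!i j. i < n ==> j < n ==> i ~= j ==> D i \<inter> D j = {} \<and> E i \<inter> E j = {}"
    and DZ: "!!k f. k < n ==> f \<in> Z ==> cut (D k) f \<in> Z"
    and EZ: "!!k f. k < n ==> f \<in> Z' ==> cut (E k) f \<in> Z'"
  shows "(\<Sum>k<n. fnorm Z Z' (\<lambda>f g. \<psi> (cut (D k) f) (cut (E k) g))) <= B"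
proof (rule field_le_epsilon)
  let ?N = "\<lambda>k. fnorm Z Z' (\<lambda>f g. \<psi> (cut (D k) f) (cut (E k) g))"
  fix d :: real assume d: "0 < d"
  define e where "e = d / (real n + 1)"
  have e: "0 < e" using d by (simp add: e_def)
  have Fk: "form Z Z' (\<lambda>f g. \<psi> (cut (D k) f) (cut (E k) g)) (B * 1 * 1)" if "k < n" for k
    by (rule form_comp[OF F op_cut op_cut]) (use DZ EZ that in auto)
  have "\<forall>k. \<exists>f g. k < n --> f \<in> Z \<and> g \<in> Z' \<and> sbd f 1 \<and> sbd g 1 \<and> ?N k - e < norm (\<psi> (cut (D k) f) (cut (E k) g))"
    using fnorm_approx[OF Fk Z e] by metis
  then obtain f g where fg: "!!k. k < n ==> f k \<in> Z \<and> g k \<in> Z' \<and> sbd (f k) 1 \<and> sbd (g k) 1 \<and>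
      ?N k - e < norm (\<psi> (cut (D k) (f k)) (cut (E k) (g k)))"
    by metis
  define z where "z k = \<psi> (cut (D k) (f k)) (cut (E k) (g k))" for k
  \<comment> \<open>Phases that make the diagonal values non-negative, so that their sum is the sum
    of the norms.\<close>
  define p where "p k = (if z k = 0 then 1 else conj_scalar (z k) / of_real (norm (z k)))" for k
  have p: "norm (p k) = 1" "p k * z k = of_real (norm (z k))" for k
    by (auto simp: p_def norm_divide norm_conj_scalar conj_scalar_mult power2_eq_square)
  let ?F = "\<lambda>k x. p k * cut (D k) (f k) x" and ?G = "\<lambda>k. cut (E k) (g k)"
  have FG: "?F k \<in> Z \<and> ?G k \<in> Z'" if "k < n" for k using that fg DZ EZ fspace_scale[OF Z(1)] by simp
  have "norm (\<psi> (\<lambda>_. 0) (\<lambda>_. 0) + (\<Sum>k<n. \<psi> (?F k) (?G k))) <= B"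
  proof (rule sign_average[OF F Z FG fspace_zero[OF Z(1)] fspace_zero[OF Z(2)]])
    fix \<delta> :: "nat => 'k" assume \<delta>: "!!k. \<delta> k = 1 \<or> \<delta> k = -1"
    have nd: "norm (\<delta> k) = 1" for k using \<delta>[of k] by auto
    have "sbd (\<lambda>x. \<Sum>k\<in>{..<n}. cut (D k) (\<lambda>x. \<delta> k * p k * f k x) x) 1"
      using D fg nd p by (intro sbd_sum_disjoint sbd_scale) (auto simp: norm_mult)
    hence a: "sbd (\<lambda>x. 0 + (\<Sum>k<n. \<delta> k * ?F k x)) 1" by (simp add: cut_scale mult.assoc)
    have "sbd (\<lambda>x. \<Sum>k\<in>{..<n}. cut (E k) (\<lambda>x. \<delta> k * g k x) x) 1"
      using D fg nd by (intro sbd_sum_disjoint sbd_scale) auto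
    hence b: "sbd (\<lambda>x. 0 + (\<Sum>k<n. \<delta> k * ?G k x)) 1" by (simp add: cut_scale)
    have "(\<lambda>x. \<Sum>k<n. \<delta> k * ?F k x) \<in> Z" "(\<lambda>x. \<Sum>k<n. \<delta> k * ?G k x) \<in> Z'"
      by (intro fspace_sum[OF Z(1)] fspace_sum[OF Z(2)] finite_lessThan
          fspace_scale[OF Z(1), of "?F _"] fspace_scale[OF Z(2)] conjunct1[OF FG] conjunct2[OF FG]; simp)+
    thus "norm (\<psi> (\<lambda>x. 0 + (\<Sum>k<n. \<delta> k * ?F k x)) (\<lambda>x. 0 + (\<Sum>k<n. \<delta> k * ?G k x))) <= B"
      using formD(6)[OF F _ _ a b] by simp
  qed
  moreover have "\<psi> (?F k) (?G k) = of_real (norm (z k))" if "k < n" for k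
    using formD(3)[OF F, of "cut (D k) (f k)" "?G k" "p k"] DZ EZ fg that p(2) by (simp add: z_def)
  moreover have "\<psi> (\<lambda>_. 0) (\<lambda>_. 0) = 0" using form_zero(1)[OF F fspace_zero[OF Z(1)] fspace_zero[OF Z(2)]] .
  ultimately have "norm (of_real (\<Sum>k<n. norm (z k)) :: 'k) <= B" by simp
  hence "(\<Sum>k<n. norm (z k)) <= B" unfolding norm_of_real by (simp add: sum_nonneg)
  moreover have "(\<Sum>k<n. ?N k) <= (\<Sum>k<n. norm (z k) + e)"
  proof (rule sum_mono)
    fix k assume "k \<in> {..<n}"
    thus "?N k <= norm (z k) + e" using fg[of k] unfolding z_def by simp
  qed
  moreover have "real n * e <= d" using d by (simp add: e_def field_simps)
  ultimately show "(\<Sum>k<n. ?N k) <= B + d" by (simp add: sum.distrib)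
qed

section \<open>Sparse blocks\<close>

definition hist :: "nat set => bool" where
  "hist h \<longleftrightarrow> finite h \<and> h \<subseteq> {1..}"

definition sparse :: "(nat set => nat) => nat set => nat set => bool" where
  "sparse g h F \<longleftrightarrow> (\<forall>k\<in>F. g ((h \<union> F) \<inter> {..<k}) <= k)"

lemma sparse_mono: "sparse g h F ==> (!!H. g' H <= g H) ==> sparse g' h F"
  unfolding sparse_def using order_trans by blast

lemma sparse_Un:
  assumes "sparse g h (F \<union> R)" "set_less F R" shows "sparse g h F" "sparse g (h \<union> F) R"
proof -
  have "(h \<union> (F \<union> R)) \<inter> {..<k} = (h \<union> F) \<inter> {..<k}" if "k \<in> F" for k
    using assms(2) that by (force simp: set_less_def)
  thus "sparse g h F" using assms(1) unfolding sparse_def by (metis UnI1)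
  show "sparse g (h \<union> F) R" using assms(1) by (simp add: sparse_def Un_assoc)
qed

context schreier_hierarchy
begin

text \<open>Passing to a subsequence is replaced by sparseness: \<open>F\<close> is a block after the history \<open>h\<close>, and
  each of its elements exceeds the value of \<open>g\<close> at the set of all elements before it.\<close>

definition vb :: "(nat set => nat) => omega1 => nat set => nat set => bool" where
  "vb g \<zeta> h F \<longleftrightarrow> hist h \<and> set_less h F \<and> block \<zeta> F \<and> sparse g h F"

fun chn :: "(nat set => nat) => omega1 => nat set => nat set list => bool" where
  "chn g \<zeta> h [] \<longleftrightarrow> True"
| "chn g \<zeta> h (F # Fs) \<longleftrightarrow> vb g \<zeta> h F \<and> chn g \<zeta> (h \<union> F) Fs"

lemma vb_mono: "vb g \<zeta> h F ==> (!!H. g' H <= g H) ==> vb g' \<zeta> h F"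
  using sparse_mono by (auto simp: vb_def)

lemma vbD:
  assumes "vb g \<zeta> h F"
  shows "hist h" "set_less h F" "block \<zeta> F" "sparse g h F" "finite F" "F ~= {}" "F \<subseteq> {1..}" "hist (h \<union> F)" "h \<inter> F = {}"
  using assms blkD[of \<zeta> F] set_less_disjoint[of h F] by (auto simp: vb_def hist_def)

lemma chnI:
  assumes "hist h" "sorted_wrt set_less Fs" "!!F. F \<in> set Fs ==> block \<zeta> F"
    "set_less h (\<Union>(set Fs))" "sparse g h (\<Union>(set Fs))"
  shows "chn g \<zeta> h Fs"
  using assms
proof (induction Fs arbitrary: h)
  case (Cons F Fs)
  have less: "set_less F (\<Union>(set Fs))" using Cons.prems(2) by (simp add: set_less_Union2)
  have U: "\<Union>(set (F # Fs)) = F \<union> \<Union>(set Fs)" by simp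
  have sp: "sparse g h F" "sparse g (h \<union> F) (\<Union>(set Fs))"
    using sparse_Un[OF _ less] Cons.prems(5) unfolding U by auto
  have F: "block \<zeta> F" using Cons.prems(3) by simp
  have "hist (h \<union> F)" using Cons.prems(1) blkD[OF F] by (auto simp: hist_def)
  moreover have "set_less h F" "set_less h (\<Union>(set Fs))" using Cons.prems(4) unfolding U by (auto simp: set_less_Un2)
  ultimately show ?case
    using Cons.IH[of "h \<union> F"] Cons.prems F sp less by (simp add: vb_def set_less_Un)
qed simp

lemma vb_osucE:
  assumes "vb g (osuc \<zeta>) h F"
  obtains Fs where "Fs ~= []" "F = \<Union>(set Fs)" "length Fs = Min F" "sorted_wrt set_less Fs"
    "!!F. F \<in> set Fs ==> block \<zeta> F" "chn g \<zeta> h Fs"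
proof -
  note V = vbD[OF assms]
  obtain Fs where Fs: "Fs ~= []" "!!F. F \<in> set Fs ==> block \<zeta> F" "sorted_wrt set_less Fs"
    "length Fs = Min (hd Fs)" "F = \<Union>(set Fs)" using V(3) by (rule blk_osuc_cases) (rule that)
  have "Min F = Min (hd Fs)" unfolding Fs(5) using Fs blkD by (intro Min_Union_sorted) auto
  moreover have "chn g \<zeta> h Fs" using V Fs by (intro chnI) auto
  ultimately show thesis using Fs that by metis
qed

lemma vb_limit: "vb g \<zeta> h F ==> is_limit \<zeta> ==> vb g (osuc (cs \<zeta> (Min F))) h F"
  unfolding vb_def using blk_limit_cases by blast

text \<open>A bound of this kind passes from consecutive blocks to their union without growing
  (\<open>ssum_superadd\<close>), however many blocks there are.\<close>

definition superadd :: "(nat set => nat set => real) => bool" where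
  "superadd A \<longleftrightarrow> (\<forall>h F R. hist h --> hist F --> hist R --> set_less h F --> set_less (h \<union> F) R --> F ~= {} -->
      A h F + A (h \<union> F) R <= A h (F \<union> R)) \<and> (\<forall>h F. hist h --> hist F --> 0 <= A h F)"

lemma superadd_add: "superadd A ==> superadd B ==> superadd (\<lambda>h F. A h F + B h F)"
  unfolding superadd_def
proof (elim conjE, intro conjI allI impI)
  fix h F R
  assume *: "\<forall>h F R. hist h --> hist F --> hist R --> set_less h F --> set_less (h \<union> F) R --> F ~= {} -->
      A h F + A (h \<union> F) R <= A h (F \<union> R)"
    "\<forall>h F R. hist h --> hist F --> hist R --> set_less h F --> set_less (h \<union> F) R --> F ~= {} -->
      B h F + B (h \<union> F) R <= B h (F \<union> R)"
    and h: "hist h" "hist F" "hist R" "set_less h F" "set_less (h \<union> F) R" "F ~= {}"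
  show "A h F + B h F + (A (h \<union> F) R + B (h \<union> F) R) <= A h (F \<union> R) + B h (F \<union> R)"
    using *(1)[rule_format, OF h] *(2)[rule_format, OF h] by simp
qed simp

lemma chn_less: "chn g \<zeta> h Fs ==> set_less h (\<Union>(set Fs))"
proof (induction Fs arbitrary: h)
  case (Cons F Fs)
  hence "vb g \<zeta> h F" "set_less (h \<union> F) (\<Union>(set Fs))" by simp_all
  thus ?case using vbD(2)[of g \<zeta> h F] by (simp add: set_less_Un set_less_Un2)
qed simp

lemma chn_hist:
  assumes "chn g \<zeta> h Fs" "hist h" "set_less h (\<Union>(set Fs))"
  shows "hist (\<Union>(set Fs))" "sorted_wrt set_less Fs"
proof -
  have "hist (\<Union>(set Fs)) \<and> sorted_wrt set_less Fs"
    using assms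
  proof (induction Fs arbitrary: h)
    case (Cons F Fs)
    have *: "set_less (h \<union> F) (\<Union>(set Fs))"
      using Cons.prems(1) chn_less[of g \<zeta> "h \<union> F" Fs] by simp
    thus ?case
      using Cons.IH[of "h \<union> F"] Cons.prems vbD[of g \<zeta> h F]
      by (auto simp: hist_def set_less_Un set_less_Union2)
  qed (simp add: hist_def)
  thus "hist (\<Union>(set Fs))" "sorted_wrt set_less Fs" by auto
qed

lemma ssum_superadd:
  assumes "superadd A" "chn g \<zeta> h Fs" "hist h" shows "ssum A h Fs <= A h (\<Union>(set Fs))"
  using assms(2,3)
proof (induction Fs arbitrary: h)
  case Nil
  thus ?case using assms(1) by (auto simp: superadd_def hist_def)
next
  case (Cons F Fs)
  note V = vbD[of g \<zeta> h F]
  have c: "chn g \<zeta> (h \<union> F) Fs" "vb g \<zeta> h F" using Cons.prems by auto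
  have less: "set_less (h \<union> F) (\<Union>(set Fs))" by (rule chn_less[OF c(1)])
  have "A h F + A (h \<union> F) (\<Union>(set Fs)) <= A h (F \<union> \<Union>(set Fs))"
    using assms(1) V[OF c(2)] chn_hist[OF c(1) _ less] less unfolding superadd_def
    by (auto simp: hist_def)
  thus ?case using Cons.IH[OF c(1)] V(8)[OF c(2)] by simp
qed

lemma ssum_le:
  fixes B :: "nat set => nat set => real"
  assumes "chn g \<zeta> h Fs" "h \<union> \<Union>(set Fs) \<subseteq> U"
    and "!!h F. vb g \<zeta> h F ==> h \<union> F \<subseteq> U ==> norm (A h F) <= B h F"
  shows "norm (ssum A h Fs) <= ssum B h Fs"
  using assms(1,2)
proof (induction Fs arbitrary: h)
  case (Cons F Fs)
  have "norm (A h F) <= B h F" using Cons.prems by (intro assms(3)) auto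
  moreover have "norm (ssum A (h \<union> F) Fs) <= ssum B (h \<union> F) Fs" using Cons by auto
  ultimately show ?case by (auto intro: norm_triangle_mono)
qed simp

lemma ssum_const: "ssum (\<lambda>_ _. c) h Fs = real (length Fs) * c"
  by (induction Fs arbitrary: h) (simp_all add: algebra_simps)

lemma ssum_add: "ssum (\<lambda>h F. A h F + B h F) h Fs = ssum A h Fs + (ssum B h Fs :: real)"
  by (induction Fs arbitrary: h) simp_all

lemma ssum_nonneg:
  "chn g \<zeta> h Fs ==> (!!h F. hist h ==> hist F ==> 0 <= (A h F :: real)) ==> 0 <= ssum A h Fs"
proof (induction Fs arbitrary: h)
  case (Cons F Fs)
  thus ?case using vbD[of g \<zeta> h F] by (auto simp: hist_def intro!: add_nonneg_nonneg)
qed simp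

text \<open>Cauchy-Schwarz along the pieces; the induction step is 2 a b \<le> a^2 + b^2.\<close>

lemma ssum_sqrt:
  assumes "chn g \<zeta> h Fs" "!!h F. hist h ==> hist F ==> 0 <= M h F"
  shows "ssum (\<lambda>h F. sqrt (M h F)) h Fs <= sqrt (real (length Fs)) * sqrt (ssum M h Fs)"
  using assms(1)
proof (induction Fs arbitrary: h)
  case (Cons F Fs)
  let ?S = "ssum M (h \<union> F) Fs" and ?n = "real (length Fs)"
  have c: "chn g \<zeta> (h \<union> F) Fs" "vb g \<zeta> h F" using Cons.prems by auto
  have S: "0 <= ?S" by (rule ssum_nonneg[OF c(1) assms(2)])
  have M: "0 <= M h F" using vbD[OF c(2)] by (intro assms(2)) (auto simp: hist_def)
  have "sqrt (M h F) + sqrt ?n * sqrt ?S <= sqrt ((1 + ?n) * (M h F + ?S))"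
  proof (rule real_le_rsqrt)
    have "2 * (sqrt (M h F) * (sqrt ?n * sqrt ?S)) <= ?n * M h F + ?S"
      using sum_squares_bound[of "sqrt ?n * sqrt (M h F)" "sqrt ?S"] S M
      by (simp add: power_mult_distrib mult_ac)
    thus "(sqrt (M h F) + sqrt ?n * sqrt ?S)\<^sup>2 <= (1 + ?n) * (M h F + ?S)"
      using S M by (simp add: power2_sum power_mult_distrib algebra_simps)
  qed
  thus ?case using Cons.IH[OF c(1)] by (simp add: real_sqrt_mult)
qed simp

end

section \<open>Weighted sums along sparse blocks\<close>

locale game = weighted_hierarchy +
  assumes \<rho>_nonneg: "0 <= \<rho> m" and \<rho>_le1: "\<rho> m <= 1" and \<rho>_lim: "\<rho> \<longlonglongrightarrow> 0"
begin

lemma wsum_add: "wsum (\<lambda>E. v E + v' E) \<zeta> h F = wsum v \<zeta> h F + wsum v' \<zeta> h F"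
  by (simp add: wsum_def algebra_simps sum.distrib)

lemma wsum_diff: "wsum (\<lambda>E. v E - v' E) \<zeta> h F = wsum v \<zeta> h F - wsum v' \<zeta> h F"
  by (simp add: wsum_def algebra_simps sum_subtractf)

lemma wsum_scale: "wsum (\<lambda>E. c * v E) \<zeta> h F = c * wsum v \<zeta> h F"
  by (simp add: wsum_def sum_distrib_left mult_ac)

lemma wsum_cong:
  assumes "vb g \<zeta> h F" "!!E. hist E ==> E ~= {} ==> v E = v' E"
  shows "wsum v \<zeta> h F = wsum v' \<zeta> h F"
  unfolding wsum_def
proof (intro sum.cong refl)
  fix E assume E: "E \<in> segs F"
  note D = Union_block_segs[OF vbD(3)[OF assms(1)] E]
  have "hist (h \<union> E)" "h \<union> E ~= {}" using vbD(1)[OF assms(1)] D by (auto simp: hist_def)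
  thus "of_real (t \<zeta> E * s E) * v (h \<union> E) = of_real (t \<zeta> E * s E) * v' (h \<union> E)"
    using assms(2) by simp
qed

lemma wsum_osuc':
  assumes "vb g (osuc \<zeta>) h F"
  obtains Fs where "Fs ~= []" "F = \<Union>(set Fs)" "length Fs = Min F" "chn g \<zeta> h Fs" "hist h"
    "wsum v (osuc \<zeta>) h F = of_real (\<rho> (Min F)) * ssum (wsum v \<zeta>) h Fs"
proof -
  obtain Fs where Fs: "Fs ~= []" "F = \<Union>(set Fs)" "length Fs = Min F" "sorted_wrt set_less Fs"
    "!!F. F \<in> set Fs ==> block \<zeta> F" "chn g \<zeta> h Fs"
    using assms by (rule vb_osucE) (rule that)
  show thesis
    by (rule that[OF Fs(1-3,6) vbD(1)[OF assms]]) (use wsum_osuc[OF Fs(1,5,4)] Fs(2) in simp)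
qed

text \<open>At a limit the block does not change: its minimum selects a smaller successor level on
  which it is already a block, with the same history and the same g. Only successors decompose
  it.\<close>

lemma vb_induct [consumes 1, case_names base succ limit]:
  assumes "vb g \<zeta> h F"
    and base: "!!h F. vb g 0 h F ==> P 0 h F"
    and succ: "!!\<zeta> h F. (!!h F. vb g \<zeta> h F ==> P \<zeta> h F) ==> vb g (osuc \<zeta>) h F ==> P (osuc \<zeta>) h F"
    and lim: "!!\<zeta> h F. is_limit \<zeta> ==> vb g \<zeta> h F ==> P (osuc (cs \<zeta> (Min F))) h F ==> P \<zeta> h F"
  shows "P \<zeta> h F"
  using assms(1)
proof (induction \<zeta> arbitrary: h F rule: less_induct)
  case (less \<zeta>)
  consider "\<zeta> = 0" | \<eta> where "\<zeta> = osuc \<eta>" | "is_limit \<zeta>"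
    by (auto simp: is_limit_def is_succ_def)
  thus ?case
  proof cases
    case 1
    thus ?thesis using base less.prems by blast
  next
    case 2
    thus ?thesis using succ[of \<eta>] less by auto
  next
    case 3
    have "1 <= Min F" using vbD(5-7)[OF less.prems] by (meson Min_in atLeast_iff subsetD)
    hence "osuc (cs \<zeta> (Min F)) < \<zeta>" by (rule osuc_char_less[OF cs 3])
    thus ?thesis using lim[OF 3 less.prems] less.IH vb_limit[OF less.prems 3] by blast
  qed
qed

text \<open>As \<rho> is at most 1, a superadditive bound for atoms holds on every level. The
  restriction to subsets of U is made for the tail estimates: there the supports are fixed at the
  end of a block and the error is controlled only for indices inside the set reached by
  then.\<close>

lemma wsum_le:
  assumes A: "superadd A" and U: "!!h F. vb g 0 h F ==> h \<union> F \<subseteq> U ==> norm (wsum v 0 h F) <= A h F"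
    and "vb g \<zeta> h F" "h \<union> F \<subseteq> U"
  shows "norm (wsum v \<zeta> h F) <= A h F"
  using assms(3,4)
proof (induction rule: vb_induct)
  case (base h F)
  thus ?case by (rule U)
next
  case (succ \<zeta> h F)
  obtain Fs where Fs: "Fs ~= []" "F = \<Union>(set Fs)" "length Fs = Min F" "chn g \<zeta> h Fs" "hist h"
    "wsum v (osuc \<zeta>) h F = of_real (\<rho> (Min F)) * ssum (wsum v \<zeta>) h Fs"
    using succ.hyps by (rule wsum_osuc'[where v = v]) (rule that)
  have "norm (ssum (wsum v \<zeta>) h Fs) <= ssum A h Fs"
    using Fs(2,4) succ.IH succ.prems by (intro ssum_le) auto
  also have "\<dots> <= A h F" using ssum_superadd[OF A Fs(4,5)] Fs(2) by simp
  finally have le: "norm (ssum (wsum v \<zeta>) h Fs) <= A h F" .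
  have "norm (wsum v (osuc \<zeta>) h F) = \<rho> (Min F) * norm (ssum (wsum v \<zeta>) h Fs)"
    using \<rho>_nonneg[of "Min F"] by (simp add: Fs(6) norm_mult)
  also have "\<dots> <= norm (ssum (wsum v \<zeta>) h Fs)"
    using \<rho>_le1[of "Min F"] \<rho>_nonneg by (intro mult_left_le_one_le) auto
  finally show ?case using le by simp
next
  case (limit \<zeta> h F)
  thus ?case by (simp add: wsum_limit[OF limit(1) vbD(3)[OF limit(2)]])
qed

text \<open>One g serves all members of \<V>. With \<V> the set of all tests by forms of norm at
  most 1, this is the uniformity that the choice of the infinite set requires.\<close>

definition null :: "omega1 => (nat set => 'b::real_normed_field) set => bool" where
  "null \<zeta> \<V> \<longleftrightarrow> (\<forall>\<epsilon>>0. \<exists>g. \<forall>h F. vb g \<zeta> h F --> (\<forall>v\<in>\<V>. norm (wsum v \<zeta> h F) <= \<epsilon>))"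

lemma nullD:
  assumes "null \<zeta> \<V>" "0 < \<epsilon>"
  obtains g where "!!h F v. vb g \<zeta> h F ==> v \<in> \<V> ==> norm (wsum v \<zeta> h F) <= \<epsilon>"
  using assms unfolding null_def by blast

lemma null_dominated:
  assumes "null \<zeta> \<V>1" "null \<zeta> \<V>2" "0 <= K"
    and "!!v. v \<in> \<V> ==> \<exists>v1\<in>\<V>1. \<exists>v2\<in>\<V>2. \<forall>g h F. vb g \<zeta> h F -->
      norm (wsum v \<zeta> h F) <= K * (norm (wsum v1 \<zeta> h F) + norm (wsum v2 \<zeta> h F))"
  shows "null \<zeta> \<V>"
  unfolding null_def
proof (intro allI impI)
  fix \<epsilon> :: real assume "0 < \<epsilon>"
  hence e: "0 < \<epsilon> / (2 * K + 1)" using assms(3) by simp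
  obtain g1 where g1: "!!h F v. vb g1 \<zeta> h F ==> v \<in> \<V>1 ==> norm (wsum v \<zeta> h F) <= \<epsilon> / (2 * K + 1)"
    using nullD[OF assms(1) e] by blast
  obtain g2 where g2: "!!h F v. vb g2 \<zeta> h F ==> v \<in> \<V>2 ==> norm (wsum v \<zeta> h F) <= \<epsilon> / (2 * K + 1)"
    using nullD[OF assms(2) e] by blast
  show "\<exists>g. \<forall>h F. vb g \<zeta> h F --> (\<forall>v\<in>\<V>. norm (wsum v \<zeta> h F) <= \<epsilon>)"
  proof (intro exI[of _ "\<lambda>H. max (g1 H) (g2 H)"] allI impI ballI)
    fix h F v assume V: "vb (\<lambda>H. max (g1 H) (g2 H)) \<zeta> h F" "v \<in> \<V>"
    obtain v1 v2 where v: "v1 \<in> \<V>1" "v2 \<in> \<V>2"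
      "norm (wsum v \<zeta> h F) <= K * (norm (wsum v1 \<zeta> h F) + norm (wsum v2 \<zeta> h F))"
      using assms(4)[OF V(2)] V(1) by blast
    have "vb g1 \<zeta> h F" "vb g2 \<zeta> h F" using V(1) by (auto elim!: vb_mono)
    hence "norm (wsum v1 \<zeta> h F) + norm (wsum v2 \<zeta> h F) <= \<epsilon> / (2 * K + 1) + \<epsilon> / (2 * K + 1)"
      using g1 g2 v by (intro add_mono) auto
    hence "norm (wsum v \<zeta> h F) <= K * (\<epsilon> / (2 * K + 1) + \<epsilon> / (2 * K + 1))"
      using v(3) mult_left_mono[OF _ assms(3)] order_trans by blast
    also have "\<dots> = \<epsilon> * (2 * K / (2 * K + 1))" by simp
    also have "\<dots> <= \<epsilon>" using assms(3) \<open>0 < \<epsilon>\<close> by (intro mult_left_le) auto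
    finally show "norm (wsum v \<zeta> h F) <= \<epsilon>" .
  qed
qed

text \<open>The first piece is bounded only by C, and the factor \<rho>(Min F) makes this at most
  \<epsilon>/2. When the other pieces are chosen, Min F already belongs to the history, so g can
  impose the accuracy \<epsilon> / (2 Min F) on each; as there are fewer than Min F of them, they
  contribute at most \<epsilon>/2.\<close>

lemma null_succ_estimate:
  assumes V: "vb g (osuc \<zeta>) h F" and v: "v \<in> \<V>"
    and g0: "!!H. g0 H <= g H" "!!h F. vb g0 \<zeta> h F ==> norm (wsum v \<zeta> h F) <= C"
    and g': "!!H. Min F \<in> H ==> g' H <= g H"
      "!!h F'. vb g' \<zeta> h F' ==> norm (wsum v \<zeta> h F') <= \<epsilon> / (2 * real (Min F))"
    and C: "\<rho> (Min F) * C <= \<epsilon> / 2" and "0 < \<epsilon>"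
  shows "norm (wsum v (osuc \<zeta>) h F) <= \<epsilon>"
proof -
  obtain Fs where Fs: "Fs ~= []" "F = \<Union>(set Fs)" "length Fs = Min F" "chn g \<zeta> h Fs" "hist h"
    "wsum v (osuc \<zeta>) h F = of_real (\<rho> (Min F)) * ssum (wsum v \<zeta>) h Fs"
    using V by (rule wsum_osuc'[where v = v]) (rule that)
  obtain F1 Gs where FG: "Fs = F1 # Gs" using Fs(1) by (cases Fs) auto
  have c: "vb g \<zeta> h F1" "chn g \<zeta> (h \<union> F1) Gs" using Fs(4) by (auto simp: FG)
  have m1: "Min F \<in> F1"
  proof -
    have "Min F = Min (hd Fs)"
      unfolding Fs(2) using chn_hist(2)[OF Fs(4,5) chn_less[OF Fs(4)]] Fs(1)
    proof (intro Min_Union_sorted)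
      have "finite A \<and> A ~= {}" if "vb g \<zeta> k A" for k A using vbD[OF that] by simp
      hence "chn g \<zeta> k As ==> A \<in> set As ==> finite A \<and> A ~= {}" for k As A
        by (induction As arbitrary: k) auto
      thus "A \<in> set Fs ==> finite A \<and> A ~= {}" for A using Fs(4) by blast
    qed
    thus ?thesis using vbD(5,6)[OF c(1)] by (simp add: FG)
  qed
  have V1: "norm (wsum v \<zeta> h F1) <= C" by (rule g0(2)[OF vb_mono[OF c(1) g0(1)]])
  have "norm (ssum (wsum v \<zeta>) k As) <= real (length As) * (\<epsilon> / (2 * real (Min F)))"
    if "chn g \<zeta> k As" "Min F \<in> k" for k As
    using that
  proof (induction As arbitrary: k)
    case (Cons A As)
    hence A: "vb g \<zeta> k A" "chn g \<zeta> (k \<union> A) As" by auto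
    have "sparse g' k A"
      unfolding sparse_def
    proof
      fix x assume x: "x \<in> A"
      have "Min F < x" using vbD(2)[OF A(1)] Cons.prems(2) x by (auto simp: set_less_def)
      hence "g' ((k \<union> A) \<inter> {..<x}) <= g ((k \<union> A) \<inter> {..<x})" using Cons.prems(2) by (intro g'(1)) auto
      also have "\<dots> <= x" using vbD(4)[OF A(1)] x by (simp add: sparse_def)
      finally show "g' ((k \<union> A) \<inter> {..<x}) <= x" .
    qed
    hence "norm (wsum v \<zeta> k A) <= \<epsilon> / (2 * real (Min F))" using A(1) by (intro g'(2)) (simp add: vb_def)
    moreover have "norm (ssum (wsum v \<zeta>) (k \<union> A) As) <= real (length As) * (\<epsilon> / (2 * real (Min F)))"
      using Cons A(2) by auto
    ultimately have "norm (ssum (wsum v \<zeta>) k (A # As)) <=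
        \<epsilon> / (2 * real (Min F)) + real (length As) * (\<epsilon> / (2 * real (Min F)))"
      unfolding ssum.simps by (rule norm_triangle_mono)
    also have "\<dots> = real (length (A # As)) * (\<epsilon> / (2 * real (Min F)))"
      by (simp only: length_Cons of_nat_Suc distrib_right mult_1)
    finally show ?case .
  qed simp
  hence R: "norm (ssum (wsum v \<zeta>) (h \<union> F1) Gs) <= real (length Gs) * (\<epsilon> / (2 * real (Min F)))"
    using c(2) m1 by auto
  also have "real (length Gs) * (\<epsilon> / (2 * real (Min F))) <= \<epsilon> / 2"
    using Fs(3) \<open>0 < \<epsilon>\<close> by (auto simp: FG field_simps)
  finally have "norm (ssum (wsum v \<zeta>) h Fs) <= C + \<epsilon> / 2"
    unfolding FG ssum.simps using V1 R by (intro norm_triangle_mono) auto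
  hence "\<rho> (Min F) * norm (ssum (wsum v \<zeta>) h Fs) <= \<rho> (Min F) * C + \<rho> (Min F) * (\<epsilon> / 2)"
    unfolding distrib_left[symmetric] by (rule mult_left_mono[OF _ \<rho>_nonneg])
  also have "\<dots> <= \<epsilon> / 2 + 1 * (\<epsilon> / 2)"
    using C \<rho>_le1[of "Min F"] \<open>0 < \<epsilon>\<close> by (intro add_mono mult_right_mono) auto
  finally show ?thesis using \<rho>_nonneg[of "Min F"] by (simp add: Fs(6) norm_mult)
qed

text \<open>Nullness persists on higher levels once there is a bound C valid on all levels: it takes
  care of the first piece of each block, and the induction hypothesis of the others.\<close>

lemma null_mono:
  fixes \<V> :: "(nat set => 'k::real_normed_field) set"
  assumes "null \<eta> \<V>" "\<eta> <= \<xi>" and g0: "!!\<zeta> h F v. vb g0 \<zeta> h F ==> v \<in> \<V> ==> norm (wsum v \<zeta> h F) <= C"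
  shows "null \<xi> \<V>"
  using assms(2)
proof (induction \<xi> rule: less_induct)
  case (less \<xi>)
  have ev: "\<exists>m0. \<forall>m\<ge>m0. \<rho> m * C <= \<epsilon> / 2" if "0 < \<epsilon>" for \<epsilon>
  proof -
    have "(\<lambda>m. \<rho> m * C) \<longlonglongrightarrow> 0" using tendsto_mult_left_zero[OF \<rho>_lim] .
    hence "\<forall>\<^sub>F m in sequentially. \<rho> m * C < \<epsilon> / 2" using that by (intro order_tendstoD(2)) auto
    thus ?thesis by (auto simp: eventually_sequentially intro: less_imp_le)
  qed
  \<comment> \<open>\<open>lv m\<close> is the level of the pieces of a block with minimum m:
    constant at a successor, \<open>cs \<xi> m\<close> at a limit. In the latter case it has passed
    \<eta> only from some index n0 on.\<close>
  have main: "\<exists>g. \<forall>h F. vb g \<xi> h F --> (\<forall>v\<in>\<V>. norm (wsum v \<xi> h F) <= \<epsilon>)"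
    if lev: "!!m. n0 <= m ==> 1 <= m ==> null (lv m) \<V>"
      and red: "!!g h F v. vb g \<xi> h F ==> vb g (osuc (lv (Min F))) h F \<and> wsum v \<xi> h F = wsum (v :: nat set => 'k) (osuc (lv (Min F))) h F"
      and e: "0 < \<epsilon>" for lv n0 \<epsilon>
  proof -
    obtain m0 where m0: "!!m. m0 <= m ==> \<rho> m * C <= \<epsilon> / 2" using ev[OF e] by blast
    have "\<exists>g. \<forall>h F. vb g (lv m) h F --> (\<forall>v\<in>\<V>. norm (wsum v (lv m) h F) <= \<epsilon> / (2 * real m))" if "n0 <= m" "1 <= m" for m
      using lev[OF that] e that(2) unfolding null_def by simp
    then obtain G where G: "!!m h F v. n0 <= m ==> 1 <= m ==> vb (G m) (lv m) h F ==> v \<in> \<V> ==>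
        norm (wsum v (lv m) h F) <= \<epsilon> / (2 * real m)"
      by metis
    \<comment> \<open>The minimum m of the coming block is unknown beforehand. The maximum over all
      m in H imposes the demand of \<open>G m\<close> as soon as m has been played; n0 and m0 are
      included to force Min F beyond them.\<close>
    define g where "g H = max (max (g0 H) (max n0 m0)) (if finite H then Max (insert 0 ((\<lambda>m. G m H) ` H)) else 0)" for H
    show ?thesis
    proof (intro exI[of _ g] allI impI ballI)
      fix h F v assume V: "vb g \<xi> h F" and v: "v \<in> \<V>"
      let ?m = "Min F"
      note VD = vbD[OF V]
      have m: "?m \<in> F" "1 <= ?m" using VD(5-7) Min_in[OF VD(5,6)] by auto
      have "g ((h \<union> F) \<inter> {..<?m}) <= ?m" using VD(4) m(1) by (simp add: sparse_def)
      hence mm: "n0 <= ?m" "m0 <= ?m" by (auto simp: g_def)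
      define g' where "g' H = (if finite H then G ?m H else 0)" for H
      have "norm (wsum v (osuc (lv ?m)) h F) <= \<epsilon>"
      proof (rule null_succ_estimate[where ?g0.0 = g0 and g' = g' and C = C])
        show "vb g (osuc (lv ?m)) h F" using red[OF V] by blast
        show "v \<in> \<V>" by fact
        show "g0 H <= g H" for H by (simp add: g_def)
        show "norm (wsum v (lv ?m) h F) <= C" if "vb g0 (lv ?m) h F" for h F using g0[OF that v] .
        show "g' H <= g H" if "?m \<in> H" for H
        proof (cases "finite H")
          case True
          hence "G ?m H <= Max (insert 0 ((\<lambda>m. G m H) ` H))" using that by (intro Max_ge) auto
          thus ?thesis using True by (simp add: g_def g'_def)
        qed (simp add: g'_def)
        show "norm (wsum v (lv ?m) k A) <= \<epsilon> / (2 * real ?m)" if "vb g' (lv ?m) k A" for k A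
        proof -
          have "sparse (G ?m) k A"
            using vbD[OF that] by (auto simp: sparse_def g'_def hist_def)
          thus ?thesis using G[OF mm(1) m(2) _ v] that by (auto simp: vb_def)
        qed
      qed (use m0[OF mm(2)] e in auto)
      thus "norm (wsum v \<xi> h F) <= \<epsilon>" using red[OF V] by simp
    qed
  qed
  show ?case
  proof (cases "\<eta> = \<xi>")
    case False
    hence lt: "\<eta> < \<xi>" using less.prems by simp
    consider "\<xi> = 0" | \<gamma> where "\<xi> = osuc \<gamma>" | "is_limit \<xi>"
      by (auto simp: is_limit_def is_succ_def)
    thus ?thesis
    proof cases
      case 1
      thus ?thesis using lt by (simp add: leD)
    next
      case 2
      hence "\<eta> <= \<gamma>" using lt by (metis linorder_not_le osuc_le_iff)
      hence "null \<gamma> \<V>" using less.IH[of \<gamma>] 2 by simp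
      thus ?thesis
        unfolding null_def using main[of 0 "\<lambda>_. \<gamma>"] 2 by (simp add: null_def)
    next
      case 3
      then obtain n0 where n0: "1 <= n0" "\<eta> < cs \<xi> n0"
        using cs lt unfolding characteristic_sequences_def by blast
      have le: "cs \<xi> n0 <= cs \<xi> m" if "n0 <= m" for m
        using that
      proof (induction m rule: dec_induct)
        case (step m)
        hence "cs \<xi> m < cs \<xi> (Suc m)" using cs 3 n0(1) unfolding characteristic_sequences_def by simp
        thus ?case using step by simp
      qed simp
      have "null (cs \<xi> m) \<V>" if "n0 <= m" "1 <= m" for m
      proof (rule less.IH)
        show "cs \<xi> m < \<xi>" using cs 3 that(2) unfolding characteristic_sequences_def by simp
        show "\<eta> <= cs \<xi> m" using le[OF that(1)] n0(2) by simp
      qed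
      moreover have "vb g (osuc (cs \<xi> (Min F))) h F \<and> wsum v \<xi> h F = wsum v (osuc (cs \<xi> (Min F))) h F"
        if "vb g \<xi> h F" for g h F and v :: "nat set => 'k"
        using vb_limit[OF that 3] wsum_limit[OF 3 vbD(3)[OF that]] by simp
      ultimately show ?thesis
        unfolding null_def using main[of n0 "cs \<xi>", unfolded null_def] by blast
    qed
  qed (use assms(1) in simp)
qed

text \<open>The superadditive part passes to the union as it stands, while Cauchy-Schwarz over the
  Min F pieces costs the roots a factor sqrt(Min F). Hence \<rho> m = 1/m makes the roots tend to 0,
  and \<rho> m = 1/sqrt m just preserves them.\<close>

lemma wsum_osuc_le:
  assumes A: "superadd A" "superadd M" "superadd M'"
    and U: "!!h F. vb g \<zeta> h F ==> norm (wsum v \<zeta> h F) <= A h F + sqrt (M h F) + sqrt (M' h F)"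
    and V: "vb g (osuc \<zeta>) h F"
  shows "norm (wsum v (osuc \<zeta>) h F) <= \<rho> (Min F) * (A h F + sqrt (real (Min F)) * (sqrt (M h F) + sqrt (M' h F)))"
proof -
  obtain Fs where Fs: "Fs ~= []" "F = \<Union>(set Fs)" "length Fs = Min F" "chn g \<zeta> h Fs" "hist h"
    "wsum v (osuc \<zeta>) h F = of_real (\<rho> (Min F)) * ssum (wsum v \<zeta>) h Fs"
    using V by (rule wsum_osuc'[where v = v]) (rule that)
  let ?S = "\<lambda>M. ssum (\<lambda>h F. sqrt (M h F)) h Fs"
  have root: "?S N <= sqrt (real (Min F)) * sqrt (N h F)" if N: "superadd N" for N
  proof -
    have nn: "0 <= N h F" if "hist h" "hist F" for h F using that N by (auto simp: superadd_def)
    have "?S N <= sqrt (real (Min F)) * sqrt (ssum N h Fs)"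
      using ssum_sqrt[OF Fs(4), of N] nn Fs(3) by simp
    also have "\<dots> <= sqrt (real (Min F)) * sqrt (N h F)"
      using ssum_superadd[OF N Fs(4,5)] Fs(2) by (intro mult_left_mono) auto
    finally show ?thesis .
  qed
  have "norm (ssum (wsum v \<zeta>) h Fs) <= ssum (\<lambda>h F. A h F + sqrt (M h F) + sqrt (M' h F)) h Fs"
    using Fs(4) U by (intro ssum_le[of g \<zeta> h Fs UNIV]) auto
  also have "\<dots> <= A h F + sqrt (real (Min F)) * (sqrt (M h F) + sqrt (M' h F))"
    using ssum_superadd[OF A(1) Fs(4,5)] root[OF A(2)] root[OF A(3)] Fs(2)
    by (simp add: ssum_add distrib_left)
  finally show ?thesis
    using \<rho>_nonneg[of "Min F"] by (simp add: Fs(6) norm_mult mult_left_mono)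
qed

lemma wsum_le_sqrt:
  assumes A: "superadd A" "superadd M" "superadd M'" and \<rho>: "!!m. \<rho> m * sqrt (real m) <= 1"
    and U: "!!h F. vb g 0 h F ==> norm (wsum v 0 h F) <= A h F + sqrt (M h F) + sqrt (M' h F)"
    and "vb g \<zeta> h F"
  shows "norm (wsum v \<zeta> h F) <= A h F + sqrt (M h F) + sqrt (M' h F)"
  using assms(6)
proof (induction rule: vb_induct)
  case (base h F)
  thus ?case by (rule U)
next
  case (succ \<zeta> h F)
  let ?r = "\<rho> (Min F)" and ?S = "sqrt (M h F) + sqrt (M' h F)"
  have nn: "0 <= N h F" if "superadd N" for N using that vbD[OF succ.hyps] by (auto simp: superadd_def hist_def)
  have "norm (wsum v (osuc \<zeta>) h F) <= ?r * (A h F + sqrt (real (Min F)) * ?S)"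
    by (rule wsum_osuc_le[OF A succ.IH succ.hyps])
  also have "\<dots> = ?r * A h F + (?r * sqrt (real (Min F))) * ?S" by (simp add: algebra_simps)
  also have "\<dots> <= 1 * A h F + 1 * ?S"
    using nn[OF A(1)] nn[OF A(2)] nn[OF A(3)] by (intro add_mono mult_right_mono \<rho>_le1 \<rho>) auto
  finally show ?case by simp
next
  case (limit \<zeta> h F)
  thus ?case by (simp add: wsum_limit[OF limit(1) vbD(3)[OF limit(2)]])
qed

lemma wsum_le_average:
  assumes \<rho>: "!!m. \<rho> m * real m <= 1" and "0 <= B"
    and U: "!!h F. vb g 0 h F ==> norm (wsum v 0 h F) <= B" and "vb g \<zeta> h F"
  shows "norm (wsum v \<zeta> h F) <= B"
  using assms(4)
proof (induction rule: vb_induct)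
  case (base h F)
  thus ?case by (rule U)
next
  case (succ \<zeta> h F)
  obtain Fs where Fs: "Fs ~= []" "F = \<Union>(set Fs)" "length Fs = Min F" "chn g \<zeta> h Fs" "hist h"
    "wsum v (osuc \<zeta>) h F = of_real (\<rho> (Min F)) * ssum (wsum v \<zeta>) h Fs"
    using succ.hyps by (rule wsum_osuc'[where v = v]) (rule that)
  have "norm (ssum (wsum v \<zeta>) h Fs) <= ssum (\<lambda>_ _. B) h Fs"
    using Fs(4) succ.IH by (intro ssum_le[of g \<zeta> h Fs UNIV]) auto
  hence "norm (wsum v (osuc \<zeta>) h F) <= \<rho> (Min F) * (real (Min F) * B)"
    using \<rho>_nonneg[of "Min F"] Fs(3) by (simp add: Fs(6) norm_mult mult_left_mono ssum_const)
  also have "\<dots> <= 1 * B" unfolding mult.assoc[symmetric] using \<rho> assms(2) by (intro mult_right_mono) auto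
  finally show ?case by simp
next
  case (limit \<zeta> h F)
  thus ?case by (simp add: wsum_limit[OF limit(1) vbD(3)[OF limit(2)]])
qed

text \<open>Raising g to at least m0 forces Min F \<ge> m0, so a term that tends to 0 with the
  minimum of the block can be absorbed.\<close>

lemma null_eventually:
  assumes "\<tau> \<longlonglongrightarrow> 0"
    and "!!\<epsilon>. 0 < \<epsilon> ==> \<exists>g. \<forall>h F. vb g \<zeta> h F --> (\<forall>v\<in>\<V>. norm (wsum v \<zeta> h F) <= \<epsilon> + \<tau> (Min F))"
  shows "null \<zeta> \<V>"
  unfolding null_def
proof (intro allI impI)
  fix \<epsilon> :: real assume e: "0 < \<epsilon>"
  then obtain g where g: "!!h F v. vb g \<zeta> h F ==> v \<in> \<V> ==> norm (wsum v \<zeta> h F) <= \<epsilon> / 2 + \<tau> (Min F)"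
    using assms(2)[of "\<epsilon> / 2"] by auto
  have "\<forall>\<^sub>F m in sequentially. \<tau> m < \<epsilon> / 2" using e by (intro order_tendstoD(2)[OF assms(1)]) auto
  then obtain m0 where m0: "!!m. m0 <= m ==> \<tau> m < \<epsilon> / 2" by (auto simp: eventually_sequentially)
  show "\<exists>g. \<forall>h F. vb g \<zeta> h F --> (\<forall>v\<in>\<V>. norm (wsum v \<zeta> h F) <= \<epsilon>)"
  proof (intro exI[of _ "\<lambda>H. max (g H) m0"] allI impI ballI)
    fix h F v assume V: "vb (\<lambda>H. max (g H) m0) \<zeta> h F" "v \<in> \<V>"
    have "Min F \<in> F" using vbD[OF V(1)] by simp
    hence "m0 <= Min F" using vbD(4)[OF V(1)] by (fastforce simp: sparse_def)
    moreover have "vb g \<zeta> h F" using V(1) by (rule vb_mono) simp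
    ultimately show "norm (wsum v \<zeta> h F) <= \<epsilon>" using g[OF _ V(2)] m0 by fastforce
  qed
qed

end

text \<open>The demand \<open>G h\<close> of the history h at which a block starts has to be kept up
  while the block is played. At that time h is some subset of the past, so the maximum of
  \<open>G K\<close> over all subsets K of the past contains it.\<close>

lemma (in schreier_hierarchy) vb_diagonal:
  assumes "!!H. hist H ==> \<exists>g. \<forall>F. vb g \<zeta> H F --> Q H F"
  shows "\<exists>g. \<forall>h F. vb g \<zeta> h F --> Q h F"
proof -
  obtain G where G: "!!H F. hist H ==> vb (G H) \<zeta> H F ==> Q H F" using assms by metis
  define g where "g H = (if finite H then Max ((\<lambda>K. G K H) ` Pow H) else 0)" for H
  have "Q h F" if V: "vb g \<zeta> h F" for h F
  proof (rule G)
    show h: "hist h" by (rule vbD(1)[OF V])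
    have "G h ((h \<union> F) \<inter> {..<k}) <= k" if k: "k \<in> F" for k
    proof -
      have fin: "finite ((h \<union> F) \<inter> {..<k})" by simp
      have "h \<subseteq> (h \<union> F) \<inter> {..<k}" using vbD(2)[OF V] k by (auto simp: set_less_def)
      hence "G h ((h \<union> F) \<inter> {..<k}) <= g ((h \<union> F) \<inter> {..<k})"
        using fin unfolding g_def by (simp add: Max_ge del: Pow_Int_eq)
      also have "\<dots> <= k" using vbD(4)[OF V] k by (simp add: sparse_def)
      finally show ?thesis .
    qed
    thus "vb (G h) \<zeta> h F" using V by (simp add: vb_def sparse_def)
  qed
  thus ?thesis by blast
qed

text \<open>An error budget that telescopes along consecutive blocks.\<close>

definition er :: "nat set => nat set => real" where
  "er h F = (1/2) ^ card h - (1/2) ^ card (h \<union> F)"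

lemma (in schreier_hierarchy) superadd_er: "0 <= e ==> superadd (\<lambda>h F. e * er h F)"
  unfolding superadd_def er_def
proof (intro conjI allI impI)
  fix h F :: "nat set" assume "0 <= e" "hist h" "hist F"
  hence "card h <= card (h \<union> F)" by (intro card_mono) (auto simp: hist_def)
  hence "(1/2 :: real) ^ card (h \<union> F) <= (1/2) ^ card h" by (intro power_decreasing) auto
  thus "0 <= e * ((1/2) ^ card h - (1/2) ^ card (h \<union> F))" using \<open>0 <= e\<close> by simp
qed (simp add: algebra_simps Un_assoc)

lemma er_le_1: "er h F <= 1"
proof -
  have "(1/2 :: real) ^ card h <= 1" by (rule power_le_one) auto
  moreover have "0 <= (1/2 :: real) ^ card (h \<union> F)" by simp
  ultimately show ?thesis unfolding er_def by linarith
qed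

text \<open>A non-empty block frees at least half of the budget left at its start. An error of order
  2^(-card h), fixed when h is known, can therefore be paid from \<open>er\<close>.\<close>

lemma er_ge:
  assumes "hist h" "finite F" "F ~= {}" "h \<inter> F = {}" shows "(1/2) ^ card h <= 2 * er h F"
proof -
  have "card (h \<union> F) = card h + card F" "0 < card F"
    using assms by (auto simp: hist_def card_Un_disjoint card_gt_0_iff)
  hence "(1/2 :: real) ^ card (h \<union> F) <= (1/2) ^ Suc (card h)" by (intro power_decreasing) auto
  thus ?thesis by (simp add: er_def)
qed

section \<open>Superadditive set functions\<close>

text \<open>The supports grow with the history, so the increments over consecutive blocks are
  disjoint and make up the increment over their union.\<close>

lemma (in schreier_hierarchy) superadd_set2:
  assumes EE: "!!H. EE H \<in> R" "!!H H'. finite H' ==> H \<subseteq> H' ==> EE H \<subseteq> EE H'" and R: "ring_of_sets UNIV R"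
    and EE': "!!H. EE' H \<in> R'" "!!H H'. finite H' ==> H \<subseteq> H' ==> EE' H \<subseteq> EE' H'" and R': "ring_of_sets UNIV R'"
    and m: "!!D D'. D \<in> R ==> D' \<in> R' ==> 0 <= m D D'"
      "!!D1 D2 D1' D2'. D1 \<in> R ==> D2 \<in> R ==> D1' \<in> R' ==> D2' \<in> R' ==> D1 \<inter> D2 = {} ==> D1' \<inter> D2' = {} ==>
        m D1 D1' + m D2 D2' <= m (D1 \<union> D2) (D1' \<union> D2')"
  shows "superadd (\<lambda>h F. m (EE (h \<union> F) - EE h) (EE' (h \<union> F) - EE' h))"
proof -
  interpret R: ring_of_sets UNIV R by fact
  interpret R': ring_of_sets UNIV R' by fact
  have d: "EE H - EE H' \<in> R" "EE' H - EE' H' \<in> R'" for H H' by (intro R.Diff R'.Diff EE(1) EE'(1))+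
  have "m (EE (h \<union> F) - EE h) (EE' (h \<union> F) - EE' h) +
      m (EE (h \<union> F \<union> K) - EE (h \<union> F)) (EE' (h \<union> F \<union> K) - EE' (h \<union> F)) <=
      m (EE (h \<union> (F \<union> K)) - EE h) (EE' (h \<union> (F \<union> K)) - EE' h)"
    if "hist h" "hist F" "hist K" for h F K
  proof -
    have "EE h \<subseteq> EE (h \<union> F)" "EE (h \<union> F) \<subseteq> EE (h \<union> F \<union> K)" "EE' h \<subseteq> EE' (h \<union> F)"
      "EE' (h \<union> F) \<subseteq> EE' (h \<union> F \<union> K)"
      using that by (intro EE(2) EE'(2); simp add: hist_def)+
    hence "EE (h \<union> (F \<union> K)) - EE h = (EE (h \<union> F) - EE h) \<union> (EE (h \<union> F \<union> K) - EE (h \<union> F))"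
      "EE' (h \<union> (F \<union> K)) - EE' h = (EE' (h \<union> F) - EE' h) \<union> (EE' (h \<union> F \<union> K) - EE' (h \<union> F))"
      by (auto simp: Un_assoc)
    moreover have "(EE (h \<union> F) - EE h) \<inter> (EE (h \<union> F \<union> K) - EE (h \<union> F)) = {}"
      "(EE' (h \<union> F) - EE' h) \<inter> (EE' (h \<union> F \<union> K) - EE' (h \<union> F)) = {}" by blast+
    ultimately show ?thesis using m(2)[OF d(1) d(1) d(2) d(2)] by simp
  qed
  thus ?thesis unfolding superadd_def using m(1)[OF d] by auto
qed

lemma (in schreier_hierarchy) superadd_set:
  assumes EE: "!!H. EE H \<in> R" "!!H H'. finite H' ==> H \<subseteq> H' ==> EE H \<subseteq> EE H'" and R: "ring_of_sets UNIV R"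
    and m: "!!D. D \<in> R ==> 0 <= m D" "!!D D'. D \<in> R ==> D' \<in> R ==> D \<inter> D' = {} ==> m D + m D' <= m (D \<union> D')"
  shows "superadd (\<lambda>h F. m (EE (h \<union> F) - EE h))"
proof -
  have "ring_of_sets UNIV {{} :: unit set}" by (simp add: ring_of_sets_iff)
  from superadd_set2[of EE R "\<lambda>_. {}" "{{}}" "\<lambda>D _. m D", OF EE R _ _ this] m show ?thesis by simp
qed

text \<open>The members are required to be non-empty so that families inside disjoint sets have no
  member in common and their sums add up.\<close>

definition parts :: "'p set set => 'p set => 'p set set set" where
  "parts R D = {\<D>. finite \<D> \<and> \<D> \<subseteq> R \<and> {} \<notin> \<D> \<and> disjoint \<D> \<and> \<Union>\<D> \<subseteq> D}"

text \<open>The least superadditive set function above \<open>D \<mapsto> \<parallel>\<psi> (1\<^sub>D \<cdot>) \<cdot>\<parallel>\<^sup>2\<close>; Grothendieck's inequality makes it finite.\<close>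

definition mu :: "'p set set => ('q => 'k::real_normed_field) set => (('p => 'k) => ('q => 'k) => 'k) => 'p set => real" where
  "mu R Z' \<psi> D = (SUP \<D>\<in>parts R D. \<Sum>A\<in>\<D>. (fnorm (Sp R) Z' (\<lambda>f g. \<psi> (cut A f) g))\<^sup>2)"

context
  fixes \<psi> :: "('p => 'k::real_normed_field) => ('q => 'k) => 'k" and c B :: real and R R'
  assumes gb: "grothendieck_bound TYPE('k) c" "0 <= c"
    and R: "ring_of_sets UNIV R" and R': "ring_of_sets UNIV R'" and F: "form (Sp R) (Sp R') \<psi> B"
begin

interpretation ring_of_sets UNIV R by (rule R)

lemma mu_part_le: "\<D> \<in> parts R D ==> (\<Sum>A\<in>\<D>. (fnorm (Sp R) (Sp R') (\<lambda>f g. \<psi> (cut A f) g))\<^sup>2) <= (c * B)\<^sup>2"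
  by (rule grothendieck_l2[OF gb R' fspace_Sp F])
    (auto simp: parts_def disjoint_def intro: Sp_cut'[OF R])

lemma parts_nonempty: "parts R D ~= {}"
proof -
  have "{} \<in> parts R D" by (simp add: parts_def)
  thus ?thesis by blast
qed

lemma mu_bdd: "bdd_above ((\<lambda>\<D>. \<Sum>A\<in>\<D>. (fnorm (Sp R) (Sp R') (\<lambda>f g. \<psi> (cut A f) g))\<^sup>2) ` parts R D)"
  using mu_part_le by (rule bdd_aboveI2)

lemma mu_upper: "\<D> \<in> parts R D ==> (\<Sum>A\<in>\<D>. (fnorm (Sp R) (Sp R') (\<lambda>f g. \<psi> (cut A f) g))\<^sup>2) <= mu R (Sp R') \<psi> D"
  unfolding mu_def using mu_bdd by (intro cSUP_upper)

lemma mu_le: "mu R (Sp R') \<psi> D <= (c * B)\<^sup>2"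
  unfolding mu_def by (rule cSUP_least[OF parts_nonempty mu_part_le])

lemma mu_nonneg: "0 <= mu R (Sp R') \<psi> D"
  using mu_upper[of "{}" D] by (simp add: parts_def)

lemma mu_ge:
  assumes "D \<in> R" shows "fnorm (Sp R) (Sp R') (\<lambda>f g. \<psi> (cut D f) g) <= sqrt (mu R (Sp R') \<psi> D)"
proof (cases "D = {}")
  case True
  have "form (Sp R) (Sp R') (\<lambda>f g. \<psi> (cut D f) g) 0"
  proof -
    have "cut D f = (\<lambda>_. 0)" for f :: "'p => 'k" by (auto simp: cut_def True)
    hence z: "\<psi> (cut D f) g = 0" if "g \<in> Sp R'" for f g
      using form_zero(1)[OF F fspace_zero[OF fspace_Sp] that] by simp
    show ?thesis
      by (rule formI) (auto simp: z Sp_add Sp_scale)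
  qed
  hence "fnorm (Sp R) (Sp R') (\<lambda>f g. \<psi> (cut D f) g) <= 0"
    by (rule fnorm_le[OF _ fspace_Sp fspace_Sp])
  thus ?thesis using mu_nonneg[of D] real_sqrt_ge_zero order_trans by blast
next
  case False
  hence "{D} \<in> parts R D" using assms by (simp add: parts_def)
  from mu_upper[OF this] show ?thesis by (intro real_le_rsqrt) simp
qed

lemma mu_superadd:
  assumes "D \<inter> D' = {}" shows "mu R (Sp R') \<psi> D + mu R (Sp R') \<psi> D' <= mu R (Sp R') \<psi> (D \<union> D')"
proof -
  let ?s = "\<lambda>\<D>. \<Sum>A\<in>\<D>. (fnorm (Sp R) (Sp R') (\<lambda>f g. \<psi> (cut A f) g))\<^sup>2"
  have *: "?s \<D> + ?s \<E> <= mu R (Sp R') \<psi> (D \<union> D')" if D: "\<D> \<in> parts R D" and E: "\<E> \<in> parts R D'" for \<D> \<E>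
  proof -
    have dis: "A \<inter> A' = {}" if "A \<in> \<D>" "A' \<in> \<E>" for A A'
      using that D E assms unfolding parts_def by blast
    hence "\<D> \<inter> \<E> = {}" using D by (fastforce simp: parts_def)
    hence "?s \<D> + ?s \<E> = ?s (\<D> \<union> \<E>)" using D E by (simp add: sum.union_disjoint parts_def)
    also have "\<D> \<union> \<E> \<in> parts R (D \<union> D')"
      using D E dis unfolding parts_def disjoint_def by (simp add: Un_iff ball_Un) (metis Int_commute le_supI1 le_supI2)
    hence "?s (\<D> \<union> \<E>) <= mu R (Sp R') \<psi> (D \<union> D')" by (rule mu_upper)
    finally show ?thesis .
  qed
  have "mu R (Sp R') \<psi> D <= mu R (Sp R') \<psi> (D \<union> D') - ?s \<E>" if "\<E> \<in> parts R D'" for \<E>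
    unfolding mu_def[of R "Sp R'" \<psi> D] using *[OF _ that] by (intro cSUP_least parts_nonempty) (simp add: le_diff_eq)
  hence "mu R (Sp R') \<psi> D' <= mu R (Sp R') \<psi> (D \<union> D') - mu R (Sp R') \<psi> D"
    unfolding mu_def[of R "Sp R'" \<psi> D'] by (intro cSUP_least parts_nonempty) (simp add: algebra_simps)
  thus ?thesis by simp
qed

end

section \<open>Additivity of norms over disjoint sets\<close>

definition lnorm :: "('p => 'k::real_normed_field) set => (('p => 'k) => 'k) => real" where
  "lnorm Z l = (SUP f\<in>{f\<in>Z. sbd f 1}. norm (l f))"

context
  fixes Z :: "('p => 'k::real_normed_field) set" and l C
  assumes l: "fnl Z l C" and Z: "fspace Z"
begin

lemma fnl_ball: "f \<in> Z ==> sbd f 1 ==> norm (l f) <= C"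
  using l unfolding fnl_def by (metis mult.right_neutral)

lemma lnorm_upper: "f \<in> Z ==> sbd f 1 ==> norm (l f) <= lnorm Z l"
  unfolding lnorm_def using fnl_ball by (intro cSUP_upper bdd_aboveI2[where M = C]) auto

lemma lnorm_le: "lnorm Z l <= C"
proof -
  have "{f\<in>Z. sbd f 1} ~= {}" using fspace_zero[OF Z] sbd_zero by blast
  thus ?thesis unfolding lnorm_def using fnl_ball by (intro cSUP_least) auto
qed

lemma lnorm_nonneg: "0 <= lnorm Z l"
  using order_trans[OF norm_ge_zero lnorm_upper[OF fspace_zero[OF Z] sbd_zero]] .

lemma lnorm_bound:
  assumes "f \<in> Z" "sbd f a" shows "norm (l f) <= lnorm Z l * a"
proof (cases "a = 0")
  case True
  hence "norm (l f) <= C * 0" using l assms unfolding fnl_def by blast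
  thus ?thesis using True by simp
next
  case False
  hence a: "0 < a" using sbd_nonneg[OF assms(2)] by simp
  let ?f = "\<lambda>x. of_real (inverse a) * f x"
  have "?f \<in> Z" by (rule fspace_scale[OF Z assms(1)])
  moreover have "sbd ?f 1"
    using assms(2) a by (simp add: sbd_def norm_mult norm_divide divide_simps)
  ultimately have "norm (l ?f) <= lnorm Z l" by (rule lnorm_upper)
  moreover have "l ?f = of_real (inverse a) * l f" using l assms(1) by (simp add: fnl_def)
  ultimately have "norm (of_real (inverse a) * l f) <= lnorm Z l" by simp
  thus ?thesis using a by (simp add: norm_mult norm_divide field_simps)
qed

lemma fnl_cut: "(!!f. f \<in> Z ==> cut D f \<in> Z) ==> fnl Z (\<lambda>f. l (cut D f)) C"
  using l by (auto simp: fnl_def cut_add cut_scale sbd_cut)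

end

lemma unit_phase:
  obtains s :: "'k::real_normed_field" where "norm s = 1" "s * z = of_real (norm z)"
proof (cases "z = 0")
  case False
  have "norm (of_real (norm z) / z) = 1" "of_real (norm z) / z * z = of_real (norm z)"
    using False by (simp_all add: norm_divide)
  thus thesis by (rule that)
qed (use that[of 1] in simp)

lemma lnorm_approx:
  assumes "fnl Z l C" "fspace Z" "0 < e"
  obtains f where "f \<in> Z" "sbd f 1" "lnorm Z l - e < norm (l f)"
proof -
  have ne: "{f\<in>Z. sbd f 1} ~= {}" using fspace_zero[OF assms(2)] sbd_zero by blast
  have bdd: "bdd_above ((\<lambda>f. norm (l f)) ` {f\<in>Z. sbd f 1})"
    using fnl_ball[OF assms(1,2)] by (intro bdd_aboveI2[where M = C]) auto
  have "lnorm Z l - e < lnorm Z l" using assms(3) by simp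
  then obtain f where "f \<in> {f\<in>Z. sbd f 1}" "lnorm Z l - e < norm (l f)"
    unfolding lnorm_def less_cSUP_iff[OF ne bdd] by blast
  thus thesis using that by auto
qed

text \<open>Almost norming functions are cut to D and D' and rotated so that both values become
  non-negative. By disjointness their sum still has sup norm at most 1, and the functional takes the
  sum of the two moduli on it.\<close>

lemma lnorm_superadd:
  assumes l: "fnl Z l C" and Z: "fspace Z" and "D \<inter> D' = {}"
    and D: "!!f. f \<in> Z ==> cut D f \<in> Z" "!!f. f \<in> Z ==> cut D' f \<in> Z" "!!f. f \<in> Z ==> cut (D \<union> D') f \<in> Z"
  shows "lnorm Z (\<lambda>f. l (cut D f)) + lnorm Z (\<lambda>f. l (cut D' f)) <= lnorm Z (\<lambda>f. l (cut (D \<union> D') f))"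
proof (rule field_le_epsilon)
  fix e :: real assume "0 < e"
  note lD = fnl_cut[OF l Z D(1)] and lD' = fnl_cut[OF l Z D(2)] and lU = fnl_cut[OF l Z D(3)]
  obtain f where f: "f \<in> Z" "sbd f 1" "lnorm Z (\<lambda>f. l (cut D f)) - e/2 < norm (l (cut D f))"
    using lnorm_approx[OF lD Z, of "e/2"] \<open>0 < e\<close> by auto
  obtain g where g: "g \<in> Z" "sbd g 1" "lnorm Z (\<lambda>f. l (cut D' f)) - e/2 < norm (l (cut D' g))"
    using lnorm_approx[OF lD' Z, of "e/2"] \<open>0 < e\<close> by auto
  obtain s where s: "norm s = 1" "s * l (cut D f) = of_real (norm (l (cut D f)))" by (rule unit_phase)
  obtain t where t: "norm t = 1" "t * l (cut D' g) = of_real (norm (l (cut D' g)))" by (rule unit_phase)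
  have m: "(\<lambda>x. s * cut D f x) \<in> Z" "(\<lambda>x. t * cut D' g x) \<in> Z"
    using f(1) g(1) D by (auto intro: fspace_scale[OF Z])
  define u where "u = (\<lambda>x. s * cut D f x + t * cut D' g x)"
  have "u \<in> Z" unfolding u_def using m Z by (simp add: fspace_def)
  moreover have "sbd u 1"
    unfolding sbd_def
  proof
    fix x
    have fx: "norm (f x) <= 1" "norm (g x) <= 1" using f(2) g(2) by (auto simp: sbd_def)
    show "norm (u x) <= 1"
    proof (cases "x \<in> D")
      case True
      hence "x \<notin> D'" using assms(3) by blast
      thus ?thesis using True fx s(1) by (simp add: u_def cut_def norm_mult)
    next
      case False
      thus ?thesis using fx t(1) by (simp add: u_def cut_def norm_mult)
    qed
  qed
  ultimately have "norm (l (cut (D \<union> D') u)) <= lnorm Z (\<lambda>f. l (cut (D \<union> D') f))" using lnorm_upper[OF lU Z, of u] by simp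
  moreover have "cut (D \<union> D') u = u" by (auto simp: u_def cut_def)
  moreover have "l u = s * l (cut D f) + t * l (cut D' g)"
    unfolding u_def using l m D f(1) g(1) by (simp add: fnl_def)
  hence "l u = of_real (norm (l (cut D f)) + norm (l (cut D' g)))" using s t by simp
  hence "norm (l u) = norm (l (cut D f)) + norm (l (cut D' g))"
    unfolding \<open>l u = of_real (norm (l (cut D f)) + norm (l (cut D' g)))\<close> norm_of_real by simp
  ultimately show "lnorm Z (\<lambda>f. l (cut D f)) + lnorm Z (\<lambda>f. l (cut D' f)) <= lnorm Z (\<lambda>f. l (cut (D \<union> D') f)) + e"
    using f(3) g(3) by simp
qed

text \<open>This is \<open>form_diagonal\<close> for two pairs, applied to the form restricted to
  the unions and normed by its own norm.\<close>

lemma fnorm_diag_superadd: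
  fixes \<psi> :: "('p => 'k::real_normed_field) => ('q => 'k) => 'k"
  assumes F: "form Z Z' \<psi> B" and Z: "fspace Z" "fspace Z'"
    and dis: "D1 \<inter> D2 = {}" "E1 \<inter> E2 = {}"
    and D: "!!f. f \<in> Z ==> cut D1 f \<in> Z" "!!f. f \<in> Z ==> cut D2 f \<in> Z" "!!f. f \<in> Z ==> cut (D1 \<union> D2) f \<in> Z"
    and E: "!!f. f \<in> Z' ==> cut E1 f \<in> Z'" "!!f. f \<in> Z' ==> cut E2 f \<in> Z'" "!!f. f \<in> Z' ==> cut (E1 \<union> E2) f \<in> Z'"
  shows "fnorm Z Z' (\<lambda>f g. \<psi> (cut D1 f) (cut E1 g)) + fnorm Z Z' (\<lambda>f g. \<psi> (cut D2 f) (cut E2 g)) <=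
    fnorm Z Z' (\<lambda>f g. \<psi> (cut (D1 \<union> D2) f) (cut (E1 \<union> E2) g))"
proof -
  let ?\<psi> = "\<lambda>f g. \<psi> (cut (D1 \<union> D2) f) (cut (E1 \<union> E2) g)"
  have F': "form Z Z' ?\<psi> (B * 1 * 1)" by (rule form_comp[OF F op_cut[OF D(3)] op_cut[OF E(3)]])
  have "(\<Sum>k<2::nat. fnorm Z Z' (\<lambda>f g. ?\<psi> (cut (if k = 0 then D1 else D2) f) (cut (if k = 0 then E1 else E2) g))) <= fnorm Z Z' ?\<psi>"
    by (rule form_diagonal[OF form_fnorm[OF F' Z] Z]) (use dis D E in auto)
  moreover have "(D1 \<union> D2) \<inter> D1 = D1" "(D1 \<union> D2) \<inter> D2 = D2" "(E1 \<union> E2) \<inter> E1 = E1" "(E1 \<union> E2) \<inter> E2 = E2" by auto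
  ultimately show ?thesis by (simp add: numeral_2_eq_2 cut_cut)
qed

section \<open>Functionals on bilinear forms\<close>

definition pull :: "('z => 'y => 'k) => ('x => 'z) => ('x' => 'y) => 'x => 'x' => 'k" where
  "pull \<psi> T T' = (\<lambda>x y. \<psi> (T x) (T' y))"

type_synonym ('p, 'k) bform = "('p => 'k) => ('p => 'k) => 'k"

text \<open>The scalar families obtained by testing w with all forms of norm at most 1 after
  applying T and T' to the factors. Nullness of this set expresses how small T and T' are jointly;
  neither operator needs to be small alone.\<close>

definition TV :: "(nat set => (omega1, 'k::real_normed_field) bform => 'k) => 'k fn set =>
    ((omega1 => 'k) => omega1 => 'k) => 'k fn set => ((omega1 => 'k) => omega1 => 'k) => (nat set => 'k) set" where
  "TV w Z T Z' T' = {v. \<exists>\<psi>. form Z Z' \<psi> 1 \<and> v = (\<lambda>E. w E (pull \<psi> T T'))}"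

definition flip :: "('x => 'y => 'k) => 'y => 'x => 'k" where
  "flip \<phi> = (\<lambda>y x. \<phi> x y)"

lemma TV_flip: "TV (\<lambda>E \<phi>. w E (flip \<phi>)) Z' T' Z T = TV w Z T Z' T'"
proof -
  have "TV (\<lambda>E \<phi>. w E (flip \<phi>)) Z' T' Z T \<subseteq> TV w Z T Z' T'"
    for w :: "nat set => (omega1, 'k::real_normed_field) bform => 'k" and Z Z' T T'
    unfolding TV_def pull_def flip_def using form_flip by fastforce
  from this[of w] this[of "\<lambda>E \<phi>. w E (flip \<phi>)" Z T Z' T'] show ?thesis 
    by (intro equalityI) (simp_all add: flip_def)
qed

lemma fspace_add: "fspace Z ==> f \<in> Z ==> g \<in> Z ==> (\<lambda>x. f x + g x) \<in> Z"
  by (simp add: fspace_def)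

lemma form_cong:
  assumes "form X Y \<phi> B" "fspace X" "fspace Y" "!!x y. x \<in> X ==> y \<in> Y ==> \<phi>' x y = \<phi> x y"
  shows "form X Y \<phi>' B"
  using assms unfolding form_def fspace_def by simp

text \<open>Covers the rings used for localisation and also the one-element family {UNIV}, by which
  a factor is left uncut. The set {} is adjoined for the ring condition so that differences of
  supports make sense in both cases.\<close>

definition exh :: "omega1 set set => (omega1 => 'k::real_normed_field) set => 'k fn set =>
    ((omega1 => 'k) => omega1 => 'k) => bool" where
  "exh \<A> X Z T \<longleftrightarrow> ring_of_sets UNIV (insert {} \<A>) \<and> \<A> ~= {} \<and> (\<forall>D\<in>\<A>. \<forall>D'\<in>\<A>. D \<union> D' \<in> \<A>) \<and> (\<forall>D\<in>\<A>. \<forall>f\<in>Z. cut D f \<in> Z) \<and>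
    (\<forall>x\<in>X. \<forall>e>0. \<exists>D0\<in>\<A>. \<forall>D\<in>\<A>. D0 \<subseteq> D --> sbd (\<lambda>p. T x p - cut D (T x) p) e)"

lemma exhD:
  assumes "exh \<A> X Z T"
  shows "\<A> ~= {}" "D \<in> \<A> ==> D' \<in> \<A> ==> D \<union> D' \<in> \<A>" "D \<in> \<A> ==> f \<in> Z ==> cut D f \<in> Z"
    "x \<in> X ==> 0 < e ==> \<exists>D0\<in>\<A>. \<forall>D\<in>\<A>. D0 \<subseteq> D --> sbd (\<lambda>p. T x p - cut D (T x) p) e"
  using assms unfolding exh_def by blast+

lemma exh_Diff:
  assumes "exh \<A> X Z T" "fspace Z" "D \<in> \<A>" "D' \<in> \<A>" "f \<in> Z" shows "cut (D - D') f \<in> Z"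
proof -
  interpret ring_of_sets UNIV "insert {} \<A>" using assms(1) by (simp add: exh_def)
  have "D - D' \<in> insert {} \<A>" using assms(3,4) by (intro Diff) auto
  thus ?thesis
  proof
    assume "D - D' = {}"
    moreover have "cut {} f = (\<lambda>_. 0)" by (auto simp: cut_def)
    ultimately have "cut (D - D') f = (\<lambda>_. 0)" by metis
    thus ?thesis using fspace_zero[OF assms(2)] by simp
  qed (use exhD(3)[OF assms(1)] assms(5) in blast)
qed

lemma exh_Sp:
  assumes R: "ring_of_sets UNIV R" and T: "op X (Sp R) T C" shows "exh R X (Sp R) T"
proof -
  interpret ring_of_sets UNIV R by (rule R)
  have "insert {} R = R" by auto
  thus ?thesis
    unfolding exh_def
  proof (intro conjI ballI allI impI)
    show "R ~= {}" by auto
    fix x and e :: real assume "x \<in> X" "0 < e"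
    show "\<exists>D0\<in>R. \<forall>D\<in>R. D0 \<subseteq> D --> sbd (\<lambda>p. T x p - cut D (T x) p) e"
      using Sp_tail[OF R opD(2)[OF T \<open>x \<in> X\<close>] \<open>0 < e\<close>] by blast
  qed (use R Sp_cut'[OF R] in auto)
qed

lemma exh_UNIV: "exh {UNIV} X Z T"
proof -
  have "cut UNIV f = f" for f :: "omega1 => 'a" by (auto simp: cut_def)
  moreover have "ring_of_sets UNIV {{}, UNIV :: omega1 set}" by (auto simp: ring_of_sets_iff)
  ultimately show ?thesis by (simp add: exh_def sbd_def)
qed

lemma op_cut_comp: "op X Z T C ==> (!!f. f \<in> Z ==> cut D f \<in> Z) ==> op X Z (\<lambda>x. cut D (T x)) C"
  using op_comp[OF _ op_cut, of X Z T C D Z] by simp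

text \<open>The value \<open>w E \<phi>\<close> is that of the form \<open>\<phi>\<close> at the tensor \<open>u E\<close>.\<close>

locale wfam =
  fixes X Y :: "(omega1 => 'k::real_normed_field) set"
    and w :: "nat set => (omega1, 'k) bform => 'k"
  assumes X: "fspace X" and Y: "fspace Y"
    and w_bound: "hist E ==> E ~= {} ==> form X Y \<phi> B ==> norm (w E \<phi>) <= B"
    and w_null: "hist E ==> form X Y \<phi> B ==> (\<lambda>k. w (insert k E) \<phi>) \<longlonglongrightarrow> 0"
    and w_tensor: "hist E ==> E ~= {} ==> 0 < e ==>
      \<exists>zs. set zs \<subseteq> X \<times> Y \<and> (\<forall>\<phi> B. form X Y \<phi> B --> norm (w E \<phi> - (\<Sum>(x, y)\<leftarrow>zs. \<phi> x y)) <= e * B)"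
begin

text \<open>The axioms of \<open>wfam\<close> do not state linearity. It follows from
  \<open>w_tensor\<close>: up to an arbitrarily small multiple of the norms, w E is evaluation at
  one finite tensor, which is linear in the form.\<close>

lemma w_linear:
  assumes E: "hist E" "E ~= {}" and F: "form X Y \<phi> B" "form X Y \<phi>1 B1" "form X Y \<phi>2 B2"
    and eq: "!!x y. x \<in> X ==> y \<in> Y ==> \<phi> x y = a * \<phi>1 x y + b * \<phi>2 x y"
  shows "w E \<phi> = a * w E \<phi>1 + b * w E \<phi>2"
proof -
  define K where "K = B + norm a * B1 + norm b * B2"
  have K: "0 <= K" using formD(1)[OF F(1)] formD(1)[OF F(2)] formD(1)[OF F(3)] by (simp add: K_def)
  have main: "norm (w E \<phi> - (a * w E \<phi>1 + b * w E \<phi>2)) <= e * K" if "0 < e" for e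
  proof -
    obtain zs where zs: "set zs \<subseteq> X \<times> Y" "!!\<phi> B. form X Y \<phi> B ==> norm (w E \<phi> - (\<Sum>(x, y)\<leftarrow>zs. \<phi> x y)) <= e * B"
      using w_tensor[OF E \<open>0 < e\<close>] by blast
    let ?s = "\<lambda>\<phi>. \<Sum>(x, y)\<leftarrow>zs. \<phi> x y"
    have "?s \<phi> = a * ?s \<phi>1 + b * ?s \<phi>2"
      using zs(1) by (induction zs) (auto simp: eq algebra_simps)
    hence "w E \<phi> - (a * w E \<phi>1 + b * w E \<phi>2) =
        (w E \<phi> - ?s \<phi>) - (a * (w E \<phi>1 - ?s \<phi>1) + b * (w E \<phi>2 - ?s \<phi>2))"
      by (simp add: algebra_simps)
    hence "norm (w E \<phi> - (a * w E \<phi>1 + b * w E \<phi>2)) =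
        norm ((w E \<phi> - ?s \<phi>) - (a * (w E \<phi>1 - ?s \<phi>1) + b * (w E \<phi>2 - ?s \<phi>2)))"
      by (rule arg_cong)
    also have "\<dots> <= norm (w E \<phi> - ?s \<phi>) + (norm (a * (w E \<phi>1 - ?s \<phi>1)) + norm (b * (w E \<phi>2 - ?s \<phi>2)))"
      by (rule order_trans[OF norm_triangle_ineq4 add_left_mono[OF norm_triangle_ineq]])
    also have "\<dots> <= e * B + (norm a * (e * B1) + norm b * (e * B2))"
      unfolding norm_mult by (intro add_mono mult_left_mono zs(2) F norm_ge_zero)
    finally show ?thesis by (simp add: K_def algebra_simps)
  qed
  have "norm (w E \<phi> - (a * w E \<phi>1 + b * w E \<phi>2)) <= 0"
  proof (rule field_le_epsilon)
    fix e :: real assume "0 < e"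
    hence "norm (w E \<phi> - (a * w E \<phi>1 + b * w E \<phi>2)) <= e / (K + 1) * K" using K by (intro main) simp
    also have "\<dots> <= e" using K \<open>0 < e\<close> by (simp add: field_simps)
    finally show "norm (w E \<phi> - (a * w E \<phi>1 + b * w E \<phi>2)) <= 0 + e" by simp
  qed
  thus ?thesis by simp
qed

lemma w_cong:
  assumes "hist E" "E ~= {}" "form X Y \<phi> B" "!!x y. x \<in> X ==> y \<in> Y ==> \<phi>' x y = \<phi> x y"
  shows "w E \<phi>' = w E \<phi>"
  using w_linear[OF assms(1,2) form_cong[OF assms(3) X Y assms(4)] assms(3,3), of 1 0] assms(4) by simp

lemma w_add:
  assumes "hist E" "E ~= {}" "form X Y \<phi> B" "form X Y \<psi> C"
  shows "w E (\<lambda>x y. \<phi> x y + \<psi> x y) = w E \<phi> + w E \<psi>"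
  using w_linear[OF assms(1,2) form_add[OF assms(3,4)] assms(3,4), of 1 1] by simp

lemma w_scale:
  assumes "hist E" "E ~= {}" "form X Y \<phi> B" shows "w E (\<lambda>x y. c * \<phi> x y) = c * w E \<phi>"
  using w_linear[OF assms(1,2) form_scale[OF assms(3)] assms(3,3), of c c 0] by simp

lemma wfam_flip: "wfam Y X (\<lambda>E \<phi>. w E (flip \<phi>))"
proof
  fix E and \<phi> :: "(omega1, 'k) bform" and B e
  show "norm (w E (flip \<phi>)) <= B" if "hist E" "E ~= {}" "form Y X \<phi> B"
    using w_bound[OF that(1,2)] form_flip[OF that(3)] by (simp add: flip_def)
  show "(\<lambda>k. w (insert k E) (flip \<phi>)) \<longlonglongrightarrow> 0" if "hist E" "form Y X \<phi> B"
    using w_null[OF that(1)] form_flip[OF that(2)] by (simp add: flip_def)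
  show "\<exists>zs. set zs \<subseteq> Y \<times> X \<and> (\<forall>\<phi> B. form Y X \<phi> B --> norm (w E (flip \<phi>) - (\<Sum>(x, y)\<leftarrow>zs. \<phi> x y)) <= e * B)"
    if E: "hist E" "E ~= {}" "0 < e"
  proof -
    obtain zs where zs: "set zs \<subseteq> X \<times> Y" "!!\<phi> B. form X Y \<phi> B ==> norm (w E \<phi> - (\<Sum>(x, y)\<leftarrow>zs. \<phi> x y)) <= e * B"
      using w_tensor[OF E] by blast
    have s: "(\<Sum>(x, y)\<leftarrow>map prod.swap zs. \<phi> x y) = (\<Sum>(x, y)\<leftarrow>zs. flip \<phi> x y)" for \<phi> :: "(omega1, 'k) bform"
      by (induction zs) (auto simp: flip_def)
    show ?thesis
    proof (intro exI[of _ "map prod.swap zs"] conjI allI impI)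
      show "set (map prod.swap zs) \<subseteq> Y \<times> X" using zs(1) by auto
      fix \<phi> :: "(omega1, 'k) bform" and B assume "form Y X \<phi> B"
      hence "form X Y (flip \<phi>) B" using form_flip by (auto simp: flip_def)
      thus "norm (w E (flip \<phi>) - (\<Sum>(x, y)\<leftarrow>map prod.swap zs. \<phi> x y)) <= e * B"
        unfolding s by (rule zs(2))
    qed
  qed
qed (rule Y X)+

lemma form_pull:
  assumes "form Z Z' \<psi> B" "op X Z T C" "op Y Z' T' C'" shows "form X Y (pull \<psi> T T') (B * C * C')"
  unfolding pull_def by (rule form_comp[OF assms])

text \<open>The supports are found from the finitely many functions T x and T' y alone. The form
  enters only through its norm, by \<psi>(f,g) - \<psi>(f',g') = \<psi>(f - f',g) + \<psi>(f',g -
  g'), and this is why one pair of supports works for all forms.\<close>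

lemma tail_list:
  assumes T: "op X Z T C" "op Y Z' T' C'" and Z: "fspace Z" "fspace Z'"
    and A: "exh \<A> X Z T" "exh \<A>' Y Z' T'" and "set zs \<subseteq> X \<times> Y" "0 < d"
  shows "\<exists>D0\<in>\<A>. \<exists>D0'\<in>\<A>'. \<forall>D\<in>\<A>. \<forall>D'\<in>\<A>'. D0 \<subseteq> D --> D0' \<subseteq> D' --> (\<forall>\<psi>. form Z Z' \<psi> 1 -->
    norm ((\<Sum>(x, y)\<leftarrow>zs. \<psi> (T x) (T' y)) - (\<Sum>(x, y)\<leftarrow>zs. \<psi> (cut D (T x)) (cut D' (T' y)))) <= d)"
  using assms(7,8)
proof (induction zs arbitrary: d)
  case Nil
  thus ?case using exhD(1)[OF A(1)] exhD(1)[OF A(2)] by fastforce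
next
  case (Cons z zs)
  obtain x y where z: "z = (x, y)" by (cases z)
  have xy: "x \<in> X" "y \<in> Y" and zs: "set zs \<subseteq> X \<times> Y" using Cons.prems by (auto simp: z)
  have d2: "0 < d / 2" using Cons.prems by simp
  obtain D1 D1' where D1: "D1 \<in> \<A>" "D1' \<in> \<A>'" "!!D D' \<psi>. D \<in> \<A> ==> D' \<in> \<A>' ==> D1 \<subseteq> D ==> D1' \<subseteq> D' ==> form Z Z' \<psi> 1 ==>
    norm ((\<Sum>(x, y)\<leftarrow>zs. \<psi> (T x) (T' y)) - (\<Sum>(x, y)\<leftarrow>zs. \<psi> (cut D (T x)) (cut D' (T' y)))) <= d / 2"
    using Cons.IH[OF zs d2] by (elim bexE) (rule that, assumption+, blast)
  have f: "T x \<in> Z" "T' y \<in> Z'" using opD(2)[OF T(1) xy(1)] opD(2)[OF T(2) xy(2)] .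
  obtain b0 b1 where b01: "sbd (T x) b0" "sbd (T' y) b1" using f Z unfolding fspace_def by blast
  define b where "b = max b0 b1"
  have b: "sbd (T x) b" "sbd (T' y) b" "0 <= b"
    using b01 sbd_mono[of _ _ b] sbd_nonneg by (auto simp: b_def le_max_iff_disj)
  define e where "e = d / (4 * (b + 1))"
  have e: "0 < e" "e * b <= d / 4" using d2 b(3) by (auto simp: e_def field_simps)
  obtain D2 where D2: "D2 \<in> \<A>" "!!D. D \<in> \<A> ==> D2 \<subseteq> D ==> sbd (\<lambda>p. T x p - cut D (T x) p) e"
    using exhD(4)[OF A(1) xy(1) e(1)] by blast
  obtain D2' where D2': "D2' \<in> \<A>'" "!!D. D \<in> \<A>' ==> D2' \<subseteq> D ==> sbd (\<lambda>p. T' y p - cut D (T' y) p) e"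
    using exhD(4)[OF A(2) xy(2) e(1)] by blast
  show ?case
  proof (rule bexI[of _ "D1 \<union> D2"], rule bexI[of _ "D1' \<union> D2'"], intro ballI allI impI)
    show "D1 \<union> D2 \<in> \<A>" "D1' \<union> D2' \<in> \<A>'" using D1 D2 D2' exhD(2)[OF A(1)] exhD(2)[OF A(2)] by auto
    fix D D' \<psi> assume D: "D \<in> \<A>" "D' \<in> \<A>'" "D1 \<union> D2 \<subseteq> D" "D1' \<union> D2' \<subseteq> D'" and F: "form Z Z' \<psi> 1"
    let ?f = "T x" and ?g = "T' y"
    have c: "cut D ?f \<in> Z" "cut D' ?g \<in> Z'" using exhD(3)[OF A(1) D(1) f(1)] exhD(3)[OF A(2) D(2) f(2)] .
    let ?df = "\<lambda>p. ?f p + (-1) * cut D ?f p" and ?dg = "\<lambda>p. ?g p + (-1) * cut D' ?g p"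
    have m: "(\<lambda>p. (-1) * cut D ?f p) \<in> Z" "(\<lambda>p. (-1) * cut D' ?g p) \<in> Z'"
      by (rule fspace_scale[OF Z(1) c(1)], rule fspace_scale[OF Z(2) c(2)])
    have dm: "?df \<in> Z" "?dg \<in> Z'" by (rule fspace_add[OF Z(1) f(1) m(1)], rule fspace_add[OF Z(2) f(2) m(2)])
    have ds: "sbd ?df e" "sbd ?dg e" using D2(2)[of D] D2'(2)[of D'] D by auto
    have "\<psi> ?f ?g - \<psi> (cut D ?f) (cut D' ?g) = \<psi> ?df ?g + \<psi> (cut D ?f) ?dg"
    proof -
      have "\<psi> ?df ?g = \<psi> ?f ?g + (-1) * \<psi> (cut D ?f) ?g"
        using formD(2)[OF F f(1) m(1) f(2)] formD(3)[OF F c(1) f(2), of "-1"] by simp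
      moreover have "\<psi> (cut D ?f) ?dg = \<psi> (cut D ?f) ?g + (-1) * \<psi> (cut D ?f) (cut D' ?g)"
        using formD(4)[OF F c(1) f(2) m(2)] formD(5)[OF F c, of "-1"] by simp
      ultimately show ?thesis by simp
    qed
    moreover have "norm (\<psi> ?df ?g) <= 1 * e * b" by (rule formD(6)[OF F dm(1) f(2) ds(1) b(2)])
    moreover have "norm (\<psi> (cut D ?f) ?dg) <= 1 * b * e" by (rule formD(6)[OF F c(1) dm(2) sbd_cut[OF b(1)] ds(2)])
    ultimately have "norm (\<psi> ?f ?g - \<psi> (cut D ?f) (cut D' ?g)) <= d / 4 + d / 4"
      using e(2) norm_triangle_ineq[of "\<psi> ?df ?g" "\<psi> (cut D ?f) ?dg"] by (simp add: mult.commute)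
    moreover have "norm ((\<Sum>(x, y)\<leftarrow>zs. \<psi> (T x) (T' y)) - (\<Sum>(x, y)\<leftarrow>zs. \<psi> (cut D (T x)) (cut D' (T' y)))) <= d / 2"
      using D1(3)[of D D' \<psi>] D F by auto
    ultimately have "norm ((\<psi> ?f ?g - \<psi> (cut D ?f) (cut D' ?g)) + ((\<Sum>(x, y)\<leftarrow>zs. \<psi> (T x) (T' y)) - (\<Sum>(x, y)\<leftarrow>zs. \<psi> (cut D (T x)) (cut D' (T' y))))) <= d"
      using norm_triangle_mono by fastforce
    thus "norm ((\<Sum>(x, y)\<leftarrow>z # zs. \<psi> (T x) (T' y)) - (\<Sum>(x, y)\<leftarrow>z # zs. \<psi> (cut D (T x)) (cut D' (T' y)))) <= d"
      by (simp add: z algebra_simps)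
  qed
qed

lemma tail_w:
  assumes T: "op X Z T C" "op Y Z' T' C'" and Z: "fspace Z" "fspace Z'"
    and A: "exh \<A> X Z T" "exh \<A>' Y Z' T'" and E: "hist E" "E ~= {}" and "0 < d"
  shows "\<exists>D0\<in>\<A>. \<exists>D0'\<in>\<A>'. \<forall>D\<in>\<A>. \<forall>D'\<in>\<A>'. D0 \<subseteq> D --> D0' \<subseteq> D' --> (\<forall>\<psi>. form Z Z' \<psi> 1 -->
    norm (w E (pull \<psi> T T') - w E (pull \<psi> (\<lambda>x. cut D (T x)) (\<lambda>y. cut D' (T' y)))) <= d)"
proof -
  have CC: "0 <= C * C'" using opD(1)[OF T(1)] opD(1)[OF T(2)] by simp
  define e where "e = d / (4 * (C * C' + 1))"
  have e: "0 < e" "e * (C * C') <= d / 4" using \<open>0 < d\<close> CC by (auto simp: e_def field_simps)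
  obtain zs where zs: "set zs \<subseteq> X \<times> Y" "!!\<phi> B. form X Y \<phi> B ==> norm (w E \<phi> - (\<Sum>(x, y)\<leftarrow>zs. \<phi> x y)) <= e * B"
    using w_tensor[OF E e(1)] by blast
  obtain D0 D0' where D0: "D0 \<in> \<A>" "D0' \<in> \<A>'" "!!D D' \<psi>. D \<in> \<A> ==> D' \<in> \<A>' ==> D0 \<subseteq> D ==> D0' \<subseteq> D' ==> form Z Z' \<psi> 1 ==>
    norm ((\<Sum>(x, y)\<leftarrow>zs. \<psi> (T x) (T' y)) - (\<Sum>(x, y)\<leftarrow>zs. \<psi> (cut D (T x)) (cut D' (T' y)))) <= d / 2"
    using tail_list[OF T Z A zs(1) half_gt_zero[OF \<open>0 < d\<close>]] by (elim bexE) (rule that, assumption+, blast)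
  show ?thesis
  proof (intro bexI[OF _ D0(1)] bexI[OF _ D0(2)] ballI allI impI)
    fix D D' \<psi> assume D: "D \<in> \<A>" "D' \<in> \<A>'" "D0 \<subseteq> D" "D0' \<subseteq> D'" and F: "form Z Z' \<psi> 1"
    let ?\<phi> = "pull \<psi> T T'" and ?\<phi>' = "pull \<psi> (\<lambda>x. cut D (T x)) (\<lambda>y. cut D' (T' y))"
    let ?s = "\<lambda>\<phi>. \<Sum>(x, y)\<leftarrow>zs. \<phi> x y"
    have F1: "form X Y ?\<phi> (1 * C * C')" by (rule form_pull[OF F T])
    have F2: "form X Y ?\<phi>' (1 * C * C')"
      by (rule form_pull[OF F op_cut_comp[OF T(1) exhD(3)[OF A(1) D(1)]] op_cut_comp[OF T(2) exhD(3)[OF A(2) D(2)]]])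
    have "norm (?s ?\<phi> - ?s ?\<phi>') <= d / 2" using D0(3)[OF D F] by (simp add: pull_def)
    moreover have "norm (w E ?\<phi> - ?s ?\<phi>) <= d / 4" "norm (w E ?\<phi>' - ?s ?\<phi>') <= d / 4"
      using zs(2)[OF F1] zs(2)[OF F2] e(2) by auto
    ultimately have "norm (((w E ?\<phi> - ?s ?\<phi>) - (w E ?\<phi>' - ?s ?\<phi>')) + (?s ?\<phi> - ?s ?\<phi>')) <= (d / 4 + d / 4) + d / 2"
      by (meson add_mono norm_triangle_ineq norm_triangle_ineq4 order_trans)
    thus "norm (w E ?\<phi> - w E ?\<phi>') <= d" by (simp add: algebra_simps)
  qed
qed

text \<open>\<open>EE H\<close> and \<open>EE' H\<close> carry all tensors whose index is a
  non-empty part of H, up to an error that decays with the size of the index fast enough to be paid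
  from the budget \<open>er\<close>. Monotonicity in H gives sense to the increments of the supports
  along blocks.\<close>

definition tailed :: "omega1 set set => omega1 set set => 'k fn set => _ => 'k fn set => _ => real =>
    (nat set => omega1 set) => (nat set => omega1 set) => bool" where
  "tailed \<A> \<A>' Z T Z' T' e EE EE' \<longleftrightarrow> (\<forall>H. EE H \<in> \<A> \<and> EE' H \<in> \<A>') \<and>
    (\<forall>H H'. finite H' --> H \<subseteq> H' --> EE H \<subseteq> EE H' \<and> EE' H \<subseteq> EE' H') \<and>
    (\<forall>H E D D' \<psi>. hist H --> E \<subseteq> H --> E ~= {} --> D \<in> \<A> --> D' \<in> \<A>' --> EE H \<subseteq> D --> EE' H \<subseteq> D' --> form Z Z' \<psi> 1 -->
      norm (w E (pull \<psi> T T') - w E (pull \<psi> (\<lambda>x. cut D (T x)) (\<lambda>y. cut D' (T' y)))) <= e / 2 ^ card E)"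

lemma tailedD:
  assumes "tailed \<A> \<A>' Z T Z' T' e EE EE'"
  shows "EE H \<in> \<A>" "EE' H \<in> \<A>'" "finite H' ==> H \<subseteq> H' ==> EE H \<subseteq> EE H'" "finite H' ==> H \<subseteq> H' ==> EE' H \<subseteq> EE' H'"
    "hist H ==> E \<subseteq> H ==> E ~= {} ==> D \<in> \<A> ==> D' \<in> \<A>' ==> EE H \<subseteq> D ==> EE' H \<subseteq> D' ==> form Z Z' \<psi> 1 ==>
      norm (w E (pull \<psi> T T') - w E (pull \<psi> (\<lambda>x. cut D (T x)) (\<lambda>y. cut D' (T' y)))) <= e / 2 ^ card E"
proof -
  note a = assms[unfolded tailed_def]
  show "EE H \<in> \<A>" "EE' H \<in> \<A>'" using a[THEN conjunct1] by simp_all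
  show "EE H \<subseteq> EE H'" "EE' H \<subseteq> EE' H'" if "finite H'" "H \<subseteq> H'" for H H'
    using a[THEN conjunct2, THEN conjunct1, rule_format, OF that] by simp_all
  show "norm (w E (pull \<psi> T T') - w E (pull \<psi> (\<lambda>x. cut D (T x)) (\<lambda>y. cut D' (T' y)))) <= e / 2 ^ card E"
    if "hist H" "E \<subseteq> H" "E ~= {}" "D \<in> \<A>" "D' \<in> \<A>'" "EE H \<subseteq> D" "EE' H \<subseteq> D'" "form Z Z' \<psi> 1"
    using a[THEN conjunct2, THEN conjunct2, rule_format, OF that] .
qed

lemma directed_Union:
  assumes "exh \<A> X0 Z T" "finite \<B>" "\<B> ~= {}" "\<B> \<subseteq> \<A>" shows "\<Union>\<B> \<in> \<A>"
  using assms(2-) by (induction rule: finite_ne_induct) (use exhD(2)[OF assms(1)] in auto)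

lemma tailed_ex:
  assumes T: "op X Z T C" "op Y Z' T' C'" and Z: "fspace Z" "fspace Z'"
    and A: "exh \<A> X Z T" "exh \<A>' Y Z' T'" and e: "0 < e"
  shows "\<exists>EE EE'. tailed \<A> \<A>' Z T Z' T' e EE EE'"
proof -
  have "\<exists>D0 D0'. D0 \<in> \<A> \<and> D0' \<in> \<A>' \<and> (hist E \<and> E ~= {} --> (\<forall>D\<in>\<A>. \<forall>D'\<in>\<A>'. D0 \<subseteq> D --> D0' \<subseteq> D' --> (\<forall>\<psi>. form Z Z' \<psi> 1 -->
      norm (w E (pull \<psi> T T') - w E (pull \<psi> (\<lambda>x. cut D (T x)) (\<lambda>y. cut D' (T' y)))) <= e / 2 ^ card E)))" for E
  proof (cases "hist E \<and> E ~= {}")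
    case True
    thus ?thesis using tail_w[OF T Z A, of E "e / 2 ^ card E"] e by auto
  next
    case False
    thus ?thesis using exhD(1)[OF A(1)] exhD(1)[OF A(2)] by blast
  qed
  then obtain D0 D0' where D0: "!!E. D0 E \<in> \<A>" "!!E. D0' E \<in> \<A>'"
    "!!E D D' \<psi>. hist E ==> E ~= {} ==> D \<in> \<A> ==> D' \<in> \<A>' ==> D0 E \<subseteq> D ==> D0' E \<subseteq> D' ==> form Z Z' \<psi> 1 ==>
      norm (w E (pull \<psi> T T') - w E (pull \<psi> (\<lambda>x. cut D (T x)) (\<lambda>y. cut D' (T' y)))) <= e / 2 ^ card E"
    by metis
  \<comment> \<open>The union over all subsets of H makes the supports monotone. The value for
    infinite H is a default; monotonicity is asserted for finite sets.\<close>
  define EE where "EE H = (if finite H then \<Union>(D0 ` Pow H) else D0 {})" for H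
  define EE' where "EE' H = (if finite H then \<Union>(D0' ` Pow H) else D0' {})" for H
  have "tailed \<A> \<A>' Z T Z' T' e EE EE'"
    unfolding tailed_def
  proof (intro conjI allI impI)
    fix H
    show "EE H \<in> \<A>" unfolding EE_def using D0(1) directed_Union[OF A(1), of "D0 ` Pow H"] by auto
    show "EE' H \<in> \<A>'" unfolding EE'_def using D0(2) directed_Union[OF A(2), of "D0' ` Pow H"] by auto
    fix H' :: "nat set" assume "finite H'" "H \<subseteq> H'"
    hence "finite H" "Pow H \<subseteq> Pow H'" using finite_subset by auto
    thus "EE H \<subseteq> EE H'" "EE' H \<subseteq> EE' H'"
      unfolding EE_def EE'_def using \<open>finite H'\<close> by (auto intro: Union_mono)
  next
    fix H E D D' \<psi>
    assume H: "hist H" "E \<subseteq> H" "E ~= {}" "D \<in> \<A>" "D' \<in> \<A>'" "EE H \<subseteq> D" "EE' H \<subseteq> D'" "form Z Z' \<psi> 1"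
    have "finite H" using H(1) by (simp add: hist_def)
    hence "D0 E \<subseteq> EE H" "D0' E \<subseteq> EE' H" using H(2) by (auto simp: EE_def EE'_def)
    moreover have "hist E" using H(1,2) finite_subset by (auto simp: hist_def)
    ultimately show "norm (w E (pull \<psi> T T') - w E (pull \<psi> (\<lambda>x. cut D (T x)) (\<lambda>y. cut D' (T' y)))) <= e / 2 ^ card E"
      using D0(3)[of E D D' \<psi>] H by auto
  qed
  thus ?thesis by blast
qed

end

section \<open>Null families of functionals\<close>

text \<open>\<open>tail_sum\<close> is what either game has to supply: errors e / 2^(card E) per
  index add up to at most \<open>e * er h F\<close> over a block, so that they telescope from block
  to block.\<close>

locale tgame = wfam X Y w + game cs S At \<rho> t s
  for X Y :: "(omega1 => 'k::real_normed_field) set" and w cs S At \<rho> t s +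
  assumes tail_sum: "0 <= e ==> (!!E. hist E ==> E ~= {} ==> E \<subseteq> U ==> norm (v E :: 'k) <= e / 2 ^ card E) ==>
    vb g \<zeta> h F ==> h \<union> F \<subseteq> U ==> norm (wsum v \<zeta> h F) <= e * er h F"
begin

abbreviation wp :: "(omega1, 'k) bform => omega1 => nat set => nat set => 'k" where
  "wp \<phi> \<equiv> wsum (\<lambda>E. w E \<phi>)"

lemma tgame_flip: "tgame Y X (\<lambda>E \<phi>. w E (flip \<phi>)) cs S At \<rho> t s"
  by (intro tgame.intro wfam_flip game_axioms tgame_axioms.intro tail_sum)

lemma wp_cong:
  assumes "vb g \<zeta> h F" "form X Y \<phi> B" "!!x y. x \<in> X ==> y \<in> Y ==> \<phi>' x y = \<phi> x y"
  shows "wp \<phi>' \<zeta> h F = wp \<phi> \<zeta> h F"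
  by (rule wsum_cong[OF assms(1)], rule w_cong[OF _ _ assms(2)]) (use assms(3) in auto)

lemma wp_add:
  assumes "vb g \<zeta> h F" "form X Y \<phi> B" "form X Y \<psi> C"
  shows "wp (\<lambda>x y. \<phi> x y + \<psi> x y) \<zeta> h F = wp \<phi> \<zeta> h F + wp \<psi> \<zeta> h F"
  unfolding wsum_add[symmetric] by (rule wsum_cong[OF assms(1)], rule w_add[OF _ _ assms(2,3)])

lemma wp_scale:
  assumes "vb g \<zeta> h F" "form X Y \<phi> B" shows "wp (\<lambda>x y. c * \<phi> x y) \<zeta> h F = c * wp \<phi> \<zeta> h F"
  unfolding wsum_scale[symmetric] by (rule wsum_cong[OF assms(1)], rule w_scale[OF _ _ assms(2)])

lemma wp_pull_add:
  assumes V: "vb g \<zeta> h F" and F: "form Z Z' \<psi> B" and T: "op X Z T1 C1" "op X Z T2 C2" "op Y Z' T' C'"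
    and eq: "!!x. x \<in> X ==> T x = (\<lambda>p. T1 x p + T2 x p)"
  shows "wp (pull \<psi> T T') \<zeta> h F = wp (pull \<psi> T1 T') \<zeta> h F + wp (pull \<psi> T2 T') \<zeta> h F"
proof -
  note F1 = form_pull[OF F T(1,3)] and F2 = form_pull[OF F T(2,3)]
  have "wp (pull \<psi> T T') \<zeta> h F = wp (\<lambda>x y. pull \<psi> T1 T' x y + pull \<psi> T2 T' x y) \<zeta> h F"
    by (rule wp_cong[OF V form_add[OF F1 F2]])
      (simp add: pull_def eq formD(2)[OF F opD(2)[OF T(1)] opD(2)[OF T(2)] opD(2)[OF T(3)]])
  thus ?thesis using wp_add[OF V F1 F2] by simp
qed

lemma wp_pull_add_right:
  assumes V: "vb g \<zeta> h F" and F: "form Z Z' \<psi> B" and T: "op X Z T C" "op Y Z' T1 C1" "op Y Z' T2 C2"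
    and eq: "!!y. y \<in> Y ==> T' y = (\<lambda>p. T1 y p + T2 y p)"
  shows "wp (pull \<psi> T T') \<zeta> h F = wp (pull \<psi> T T1) \<zeta> h F + wp (pull \<psi> T T2) \<zeta> h F"
proof -
  interpret F: tgame Y X "\<lambda>E \<phi>. w E (flip \<phi>)" cs S At \<rho> t s by (rule tgame_flip)
  have p: "flip (pull (\<lambda>g f. \<psi> f g) J T) = pull \<psi> T J" for J by (simp add: flip_def pull_def)
  show ?thesis using F.wp_pull_add[OF V form_flip[OF F] T(2,3,1) eq] by (simp add: p)
qed

lemma null_sum:
  assumes T: "op X Z T1 C1" "op X Z T2 C2" "op Y Z' T' C'"
    and n: "null \<zeta> (TV w Z T1 Z' T')" "null \<zeta> (TV w Z T2 Z' T')"
  shows "null \<zeta> (TV w Z (\<lambda>f p. T1 f p + T2 f p) Z' T')"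
proof (rule null_dominated[OF n, of 1])
  fix v assume "v \<in> TV w Z (\<lambda>f p. T1 f p + T2 f p) Z' T'"
  then obtain \<psi> where \<psi>: "form Z Z' \<psi> 1" "v = (\<lambda>E. w E (pull \<psi> (\<lambda>f p. T1 f p + T2 f p) T'))"
    by (auto simp: TV_def)
  have "norm (wsum v \<zeta> h F) <= 1 * (norm (wp (pull \<psi> T1 T') \<zeta> h F) + norm (wp (pull \<psi> T2 T') \<zeta> h F))"
    if "vb g \<zeta> h F" for g h F
    unfolding \<psi>(2) wp_pull_add[OF that \<psi>(1) T refl] by (simp add: norm_triangle_ineq)
  moreover have "(\<lambda>E. w E (pull \<psi> T1 T')) \<in> TV w Z T1 Z' T'" "(\<lambda>E. w E (pull \<psi> T2 T')) \<in> TV w Z T2 Z' T'"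
    using \<psi>(1) by (auto simp: TV_def)
  ultimately show "\<exists>v1\<in>TV w Z T1 Z' T'. \<exists>v2\<in>TV w Z T2 Z' T'. \<forall>g h F. vb g \<zeta> h F -->
      norm (wsum v \<zeta> h F) <= 1 * (norm (wsum v1 \<zeta> h F) + norm (wsum v2 \<zeta> h F))"
    by (intro bexI) auto
qed simp

lemma null_cong:
  assumes T: "op X Z T C" "op Y Z' T' C'" and n: "null \<zeta> (TV w Z T Z' T')" and eq: "!!f. f \<in> X ==> J f = T f"
  shows "null \<zeta> (TV w Z J Z' T')"
proof (rule null_dominated[OF n n, of 1])
  fix v assume "v \<in> TV w Z J Z' T'"
  then obtain \<psi> where \<psi>: "form Z Z' \<psi> 1" "v = (\<lambda>E. w E (pull \<psi> J T'))"
    by (auto simp: TV_def)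
  have "wsum v \<zeta> h F = wp (pull \<psi> T T') \<zeta> h F" if "vb g \<zeta> h F" for g h F
    unfolding \<psi>(2) by (rule wp_cong[OF that form_pull[OF \<psi>(1) T]]) (simp add: pull_def eq)
  hence "norm (wsum v \<zeta> h F) <= 1 * (norm (wp (pull \<psi> T T') \<zeta> h F) + norm (wp (pull \<psi> T T') \<zeta> h F))"
    if "vb g \<zeta> h F" for g h F using that by simp
  moreover have "(\<lambda>E. w E (pull \<psi> T T')) \<in> TV w Z T Z' T'" using \<psi>(1) by (auto simp: TV_def)
  ultimately show "\<exists>v1\<in>TV w Z T Z' T'. \<exists>v2\<in>TV w Z T Z' T'. \<forall>g h F. vb g \<zeta> h F -->
      norm (wsum v \<zeta> h F) <= 1 * (norm (wsum v1 \<zeta> h F) + norm (wsum v2 \<zeta> h F))"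
    by (intro bexI) auto
qed simp

text \<open>Moving J into the form gives a form of norm at most B; divided by B + 1, which is never
  0, it is an admissible test. Nullness is thus preserved up to the constant B + 1.\<close>

lemma null_comp:
  assumes T: "op X Z1 T C" "op Y Z' T' C'" and J: "op Z1 Z J B" and n: "null \<zeta> (TV w Z1 T Z' T')"
  shows "null \<zeta> (TV w Z (\<lambda>f. J (T f)) Z' T')"
proof (rule null_dominated[OF n n, of "B + 1"])
  have B: "0 <= B" by (rule opD(1)[OF J])
  thus "0 <= B + 1" by simp
  fix v assume "v \<in> TV w Z (\<lambda>f. J (T f)) Z' T'"
  then obtain \<psi> where \<psi>: "form Z Z' \<psi> 1" "v = (\<lambda>E. w E (pull \<psi> (\<lambda>f. J (T f)) T'))"
    by (auto simp: TV_def)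
  define \<psi>' where "\<psi>' = (\<lambda>f g. of_real (inverse (B + 1)) * \<psi> (J f) g)"
  have "form Z1 Z' (\<lambda>f g. \<psi> (J f) g) (1 * B * 1)" by (rule form_comp[OF \<psi>(1) J op_id])
  hence "form Z1 Z' \<psi>' (norm (of_real (inverse (B + 1)) :: 'k) * (1 * B * 1))"
    unfolding \<psi>'_def by (rule form_scale)
  moreover have "norm (of_real (inverse (B + 1)) :: 'k) * (1 * B * 1) <= 1"
    using B unfolding norm_of_real by (simp add: field_simps)
  ultimately have \<psi>': "form Z1 Z' \<psi>' 1" by (rule form_mono)
  have Beq: "of_real (B + 1) * (of_real (inverse (B + 1)) * z) = z" for z :: 'k
  proof -
    have "of_real (B + 1) * of_real (inverse (B + 1)) = (1::'k)"
      unfolding of_real_mult[symmetric] using B by simp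
    thus ?thesis by (metis mult.assoc mult_1)
  qed
  have "wsum v \<zeta> h F = of_real (B + 1) * wp (pull \<psi>' T T') \<zeta> h F" if V: "vb g \<zeta> h F" for g h F
    unfolding \<psi>(2) wp_scale[OF V form_pull[OF \<psi>' T], symmetric]
    by (rule arg_cong[of _ _ "\<lambda>\<phi>. wp \<phi> \<zeta> h F"]) (simp add: pull_def \<psi>'_def Beq del: of_real_add of_real_inverse)
  hence "norm (wsum v \<zeta> h F) <= (B + 1) * (norm (wp (pull \<psi>' T T') \<zeta> h F) + norm (wp (pull \<psi>' T T') \<zeta> h F))"
    if V: "vb g \<zeta> h F" for g h F
    using that B by (simp add: norm_mult del: of_real_add)
  moreover have "(\<lambda>E. w E (pull \<psi>' T T')) \<in> TV w Z1 T Z' T'" using \<psi>' by (auto simp: TV_def)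
  ultimately show "\<exists>v1\<in>TV w Z1 T Z' T'. \<exists>v2\<in>TV w Z1 T Z' T'. \<forall>g h F. vb g \<zeta> h F -->
      norm (wsum v \<zeta> h F) <= (B + 1) * (norm (wsum v1 \<zeta> h F) + norm (wsum v2 \<zeta> h F))"
    by (intro bexI) auto
qed

text \<open>Nullness respects sums, compositions and agreement on X, so among small operators it has
  to be verified only for the generators: rank one operators at level 0 and localised
  operators.\<close>

lemma null_sm_left:
  assumes "sm X \<xi> Z T" and T': "op Y Z' T' C'"
    and rank1: "!!Z z l C. \<xi> = 0 ==> fspace Z ==> z \<in> Z ==> fnl X l C ==> null \<zeta> (TV w Z (\<lambda>f p. l f * z p) Z' T')"
    and loc: "!!\<eta> R T C. \<eta> < \<xi> ==> ring_of_sets UNIV R ==> op X (Sp R) T C ==>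
      (!!D. D \<in> R ==> sm X \<eta> (Sp R) (\<lambda>f. cut D (T f))) ==> null \<zeta> (TV w (Sp R) T Z' T')"
  shows "null \<zeta> (TV w Z T Z' T')"
  using assms(1) rank1 loc
proof (induction rule: sm.induct)
  case (rank1 Z z l C)
  show ?case by (rule rank1.prems(1)) (use rank1 in auto)
next
  case (sum \<xi> Z T J)
  obtain C1 C2 where "op X Z T C1" "op X Z J C2" using sm_op[OF sum.hyps(1)] sm_op[OF sum.hyps(2)] by blast
  thus ?case
    by (rule null_sum[OF _ _ T' sum.IH(1)[OF sum.prems] sum.IH(2)[OF sum.prems]])
next
  case (comp \<xi> Z T Z1 J C)
  obtain C1 where "op X Z T C1" using sm_op[OF comp.hyps(1)] by blast
  thus ?case by (rule null_comp[OF _ T' comp.hyps(2) comp.IH[OF comp.prems]])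
next
  case (loc \<eta> \<xi> R T C)
  show ?case by (rule loc.prems(2)[OF loc.hyps])
next
  case (cong \<xi> Z T J)
  obtain C1 where "op X Z T C1" using sm_op[OF cong.hyps(1)] by blast
  thus ?case by (rule null_cong[OF _ T' cong.IH[OF cong.prems] cong.hyps(3)])
qed

lemma null_sm_right:
  assumes "sm Y \<xi> Z' T'" and T: "op X Z T C"
    and rank1: "!!Z' z l C'. \<xi> = 0 ==> fspace Z' ==> z \<in> Z' ==> fnl Y l C' ==> null \<zeta> (TV w Z T Z' (\<lambda>f p. l f * z p))"
    and loc: "!!\<eta> R T' C'. \<eta> < \<xi> ==> ring_of_sets UNIV R ==> op Y (Sp R) T' C' ==>
      (!!D. D \<in> R ==> sm Y \<eta> (Sp R) (\<lambda>f. cut D (T' f))) ==> null \<zeta> (TV w Z T (Sp R) T')"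
  shows "null \<zeta> (TV w Z T Z' T')"
proof -
  interpret F: tgame Y X "\<lambda>E \<phi>. w E (flip \<phi>)" cs S At \<rho> t s by (rule tgame_flip)
  show ?thesis
    using F.null_sm_left[OF assms(1) T, of \<zeta>, unfolded TV_flip, OF rank1 loc] .
qed

end

section \<open>Splitting along exhausting families\<close>

lemma (in wfam) tail_wE:
  assumes "tailed \<A> \<A>' Z T Z' T' e EE EE'" "hist H" "E \<subseteq> H" "E ~= {}" "form Z Z' \<psi> 1"
  shows "norm (w E (pull \<psi> T T') - w E (pull \<psi> (\<lambda>x. cut (EE H) (T x)) (\<lambda>y. cut (EE' H) (T' y)))) <= e / 2 ^ card E"
  by (rule tailedD(5)[OF assms(1-4) tailedD(1,2)[OF assms(1)] order_refl order_refl assms(5)])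

context tgame
begin

text \<open>For the history H one asks for accuracy e / 2^(card H), which \<open>er_ge\<close>
  charges to the budget. The family \<V> may depend on the history at which the block starts, in
  particular on the supports known then.\<close>

lemma null_diagonal:
  fixes e :: real and \<V> :: "nat set => (nat set => 'k) set"
  assumes "0 < e" "!!H. hist H ==> null \<eta> (\<V> H)"
  shows "\<exists>g. \<forall>h F. vb g \<eta> h F --> (\<forall>v\<in>\<V> h. norm (wsum v \<eta> h F) <= 2 * e * er h F)"
proof (rule vb_diagonal)
  fix H assume H: "hist H"
  have "0 < e * (1/2) ^ card H" using assms(1) by simp
  then obtain g where g: "!!F v. vb g \<eta> H F ==> v \<in> \<V> H ==> norm (wsum v \<eta> H F) <= e * (1/2) ^ card H"
    using nullD[OF assms(2)[OF H]] by metis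
  have "norm (wsum v \<eta> H F) <= 2 * e * er H F" if V: "vb g \<eta> H F" "v \<in> \<V> H" for F v
  proof -
    have "e * (1/2) ^ card H <= e * (2 * er H F)"
      using er_ge[OF H vbD(5,6,9)[OF V(1)]] assms(1) by (intro mult_left_mono) auto
    thus ?thesis using g[OF V] by simp
  qed
  thus "\<exists>g. \<forall>F. vb g \<eta> H F --> (\<forall>v\<in>\<V> H. norm (wsum v \<eta> H F) <= 2 * e * er H F)" by blast
qed

context
  fixes \<A> \<A>' Z T Z' T' e EE EE' C C'
  assumes tl: "tailed \<A> \<A>' Z T Z' T' e EE EE'" and e: "0 <= e"
    and T: "op X Z T C" "op Y Z' T' C'" and Z: "fspace Z" "fspace Z'"
    and A: "exh \<A> X Z T" "exh \<A>' Y Z' T'"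
begin

abbreviation "cT D \<equiv> \<lambda>x. cut D (T x)"
abbreviation "cT' D \<equiv> \<lambda>y. cut D (T' y)"

lemma EE_mono: "vb g \<zeta> h F ==> EE h \<subseteq> EE (h \<union> F)" "vb g \<zeta> h F ==> EE' h \<subseteq> EE' (h \<union> F)"
  using tailedD(3,4)[OF tl, of "h \<union> F" h] vbD(8)[of g \<zeta> h F] by (simp_all add: hist_def)

lemma op_cT: "op X Z (cT (EE H)) C" "op Y Z' (cT' (EE' H)) C'"
  "op X Z (cT (EE H - EE H')) C" "op Y Z' (cT' (EE' H - EE' H')) C'"
  by (rule op_cut_comp[OF T(1)] op_cut_comp[OF T(2)];
      rule exhD(3)[OF A(1) tailedD(1)[OF tl]] exhD(3)[OF A(2) tailedD(2)[OF tl]]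
        exh_Diff[OF A(1) Z(1) tailedD(1)[OF tl] tailedD(1)[OF tl]]
        exh_Diff[OF A(2) Z(2) tailedD(2)[OF tl] tailedD(2)[OF tl]]; assumption)+

lemma wp_tail:
  assumes V: "vb g \<zeta> h F" and F: "form Z Z' \<psi> 1"
  shows "norm (wp (pull \<psi> T T') \<zeta> h F - wp (pull \<psi> (cT (EE (h \<union> F))) (cT' (EE' (h \<union> F)))) \<zeta> h F) <= e * er h F"
  unfolding wsum_diff[symmetric]
  by (rule tail_sum[OF e _ V order_refl]) (rule tail_wE[OF tl vbD(8)[OF V] _ _ F])

lemma wp_split_left:
  assumes V: "vb g \<zeta> h F" and F: "form Z Z' \<psi> B" and T': "op Y Z' J K"
  shows "wp (pull \<psi> (cT (EE (h \<union> F))) J) \<zeta> h F =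
    wp (pull \<psi> (cT (EE (h \<union> F) - EE h)) J) \<zeta> h F + wp (pull \<psi> (cT (EE h)) J) \<zeta> h F"
proof (rule wp_pull_add[OF V F op_cT(3) op_cT(1) T'])
  fix x
  have "EE (h \<union> F) = (EE (h \<union> F) - EE h) \<union> EE h" using EE_mono(1)[OF V] by blast
  thus "cut (EE (h \<union> F)) (T x) = (\<lambda>p. cut (EE (h \<union> F) - EE h) (T x) p + cut (EE h) (T x) p)"
    using cut_Un_disjoint[of "EE (h \<union> F) - EE h" "EE h" "T x"] by auto
qed

lemma wp_split_right:
  assumes V: "vb g \<zeta> h F" and F: "form Z Z' \<psi> B" and J: "op X Z J K"
  shows "wp (pull \<psi> J (cT' (EE' (h \<union> F)))) \<zeta> h F =
    wp (pull \<psi> J (cT' (EE' (h \<union> F) - EE' h))) \<zeta> h F + wp (pull \<psi> J (cT' (EE' h))) \<zeta> h F"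
proof (rule wp_pull_add_right[OF V F J op_cT(4) op_cT(2)])
  fix y
  have "EE' (h \<union> F) = (EE' (h \<union> F) - EE' h) \<union> EE' h" using EE_mono(2)[OF V] by blast
  thus "cut (EE' (h \<union> F)) (T' y) = (\<lambda>p. cut (EE' (h \<union> F) - EE' h) (T' y) p + cut (EE' h) (T' y) p)"
    using cut_Un_disjoint[of "EE' (h \<union> F) - EE' h" "EE' h" "T' y"] by auto
qed

text \<open>Write U, U' for the supports at the end and h, h' for those at the start of the block.
  Then U x U' is the sum of (U - h) x U', h x (U' - h') and h x h'. The last product is known when
  the block starts, so the hypothesis makes it small. Of the budget 3 e, the tail uses e and this
  product 2 e.\<close>

lemma split_three:
  assumes e0: "0 < e" and n: "!!H. hist H ==> null \<eta> (TV w Z (cT (EE H)) Z' (cT' (EE' H)))"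
  shows "\<exists>g. \<forall>h F. vb g \<eta> h F --> (\<forall>\<psi>. form Z Z' \<psi> 1 --> norm (wp (pull \<psi> T T') \<eta> h F) <= 3 * e * er h F +
    norm (wp (pull \<psi> (cT (EE (h \<union> F) - EE h)) (cT' (EE' (h \<union> F)))) \<eta> h F) +
    norm (wp (pull \<psi> (cT (EE h)) (cT' (EE' (h \<union> F) - EE' h))) \<eta> h F))"
proof -
  obtain g where g: "!!h F v. vb g \<eta> h F ==> v \<in> TV w Z (cT (EE h)) Z' (cT' (EE' h)) ==>
      norm (wsum v \<eta> h F) <= 2 * e * er h F"
    using null_diagonal[OF e0, of \<eta> "\<lambda>H. TV w Z (cT (EE H)) Z' (cT' (EE' H))"] n by blast
  show ?thesis
  proof (intro exI[of _ g] allI impI)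
    fix h F \<psi> assume V: "vb g \<eta> h F" and F: "form Z Z' \<psi> 1"
    let ?U = "EE (h \<union> F)" and ?U' = "EE' (h \<union> F)"
    let ?a = "wp (pull \<psi> T T') \<eta> h F" and ?b = "wp (pull \<psi> (cT ?U) (cT' ?U')) \<eta> h F"
      and ?c = "wp (pull \<psi> (cT (?U - EE h)) (cT' ?U')) \<eta> h F"
      and ?d = "wp (pull \<psi> (cT (EE h)) (cT' (?U' - EE' h))) \<eta> h F"
      and ?f = "wp (pull \<psi> (cT (EE h)) (cT' (EE' h))) \<eta> h F"
    have "?b = ?c + (?d + ?f)"
      unfolding wp_split_left[OF V F op_cT(2)] wp_split_right[OF V F op_cT(1)] ..
    hence eq: "(?a - ?b) + (?c + (?d + ?f)) = ?a" by simp
    have "norm ((?a - ?b) + (?c + (?d + ?f))) <= norm (?a - ?b) + (norm ?c + (norm ?d + norm ?f))"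
      by (rule norm_triangle_mono[OF order_refl norm_triangle_mono[OF order_refl norm_triangle_ineq]])
    hence "norm ?a <= norm (?a - ?b) + (norm ?c + (norm ?d + norm ?f))" unfolding eq .
    moreover have "norm (?a - ?b) <= e * er h F" by (rule wp_tail[OF V F])
    moreover have "norm ?f <= 2 * e * er h F" by (rule g[OF V]) (use F in \<open>auto simp: TV_def\<close>)
    ultimately show "norm ?a <= 3 * e * er h F + norm ?c + norm ?d" by simp
  qed
qed

text \<open>Here only (U - h) x (U' - h') is left over. The rest of U x U' is U x h' - h x h' + h x
  U', where every product has one factor cut by a support known at the start; the cut of the other
  factor is absorbed into the form. The tail costs e and each of the three products 2 e, which gives
  7 e.\<close>

lemma split_four:
  assumes e0: "0 < e" and n: "!!H. hist H ==> null \<eta> (TV w Z T Z' (cT' (EE' H)))"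
    "!!H. hist H ==> null \<eta> (TV w Z (cT (EE H)) Z' T')"
  shows "\<exists>g. \<forall>h F. vb g \<eta> h F --> (\<forall>\<psi>. form Z Z' \<psi> 1 --> norm (wp (pull \<psi> T T') \<eta> h F) <= 7 * e * er h F +
    norm (wp (pull \<psi> (cT (EE (h \<union> F) - EE h)) (cT' (EE' (h \<union> F) - EE' h))) \<eta> h F))"
proof -
  obtain g1 where g1: "!!h F v. vb g1 \<eta> h F ==> v \<in> TV w Z T Z' (cT' (EE' h)) ==>
      norm (wsum v \<eta> h F) <= 2 * e * er h F"
    using null_diagonal[OF e0, of \<eta> "\<lambda>H. TV w Z T Z' (cT' (EE' H))"] n(1) by blast
  obtain g2 where g2: "!!h F v. vb g2 \<eta> h F ==> v \<in> TV w Z (cT (EE h)) Z' T' ==>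
      norm (wsum v \<eta> h F) <= 2 * e * er h F"
    using null_diagonal[OF e0, of \<eta> "\<lambda>H. TV w Z (cT (EE H)) Z' T'"] n(2) by blast
  show ?thesis
  proof (intro exI[of _ "\<lambda>H. max (g1 H) (g2 H)"] allI impI)
    fix h F \<psi> assume V: "vb (\<lambda>H. max (g1 H) (g2 H)) \<eta> h F" and F: "form Z Z' \<psi> 1"
    have V1: "vb g1 \<eta> h F" and V2: "vb g2 \<eta> h F" using V by (auto elim!: vb_mono)
    have cA: "cut D f \<in> Z" if "f \<in> Z" "D \<in> \<A>" for D f using exhD(3)[OF A(1)] that by blast
    have cA': "cut D f \<in> Z'" if "f \<in> Z'" "D \<in> \<A>'" for D f using exhD(3)[OF A(2)] that by blast
    let ?U = "EE (h \<union> F)" and ?U' = "EE' (h \<union> F)"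
    let ?a = "wp (pull \<psi> T T') \<eta> h F" and ?b = "wp (pull \<psi> (cT ?U) (cT' ?U')) \<eta> h F"
      and ?c = "wp (pull \<psi> (cT (?U - EE h)) (cT' (?U' - EE' h))) \<eta> h F"
      and ?c1 = "wp (pull \<psi> (cT (?U - EE h)) (cT' (EE' h))) \<eta> h F"
      and ?d = "wp (pull \<psi> (cT (EE h)) (cT' ?U')) \<eta> h F"
      and ?u = "wp (pull \<psi> (cT ?U) (cT' (EE' h))) \<eta> h F"
      and ?f = "wp (pull \<psi> (cT (EE h)) (cT' (EE' h))) \<eta> h F"
    have "?b = ?c + ?c1 + ?d"
      unfolding wp_split_left[OF V F op_cT(2)] wp_split_right[OF V F op_cT(3)] ..
    moreover have "?u = ?c1 + ?f" by (rule wp_split_left[OF V F op_cT(2)])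
    ultimately have eq: "(?a - ?b) + ?c + ((?u - ?f) + ?d) = ?a" by simp
    have "norm ((?a - ?b) + ?c + ((?u - ?f) + ?d)) <= norm (?a - ?b) + norm ?c + ((norm ?u + norm ?f) + norm ?d)"
      by (rule norm_triangle_mono[OF norm_triangle_ineq norm_triangle_mono[OF norm_triangle_ineq4 order_refl]])
    hence "norm ?a <= norm (?a - ?b) + norm ?c + ((norm ?u + norm ?f) + norm ?d)" unfolding eq .
    moreover have "norm (?a - ?b) <= e * er h F" by (rule wp_tail[OF V F])
    moreover have "norm ?u <= 2 * e * er h F"
    proof (rule g1[OF V1])
      have "form Z Z' (\<lambda>f g. \<psi> (cut ?U f) g) (1 * 1 * 1)"
        by (rule form_comp[OF F op_cut op_id]) (rule cA[OF _ tailedD(1)[OF tl]])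
      thus "(\<lambda>E. w E (pull \<psi> (cT ?U) (cT' (EE' h)))) \<in> TV w Z T Z' (cT' (EE' h))"
        unfolding TV_def by (auto intro!: exI[of _ "\<lambda>f g. \<psi> (cut ?U f) g"] simp: pull_def)
    qed
    moreover have "norm (wp (pull \<psi> (cT (EE h)) (cT' (EE' H))) \<eta> h F) <= 2 * e * er h F" for H
    proof (rule g2[OF V2])
      have "form Z Z' (\<lambda>f g. \<psi> f (cut (EE' H) g)) (1 * 1 * 1)"
        by (rule form_comp[OF F op_id op_cut]) (rule cA'[OF _ tailedD(2)[OF tl]])
      thus "(\<lambda>E. w E (pull \<psi> (cT (EE h)) (cT' (EE' H)))) \<in> TV w Z (cT (EE h)) Z' T'"
        unfolding TV_def by (auto intro!: exI[of _ "\<lambda>f g. \<psi> f (cut (EE' H) g)"] simp: pull_def)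
    qed
    from this[of "h \<union> F"] this[of h] have "norm ?d <= 2 * e * er h F" "norm ?f <= 2 * e * er h F" .
    ultimately show "norm ?a <= 7 * e * er h F + norm ?c" by simp
  qed
qed

end

end

section \<open>The two games of a functional family\<close>

text \<open>The two kinds of bounds that survive the passage to unions of blocks.\<close>

definition (in game) dominated :: "(nat set => nat) => omega1 => (nat set => 'b::real_normed_field) => real => bool" where
  "dominated g \<zeta> v b \<longleftrightarrow> (\<exists>A. superadd A \<and> (\<forall>h F. A h F <= b) \<and>
    (\<forall>h F. vb g \<zeta> h F --> norm (wsum v \<zeta> h F) <= A h F))"

text \<open>The two roots belong to the increments of the left and of the right supports, and a, b
  bound them over the whole game; \<open>3 * e\<close> is the budget of
  \<open>split_three\<close>.\<close>

definition (in game) root_dominated ::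
  "(nat set => nat) => omega1 => (nat set => 'b::real_normed_field) => real => real => real => bool" where
  "root_dominated g \<zeta> v e a b \<longleftrightarrow> (\<exists>M M'. superadd M \<and> superadd M' \<and>
    (\<forall>h F. M h F <= a\<^sup>2) \<and> (\<forall>h F. M' h F <= b\<^sup>2) \<and>
    (\<forall>h F. vb g \<zeta> h F --> norm (wsum v \<zeta> h F) <= 3 * e * er h F + sqrt (M h F) + sqrt (M' h F)))"

lemma blk_zero: "blk cs At 0 F ==> At F"
  by (erule blk.cases) (use osuc_pos[THEN less_imp_neq] in \<open>auto simp: is_limit_def\<close>)

lemma segs_singleton: "segs {k} = {{k}}"
  by (auto simp: segs_def init_seg_def)

lemma sqrt_recip: "1 / sqrt (real m) * sqrt (real m) <= 1"
  by simp

locale wgame = wfam X Y w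
  for X Y :: "(omega1 => 'k::real_normed_field) set" and w +
  fixes cs :: "omega1 => nat => omega1" and \<xi> :: omega1 and c :: real
  assumes cs: "characteristic_sequences cs" and gb: "grothendieck_bound TYPE('k) c" "0 <= c"
begin

lemma wgame_flip: "wgame Y X (\<lambda>E \<phi>. w E (flip \<phi>)) cs c"
  by (intro wgame.intro wfam_flip wgame_axioms.intro cs gb)

end

sublocale wgame \<subseteq> P: tgame X Y w cs "schreier cs" atom "\<lambda>m. 1 / real m" "p_mem cs" "\<lambda>_. 1"
proof -
  have g: "game cs (schreier cs) atom (\<lambda>m. 1 / real m) (p_mem cs) (\<lambda>_. 1)"
  proof (intro game.intro weighted_hierarchy_p[OF cs] game_axioms.intro)
    show "(\<lambda>m. 1 / real m) \<longlonglongrightarrow> 0" by real_asymp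
    show "1 / real m <= 1" for m by (cases m) auto
  qed simp
  interpret P: game cs "schreier cs" atom "\<lambda>m. 1 / real m" "p_mem cs" "\<lambda>_. 1" by (rule g)
  show "tgame X Y w cs (schreier cs) atom (\<lambda>m. 1 / real m) (p_mem cs) (\<lambda>_. 1)"
  proof (intro tgame.intro wfam_axioms g tgame_axioms.intro)
    fix e :: real and U and v :: "nat set => 'k" and g \<zeta> h F
    assume e: "0 <= e" and v: "!!E. hist E ==> E ~= {} ==> E \<subseteq> U ==> norm (v E) <= e / 2 ^ card E"
      and V: "P.vb g \<zeta> h F" "h \<union> F \<subseteq> U"
    show "norm (P.wsum v \<zeta> h F) <= e * er h F"
    proof (rule P.wsum_le[OF P.superadd_er[OF e] _ V])
      fix h F assume V: "P.vb g 0 h F" "h \<union> F \<subseteq> U"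
      note D = P.vbD[OF V(1)]
      obtain k where F: "F = {k}" using blk_zero[OF D(3)] by (auto simp: atom_def)
      \<comment> \<open>One new element halves the remaining budget, so \<open>er\<close> equals
        2^(-card(h \<union> F)) here, exactly the permitted error of the single index.\<close>
      have "card (h \<union> F) = Suc (card h)" using D(1,9) by (simp add: F hist_def)
      hence "e / 2 ^ card (h \<union> F) = e * er h F" by (simp add: er_def power_divide)
      thus "norm (P.wsum v 0 h F) <= e * er h F"
        using v[OF D(8) _ V(2)] by (simp add: P.wsum_zero segs_singleton F)
    qed
  qed
qed

context wgame
begin

lemma P_zero:
  assumes "P.vb g 0 h F"
  obtains k where "F = {k}" "g h <= k" "P.wsum v 0 h F = v (insert k h)"
proof -
  note D = P.vbD[OF assms]
  obtain k where F: "F = {k}" using blk_zero[OF D(3)] by (auto simp: atom_def)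
  have "(h \<union> F) \<inter> {..<k} = h" using D(2,6) by (auto simp: F set_less_def)
  hence "g h <= k" using D(4) by (simp add: sparse_def F)
  thus thesis using that[OF F] by (simp add: F P.wsum_zero segs_singleton)
qed

text \<open>With \<rho> m = 1/m a block of the first game is an average of its pieces, so bounds for
  single values of w hold on all levels.\<close>

lemma P_bound:
  assumes F: "form X Y \<phi> B" and V: "P.vb g \<zeta> h F" shows "norm (P.wp \<phi> \<zeta> h F) <= B"
proof (rule P.wsum_le_average[OF _ _ _ V])
  show "0 <= B" by (rule formD(1)[OF F])
  show "1 / real m * real m <= 1" for m by simp
  fix h F assume V: "P.vb g 0 h F"
  obtain k where "F = {k}" "P.wp \<phi> 0 h F = w (insert k h) \<phi>" 
    by (rule P_zero[OF V, of "\<lambda>E. w E \<phi>"]) (rule that)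
  thus "norm (P.wp \<phi> 0 h F) <= B"
    using w_bound[OF _ _ F, of "insert k h"] P.vbD(8)[OF V] by simp
qed

text \<open>Disposes of the second increment when the right factor is not localised and all its
  supports are UNIV.\<close>

lemma P_cut_empty:
  assumes V: "P.vb g \<eta> h F" and F: "form Z Z' \<psi> B" and T: "op X Z T C" "op Y Z' T' C'" and Z: "fspace Z" "fspace Z'"
  shows "norm (P.wp (pull \<psi> T (\<lambda>y. cut {} (T' y))) \<eta> h F) <= 0"
proof (rule P_bound[OF form_cong[OF _ X Y] V])
  show "form X Y (\<lambda>_ _. 0) 0" by (simp add: form_def)
  have "cut {} (T' y) = (\<lambda>_. 0)" for y by (auto simp: cut_def)
  thus "pull \<psi> T (\<lambda>y. cut {} (T' y)) x y = 0" if "x \<in> X" for x y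
    using form_zero(2)[OF F opD(2)[OF T(1) that] fspace_zero[OF Z(2)]] by (simp add: pull_def)
qed

lemma P_estimate:
  assumes R: "ring_of_sets UNIV R" "ring_of_sets UNIV R'"
    and T: "op X (Sp R) T C" "op Y (Sp R') T' C'"
    and e: "0 < e"
    and A': "\<A>' = R' \<and> \<kappa> = 2 \<or> \<A>' = {UNIV} \<and> \<kappa> = 1"
    and n: "!!D D'. D \<in> R ==> D' \<in> \<A>' ==> P.null \<eta> (TV w (Sp R) (\<lambda>x. cut D (T x)) (Sp R') (\<lambda>y. cut D' (T' y)))"
  shows "\<exists>g. \<forall>\<psi>. form (Sp R) (Sp R') \<psi> 1 --> P.root_dominated g \<eta> (\<lambda>E. w E (pull \<psi> T T')) e
    (C * C' * (c * fnorm (Sp R) (Sp R') \<psi>)) ((\<kappa> - 1) * (C * C' * (c * fnorm (Sp R) (Sp R') \<psi>)))"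
proof -
  note Z = fspace_Sp[of R] fspace_Sp[of R']
  have A: "exh R X (Sp R) T" "exh \<A>' Y (Sp R') T'"
    using exh_Sp[OF R(1) T(1)] exh_Sp[OF R(2) T(2)] exh_UNIV A' by auto
  obtain EE EE' where tl: "tailed R \<A>' (Sp R) T (Sp R') T' e EE EE'"
    using tailed_ex[OF T Z A e] by blast
  obtain g where g: "!!h F \<psi>. P.vb g \<eta> h F ==> form (Sp R) (Sp R') \<psi> 1 ==>
    norm (P.wp (pull \<psi> T T') \<eta> h F) <= 3 * e * er h F +
    norm (P.wp (pull \<psi> (\<lambda>x. cut (EE (h \<union> F) - EE h) (T x)) (\<lambda>y. cut (EE' (h \<union> F)) (T' y))) \<eta> h F) +
    norm (P.wp (pull \<psi> (\<lambda>x. cut (EE h) (T x)) (\<lambda>y. cut (EE' (h \<union> F) - EE' h) (T' y))) \<eta> h F)"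
    using P.split_three[OF tl less_imp_le[OF e] T Z A e n[OF tailedD(1,2)[OF tl]]] by blast
  have C: "0 <= C * C'" using opD(1)[OF T(1)] opD(1)[OF T(2)] by simp
  interpret R: ring_of_sets UNIV R by (rule R)
  interpret R': ring_of_sets UNIV R' by (rule R)
  have dR: "EE H - EE H' \<in> R" for H H' using tailedD(1)[OF tl] by blast
  show ?thesis
  proof (intro exI[of _ g] allI impI)
    fix \<psi> :: "(omega1, 'k) bform" assume F: "form (Sp R) (Sp R') \<psi> 1"
    define b where "b = fnorm (Sp R) (Sp R') \<psi>"
    have Fb: "form (Sp R) (Sp R') \<psi> b" unfolding b_def by (rule form_fnorm[OF F Z])
    let ?f = "\<lambda>g f. \<psi> f g"
    have Fb': "form (Sp R') (Sp R) ?f b" by (rule form_flip[OF Fb])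
    define M where "M = (\<lambda>h F. (C * C')\<^sup>2 * mu R (Sp R') \<psi> (EE (h \<union> F) - EE h))"
    define M' where "M' = (\<lambda>h F. if \<kappa> = 2 then (C * C')\<^sup>2 * mu R' (Sp R) ?f (EE' (h \<union> F) - EE' h) else 0)"
    note mu = mu_nonneg[OF gb R(1,2) Fb] mu_le[OF gb R(1,2) Fb] mu_superadd[OF gb R(1,2) Fb] mu_ge[OF gb R(1,2) Fb]
    note mu' = mu_nonneg[OF gb R(2,1) Fb'] mu_le[OF gb R(2,1) Fb'] mu_superadd[OF gb R(2,1) Fb'] mu_ge[OF gb R(2,1) Fb']
    have sa: "P.superadd M"
      unfolding M_def
      by (rule P.superadd_set[of EE R, OF tailedD(1)[OF tl] tailedD(3)[OF tl] R(1)])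
        (use mu(1) mult_left_mono[OF mu(3), of _ _ "(C * C')\<^sup>2"] in \<open>auto simp: distrib_left\<close>)
    have sa': "P.superadd M'"
    proof (cases "\<kappa> = 2")
      case True
      hence "\<A>' = R'" using A' by auto
      hence t: "!!H. EE' H \<in> R'" using tailedD(2)[OF tl] by simp
      have "P.superadd (\<lambda>h F. (C * C')\<^sup>2 * mu R' (Sp R) ?f (EE' (h \<union> F) - EE' h))"
        by (rule P.superadd_set[of EE' R', OF t tailedD(4)[OF tl] R(2)])
          (use mu'(1) mult_left_mono[OF mu'(3), of _ _ "(C * C')\<^sup>2"] in \<open>auto simp: distrib_left\<close>)
      thus ?thesis using True by (simp add: M'_def)
    qed (simp add: M'_def P.superadd_def)
    have M: "M h F <= (C * C' * (c * b))\<^sup>2" for h F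
      unfolding M_def power_mult_distrib[of "C * C'"] by (rule mult_left_mono[OF mu(2)]) simp
    have M': "M' h F <= ((\<kappa> - 1) * (C * C' * (c * b)))\<^sup>2" for h F
    proof (cases "\<kappa> = 2")
      case True
      thus ?thesis
        unfolding M'_def power_mult_distrib[of "C * C'"] using mult_left_mono[OF mu'(2), of "(C * C')\<^sup>2"]
        by (simp add: power_mult_distrib)
    qed (simp add: M'_def)
    have est: "norm (P.wp (pull \<psi> T T') \<eta> h F) <= 3 * e * er h F + sqrt (M h F) + sqrt (M' h F)"
      if V: "P.vb g \<eta> h F" for h F
    proof -
      let ?U = "EE (h \<union> F)" and ?U' = "EE' (h \<union> F)"
      let ?Z = "Sp R :: 'k fn set" and ?Z' = "Sp R' :: 'k fn set"
      have oc: "op ?Z ?Z (cut (?U - EE h)) 1" "op ?Z ?Z (cut (EE h)) 1"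
        by (rule op_cut, erule Sp_cut'[OF R(1) _ dR], rule op_cut, erule Sp_cut'[OF R(1) _ tailedD(1)[OF tl]])
      have oc': "op ?Z' ?Z' (cut ?U') 1"
        using exhD(3)[OF A(2) tailedD(2)[OF tl]] by (rule op_cut)
      have "form (Sp R) (Sp R') (\<lambda>f g. \<psi> (cut (?U - EE h) f) g) (1 * 1 * 1)"
        by (rule form_comp[OF F oc(1) op_id])
      from form_comp[OF form_fnorm[OF this Z] op_id oc']
      have "form (Sp R) (Sp R') (\<lambda>f g. \<psi> (cut (?U - EE h) f) (cut ?U' g))
          (fnorm (Sp R) (Sp R') (\<lambda>f g. \<psi> (cut (?U - EE h) f) g))" by simp
      from form_mono[OF this mu(4)[OF dR]]
      have "norm (P.wp (pull (\<lambda>f g. \<psi> (cut (?U - EE h) f) (cut ?U' g)) T T') \<eta> h F) <=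
          sqrt (mu R (Sp R') \<psi> (?U - EE h)) * C * C'"
        by (rule P_bound[OF form_pull[OF _ T] V])
      also have "\<dots> = sqrt (M h F)"
        unfolding M_def real_sqrt_mult real_sqrt_abs using C by simp
      finally have 1: "norm (P.wp (pull \<psi> (\<lambda>x. cut (?U - EE h) (T x)) (\<lambda>y. cut ?U' (T' y))) \<eta> h F) <= sqrt (M h F)"
        by (simp add: pull_def)
      have 2: "norm (P.wp (pull \<psi> (\<lambda>x. cut (EE h) (T x)) (\<lambda>y. cut (?U' - EE' h) (T' y))) \<eta> h F) <= sqrt (M' h F)"
      proof (cases "\<kappa> = 2")
        case True
        hence "\<A>' = R'" using A' by auto
        hence t: "?U' - EE' h \<in> R'" using tailedD(2)[OF tl] by blast
        have oc2: "op ?Z' ?Z' (cut (?U' - EE' h)) 1"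
          using Sp_cut'[OF R(2) _ t] by (rule op_cut)
        have "form (Sp R) (Sp R') (\<lambda>f g. \<psi> f (cut (?U' - EE' h) g)) (1 * 1 * 1)"
          by (rule form_comp[OF F op_id oc2])
        from form_comp[OF form_fnorm[OF this Z] oc(2) op_id]
        have "form (Sp R) (Sp R') (\<lambda>f g. \<psi> (cut (EE h) f) (cut (?U' - EE' h) g))
            (fnorm (Sp R') (Sp R) (\<lambda>g f. \<psi> f (cut (?U' - EE' h) g)))"
          by (simp add: fnorm_flip[of "Sp R'"])
        from form_mono[OF this mu'(4)[OF t]]
        have "norm (P.wp (pull (\<lambda>f g. \<psi> (cut (EE h) f) (cut (?U' - EE' h) g)) T T') \<eta> h F) <=
            sqrt (mu R' (Sp R) ?f (?U' - EE' h)) * C * C'"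
          by (rule P_bound[OF form_pull[OF _ T] V])
        also have "\<dots> = sqrt (M' h F)"
          unfolding M'_def using C True by (simp add: real_sqrt_mult real_sqrt_abs)
        finally show ?thesis by (simp add: pull_def)
      next
        case False
        hence "\<A>' = {UNIV}" using A' by auto
        hence "?U' = UNIV" "EE' h = UNIV" using tailedD(2)[OF tl] by auto
        hence e: "?U' - EE' h = {}" by simp
        have "norm (P.wp (pull \<psi> (\<lambda>x. cut (EE h) (T x)) (\<lambda>y. cut (?U' - EE' h) (T' y))) \<eta> h F) <= 0"
          using P_cut_empty[OF V F op_comp[OF T(1) oc(2)] T(2) Z] unfolding e .
        thus ?thesis using False by (simp add: M'_def)
      qed
      show ?thesis using g[OF V F] 1 2 by simp
    qed
    show "P.root_dominated g \<eta> (\<lambda>E. w E (pull \<psi> T T')) e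
      (C * C' * (c * fnorm (Sp R) (Sp R') \<psi>)) ((\<kappa> - 1) * (C * C' * (c * fnorm (Sp R) (Sp R') \<psi>)))"
      using sa sa' M M' est unfolding b_def P.root_dominated_def by blast
  qed
qed

end

section \<open>Small operators give null families\<close>

context wgame
begin

lemma form_product:
  assumes l: "fnl X l C" and l': "fnl Y l' C'" shows "form X Y (\<lambda>x y. l x * l' y) (C * C')"
proof (rule formI)
  show "0 <= C * C'" using l l' by (simp add: fnl_def)
  fix f h a b assume *: "f \<in> X" "h \<in> Y" "sbd f a" "sbd h b"
  have "norm (l f) <= C * a" "norm (l' h) <= C' * b" using l l' * by (auto simp: fnl_def)
  hence "norm (l f) * norm (l' h) <= (C * a) * (C' * b)"
    using l sbd_nonneg[OF *(3)] by (intro mult_mono) (auto simp: fnl_def)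
  thus "norm (l f * l' h) <= C * C' * a * b" by (simp add: norm_mult mult_ac)
qed (use l l' in \<open>auto simp: fnl_def algebra_simps\<close>)

text \<open>For two rank one operators each test form reduces to the scalar \<psi> z z' times the
  fixed product of l and l'. The scalar is bounded uniformly in \<psi>, so weak nullness of the
  collection, applied to this single product and to each history, is enough. It is here that
  \<open>w_null\<close> gives smallness.\<close>

lemma P_null_base:
  assumes Z: "fspace Z" "z \<in> Z" and l: "fnl X l C" and Z': "fspace Z'" "z' \<in> Z'" and l': "fnl Y l' C'"
  shows "P.null 0 (TV w Z (\<lambda>f p. l f * z p) Z' (\<lambda>f p. l' f * z' p))"
  unfolding P.null_def
proof (intro allI impI)
  fix \<epsilon> :: real assume "0 < \<epsilon>"
  obtain b b' where b: "sbd z b" "sbd z' b'" using Z Z' unfolding fspace_def by blast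
  define K where "K = b * b' + 1"
  have K: "0 < K" "b * b' <= K" using sbd_nonneg[OF b(1)] sbd_nonneg[OF b(2)] by (simp_all add: K_def add_nonneg_pos)
  define \<phi>0 where "\<phi>0 = (\<lambda>x y. l x * l' y)"
  have \<phi>0: "form X Y \<phi>0 (C * C')"
    unfolding \<phi>0_def by (rule form_product[OF l l'])
  have "\<exists>g. \<forall>h F. P.vb g 0 h F --> norm (P.wp \<phi>0 0 h F) <= \<epsilon> / K"
  proof (rule P.vb_diagonal)
    fix H assume H: "hist H"
    have "\<forall>\<^sub>F k in sequentially. norm (w (insert k H) \<phi>0 - 0) < \<epsilon> / K"
      using w_null[OF H \<phi>0] \<open>0 < \<epsilon>\<close> K(1) unfolding tendsto_iff dist_norm by simp
    then obtain N where N: "!!k. N <= k ==> norm (w (insert k H) \<phi>0) < \<epsilon> / K"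
      by (auto simp: eventually_sequentially)
    have "norm (P.wp \<phi>0 0 H F) <= \<epsilon> / K" if V: "P.vb (\<lambda>_. N) 0 H F" for F
    proof -
      obtain k where "F = {k}" "N <= k" "P.wp \<phi>0 0 H F = w (insert k H) \<phi>0"
        by (rule P_zero[OF V, of "\<lambda>E. w E \<phi>0"]) (rule that)
      thus ?thesis using N[of k] by simp
    qed
    thus "\<exists>g. \<forall>F. P.vb g 0 H F --> norm (P.wp \<phi>0 0 H F) <= \<epsilon> / K" by blast
  qed
  then obtain g where g: "!!h F. P.vb g 0 h F ==> norm (P.wp \<phi>0 0 h F) <= \<epsilon> / K" by blast
  show "\<exists>g. \<forall>h F. P.vb g 0 h F --> (\<forall>v\<in>TV w Z (\<lambda>f p. l f * z p) Z' (\<lambda>f p. l' f * z' p). norm (P.wsum v 0 h F) <= \<epsilon>)"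
  proof (intro exI[of _ g] allI impI ballI)
    fix h F v assume V: "P.vb g 0 h F" and "v \<in> TV w Z (\<lambda>f p. l f * z p) Z' (\<lambda>f p. l' f * z' p)"
    then obtain \<psi> where F: "form Z Z' \<psi> 1" and v: "v = (\<lambda>E. w E (pull \<psi> (\<lambda>f p. l f * z p) (\<lambda>f p. l' f * z' p)))"
      by (auto simp: TV_def)
    have "pull \<psi> (\<lambda>f p. l f * z p) (\<lambda>f p. l' f * z' p) = (\<lambda>x y. \<psi> z z' * \<phi>0 x y)"
      using formD(3)[OF F Z(2) fspace_scale[OF Z']] formD(5)[OF F Z(2) Z'(2)]
      by (simp add: pull_def \<phi>0_def fun_eq_iff mult_ac)
    hence "P.wsum v 0 h F = \<psi> z z' * P.wp \<phi>0 0 h F"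
      unfolding v by (simp only:) (rule P.wp_scale[OF V \<phi>0])
    moreover have "norm (\<psi> z z') <= K" using formD(6)[OF F Z(2) Z'(2) b] K(2) by simp
    ultimately have "norm (P.wsum v 0 h F) <= K * (\<epsilon> / K)"
      using g[OF V] K(1) by (simp only: norm_mult) (intro mult_mono, auto)
    thus "norm (P.wsum v 0 h F) <= \<epsilon>" using K(1) by simp
  qed
qed

text \<open>Nullness of the cut operators on level \<mu> gives root bounds for the uncut ones on the
  same level. One further step turns these into \<epsilon> / m + 2 K / sqrt m with m the minimum of
  the block, which \<open>null_eventually\<close> absorbs.\<close>

lemma P_null_loc:
  assumes R: "ring_of_sets UNIV R" "ring_of_sets UNIV R'"
    and T: "op X (Sp R) T C" "op Y (Sp R') T' C'"
    and n: "!!D D'. D \<in> R ==> D' \<in> R' ==> P.null \<mu> (TV w (Sp R) (\<lambda>x. cut D (T x)) (Sp R') (\<lambda>y. cut D' (T' y)))"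
  shows "P.null (osuc \<mu>) (TV w (Sp R) T (Sp R') T')"
proof (rule P.null_eventually)
  define K where "K = C * C' * c"
  have K: "0 <= K" using opD(1)[OF T(1)] opD(1)[OF T(2)] gb(2) by (simp add: K_def)
  show "(\<lambda>m. 2 * K / sqrt (real m)) \<longlonglongrightarrow> 0" by real_asymp
  fix \<epsilon> :: real assume e: "0 < \<epsilon>"
  define e where "e = \<epsilon> / 3"
  have e3: "0 < e" using e by (simp add: e_def)
  note Z = fspace_Sp[of R] fspace_Sp[of R']
  obtain g where g: "!!\<psi>. form (Sp R) (Sp R') \<psi> 1 ==> P.root_dominated g \<mu> (\<lambda>E. w E (pull \<psi> T T')) e
    (C * C' * (c * fnorm (Sp R) (Sp R') \<psi>)) ((2 - 1) * (C * C' * (c * fnorm (Sp R) (Sp R') \<psi>)))"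
    using P_estimate[OF R T e3 disjI1[OF conjI[OF refl refl]] n] by blast
  show "\<exists>g. \<forall>h F. P.vb g (osuc \<mu>) h F -->
    (\<forall>v\<in>TV w (Sp R) T (Sp R') T'. norm (P.wsum v (osuc \<mu>) h F) <= \<epsilon> + 2 * K / sqrt (real (Min F)))"
  proof (intro exI[of _ g] allI impI ballI)
    fix h F v assume V: "P.vb g (osuc \<mu>) h F" and "v \<in> TV w (Sp R) T (Sp R') T'"
    then obtain \<psi> where F: "form (Sp R) (Sp R') \<psi> 1" and v: "v = (\<lambda>E. w E (pull \<psi> T T'))"
      by (auto simp: TV_def)
    obtain M M' where M: "P.superadd M" "P.superadd M'"
      "!!h F. M h F <= (C * C' * (c * fnorm (Sp R) (Sp R') \<psi>))\<^sup>2"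
      "!!h F. M' h F <= ((2 - 1) * (C * C' * (c * fnorm (Sp R) (Sp R') \<psi>)))\<^sup>2"
      "!!h F. P.vb g \<mu> h F ==> norm (P.wp (pull \<psi> T T') \<mu> h F) <= 3 * e * er h F + sqrt (M h F) + sqrt (M' h F)"
      using g[OF F] unfolding P.root_dominated_def by blast
    have b: "0 <= fnorm (Sp R) (Sp R') \<psi>" "fnorm (Sp R) (Sp R') \<psi> <= 1"
      by (rule fnorm_nonneg[OF F Z], rule fnorm_le[OF F Z])
    have "C * C' * (c * fnorm (Sp R) (Sp R') \<psi>) <= K * 1"
      unfolding K_def mult.assoc[symmetric] by (rule mult_left_mono[OF b(2)]) (use K in \<open>simp add: K_def\<close>)
    hence kb: "(C * C' * (c * fnorm (Sp R) (Sp R') \<psi>))\<^sup>2 <= K\<^sup>2"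
      using b(1) opD(1)[OF T(1)] opD(1)[OF T(2)] gb(2) by (intro power_mono) auto
    have rt: "sqrt (M h F) <= K" "sqrt (M' h F) <= K"
      using order_trans[OF M(3) kb, of h F] order_trans[OF M(4), of "K\<^sup>2" h F] kb K
      by (auto intro: real_le_lsqrt)
    let ?m = "real (Min F)"
    have m: "1 <= ?m" using P.vbD(5-7)[OF V] by (simp add: subset_iff)
    have "norm (P.wsum v (osuc \<mu>) h F) <= 1 / ?m * (3 * e * er h F + sqrt ?m * (sqrt (M h F) + sqrt (M' h F)))"
      unfolding v by (rule P.wsum_osuc_le[OF P.superadd_er M(1,2,5) V]) (use e3 in simp)
    also have "\<dots> <= 1 / ?m * (\<epsilon> + sqrt ?m * (K + K))"
    proof (intro mult_left_mono add_mono rt)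
      show "3 * e * er h F <= \<epsilon>" using er_le_1[of h F] e mult_left_mono[of "er h F" 1 \<epsilon>] by (simp add: e_def)
    qed auto
    also have "\<dots> = \<epsilon> / ?m + 2 * K / sqrt ?m"
      using m by (simp add: field_simps)
    also have "\<epsilon> / ?m <= \<epsilon>" using m e by (simp add: divide_le_eq)
    finally show "norm (P.wsum v (osuc \<mu>) h F) <= \<epsilon> + 2 * K / sqrt ?m" by simp
  qed
qed

lemma P_apriori:
  assumes "op X Z T C" "op Y Z' T' C'" "v \<in> TV w Z T Z' T'" "P.vb g \<zeta> h F"
  shows "norm (P.wsum v \<zeta> h F) <= C * C'"
proof -
  obtain \<psi> where "form Z Z' \<psi> 1" "v = (\<lambda>E. w E (pull \<psi> T T'))" using assms(3) by (auto simp: TV_def)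
  thus ?thesis using P_bound[OF form_pull[OF _ assms(1,2)] assms(4)] by fastforce
qed

text \<open>Both operators are reduced to generators. At level 0 both have rank one. Otherwise their
  localisations have levels \<eta>1, \<eta>2 < \<eta>; on the larger of the two all pairs of cuts
  are null by induction, one level higher the operators themselves are, and this level is still at
  most \<eta>, so nullness persists up to \<eta>.\<close>

theorem P_null: "sm X \<eta> Z T ==> sm Y \<eta> Z' T' ==> P.null \<eta> (TV w Z T Z' T')"
proof (induction \<eta> arbitrary: Z T Z' T' rule: less_induct)
  case (less \<eta>)
  obtain C' where T': "op Y Z' T' C'" using sm_op[OF less.prems(2)] by blast
  show ?case
  proof (rule P.null_sm_left[OF less.prems(1) T'])
    fix Z :: "'k fn set" and z l C assume 0: "\<eta> = 0" and Z: "fspace Z" "z \<in> Z" "fnl X l C"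
    obtain b where "sbd z b" using Z unfolding fspace_def by blast
    hence T: "op X Z (\<lambda>f p. l f * z p) (C * b)" by (rule op_rank1[OF Z(3,1,2)])
    show "P.null \<eta> (TV w Z (\<lambda>f p. l f * z p) Z' T')"
    proof (rule P.null_sm_right[OF less.prems(2) T])
      fix \<eta>' assume "\<eta>' < \<eta>" thus "P.null \<eta> Q" for Q :: "(nat set => 'k) set" using 0 omega1_zero_le[of \<eta>'] by (simp add: leD)
    qed (use P_null_base[OF Z] 0 in simp)
  next
    fix \<eta>1 R T C assume \<eta>1: "\<eta>1 < \<eta>" and R: "ring_of_sets UNIV R" and T: "op X (Sp R) T C"
      and s: "!!D. D \<in> R ==> sm X \<eta>1 (Sp R) (\<lambda>f. cut D (T f))"
    show "P.null \<eta> (TV w (Sp R) T Z' T')"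
    proof (rule P.null_sm_right[OF less.prems(2) T])
      show "P.null \<eta> Q" if "\<eta> = 0" for Q :: "(nat set => 'k) set" using that \<eta>1 omega1_zero_le[of \<eta>1] by (simp add: leD)
    next
      fix \<eta>2 R' T' C' assume \<eta>2: "\<eta>2 < \<eta>" and R': "ring_of_sets UNIV R'" and T': "op Y (Sp R') T' C'"
        and s': "!!D. D \<in> R' ==> sm Y \<eta>2 (Sp R') (\<lambda>f. cut D (T' f))"
      define \<mu> where "\<mu> = max \<eta>1 \<eta>2"
      have \<mu>: "\<mu> < \<eta>" using \<eta>1 \<eta>2 by (simp add: \<mu>_def)
      have "P.null (osuc \<mu>) (TV w (Sp R) T (Sp R') T')"
        by (rule P_null_loc[OF R R' T T'], rule less.IH[OF \<mu>]; rule sm_mono[OF s] sm_mono[OF s'];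
          simp add: \<mu>_def)
      thus "P.null \<eta> (TV w (Sp R) T (Sp R') T')"
        by (rule P.null_mono) (use \<mu> in \<open>simp add: osuc_le_iff\<close>, rule P_apriori[OF T T'])
    qed
  qed
qed

end

section \<open>The second game\<close>

sublocale wgame \<subseteq> Q: game cs "schreier2 cs \<xi>" "blk cs atom \<xi>" "\<lambda>m. 1 / sqrt (real m)" "q_mem cs \<xi>" "p_weight cs \<xi>"
proof (intro game.intro weighted_hierarchy_q[OF cs] game_axioms.intro)
  show "(\<lambda>m. 1 / sqrt (real m)) \<longlonglongrightarrow> 0" by real_asymp
  show "1 / sqrt (real m) <= 1" for m by (cases m) auto
qed simp

text \<open>The atoms of the second game are blocks of level \<xi> of the first, and on initial
  segments of such a block the extra weight p is the recursive weight of the first game.\<close>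

lemma (in wgame) Q_zero:
  assumes "Q.vb g 0 h F"
  shows "P.vb g \<xi> h F" "Q.wsum v 0 h F = P.wsum v \<xi> h F"
proof -
  note D = Q.vbD[OF assms]
  have b: "blk cs atom \<xi> F" by (rule blk_zero[OF D(3)])
  thus "P.vb g \<xi> h F" using D(1,2,4) by (simp add: P.vb_def)
  have "p_weight cs \<xi> E = p_mem cs \<xi> E" if "E \<in> segs F" for E
    using P.last_block_self[OF P.Union_block_segs(1,2)[OF b that]] by (simp add: p_weight_def)
  thus "Q.wsum v 0 h F = P.wsum v \<xi> h F" by (simp add: Q.wsum_zero P.wsum_def)
qed

sublocale wgame \<subseteq> Q: tgame X Y w cs "schreier2 cs \<xi>" "blk cs atom \<xi>" "\<lambda>m. 1 / sqrt (real m)" "q_mem cs \<xi>" "p_weight cs \<xi>"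
proof (intro tgame.intro wfam_axioms Q.game_axioms tgame_axioms.intro)
  fix e :: real and U and v :: "nat set => 'k" and g \<zeta> h F
  assume e: "0 <= e" and v: "!!E. hist E ==> E ~= {} ==> E \<subseteq> U ==> norm (v E) <= e / 2 ^ card E"
    and V: "Q.vb g \<zeta> h F" "h \<union> F \<subseteq> U"
  show "norm (Q.wsum v \<zeta> h F) <= e * er h F"
  proof (rule Q.wsum_le[OF Q.superadd_er[OF e] _ V])
    fix h F assume V: "Q.vb g 0 h F" "h \<union> F \<subseteq> U"
    show "norm (Q.wsum v 0 h F) <= e * er h F"
      unfolding Q_zero(2)[OF V(1)] by (rule P.tail_sum[OF e v Q_zero(1)[OF V(1)] V(2)])
  qed
qed

text \<open>A bounded superadditive bound is not enlarged by adding up the pieces, so the factor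
  \<rho>(Min F) is gained in full and tends to 0.\<close>

lemma (in game) null_osuc:
  assumes "0 <= B"
    and "!!\<epsilon>. 0 < \<epsilon> ==> \<exists>g. \<forall>v\<in>\<V>. dominated g \<zeta> v (\<epsilon> + B)"
  shows "null (osuc \<zeta>) \<V>"
proof (rule null_eventually)
  show "(\<lambda>m. \<rho> m * B) \<longlonglongrightarrow> 0" using tendsto_mult_left_zero[OF \<rho>_lim] .
  fix \<epsilon> :: real assume e: "0 < \<epsilon>"
  obtain g where g: "!!v. v \<in> \<V> ==> dominated g \<zeta> v (\<epsilon> + B)"
    using assms(2)[OF e] by blast
  show "\<exists>g. \<forall>h F. vb g (osuc \<zeta>) h F --> (\<forall>v\<in>\<V>. norm (wsum v (osuc \<zeta>) h F) <= \<epsilon> + \<rho> (Min F) * B)"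
  proof (intro exI[of _ g] allI impI ballI)
    fix h F v assume V: "vb g (osuc \<zeta>) h F" and v: "v \<in> \<V>"
    obtain A where A: "superadd A" "A h F <= \<epsilon> + B" "!!h F. vb g \<zeta> h F ==> norm (wsum v \<zeta> h F) <= A h F"
      using g[OF v] unfolding dominated_def by blast
    have z: "superadd (\<lambda>_ _. 0)" by (simp add: superadd_def)
    have "norm (wsum v (osuc \<zeta>) h F) <= \<rho> (Min F) * A h F"
      using wsum_osuc_le[OF A(1) z z _ V, of v] A(3) by simp
    also have "\<dots> <= \<rho> (Min F) * (\<epsilon> + B)" using A(2) \<rho>_nonneg by (rule mult_left_mono)
    also have "\<dots> <= \<epsilon> + \<rho> (Min F) * B"
      using mult_right_mono[OF \<rho>_le1, of \<epsilon> "Min F"] e by (simp add: distrib_left)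
    finally show "norm (wsum v (osuc \<zeta>) h F) <= \<epsilon> + \<rho> (Min F) * B" .
  qed
qed

lemma (in schreier_hierarchy) superadd_scale:
  "superadd A ==> 0 <= a ==> superadd (\<lambda>h F. a * A h F)"
  unfolding superadd_def by (simp add: distrib_left[symmetric] mult_left_mono)

context wgame
begin

text \<open>Smallness on level \<xi> of the first game can be charged to the telescoping budget for
  each atom of the second, and superadditive bounds carry over to every level \<zeta>.\<close>

lemma Q_null:
  fixes \<V> :: "(nat set => 'k) set"
  assumes "P.null \<xi> \<V>" shows "Q.null \<zeta> \<V>"
  unfolding Q.null_def
proof (intro allI impI)
  fix \<epsilon> :: real assume "0 < \<epsilon>"
  then obtain g where g: "!!h F v. P.vb g \<xi> h F ==> v \<in> \<V> ==> norm (P.wsum v \<xi> h F) <= 2 * (\<epsilon> / 2) * er h F"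
    using P.null_diagonal[of "\<epsilon> / 2" \<xi> "\<lambda>_. \<V>"] assms by auto
  show "\<exists>g. \<forall>h F. Q.vb g \<zeta> h F --> (\<forall>v\<in>\<V>. norm (Q.wsum v \<zeta> h F) <= \<epsilon>)"
  proof (intro exI[of _ g] allI impI ballI)
    fix h F v assume V: "Q.vb g \<zeta> h F" and v: "v \<in> \<V>"
    have "norm (Q.wsum v \<zeta> h F) <= \<epsilon> * er h F"
    proof (rule Q.wsum_le_sqrt[where M = "\<lambda>_ _. 0" and M' = "\<lambda>_ _. 0", simplified, OF Q.superadd_er _ _ _ V])
      fix h F assume V0: "Q.vb g 0 h F"
      thus "norm (Q.wsum v 0 h F) <= \<epsilon> * er h F" using g[OF Q_zero(1)[OF V0] v] by (simp add: Q_zero(2)[OF V0])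
    qed (use \<open>0 < \<epsilon>\<close> in \<open>auto simp: P.superadd_def\<close>)
    also have "\<dots> <= \<epsilon>" using er_le_1[of h F] \<open>0 < \<epsilon>\<close> by (simp add: mult_left_le)
    finally show "norm (Q.wsum v \<zeta> h F) <= \<epsilon>" .
  qed
qed

context
  fixes R R' \<A>' T T' C C' and \<kappa> :: real
  assumes R: "ring_of_sets UNIV R" "ring_of_sets UNIV R'"
    and T: "op X (Sp R) T C" "op Y (Sp R') T' C'"
    and A': "\<A>' = R' \<and> \<kappa> = 2 \<or> \<A>' = {UNIV} \<and> \<kappa> = 1"
    and n: "!!D D'. D \<in> R ==> D' \<in> \<A>' ==> P.null \<xi> (TV w (Sp R) (\<lambda>x. cut D (T x)) (Sp R') (\<lambda>y. cut D' (T' y)))"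
begin

lemma \<kappa>_nonneg: "0 <= \<kappa> * (C * C' * c)"
  using opD(1)[OF T(1)] opD(1)[OF T(2)] gb(2) A' by auto

text \<open>The weights 1/sqrt m preserve root bounds, so the estimate for atoms holds on all
  levels. It is kept proportional to the norm of \<psi> in order to be applied to \<psi> cut by the
  increments of both supports, where the norm depends on the block.\<close>

lemma Q_estimate:
  assumes e: "0 < e"
  shows "\<exists>g. \<forall>\<zeta> h F \<psi>. Q.vb g \<zeta> h F --> form (Sp R) (Sp R') \<psi> 1 -->
    norm (Q.wp (pull \<psi> T T') \<zeta> h F) <= 3 * e * er h F + \<kappa> * (C * C' * c) * fnorm (Sp R) (Sp R') \<psi>"
proof -
  obtain g where g: "!!\<psi>. form (Sp R) (Sp R') \<psi> 1 ==> P.root_dominated g \<xi> (\<lambda>E. w E (pull \<psi> T T')) e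
    (C * C' * (c * fnorm (Sp R) (Sp R') \<psi>)) ((\<kappa> - 1) * (C * C' * (c * fnorm (Sp R) (Sp R') \<psi>)))"
    using P_estimate[OF R T e A' n] by blast
  show ?thesis
  proof (intro exI[of _ g] allI impI)
    fix \<zeta> h F and \<psi> :: "(omega1, 'k) bform" assume V: "Q.vb g \<zeta> h F" and F: "form (Sp R) (Sp R') \<psi> 1"
    let ?b = "C * C' * (c * fnorm (Sp R) (Sp R') \<psi>)"
    have b: "0 <= ?b" "0 <= (\<kappa> - 1) * ?b"
      using fnorm_nonneg[OF F fspace_Sp fspace_Sp] opD(1)[OF T(1)] opD(1)[OF T(2)] gb(2) A' by auto
    obtain M M' where M: "P.superadd M" "P.superadd M'" "!!h F. M h F <= ?b\<^sup>2" "!!h F. M' h F <= ((\<kappa> - 1) * ?b)\<^sup>2"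
      "!!h F. P.vb g \<xi> h F ==> norm (P.wp (pull \<psi> T T') \<xi> h F) <= 3 * e * er h F + sqrt (M h F) + sqrt (M' h F)"
      using g[OF F] unfolding P.root_dominated_def by blast
    have "norm (Q.wp (pull \<psi> T T') \<zeta> h F) <= 3 * e * er h F + sqrt (M h F) + sqrt (M' h F)"
    proof (rule Q.wsum_le_sqrt[OF P.superadd_er M(1,2) sqrt_recip _ V])
      fix h F assume V0: "Q.vb g 0 h F"
      show "norm (Q.wp (pull \<psi> T T') 0 h F) <= 3 * e * er h F + sqrt (M h F) + sqrt (M' h F)"
        unfolding Q_zero(2)[OF V0] by (rule M(5)[OF Q_zero(1)[OF V0]])
    qed (use e in simp)
    moreover have "sqrt (M h F) <= ?b" "sqrt (M' h F) <= (\<kappa> - 1) * ?b"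
      by (rule real_le_lsqrt[OF b(1) M(3)] real_le_lsqrt[OF b(2) M(4)])+
    ultimately show "norm (Q.wp (pull \<psi> T T') \<zeta> h F) <= 3 * e * er h F + \<kappa> * (C * C' * c) * fnorm (Sp R) (Sp R') \<psi>"
      by (simp add: algebra_simps)
  qed
qed

text \<open>\<open>split_four\<close> leaves only the diagonal part, \<open>Q_estimate\<close>
  bounds it by a multiple of the norm of \<psi>(1_D . , 1_D' . ), and these norms are superadditive
  in the increments D, D'. Thus the l_2 bound of Grothendieck type becomes an l_1 bound.\<close>

lemma Q_block:
  assumes e: "0 < e"
    and n1: "!!D'. D' \<in> R' ==> Q.null \<zeta> (TV w (Sp R) T (Sp R') (\<lambda>y. cut D' (T' y)))"
    and n2: "!!D. D \<in> R ==> Q.null \<zeta> (TV w (Sp R) (\<lambda>x. cut D (T x)) (Sp R') T')"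
  shows "\<exists>g. \<forall>\<psi>. form (Sp R) (Sp R') \<psi> 1 --> 
    Q.dominated g \<zeta> (\<lambda>E. w E (pull \<psi> T T')) (10 * e + \<kappa> * (C * C' * c))"
proof -
  note Z = fspace_Sp[of R] fspace_Sp[of R']
  have Ae: "exh R X (Sp R) T" "exh R' Y (Sp R') T'" by (rule exh_Sp[OF R(1) T(1)], rule exh_Sp[OF R(2) T(2)])
  obtain EE EE' where tl: "tailed R R' (Sp R) T (Sp R') T' e EE EE'"
    using tailed_ex[OF T Z Ae e] by blast
  interpret R: ring_of_sets UNIV R by (rule R)
  interpret R': ring_of_sets UNIV R' by (rule R)
  have d: "EE H - EE H' \<in> R" "EE' H - EE' H' \<in> R'" for H H' using tailedD(1,2)[OF tl] by blast+
  obtain g1 where g1: "!!h F \<psi>. Q.vb g1 \<zeta> h F ==> form (Sp R) (Sp R') \<psi> 1 ==>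
    norm (Q.wp (pull \<psi> T T') \<zeta> h F) <= 7 * e * er h F +
    norm (Q.wp (pull \<psi> (\<lambda>x. cut (EE (h \<union> F) - EE h) (T x)) (\<lambda>y. cut (EE' (h \<union> F) - EE' h) (T' y))) \<zeta> h F)"
    using Q.split_four[OF tl less_imp_le[OF e] T Z Ae e n1[OF tailedD(2)[OF tl]] n2[OF tailedD(1)[OF tl]]] by blast
  obtain g2 where g2: "!!h F \<psi>. Q.vb g2 \<zeta> h F ==> form (Sp R) (Sp R') \<psi> 1 ==>
    norm (Q.wp (pull \<psi> T T') \<zeta> h F) <= 3 * e * er h F + \<kappa> * (C * C' * c) * fnorm (Sp R) (Sp R') \<psi>"
    using Q_estimate[OF e] by blast
  show ?thesis
  proof (intro exI[of _ "\<lambda>H. max (g1 H) (g2 H)"] allI impI)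
    fix \<psi> :: "(omega1, 'k) bform" assume F: "form (Sp R) (Sp R') \<psi> 1"
    define N where "N = (\<lambda>D D'. fnorm (Sp R) (Sp R') (\<lambda>f g. \<psi> (cut D f) (cut D' g)))"
    let ?Z = "Sp R :: 'k fn set" and ?Z' = "Sp R' :: 'k fn set"
    have cR: "cut D f \<in> Sp R" if "D \<in> R" "f \<in> ?Z" for D f by (rule Sp_cut'[OF R(1) that(2,1)])
    have cR': "cut D f \<in> Sp R'" if "D \<in> R'" "f \<in> ?Z'" for D f by (rule Sp_cut'[OF R(2) that(2,1)])
    have FD: "form (Sp R) (Sp R') (\<lambda>f g. \<psi> (cut D f) (cut D' g)) 1" if "D \<in> R" "D' \<in> R'" for D D'
      using form_comp[OF F op_cut[OF cR[OF that(1)]] op_cut[OF cR'[OF that(2)]]] by simp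
    have N: "0 <= N D D'" "N D D' <= 1" if "D \<in> R" "D' \<in> R'" for D D'
      unfolding N_def by (rule fnorm_nonneg[OF FD[OF that] Z], rule fnorm_le[OF FD[OF that] Z])
    \<comment> \<open>The error 10 e is 7 e from the splitting plus 3 e from the estimate of the
      diagonal part.\<close>
    define A where "A = (\<lambda>h F. 10 * e * er h F + \<kappa> * (C * C' * c) * N (EE (h \<union> F) - EE h) (EE' (h \<union> F) - EE' h))"
    have "P.superadd (\<lambda>h F. N (EE (h \<union> F) - EE h) (EE' (h \<union> F) - EE' h))"
    proof (rule P.superadd_set2[of EE R EE' R', OF tailedD(1)[OF tl] tailedD(3)[OF tl] R(1) tailedD(2)[OF tl] tailedD(4)[OF tl] R(2) N(1)])
      fix D1 D2 D1' D2' assume D: "D1 \<in> R" "D2 \<in> R" "D1' \<in> R'" "D2' \<in> R'" "D1 \<inter> D2 = {}" "D1' \<inter> D2' = {}"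
      show "N D1 D1' + N D2 D2' <= N (D1 \<union> D2) (D1' \<union> D2')"
        unfolding N_def using D by (intro fnorm_diag_superadd[OF F Z] cR cR') auto
    qed
    hence 1: "P.superadd A"
      unfolding A_def using e by (intro P.superadd_add P.superadd_er P.superadd_scale[OF _ \<kappa>_nonneg]) auto
    have 2: "A h F <= 10 * e + \<kappa> * (C * C' * c)" for h F
    proof -
      have "10 * e * er h F <= 10 * e" using er_le_1[of h F] e by (simp add: mult_left_le)
      moreover have "\<kappa> * (C * C' * c) * N (EE (h \<union> F) - EE h) (EE' (h \<union> F) - EE' h) <= \<kappa> * (C * C' * c) * 1"
        by (rule mult_left_mono[OF N(2)[OF d] \<kappa>_nonneg])
      ultimately show ?thesis by (simp add: A_def)
    qed
    have 3: "norm (Q.wp (pull \<psi> T T') \<zeta> h F) <= A h F" if V: "Q.vb (\<lambda>H. max (g1 H) (g2 H)) \<zeta> h F" for h F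
    proof -
      have V1: "Q.vb g1 \<zeta> h F" and V2: "Q.vb g2 \<zeta> h F" using V by (auto elim!: Q.vb_mono)
      show ?thesis using g1[OF V1 F] g2[OF V2 FD[OF d(1)[of "h \<union> F" h] d(2)[of "h \<union> F" h]]] by (simp add: A_def N_def pull_def)
    qed
    show "Q.dominated (\<lambda>H. max (g1 H) (g2 H)) \<zeta> (\<lambda>E. w E (pull \<psi> T T')) (10 * e + \<kappa> * (C * C' * c))"
      unfolding Q.dominated_def using 1 2 3 by blast
  qed
qed

end

end

lemma fnl_comp:
  assumes "fnl Z l K" "op X Z T C" shows "fnl X (\<lambda>x. l (T x)) (K * C)"
  using assms(1) opD[OF assms(2)] by (auto simp: fnl_def mult.assoc)

context wgame
begin

text \<open>For a rank one right factor the forms reduce to functionals on the left space, where the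
  norms of the restrictions to disjoint sets add up; this costs one level of the second game.\<close>

lemma Q_null_rank1:
  assumes R: "ring_of_sets UNIV R" and T: "op X (Sp R) T C"
    and s: "!!D. D \<in> R ==> sm X \<xi> (Sp R) (\<lambda>x. cut D (T x))"
    and Z': "fspace Z'" "z \<in> Z'" and l: "fnl Y l C'"
  shows "Q.null (osuc 0) (TV w (Sp R) T Z' (\<lambda>f p. l f * z p))"
proof -
  obtain b where b: "sbd z b" using Z' unfolding fspace_def by blast
  let ?T' = "\<lambda>f p. l f * z p"
  have T': "op Y Z' ?T' (C' * b)" by (rule op_rank1[OF l Z' b])
  have nn: "0 <= b" "0 <= C" "0 <= C'" using sbd_nonneg[OF b] opD(1)[OF T] l by (auto simp: fnl_def)
  note Z = fspace_Sp[of R]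
  have Ae: "exh R X (Sp R) T" "exh {UNIV} Y Z' ?T'" by (rule exh_Sp[OF R T], rule exh_UNIV)
  show ?thesis
  proof (rule Q.null_osuc[of "C * C' * b"])
    show "0 <= C * C' * b" using nn by simp
    fix \<epsilon> :: real assume "0 < \<epsilon>"
    define e where "e = \<epsilon> / 3"
    have e: "0 < e" using \<open>0 < \<epsilon>\<close> by (simp add: e_def)
    obtain EE EE' where tl: "tailed R {UNIV} (Sp R) T Z' ?T' e EE EE'"
      using tailed_ex[OF T T' Z Z'(1) Ae e] by blast
    have U: "EE' H = UNIV" for H using tailedD(2)[OF tl] by simp
    have cU: "cut UNIV f = f" for f :: "omega1 => 'k" by (auto simp: cut_def)
    interpret R: ring_of_sets UNIV R by (rule R)
    have d: "EE H - EE H' \<in> R" for H H' using tailedD(1)[OF tl] by blast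
    have "P.null \<xi> (TV w (Sp R) (\<lambda>x. cut (EE H) (T x)) Z' (\<lambda>y. cut (EE' H) (?T' y)))" for H
      unfolding U cU by (rule P_null[OF s[OF tailedD(1)[OF tl]] sm_rank1[OF Z' l]])
    then obtain g where g: "!!h F \<psi>. P.vb g \<xi> h F ==> form (Sp R) Z' \<psi> 1 ==>
      norm (P.wp (pull \<psi> T ?T') \<xi> h F) <= 3 * e * er h F +
      norm (P.wp (pull \<psi> (\<lambda>x. cut (EE (h \<union> F) - EE h) (T x)) (\<lambda>y. cut (EE' (h \<union> F)) (?T' y))) \<xi> h F) +
      norm (P.wp (pull \<psi> (\<lambda>x. cut (EE h) (T x)) (\<lambda>y. cut (EE' (h \<union> F) - EE' h) (?T' y))) \<xi> h F)"
      using P.split_three[OF tl less_imp_le[OF e] T T' Z Z'(1) Ae e] by blast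
    show "\<exists>g. \<forall>v\<in>TV w (Sp R) T Z' ?T'. Q.dominated g 0 v (\<epsilon> + C * C' * b)"
    proof (intro exI[of _ g] ballI)
      fix v assume "v \<in> TV w (Sp R) T Z' ?T'"
      then obtain \<psi> where F: "form (Sp R) Z' \<psi> 1" and v: "v = (\<lambda>E. w E (pull \<psi> T ?T'))"
        by (auto simp: TV_def)
      have fl: "fnl (Sp R) (\<lambda>f. \<psi> f z) b"
        using formD(2,3,6)[OF F] Z' b nn by (auto simp: fnl_def mult.commute)
      have cR: "cut D f \<in> Sp R" if "D \<in> R" "f \<in> Sp R" for D and f :: "omega1 => 'k" by (rule Sp_cut'[OF R that(2,1)])
      define N where "N = (\<lambda>D. lnorm (Sp R) (\<lambda>f. \<psi> (cut D f) z))"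
      have fD: "fnl (Sp R) (\<lambda>f. \<psi> (cut D f) z) b" if "D \<in> R" for D by (rule fnl_cut[OF fl Z cR[OF that]])
      have N: "0 <= N D" "N D <= b" "fnl (Sp R) (\<lambda>f. \<psi> (cut D f) z) (N D)" if "D \<in> R" for D
      proof -
        show "0 <= N D" unfolding N_def by (rule lnorm_nonneg[OF fD[OF that] Z])
        show "N D <= b" unfolding N_def by (rule lnorm_le[OF fD[OF that] Z])
        show "fnl (Sp R) (\<lambda>f. \<psi> (cut D f) z) (N D)"
          using fD[OF that] lnorm_bound[OF fD[OF that] Z] \<open>0 <= N D\<close> by (simp add: fnl_def N_def)
      qed
      define A where "A = (\<lambda>h F. \<epsilon> * er h F + C * C' * N (EE (h \<union> F) - EE h))"
      have "P.superadd (\<lambda>h F. N (EE (h \<union> F) - EE h))"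
      proof (rule P.superadd_set[of EE R, OF tailedD(1)[OF tl] tailedD(3)[OF tl] R N(1)])
        fix D D' assume D: "D \<in> R" "D' \<in> R" "D \<inter> D' = {}"
        thus "N D + N D' <= N (D \<union> D')" unfolding N_def by (intro lnorm_superadd[OF fl Z] cR) auto
      qed
      hence 1: "P.superadd A"
        unfolding A_def using \<open>0 < \<epsilon>\<close> nn by (intro P.superadd_add P.superadd_er P.superadd_scale) auto
      have 2: "A h F <= \<epsilon> + C * C' * b" for h F
      proof -
        have "\<epsilon> * er h F <= \<epsilon>" using er_le_1[of h F] \<open>0 < \<epsilon>\<close> by (simp add: mult_left_le)
        moreover have "C * C' * N (EE (h \<union> F) - EE h) <= C * C' * b"
          using N(2)[OF d] nn by (intro mult_left_mono) auto
        ultimately show ?thesis by (simp add: A_def)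
      qed
      have 3: "norm (Q.wsum v 0 h F) <= A h F" if V0: "Q.vb g 0 h F" for h F
      proof -
        note V = Q_zero(1)[OF V0]
        let ?D = "EE (h \<union> F) - EE h"
        have "form X Y (\<lambda>x y. \<psi> (cut ?D (T x)) z * l y) (N ?D * C * C')"
          by (rule form_product[OF fnl_comp[OF N(3)[OF d] T] l])
        hence "norm (P.wp (pull \<psi> (\<lambda>x. cut ?D (T x)) (\<lambda>y. cut (EE' (h \<union> F)) (?T' y))) \<xi> h F) <= N ?D * C * C'"
        proof (rule P_bound[OF form_cong[OF _ X Y] V])
          fix x y assume "x \<in> X"
          thus "pull \<psi> (\<lambda>x. cut ?D (T x)) (\<lambda>y. cut (EE' (h \<union> F)) (?T' y)) x y = \<psi> (cut ?D (T x)) z * l y"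
            using formD(5)[OF F cR[OF d opD(2)[OF T]] Z'(2)] by (simp add: pull_def U cU mult.commute)
        qed
        moreover have "norm (P.wp (pull \<psi> (\<lambda>x. cut (EE h) (T x)) (\<lambda>y. cut (EE' (h \<union> F) - EE' h) (?T' y))) \<xi> h F) <= 0"
          unfolding U Diff_cancel
          by (rule P_cut_empty[OF V F op_cut_comp[OF T cR[OF tailedD(1)[OF tl]]] T' Z Z'(1)])
        ultimately show ?thesis
          using g[OF V F] unfolding v Q_zero(2)[OF V0] by (simp add: A_def e_def mult_ac)
      qed
      show "Q.dominated g 0 v (\<epsilon> + C * C' * b)"
        unfolding Q.dominated_def using 1 2 3 by blast
    qed
  qed
qed

text \<open>Induction on the rank of the right factor; rank one is settled on level 1. For a
  localised T' of lower rank \<eta>, pairs with T' cut are null on level 1 + \<eta> by induction.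
  Pairs with T cut are null by the first game, since the cuts of T have level \<xi> and so does T'
  because \<eta> < \<xi>. Then \<open>Q_block\<close> applies on level 1 + \<eta> and one more step
  gives nullness, on a level not above 1 + \<zeta>.\<close>

theorem Q_null_right:
  assumes R: "ring_of_sets UNIV R" and T: "op X (Sp R) T C"
    and s: "!!D. D \<in> R ==> sm X \<xi> (Sp R) (\<lambda>x. cut D (T x))"
  shows "sm Y \<zeta> Z' T' ==> \<zeta> <= \<xi> ==> Q.null (1 + \<zeta>) (TV w (Sp R) T Z' T')"
proof (induction \<zeta> arbitrary: Z' T' rule: less_induct)
  case (less \<zeta>)
  show ?case
  proof (rule Q.null_sm_right[OF less.prems(1) T])
    fix Z' :: "'k fn set" and z l C' assume "\<zeta> = 0" and Z': "fspace Z'" "z \<in> Z'" "fnl Y l C'"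
    thus "Q.null (1 + \<zeta>) (TV w (Sp R) T Z' (\<lambda>f p. l f * z p))"
      using Q_null_rank1[OF R T s Z'] by (simp add: one_omega1_def plus_omega1_simps)
  next
    fix \<eta> R' T' C' assume \<eta>: "\<eta> < \<zeta>" and R': "ring_of_sets UNIV R'" and T': "op Y (Sp R') T' C'"
      and s': "!!D. D \<in> R' ==> sm Y \<eta> (Sp R') (\<lambda>f. cut D (T' f))"
    have \<eta>\<xi>: "\<eta> < \<xi>" using \<eta> less.prems(2) by simp
    have n1: "Q.null (1 + \<eta>) (TV w (Sp R) T (Sp R') (\<lambda>y. cut D (T' y)))" if "D \<in> R'" for D
      by (rule less.IH[OF \<eta> s'[OF that]]) (use \<eta>\<xi> in simp)
    have n2: "Q.null (1 + \<eta>) (TV w (Sp R) (\<lambda>x. cut D (T x)) (Sp R') T')" if "D \<in> R" for D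
      by (rule Q_null[OF P_null[OF s[OF that] sm.loc[OF \<eta>\<xi> R' T' s']]])
    have n: "P.null \<xi> (TV w (Sp R) (\<lambda>x. cut D (T x)) (Sp R') (\<lambda>y. cut D' (T' y)))" if "D \<in> R" "D' \<in> R'" for D D'
      by (rule P_null[OF s[OF that(1)] sm_mono[OF s'[OF that(2)]]]) (use \<eta>\<xi> in simp)
    \<comment> \<open>Both factors are localised here. The resulting factor 2 does not reach the
      final constants: the whole bound B disappears at the next level.\<close>
    have k: "R' = R' \<and> (2::real) = 2 \<or> R' = {UNIV} \<and> (2::real) = 1" by simp
    define B where "B = 2 * (C * C' * c)"
    have B: "0 <= B" unfolding B_def by (rule \<kappa>_nonneg[OF R R' T T' k n])
    have "Q.null (osuc (1 + \<eta>)) (TV w (Sp R) T (Sp R') T')"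
    proof (rule Q.null_osuc[OF B])
      fix \<epsilon> :: real assume "0 < \<epsilon>"
      hence "0 < \<epsilon> / 10" by simp
      obtain g where g: "!!\<psi>. form (Sp R) (Sp R') \<psi> 1 ==> 
          Q.dominated g (1 + \<eta>) (\<lambda>E. w E (pull \<psi> T T')) (10 * (\<epsilon> / 10) + 2 * (C * C' * c))"
        using Q_block[OF R R' T T' k n \<open>0 < \<epsilon> / 10\<close> n1 n2] by blast
      thus "\<exists>g. \<forall>v\<in>TV w (Sp R) T (Sp R') T'. Q.dominated g (1 + \<eta>) v (\<epsilon> + B)"
        by (intro exI[of _ g]) (auto simp: TV_def B_def)
    qed
    moreover have "osuc (1 + \<eta>) <= 1 + \<zeta>"
      using normal_less_iff[OF normal_plus, of 1 \<eta> \<zeta>] \<eta> by (simp add: osuc_le_iff)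
    moreover obtain g0 where g0: "!!\<zeta> h F \<psi>. Q.vb g0 \<zeta> h F ==> form (Sp R) (Sp R') \<psi> 1 ==>
      norm (Q.wp (pull \<psi> T T') \<zeta> h F) <= 3 * 1 * er h F + 2 * (C * C' * c) * fnorm (Sp R) (Sp R') \<psi>"
      using Q_estimate[OF R R' T T' k n zero_less_one] by blast
    ultimately show "Q.null (1 + \<zeta>) (TV w (Sp R) T (Sp R') T')"
    proof (rule_tac Q.null_mono)
      fix \<zeta> h F v assume V: "Q.vb g0 \<zeta> h F" and "v \<in> TV w (Sp R) T (Sp R') T'"
      then obtain \<psi> where F: "form (Sp R) (Sp R') \<psi> 1" and v: "v = (\<lambda>E. w E (pull \<psi> T T'))"
        by (auto simp: TV_def)
      have "B * fnorm (Sp R) (Sp R') \<psi> <= B * 1"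
        by (rule mult_left_mono[OF fnorm_le[OF F fspace_Sp fspace_Sp] B])
      thus "norm (Q.wsum v \<zeta> h F) <= 3 + B"
        using g0[OF V F] er_le_1[of h F] by (simp add: v B_def)
    qed
  qed
qed

end

section \<open>Summability along a sequence of blocks\<close>

lemma (in schreier_hierarchy) sum_superadd_le:
  assumes A: "superadd A" and V: "!!n. vb g \<zeta> (\<Union>k\<in>{1..n}. D k) (D (Suc n))"
  shows "(\<Sum>n<N. A (\<Union>k\<in>{1..n}. D k) (D (Suc n))) <= A {} (\<Union>k\<in>{1..N}. D k)"
proof (induction N)
  case 0
  thus ?case using A by (auto simp: superadd_def hist_def)
next
  case (Suc N)
  let ?H = "\<lambda>n. \<Union>k\<in>{1..n}. D k"
  have U: "?H (Suc N) = ?H N \<union> D (Suc N)" by (auto simp: atLeastAtMostSuc_conv)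
  show ?case
  proof (cases N)
    case (Suc M)
    have "hist (D (Suc N))" using vbD(5,7)[OF V[of N]] by (simp add: hist_def)
    moreover have "?H N ~= {}" using vbD(6)[OF V[of M]] Suc by auto
    moreover have "hist {}" "set_less {} (?H N)" by (simp_all add: hist_def)
    ultimately have "A {} (?H N) + A ({} \<union> ?H N) (D (Suc N)) <= A {} (?H N \<union> D (Suc N))"
      using A vbD(1,2)[OF V[of N]] unfolding superadd_def by (metis Un_empty_left)
    thus ?thesis using Suc.IH unfolding U by simp
  qed (simp add: U)
qed

context wgame
begin

context
  fixes R R' \<A>' and \<kappa> :: real
  assumes R: "ring_of_sets UNIV R" "ring_of_sets UNIV R'" and XY: "X = Sp R" "Y = Sp R'"
    and A': "\<A>' = R' \<and> \<kappa> = 2 \<or> \<A>' = {UNIV} \<and> \<kappa> = 1"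
    and s: "!!D. D \<in> R ==> sm X \<xi> X (cut D)" and s': "!!D. D \<in> \<A>' ==> sm Y \<xi> Y (cut D)"
begin

lemma null_cut_cut: "D \<in> R ==> D' \<in> \<A>' ==> P.null \<xi> (TV w X (cut D) Y (cut D'))"
  by (rule P_null[OF s s'])

text \<open>Minkowski's inequality in l_2 separates the error from the two roots. By superadditivity
  the squares of each root add up to at most its bound over the whole game, which gives c for the
  left factor and (\<kappa> - 1) c for the right one.\<close>

lemma S_sum:
  assumes e: "0 < e"
  shows "\<exists>g. \<forall>D. (\<forall>n. P.vb g \<xi> (\<Union>k\<in>{1..n}. D k) (D (Suc n))) --> (\<forall>\<phi> N. form X Y \<phi> 1 -->
    (\<Sum>n<N. (norm (P.wp \<phi> \<xi> (\<Union>k\<in>{1..n}. D k) (D (Suc n))))\<^sup>2) <= (\<kappa> * c + 3 * e)\<^sup>2)"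
proof -
  have n: "P.null \<xi> (TV w (Sp R) (\<lambda>x. cut D x) (Sp R') (\<lambda>y. cut D' y))" if "D \<in> R" "D' \<in> \<A>'" for D D'
    using null_cut_cut[OF that] by (simp add: XY)
  have T: "op X (Sp R) (\<lambda>x. x) 1" "op Y (Sp R') (\<lambda>y. y) 1" unfolding XY by (rule op_id)+
  obtain g where g: "!!\<psi>. form (Sp R) (Sp R') \<psi> 1 ==> P.root_dominated g \<xi> (\<lambda>E. w E (pull \<psi> (\<lambda>x. x) (\<lambda>y. y))) e
    (1 * 1 * (c * fnorm (Sp R) (Sp R') \<psi>)) ((\<kappa> - 1) * (1 * 1 * (c * fnorm (Sp R) (Sp R') \<psi>)))"
    using P_estimate[OF R T e A' n] by blast
  show ?thesis
  proof (intro exI[of _ g] allI impI)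
    fix D \<phi> N assume V: "\<forall>n. P.vb g \<xi> (\<Union>k\<in>{1..n}. D k) (D (Suc n))" and "form X Y \<phi> 1"
    hence F: "form (Sp R) (Sp R') \<phi> 1" by (simp add: XY)
    let ?b = "c * fnorm (Sp R) (Sp R') \<phi>" and ?H = "\<lambda>n. \<Union>k\<in>{1..n}. D k"
    have fn: "0 <= fnorm (Sp R) (Sp R') \<phi>" "fnorm (Sp R) (Sp R') \<phi> <= 1"
      by (rule fnorm_nonneg[OF F fspace_Sp fspace_Sp], rule fnorm_le[OF F fspace_Sp fspace_Sp])
    have b: "0 <= ?b" "?b <= c" using fn gb(2) by (auto intro: mult_left_le)
    have k: "0 <= \<kappa> - 1" using A' by auto
    obtain M M' where M: "P.superadd M" "P.superadd M'" "!!h F. M h F <= ?b\<^sup>2" "!!h F. M' h F <= ((\<kappa> - 1) * ?b)\<^sup>2"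
      "!!h F. P.vb g \<xi> h F ==> norm (P.wp \<phi> \<xi> h F) <= 3 * e * er h F + sqrt (M h F) + sqrt (M' h F)"
      using g[OF F] by (auto simp: pull_def P.root_dominated_def)
    note V' = V[rule_format]
    have hD: "hist (?H n)" "hist (D (Suc n))" for n using P.vbD[OF V'[of n]] by (auto simp: hist_def)
    have nn: "0 <= A (?H n) (D (Suc n))" if "P.superadd A" for A n using that hD by (auto simp: P.superadd_def)
    have root: "L2_set (\<lambda>n. sqrt (A (?H n) (D (Suc n)))) {..<N} <= K"
      if A: "P.superadd A" "!!h F. A h F <= K\<^sup>2" "0 <= K" for A K
    proof -
      have "(\<Sum>n<N. A (?H n) (D (Suc n))) <= K\<^sup>2"
        using P.sum_superadd_le[OF A(1) V', of N] A(2) order_trans by blast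
      thus ?thesis
        unfolding L2_set_def using nn[OF A(1)] A(3) by (intro real_le_lsqrt) auto
    qed
    let ?x = "\<lambda>n. 3 * e * er (?H n) (D (Suc n))"
    have x: "L2_set ?x {..<N} <= 3 * e"
    proof -
      have sa: "P.superadd (\<lambda>h F. 3 * e * er h F)" using e by (intro P.superadd_er) simp
      have "L2_set ?x {..<N} <= (\<Sum>n<N. ?x n)" using nn[OF sa] by (intro L2_set_le_sum) auto
      also have "\<dots> <= 3 * e * er {} (?H N)" by (rule P.sum_superadd_le[OF sa V'])
      also have "\<dots> <= 3 * e" using e er_le_1 by (simp add: mult_left_le)
      finally show ?thesis .
    qed
    have "L2_set (\<lambda>n. norm (P.wp \<phi> \<xi> (?H n) (D (Suc n)))) {..<N} <=
        L2_set (\<lambda>n. (?x n + sqrt (M (?H n) (D (Suc n)))) + sqrt (M' (?H n) (D (Suc n)))) {..<N}"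
      using M(5)[OF V'] by (intro L2_set_mono) auto
    also have "\<dots> <= (L2_set ?x {..<N} + L2_set (\<lambda>n. sqrt (M (?H n) (D (Suc n)))) {..<N}) +
        L2_set (\<lambda>n. sqrt (M' (?H n) (D (Suc n)))) {..<N}"
      by (intro order_trans[OF L2_set_triangle_ineq] add_right_mono L2_set_triangle_ineq)
    also have "\<dots> <= (3 * e + ?b) + (\<kappa> - 1) * ?b"
      using x root[OF M(1,3)] root[OF M(2,4)] b(1) k by (intro add_mono) auto
    also have "\<dots> = 3 * e + \<kappa> * ?b" by (simp add: algebra_simps)
    also have "\<dots> <= \<kappa> * c + 3 * e" using b k by (simp add: mult_left_mono)
    finally have L: "L2_set (\<lambda>n. norm (P.wp \<phi> \<xi> (?H n) (D (Suc n)))) {..<N} <= \<kappa> * c + 3 * e" .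
    have "(\<Sum>n<N. (norm (P.wp \<phi> \<xi> (?H n) (D (Suc n))))\<^sup>2) = (L2_set (\<lambda>n. norm (P.wp \<phi> \<xi> (?H n) (D (Suc n)))) {..<N})\<^sup>2"
      unfolding L2_set_def by (simp add: sum_nonneg)
    also have "\<dots> <= (\<kappa> * c + 3 * e)\<^sup>2" by (rule power_mono[OF L L2_set_nonneg])
    finally show "(\<Sum>n<N. (norm (P.wp \<phi> \<xi> (?H n) (D (Suc n))))\<^sup>2) <= (\<kappa> * c + 3 * e)\<^sup>2" .
  qed
qed

text \<open>The bound supplied by \<open>Q_block\<close> is itself superadditive, so the norms are
  summed directly and the total is the bound over a single long block.\<close>

lemma G_sum:
  assumes e: "0 < e"
    and n1: "!!D'. D' \<in> R' ==> Q.null \<zeta> (TV w X (\<lambda>x. x) Y (cut D'))"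
    and n2: "!!D. D \<in> R ==> Q.null \<zeta> (TV w X (cut D) Y (\<lambda>y. y))"
  shows "\<exists>g. \<forall>D. (\<forall>n. Q.vb g \<zeta> (\<Union>k\<in>{1..n}. D k) (D (Suc n))) --> (\<forall>\<phi> N. form X Y \<phi> 1 -->
    (\<Sum>n<N. norm (Q.wp \<phi> \<zeta> (\<Union>k\<in>{1..n}. D k) (D (Suc n)))) <= \<kappa> * c + 10 * e)"
proof -
  have n: "P.null \<xi> (TV w (Sp R) (\<lambda>x. cut D x) (Sp R') (\<lambda>y. cut D' y))" if "D \<in> R" "D' \<in> \<A>'" for D D'
    using null_cut_cut[OF that] by (simp add: XY)
  have T: "op X (Sp R) (\<lambda>x. x) 1" "op Y (Sp R') (\<lambda>y. y) 1" unfolding XY by (rule op_id)+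
  have "\<exists>g. \<forall>\<psi>. form (Sp R) (Sp R') \<psi> 1 -->
    Q.dominated g \<zeta> (\<lambda>E. w E (pull \<psi> (\<lambda>x. x) (\<lambda>y. y))) (10 * e + \<kappa> * (1 * 1 * c))"
    by (rule Q_block[OF R T A' n e]) (use n1 n2 in \<open>simp_all add: XY\<close>)
  then obtain g where g: "!!\<psi>. form (Sp R) (Sp R') \<psi> 1 ==>
    Q.dominated g \<zeta> (\<lambda>E. w E (pull \<psi> (\<lambda>x. x) (\<lambda>y. y))) (10 * e + \<kappa> * (1 * 1 * c))"
    by blast
  show ?thesis
  proof (intro exI[of _ g] allI impI)
    fix D \<phi> N assume V: "\<forall>n. Q.vb g \<zeta> (\<Union>k\<in>{1..n}. D k) (D (Suc n))" and "form X Y \<phi> 1"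
    hence F: "form (Sp R) (Sp R') \<phi> 1" by (simp add: XY)
    obtain A where A: "P.superadd A" "!!h F. A h F <= 10 * e + \<kappa> * c"
      "!!h F. Q.vb g \<zeta> h F ==> norm (Q.wp \<phi> \<zeta> h F) <= A h F"
      using g[OF F] by (auto simp: pull_def Q.dominated_def)
    have "(\<Sum>n<N. norm (Q.wp \<phi> \<zeta> (\<Union>k\<in>{1..n}. D k) (D (Suc n)))) <= (\<Sum>n<N. A (\<Union>k\<in>{1..n}. D k) (D (Suc n)))"
      using V by (intro sum_mono A(3)) auto
    also have "\<dots> <= \<kappa> * c + 10 * e"
      using Q.sum_superadd_le[OF A(1) V[rule_format], of N] A(2)[of "{}" "\<Union>k\<in>{1..N}. D k"] by simp
    finally show "(\<Sum>n<N. norm (Q.wp \<phi> \<zeta> (\<Union>k\<in>{1..n}. D k) (D (Suc n)))) <= \<kappa> * c + 10 * e" .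
  qed
qed

end

end

section \<open>Completions of spaces of functions\<close>

text \<open>Algebraic tensors are functions on bilinear forms with pointwise operations. The norm is
  treated as a seminorm, and passing to classes of Cauchy sequences identifies elements at distance
  0.\<close>

locale fun_normed =
  fixes V :: "('k::{real_normed_field,banach}, 'a => 'k) normed_module" (structure)
  assumes V_zero: "\<zero> = (\<lambda>_. 0)" and V_add: "x \<oplus> y = (\<lambda>\<phi>. x \<phi> + y \<phi>)" and V_smult: "c \<odot>\<^bsub>V\<^esub> x = (\<lambda>\<phi>. c * x \<phi>)"
    and zero_carrier: "(\<lambda>_. 0) \<in> carrier V"
    and add_carrier: "x \<in> carrier V ==> y \<in> carrier V ==> (\<lambda>\<phi>. x \<phi> + y \<phi>) \<in> carrier V"
    and scale_carrier: "x \<in> carrier V ==> (\<lambda>\<phi>. c * x \<phi>) \<in> carrier V"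
    and norm_nonneg: "x \<in> carrier V ==> 0 <= vnorm V x"
    and norm_add: "x \<in> carrier V ==> y \<in> carrier V ==> vnorm V (\<lambda>\<phi>. x \<phi> + y \<phi>) <= vnorm V x + vnorm V y"
    and norm_scale: "x \<in> carrier V ==> vnorm V (\<lambda>\<phi>. c * x \<phi>) <= norm c * vnorm V x"
begin

abbreviation "N \<equiv> vnorm V"
abbreviation "CS \<equiv> cauchy_seqs V"

lemma uminus_carrier: "x \<in> carrier V ==> (\<lambda>\<phi>. - x \<phi>) \<in> carrier V"
  using scale_carrier[of x "-1"] by simp

lemma diff_carrier: "x \<in> carrier V ==> y \<in> carrier V ==> (\<lambda>\<phi>. x \<phi> - y \<phi>) \<in> carrier V"
  using add_carrier[OF _ uminus_carrier, of x y] by simp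

text \<open>The difference in \<open>cauchy_seqs\<close> and \<open>cauchy_rel\<close> comes from
  the inverse in the additive monoid, a definite description; uniqueness of pointwise negatives
  evaluates it.\<close>

lemma V_minus:
  assumes y: "y \<in> carrier V" shows "x \<ominus> y = (\<lambda>\<phi>. x \<phi> - y \<phi>)"
proof -
  have "\<ominus> y = (\<lambda>\<phi>. - y \<phi>)"
    unfolding a_inv_def m_inv_def
  proof (rule the_equality)
    fix z assume "z \<in> carrier (add_monoid V) \<and> y \<otimes>\<^bsub>add_monoid V\<^esub> z = \<one>\<^bsub>add_monoid V\<^esub> \<and> z \<otimes>\<^bsub>add_monoid V\<^esub> y = \<one>\<^bsub>add_monoid V\<^esub>"
    hence "(\<lambda>\<phi>. y \<phi> + z \<phi>) = (\<lambda>_. 0)" by (simp add: V_add V_zero)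
    thus "z = (\<lambda>\<phi>. - y \<phi>)" by (metis add_eq_0_iff)
  qed (simp add: V_add V_zero uminus_carrier[OF y])
  thus ?thesis by (simp add: a_minus_def V_add)
qed

lemma norm_minus_commute: "x \<in> carrier V ==> y \<in> carrier V ==> N (\<lambda>\<phi>. x \<phi> - y \<phi>) <= N (\<lambda>\<phi>. y \<phi> - x \<phi>)"
  using norm_scale[of "\<lambda>\<phi>. y \<phi> - x \<phi>" "-1"] diff_carrier[of y x] by simp

lemma norm_diff_triangle:
  assumes "x \<in> carrier V" "y \<in> carrier V" "z \<in> carrier V"
  shows "N (\<lambda>\<phi>. x \<phi> - z \<phi>) <= N (\<lambda>\<phi>. x \<phi> - y \<phi>) + N (\<lambda>\<phi>. y \<phi> - z \<phi>)"
  using norm_add[OF diff_carrier[OF assms(1,2)] diff_carrier[OF assms(2,3)]] by simp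

lemma norm_zero: "N (\<lambda>_. 0) = 0"
  using norm_scale[OF zero_carrier, of 0] norm_nonneg[OF zero_carrier] by simp

lemma norm_reverse:
  assumes "x \<in> carrier V" "y \<in> carrier V" shows "\<bar>N x - N y\<bar> <= N (\<lambda>\<phi>. x \<phi> - y \<phi>)"
proof -
  have "N x <= N (\<lambda>\<phi>. x \<phi> - y \<phi>) + N y" using norm_add[OF diff_carrier[OF assms] assms(2)] by simp
  moreover have "N y <= N (\<lambda>\<phi>. y \<phi> - x \<phi>) + N x" using norm_add[OF diff_carrier[OF assms(2,1)] assms(1)] by simp
  ultimately show ?thesis using norm_minus_commute[OF assms(2,1)] by linarith
qed

lemma CS_carrier: "s \<in> CS ==> s n \<in> carrier V"
  by (auto simp: cauchy_seqs_def)

lemma CS_iff: "s \<in> CS \<longleftrightarrow> (\<forall>n. s n \<in> carrier V) \<and> (\<forall>e>0. \<exists>M. \<forall>m\<ge>M. \<forall>n\<ge>M. N (\<lambda>\<phi>. s m \<phi> - s n \<phi>) < e)"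
proof (cases "\<forall>n. s n \<in> carrier V")
  case True
  thus ?thesis using V_minus by (simp add: cauchy_seqs_def image_subset_iff)
qed (auto simp: cauchy_seqs_def)

lemma CS_E:
  assumes "s \<in> CS" "0 < e" obtains M where "!!m n. M <= m ==> M <= n ==> N (\<lambda>\<phi>. s m \<phi> - s n \<phi>) < e"
proof -
  have "\<exists>M. \<forall>m\<ge>M. \<forall>n\<ge>M. N (\<lambda>\<phi>. s m \<phi> - s n \<phi>) < e" using assms by (simp add: CS_iff)
  then obtain M where M: "\<forall>m\<ge>M. \<forall>n\<ge>M. N (\<lambda>\<phi>. s m \<phi> - s n \<phi>) < e" ..
  show thesis by (rule that[of M], rule M[rule_format])
qed

lemma CS_const: "x \<in> carrier V ==> (\<lambda>_. x) \<in> CS"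
  by (simp add: CS_iff norm_zero)

lemma rel_iff: "(s, t) \<in> cauchy_rel V \<longleftrightarrow> s \<in> CS \<and> t \<in> CS \<and> (\<lambda>n. N (\<lambda>\<phi>. s n \<phi> - t n \<phi>)) \<longlonglongrightarrow> 0"
proof (cases "t \<in> CS")
  case True
  thus ?thesis using V_minus[OF CS_carrier[OF True]] by (simp add: cauchy_rel_def)
qed (simp add: cauchy_rel_def)

lemma null_seqI:
  assumes "!!n. (0::real) <= a n" "!!n. a n <= b n" "b \<longlonglongrightarrow> 0" shows "a \<longlonglongrightarrow> 0"
  by (rule tendsto_sandwich[OF _ _ tendsto_const assms(3)]) (use assms(1,2) in auto)

lemma equiv_rel: "equiv CS (cauchy_rel V)"
proof (rule equivI)
  show "cauchy_rel V \<subseteq> CS \<times> CS" by (auto simp: cauchy_rel_def)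
  show "refl_on CS (cauchy_rel V)" by (rule refl_onI) (auto simp: rel_iff norm_zero)
  show "sym (cauchy_rel V)"
  proof (rule symI)
    fix s t assume "(s, t) \<in> cauchy_rel V"
    hence *: "s \<in> CS" "t \<in> CS" "(\<lambda>n. N (\<lambda>\<phi>. s n \<phi> - t n \<phi>)) \<longlonglongrightarrow> 0" by (auto simp: rel_iff)
    have "(\<lambda>n. N (\<lambda>\<phi>. t n \<phi> - s n \<phi>)) \<longlonglongrightarrow> 0"
      by (rule null_seqI[OF norm_nonneg norm_minus_commute *(3)]) (use *(1,2) CS_carrier diff_carrier in auto)
    thus "(t, s) \<in> cauchy_rel V" using * by (simp add: rel_iff)
  qed
  show "trans (cauchy_rel V)"
  proof (rule transI)
    fix s t r assume "(s, t) \<in> cauchy_rel V" "(t, r) \<in> cauchy_rel V"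
    hence *: "s \<in> CS" "t \<in> CS" "r \<in> CS"
      "(\<lambda>n. N (\<lambda>\<phi>. s n \<phi> - t n \<phi>) + N (\<lambda>\<phi>. t n \<phi> - r n \<phi>)) \<longlonglongrightarrow> 0"
      by (auto simp: rel_iff intro: tendsto_add_zero)
    have "(\<lambda>n. N (\<lambda>\<phi>. s n \<phi> - r n \<phi>)) \<longlonglongrightarrow> 0"
      by (rule null_seqI[OF norm_nonneg norm_diff_triangle *(4)]) (use *(1-3) CS_carrier diff_carrier in auto)
    thus "(s, r) \<in> cauchy_rel V" using * by (simp add: rel_iff)
  qed
qed

definition cl :: "(nat => 'a => 'k) => (nat => 'a => 'k) set" where
  "cl s = cauchy_rel V `` {s}"

abbreviation "U \<equiv> completion V"

lemma U_carrier: "carrier U = cl ` CS"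
  by (auto simp: completion_def quotient_def cl_def)

lemma cl_eq: "s \<in> CS ==> t \<in> CS ==> cl s = cl t \<longleftrightarrow> (s, t) \<in> cauchy_rel V"
  unfolding cl_def using eq_equiv_class_iff[OF equiv_rel] by blast

lemma cl_mem: "t \<in> cl s \<longleftrightarrow> (s, t) \<in> cauchy_rel V"
  by (simp add: cl_def)

lemma cl_self: "s \<in> CS ==> s \<in> cl s"
  by (simp add: cl_mem rel_iff norm_zero)

lemma cl_memD:
  assumes "t \<in> cl s" shows "s \<in> CS" "t \<in> CS" "cl t = cl s" "(\<lambda>n. N (\<lambda>\<phi>. s n \<phi> - t n \<phi>)) \<longlonglongrightarrow> 0"
  using assms cl_eq[of s t] by (auto simp: cl_mem rel_iff)

lemma norm_add4:
  assumes "x \<in> carrier V" "y \<in> carrier V" "x' \<in> carrier V" "y' \<in> carrier V"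
  shows "N (\<lambda>\<phi>. (x \<phi> + y \<phi>) - (x' \<phi> + y' \<phi>)) <= N (\<lambda>\<phi>. x \<phi> - x' \<phi>) + N (\<lambda>\<phi>. y \<phi> - y' \<phi>)"
  using norm_add[OF diff_carrier[OF assms(1,3)] diff_carrier[OF assms(2,4)]] by (simp add: algebra_simps)

lemma norm_scale_diff:
  assumes "x \<in> carrier V" "y \<in> carrier V"
  shows "N (\<lambda>\<phi>. c * x \<phi> - c * y \<phi>) <= norm c * N (\<lambda>\<phi>. x \<phi> - y \<phi>)"
  using norm_scale[OF diff_carrier[OF assms], of c] by (simp add: algebra_simps)

lemma CS_add:
  assumes "s \<in> CS" "t \<in> CS" shows "(\<lambda>n \<phi>. s n \<phi> + t n \<phi>) \<in> CS"
  unfolding CS_iff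
proof (intro conjI allI impI)
  show "(\<lambda>\<phi>. s n \<phi> + t n \<phi>) \<in> carrier V" for n using assms CS_carrier add_carrier by blast
  fix e :: real assume "0 < e"
  hence "0 < e / 2" by simp
  obtain M1 where M1: "!!m n. M1 <= m ==> M1 <= n ==> N (\<lambda>\<phi>. s m \<phi> - s n \<phi>) < e / 2"
    by (rule CS_E[OF assms(1) \<open>0 < e / 2\<close>]) (rule that)
  obtain M2 where M2: "!!m n. M2 <= m ==> M2 <= n ==> N (\<lambda>\<phi>. t m \<phi> - t n \<phi>) < e / 2"
    by (rule CS_E[OF assms(2) \<open>0 < e / 2\<close>]) (rule that)
  have "N (\<lambda>\<phi>. (s m \<phi> + t m \<phi>) - (s n \<phi> + t n \<phi>)) < e" if "max M1 M2 <= m" "max M1 M2 <= n" for m n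
    using norm_add4[OF CS_carrier[OF assms(1)] CS_carrier[OF assms(2)] CS_carrier[OF assms(1)] CS_carrier[OF assms(2)], of m m n n]
      M1[of m n] M2[of m n] that by simp
  thus "\<exists>M. \<forall>m\<ge>M. \<forall>n\<ge>M. N (\<lambda>\<phi>. (s m \<phi> + t m \<phi>) - (s n \<phi> + t n \<phi>)) < e" by blast
qed

lemma CS_scale:
  assumes "s \<in> CS" shows "(\<lambda>n \<phi>. c * s n \<phi>) \<in> CS"
  unfolding CS_iff
proof (intro conjI allI impI)
  show "(\<lambda>\<phi>. c * s n \<phi>) \<in> carrier V" for n using assms CS_carrier scale_carrier by blast
  fix e :: real assume "0 < e"
  hence "0 < e / (norm c + 1)" by (simp add: add_nonneg_pos)
  obtain M where M: "!!m n. M <= m ==> M <= n ==> N (\<lambda>\<phi>. s m \<phi> - s n \<phi>) < e / (norm c + 1)"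
    by (rule CS_E[OF assms \<open>0 < e / (norm c + 1)\<close>]) (rule that)
  have "N (\<lambda>\<phi>. c * s m \<phi> - c * s n \<phi>) < e" if "M <= m" "M <= n" for m n
  proof -
    have "N (\<lambda>\<phi>. c * s m \<phi> - c * s n \<phi>) <= norm c * (e / (norm c + 1))"
      using norm_scale_diff[OF CS_carrier[OF assms] CS_carrier[OF assms], of c m n]
        mult_left_mono[OF less_imp_le[OF M[OF that]] norm_ge_zero[of c]] by (rule order_trans)
    also have "\<dots> < e" using \<open>0 < e\<close> add_pos_nonneg[OF zero_less_one norm_ge_zero[of c]] by (simp add: field_simps)
    finally show ?thesis .
  qed
  thus "\<exists>M. \<forall>m\<ge>M. \<forall>n\<ge>M. N (\<lambda>\<phi>. c * s m \<phi> - c * s n \<phi>) < e" by blast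
qed

lemma cl_eqI:
  assumes "s \<in> CS" "t \<in> CS" "!!n. N (\<lambda>\<phi>. s n \<phi> - t n \<phi>) <= b n" "b \<longlonglongrightarrow> 0" shows "cl s = cl t"
proof -
  have "(\<lambda>n. N (\<lambda>\<phi>. s n \<phi> - t n \<phi>)) \<longlonglongrightarrow> 0"
    by (rule null_seqI[OF norm_nonneg assms(3,4)]) (use assms(1,2) CS_carrier diff_carrier in auto)
  thus ?thesis using assms(1,2) by (simp add: cl_eq rel_iff)
qed

lemma U_add:
  assumes "s \<in> CS" "t \<in> CS" shows "cl s \<oplus>\<^bsub>U\<^esub> cl t = cl (\<lambda>n \<phi>. s n \<phi> + t n \<phi>)"
proof -
  have *: "cl (\<lambda>n \<phi>. s' n \<phi> + t' n \<phi>) = cl (\<lambda>n \<phi>. s n \<phi> + t n \<phi>)" if s': "s' \<in> cl s" and t': "t' \<in> cl t" for s' t'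
  proof -
    have z: "(\<lambda>n. N (\<lambda>\<phi>. s n \<phi> - s' n \<phi>) + N (\<lambda>\<phi>. t n \<phi> - t' n \<phi>)) \<longlonglongrightarrow> 0"
      by (rule tendsto_add_zero[OF cl_memD(4)[OF s'] cl_memD(4)[OF t']])
    have "cl (\<lambda>n \<phi>. s n \<phi> + t n \<phi>) = cl (\<lambda>n \<phi>. s' n \<phi> + t' n \<phi>)"
      by (rule cl_eqI[OF CS_add[OF assms] CS_add[OF cl_memD(2)[OF s'] cl_memD(2)[OF t']] _ z])
        (intro norm_add4 CS_carrier assms cl_memD(2)[OF s'] cl_memD(2)[OF t'])
    thus ?thesis by simp
  qed
  have "cl s \<oplus>\<^bsub>U\<^esub> cl t = (\<Union>s'\<in>cl s. \<Union>t'\<in>cl t. cl (\<lambda>n \<phi>. s' n \<phi> + t' n \<phi>))"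
    by (simp add: completion_def cl_def V_add)
  also have "\<dots> = (\<Union>s'\<in>cl s. \<Union>t'\<in>cl t. cl (\<lambda>n \<phi>. s n \<phi> + t n \<phi>))" using * by simp
  also have "\<dots> = cl (\<lambda>n \<phi>. s n \<phi> + t n \<phi>)" using cl_self assms by blast
  finally show ?thesis .
qed

lemma U_smult:
  assumes "s \<in> CS" shows "c \<odot>\<^bsub>U\<^esub> cl s = cl (\<lambda>n \<phi>. c * s n \<phi>)"
proof -
  have *: "cl (\<lambda>n \<phi>. c * s' n \<phi>) = cl (\<lambda>n \<phi>. c * s n \<phi>)" if s': "s' \<in> cl s" for s'
  proof -
    have z: "(\<lambda>n. norm c * N (\<lambda>\<phi>. s n \<phi> - s' n \<phi>)) \<longlonglongrightarrow> 0"
      by (rule tendsto_mult_right_zero[OF cl_memD(4)[OF s']])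
    have "cl (\<lambda>n \<phi>. c * s n \<phi>) = cl (\<lambda>n \<phi>. c * s' n \<phi>)"
      by (rule cl_eqI[OF CS_scale[OF assms] CS_scale[OF cl_memD(2)[OF s']] _ z])
        (intro norm_scale_diff CS_carrier assms cl_memD(2)[OF s'])
    thus ?thesis by simp
  qed
  have "c \<odot>\<^bsub>U\<^esub> cl s = (\<Union>s'\<in>cl s. cl (\<lambda>n \<phi>. c * s' n \<phi>))"
    by (simp add: completion_def cl_def V_smult)
  also have "\<dots> = (\<Union>s'\<in>cl s. cl (\<lambda>n \<phi>. c * s n \<phi>))" using * by simp
  also have "\<dots> = cl (\<lambda>n \<phi>. c * s n \<phi>)" using cl_self assms by blast
  finally show ?thesis .
qed

lemma U_zero: "\<zero>\<^bsub>U\<^esub> = cl (\<lambda>_ _. 0)"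
  by (simp add: completion_def cl_def V_zero)

lemma U_norm:
  assumes "s \<in> CS" shows "(\<lambda>n. N (s n)) \<longlonglongrightarrow> vnorm U (cl s)"
proof -
  have "Cauchy (\<lambda>n. N (s n))"
  proof (rule metric_CauchyI)
    fix e :: real assume "0 < e"
    obtain M where M: "!!m n. M <= m ==> M <= n ==> N (\<lambda>\<phi>. s m \<phi> - s n \<phi>) < e"
      by (rule CS_E[OF assms \<open>0 < e\<close>]) (rule that)
    show "\<exists>M. \<forall>m\<ge>M. \<forall>n\<ge>M. dist (N (s m)) (N (s n)) < e"
      using le_less_trans[OF norm_reverse[OF CS_carrier[OF assms] CS_carrier[OF assms]] M] unfolding dist_real_def by blast
  qed
  then obtain r where r: "(\<lambda>n. N (s n)) \<longlonglongrightarrow> r" using Cauchy_convergent convergent_def by blast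
  have t: "(\<lambda>n. N (t n)) \<longlonglongrightarrow> r" if "t \<in> cl s" for t
  proof -
    have "(\<lambda>n. N (s n) - N (t n)) \<longlonglongrightarrow> 0"
      by (rule tendsto_rabs_zero_cancel, rule null_seqI[OF _ _ cl_memD(4)[OF that]])
        (use norm_reverse CS_carrier[OF assms] CS_carrier[OF cl_memD(2)[OF that]] in auto)
    from tendsto_diff[OF r this] show ?thesis by simp
  qed
  have "vnorm U (cl s) = r"
    unfolding completion_def
  proof (simp, rule the_equality)
    show "\<forall>s\<in>cl s. (\<lambda>n. N (s n)) \<longlonglongrightarrow> r" using t by blast
    show "r' = r" if "\<forall>s\<in>cl s. (\<lambda>n. N (s n)) \<longlonglongrightarrow> r'" for r'
      using that cl_self[OF assms] LIMSEQ_unique[OF _ r] by blast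
  qed
  thus ?thesis using r by simp
qed

lemma U_abelian_monoid: "abelian_monoid U"
proof (rule abelian_monoidI)
  fix x y z assume "x \<in> carrier U" "y \<in> carrier U" "z \<in> carrier U"
  then obtain s t r where "x = cl s" "y = cl t" "z = cl r" "s \<in> CS" "t \<in> CS" "r \<in> CS"
    unfolding U_carrier by blast
  thus "x \<oplus>\<^bsub>U\<^esub> y \<oplus>\<^bsub>U\<^esub> z = x \<oplus>\<^bsub>U\<^esub> (y \<oplus>\<^bsub>U\<^esub> z)" by (simp add: U_add CS_add add.assoc)
next
  fix x y assume "x \<in> carrier U" "y \<in> carrier U"
  then obtain s t where *: "x = cl s" "y = cl t" "s \<in> CS" "t \<in> CS"
    unfolding U_carrier by blast
  thus "x \<oplus>\<^bsub>U\<^esub> y = y \<oplus>\<^bsub>U\<^esub> x" by (simp add: U_add add.commute)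
  show "x \<oplus>\<^bsub>U\<^esub> y \<in> carrier U" using * CS_add[of s t] by (auto simp: U_add U_carrier)
next
  have z: "(\<lambda>_ _. 0) \<in> CS" by (rule CS_const[OF zero_carrier])
  show "\<zero>\<^bsub>U\<^esub> \<in> carrier U" using z by (auto simp: U_zero U_carrier)
  show "\<zero>\<^bsub>U\<^esub> \<oplus>\<^bsub>U\<^esub> x = x" if x: "x \<in> carrier U" for x
  proof -
    obtain s where "x = cl s" "s \<in> CS" using x by (auto simp: U_carrier)
    thus ?thesis using z by (simp add: U_zero U_add)
  qed
qed

lemma U_smult_carrier: "x \<in> carrier U ==> c \<odot>\<^bsub>U\<^esub> x \<in> carrier U"
  unfolding U_carrier using U_smult CS_scale by fastforce

lemma dual_finsum:
  assumes f: "f \<in> dual U" and "finite A" "!!a. a \<in> A ==> g a \<in> carrier U"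
  shows "f (\<Oplus>\<^bsub>U\<^esub>a\<in>A. g a) = (\<Sum>a\<in>A. f (g a))"
  using assms(2,3)
proof (induction A)
  interpret abelian_monoid U by (rule U_abelian_monoid)
  have l: "linear_functional U f" using f by (simp add: dual_def)
  case empty
  have "\<zero>\<^bsub>U\<^esub> = 0 \<odot>\<^bsub>U\<^esub> \<zero>\<^bsub>U\<^esub>" using U_smult[OF CS_const[OF zero_carrier], of 0] by (simp add: U_zero)
  hence "f \<zero>\<^bsub>U\<^esub> = 0 * f \<zero>\<^bsub>U\<^esub>" using l zero_closed unfolding linear_functional_def by metis
  thus ?case by simp
next
  interpret abelian_monoid U by (rule U_abelian_monoid)
  case (insert a A)
  have "(\<Oplus>\<^bsub>U\<^esub>b\<in>insert a A. g b) = g a \<oplus>\<^bsub>U\<^esub> (\<Oplus>\<^bsub>U\<^esub>b\<in>A. g b)"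
    by (rule finsum_insert) (use insert in auto)
  moreover have "(\<Oplus>\<^bsub>U\<^esub>b\<in>A. g b) \<in> carrier U" by (rule finsum_closed) (use insert in auto)
  ultimately show ?case using insert f by (simp add: dual_def linear_functional_def)
qed

lemma dual_ball_bound:
  assumes f: "f \<in> dual_ball U" and P: "P \<in> carrier U" shows "norm (f P) <= vnorm U P"
proof -
  obtain s where s: "P = cl s" "s \<in> CS" using P by (auto simp: U_carrier)
  have f': "f \<in> dual U" "!!x. x \<in> unit_ball U ==> norm (f x) <= 1" using f by (auto simp: dual_ball_def)
  obtain B where B: "!!x. x \<in> carrier U ==> norm (f x) <= B * vnorm U x" using f'(1) by (auto simp: dual_def)
  have nn: "0 <= vnorm U P"
    unfolding s(1) by (rule LIMSEQ_le_const[OF U_norm[OF s(2)]]) (use norm_nonneg CS_carrier[OF s(2)] in auto)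
  show ?thesis
  proof (cases "vnorm U P = 0")
    case True
    thus ?thesis using B[OF P] by simp
  next
    case False
    define a where "a = inverse (vnorm U P)"
    have a: "0 < a" "a * vnorm U P = 1" using False nn by (auto simp: a_def)
    let ?Q = "of_real a \<odot>\<^bsub>U\<^esub> P"
    have Q: "?Q \<in> carrier U" by (rule U_smult_carrier[OF P])
    have "vnorm U ?Q <= a * vnorm U P"
      unfolding s(1) U_smult[OF s(2)]
    proof (rule LIMSEQ_le[OF U_norm[OF CS_scale[OF s(2)]] tendsto_mult_left[OF U_norm[OF s(2)]]])
      show "\<exists>M. \<forall>n\<ge>M. N (\<lambda>\<phi>. of_real a * s n \<phi>) <= a * N (s n)"
        using norm_scale[OF CS_carrier[OF s(2)], of "of_real a"] a by auto
    qed
    hence "?Q \<in> unit_ball U" using Q a by (simp add: unit_ball_def)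
    hence "norm (f ?Q) <= 1" by (rule f'(2))
    moreover have "f ?Q = of_real a * f P" using f'(1) P by (simp add: dual_def linear_functional_def)
    ultimately have "a * norm (f P) <= a * vnorm U P" using a by (simp add: norm_mult)
    thus ?thesis using a(1) by simp
  qed
qed

text \<open>Density: the class of a Cauchy sequence is the limit of the classes of its constant
  terms, and functionals of the dual ball do not increase distances.\<close>

lemma dual_ball_limit:
  assumes f: "f \<in> dual_ball U" and s: "s \<in> CS" shows "(\<lambda>n. f (cl (\<lambda>_. s n))) \<longlonglongrightarrow> f (cl s)"
proof -
  have lin: "linear_functional U f" using f by (simp add: dual_ball_def dual_def)
  have c: "(\<lambda>_. s n) \<in> CS" for n by (rule CS_const[OF CS_carrier[OF s]])
  have m: "(\<lambda>k \<phi>. (-1) * s n \<phi>) \<in> CS" for n by (rule CS_scale[OF c])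
  have d: "(\<lambda>k \<phi>. s k \<phi> + (-1) * s n \<phi>) \<in> CS" for n by (rule CS_add[OF s m])
  have "f (cl s) - f (cl (\<lambda>_. s n)) = f (cl (\<lambda>k \<phi>. s k \<phi> + (-1) * s n \<phi>))" for n
  proof -
    have "cl (\<lambda>k \<phi>. s k \<phi> + (-1) * s n \<phi>) = cl s \<oplus>\<^bsub>U\<^esub> ((-1) \<odot>\<^bsub>U\<^esub> cl (\<lambda>_. s n))"
      using U_add[OF s m[of n]] U_smult[OF c, of "-1" n] by simp
    moreover have "cl s \<in> carrier U" "cl (\<lambda>_. s n) \<in> carrier U" using s c by (auto simp: U_carrier)
    ultimately show ?thesis using lin U_smult_carrier by (simp add: linear_functional_def)
  qed
  moreover have "(\<lambda>n. f (cl (\<lambda>k \<phi>. s k \<phi> + (-1) * s n \<phi>))) \<longlonglongrightarrow> 0"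
  proof (rule metric_LIMSEQ_I)
    fix e :: real assume "0 < e"
    hence "0 < e / 2" by simp
    obtain M where M: "!!m n. M <= m ==> M <= n ==> N (\<lambda>\<phi>. s m \<phi> - s n \<phi>) < e / 2"
      by (rule CS_E[OF s \<open>0 < e / 2\<close>]) (rule that)
    have "dist (f (cl (\<lambda>k \<phi>. s k \<phi> + (-1) * s n \<phi>))) 0 < e" if "M <= n" for n
    proof -
      have "norm (f (cl (\<lambda>k \<phi>. s k \<phi> + (-1) * s n \<phi>))) <= vnorm U (cl (\<lambda>k \<phi>. s k \<phi> + (-1) * s n \<phi>))"
        by (rule dual_ball_bound[OF f]) (use d in \<open>auto simp: U_carrier\<close>)
      also have "\<dots> <= e / 2"
        by (rule LIMSEQ_le_const2[OF U_norm[OF d]]) (use M[OF _ that] in \<open>auto intro!: exI[of _ M] less_imp_le\<close>)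
      finally show ?thesis using \<open>0 < e\<close> by (simp add: dist_norm)
    qed
    thus "\<exists>M. \<forall>n\<ge>M. dist (f (cl (\<lambda>k \<phi>. s k \<phi> + (-1) * s n \<phi>))) 0 < e" by blast
  qed
  ultimately have "(\<lambda>n. f (cl s) - f (cl (\<lambda>_. s n))) \<longlonglongrightarrow> 0" by simp
  from tendsto_diff[OF tendsto_const[of "f (cl s)"] this] show ?thesis by simp
qed

text \<open>Evaluation at the form \<phi>, extended by continuity to the completion. The
  representative is picked arbitrarily; for a bounded \<phi> every representative yields the same
  limit (\<open>lam_limit\<close>).\<close>

definition lam :: "'a => (nat => 'a => 'k) set => 'k" where
  "lam \<phi> P = lim (\<lambda>n. (SOME s. s \<in> P) n \<phi>)"

context
  fixes \<phi> B
  assumes B: "!!x. x \<in> carrier V ==> norm (x \<phi>) <= B * N x" and B0: "0 <= B"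
begin

lemma lam_limit:
  assumes s: "s \<in> CS" shows "(\<lambda>n. s n \<phi>) \<longlonglongrightarrow> lam \<phi> (cl s)"
proof -
  have "(SOME t. t \<in> cl s) \<in> cl s" using cl_self[OF s] by (rule someI[of "\<lambda>t. t \<in> cl s"])
  define t where "t = (SOME t. t \<in> cl s)"
  have t: "t \<in> cl s" unfolding t_def by fact
  have tC: "t \<in> CS" by (rule cl_memD(2)[OF t])
  have "Cauchy (\<lambda>n. t n \<phi>)"
  proof (rule metric_CauchyI)
    fix e :: real assume e: "0 < e"
    hence "0 < e / (B + 1)" using B0 by simp
    obtain M where M: "!!m n. M <= m ==> M <= n ==> N (\<lambda>\<phi>. t m \<phi> - t n \<phi>) < e / (B + 1)"
      by (rule CS_E[OF tC \<open>0 < e / (B + 1)\<close>]) (rule that)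
    have "dist (t m \<phi>) (t n \<phi>) < e" if "M <= m" "M <= n" for m n
    proof -
      have "norm (t m \<phi> - t n \<phi>) <= B * N (\<lambda>\<phi>. t m \<phi> - t n \<phi>)"
        using B[OF diff_carrier[OF CS_carrier[OF tC] CS_carrier[OF tC]], of m n] by simp
      also have "\<dots> <= B * (e / (B + 1))" using M[OF that] B0 by (intro mult_left_mono) auto
      also have "\<dots> < e" using e B0 by (simp add: field_simps)
      finally show ?thesis by (simp add: dist_norm)
    qed
    thus "\<exists>M. \<forall>m\<ge>M. \<forall>n\<ge>M. dist (t m \<phi>) (t n \<phi>) < e" by blast
  qed
  hence l: "(\<lambda>n. t n \<phi>) \<longlonglongrightarrow> lam \<phi> (cl s)"
    unfolding lam_def t_def[symmetric] using Cauchy_convergent convergent_LIMSEQ_iff by blast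
  have "(\<lambda>n. s n \<phi> - t n \<phi>) \<longlonglongrightarrow> 0"
  proof (rule tendsto_norm_zero_cancel, rule null_seqI[OF norm_ge_zero _ tendsto_mult_right_zero[OF cl_memD(4)[OF t]]])
    show "norm (s n \<phi> - t n \<phi>) <= B * N (\<lambda>\<phi>. s n \<phi> - t n \<phi>)" for n
      using B[OF diff_carrier[OF CS_carrier[OF s] CS_carrier[OF tC]], of n n] by simp
  qed
  from tendsto_add[OF this l] show ?thesis by simp
qed

lemma lam_bound: "P \<in> carrier U ==> norm (lam \<phi> P) <= B * vnorm U P"
proof -
  assume "P \<in> carrier U"
  then obtain s where s: "P = cl s" "s \<in> CS" by (auto simp: U_carrier)
  show ?thesis
    unfolding s(1) by (rule LIMSEQ_le[OF tendsto_norm[OF lam_limit[OF s(2)]] tendsto_mult_left[OF U_norm[OF s(2)]]])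
      (use B CS_carrier[OF s(2)] in auto)
qed

lemma lam_dual: "lam \<phi> \<in> dual U"
proof -
  have "lam \<phi> (x \<oplus>\<^bsub>U\<^esub> y) = lam \<phi> x + lam \<phi> y" if xy: "x \<in> carrier U" "y \<in> carrier U" for x y
  proof -
    obtain s t where s: "x = cl s" "y = cl t" "s \<in> CS" "t \<in> CS" using xy by (auto simp: U_carrier)
    show ?thesis
      unfolding s(1,2) U_add[OF s(3,4)]
      by (rule LIMSEQ_unique[OF lam_limit[OF CS_add[OF s(3,4)]] tendsto_add[OF lam_limit[OF s(3)] lam_limit[OF s(4)]]])
  qed
  moreover have "lam \<phi> (c \<odot>\<^bsub>U\<^esub> x) = c * lam \<phi> x" if x: "x \<in> carrier U" for c x
  proof -
    obtain s where s: "x = cl s" "s \<in> CS" using x by (auto simp: U_carrier)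
    show ?thesis
      unfolding s(1) U_smult[OF s(2)]
      by (rule LIMSEQ_unique[OF lam_limit[OF CS_scale[OF s(2)]] tendsto_mult_left[OF lam_limit[OF s(2)]]])
  qed
  ultimately show ?thesis using lam_bound by (simp add: dual_def linear_functional_def) blast
qed

end

text \<open>One term s M of the Cauchy sequence approximates P for all \<phi> simultaneously, with
  an error proportional to the bound of \<phi>. This uniformity is the source of
  \<open>w_tensor\<close>.\<close>

lemma lam_approx:
  assumes "P \<in> carrier U" "0 < e"
  shows "\<exists>v\<in>carrier V. \<forall>\<phi> B. (\<forall>x\<in>carrier V. norm (x \<phi>) <= B * N x) --> 0 <= B --> norm (lam \<phi> P - v \<phi>) <= e * B"
proof -
  obtain s where s: "P = cl s" "s \<in> CS" using assms(1) by (auto simp: U_carrier)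
  obtain M where M: "!!m n. M <= m ==> M <= n ==> N (\<lambda>\<phi>. s m \<phi> - s n \<phi>) < e"
    by (rule CS_E[OF s(2) assms(2)]) (rule that)
  show ?thesis
  proof (intro bexI[of _ "s M"] allI impI)
    fix \<phi> and B :: real assume B: "\<forall>x\<in>carrier V. norm (x \<phi>) <= B * N x" "0 <= B"
    have "norm (s n \<phi> - s M \<phi>) <= e * B" if "M <= n" for n
    proof -
      have "norm (s n \<phi> - s M \<phi>) <= B * N (\<lambda>\<phi>. s n \<phi> - s M \<phi>)"
        using B(1)[rule_format, OF diff_carrier[OF CS_carrier[OF s(2)] CS_carrier[OF s(2)], of n M]] .
      also have "\<dots> <= B * e" using M[OF that order_refl] B(2) by (intro mult_left_mono) auto
      finally show ?thesis by (simp add: mult.commute)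
    qed
    moreover have "(\<lambda>n. s n \<phi> - s M \<phi>) \<longlonglongrightarrow> lam \<phi> P - s M \<phi>"
      unfolding s(1) by (rule tendsto_diff[OF lam_limit[OF _ B(2) s(2)] tendsto_const]) (use B(1) in auto)
    ultimately show "norm (lam \<phi> P - s M \<phi>) <= e * B"
      by (intro LIMSEQ_le_const2[OF tendsto_norm]) auto
  qed (rule CS_carrier[OF s(2)])
qed

end

section \<open>Functionals on the completed projective tensor product\<close>

context
  fixes X :: "('k::{real_normed_field,banach}, 'x) normed_module" and Y :: "('k, 'y) normed_module"
  assumes sX: "!!c x. x \<in> carrier X ==> c \<odot>\<^bsub>X\<^esub> x \<in> carrier X"
    and nsX: "!!c x. x \<in> carrier X ==> vnorm X (c \<odot>\<^bsub>X\<^esub> x) <= norm c * vnorm X x"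
    and nX: "!!x. x \<in> carrier X ==> 0 <= vnorm X x" and nY: "!!y. y \<in> carrier Y ==> 0 <= vnorm Y y"
begin

private definition cost :: "('x \<times> 'y) list => real" where
  "cost zs = (\<Sum>(x, y)\<leftarrow>zs. vnorm X x * vnorm Y y)"

private abbreviation "T \<equiv> tensor_of X Y"
private abbreviation "TR \<equiv> tensor_reps X Y"

private lemma cost_nonneg: "zs \<in> TR ==> 0 <= cost zs"
  unfolding cost_def tensor_reps_def by (intro sum_list_nonneg) (auto simp: nX nY)

private lemma norm_le_cost: "zs \<in> TR ==> vnorm (projective_tensor X Y) (T zs) <= cost zs"
  unfolding projective_tensor_def cost_def[symmetric]
  by (simp, rule cINF_lower, rule bdd_belowI2[of _ 0]) (auto simp: cost_nonneg)

private lemma norm_ge_cost: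
  assumes "zs \<in> TR" "!!zs'. zs' \<in> TR ==> T zs' = T zs ==> a <= cost zs'"
  shows "a <= vnorm (projective_tensor X Y) (T zs)"
  unfolding projective_tensor_def cost_def[symmetric] using assms by (simp, intro cINF_greatest) auto

private lemma T_append: "T (zs @ zs') = (\<lambda>\<phi>. T zs \<phi> + T zs' \<phi>)"
  by (auto simp: tensor_of_def)

private definition sc where "sc c = map (\<lambda>(x, y). (c \<odot>\<^bsub>X\<^esub> x, y :: 'y))"

private lemma sc_TR: "zs \<in> TR ==> sc c zs \<in> TR"
  by (auto simp: sc_def tensor_reps_def sX)

private lemma T_sc: "zs \<in> TR ==> T (sc c zs) = (\<lambda>\<phi>. c * T zs \<phi>)"
proof
  fix \<phi> assume zs: "zs \<in> TR"
  show "T (sc c zs) \<phi> = c * T zs \<phi>"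
  proof (cases "bilinear_form X Y \<phi>")
    case True
    hence "\<phi> (c \<odot>\<^bsub>X\<^esub> x) y = c * \<phi> x y" if "x \<in> carrier X" "y \<in> carrier Y" for x y
      using that by (simp add: bilinear_form_def linear_functional_def)
    hence "(\<Sum>(x, y)\<leftarrow>sc c zs. \<phi> x y) = c * (\<Sum>(x, y)\<leftarrow>zs. \<phi> x y)"
      using zs by (induction zs) (auto simp: sc_def tensor_reps_def distrib_left)
    thus ?thesis using True by (simp add: tensor_of_def)
  qed (simp add: tensor_of_def)
qed

private lemma cost_sc: "zs \<in> TR ==> cost (sc c zs) <= norm c * cost zs"
proof (induction zs)
  case (Cons z zs)
  obtain x y where z: "z = (x, y)" by (cases z)
  have *: "zs \<in> TR" "x \<in> carrier X" "y \<in> carrier Y" using Cons.prems by (auto simp: tensor_reps_def z)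
  have "vnorm X (c \<odot>\<^bsub>X\<^esub> x) * vnorm Y y <= norm c * vnorm X x * vnorm Y y"
    by (rule mult_right_mono[OF nsX[OF *(2)] nY[OF *(3)]])
  thus ?case using Cons.IH[OF *(1)] by (simp add: cost_def sc_def z distrib_left mult.assoc)
qed (simp add: sc_def cost_def)

lemma PT_carrier: "carrier (projective_tensor X Y) = tensor_of X Y ` tensor_reps X Y"
  by (simp add: projective_tensor_def)

lemma fun_normed_projective_tensor: "fun_normed (projective_tensor X Y)"
proof
  let ?V = "projective_tensor X Y"
  show z: "(\<lambda>_. 0) \<in> carrier ?V"
  proof -
    have "T [] = (\<lambda>_. 0)" "[] \<in> TR" by (auto simp: tensor_of_def tensor_reps_def)
    thus ?thesis unfolding PT_carrier by (metis imageI)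
  qed
  show "(\<lambda>\<phi>. v \<phi> + v' \<phi>) \<in> carrier ?V" if vv: "v \<in> carrier ?V" "v' \<in> carrier ?V" for v v'
  proof -
    obtain zs zs' where "v = T zs" "v' = T zs'" "zs \<in> TR" "zs' \<in> TR" using vv unfolding PT_carrier by blast
    hence "(\<lambda>\<phi>. v \<phi> + v' \<phi>) = T (zs @ zs')" "zs @ zs' \<in> TR" by (auto simp: T_append tensor_reps_def)
    thus ?thesis unfolding PT_carrier by blast
  qed
  show "(\<lambda>\<phi>. c * v \<phi>) \<in> carrier ?V" if v: "v \<in> carrier ?V" for v c
    using v T_sc[symmetric] sc_TR unfolding PT_carrier by fastforce
  show "0 <= vnorm ?V v" if v: "v \<in> carrier ?V" for v
    using v norm_ge_cost[of _ 0] cost_nonneg unfolding PT_carrier by blast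
  show "vnorm ?V (\<lambda>\<phi>. v \<phi> + v' \<phi>) <= vnorm ?V v + vnorm ?V v'" if vv: "v \<in> carrier ?V" "v' \<in> carrier ?V" for v v'
  proof -
    obtain zs zs' where zs: "v = T zs" "v' = T zs'" "zs \<in> TR" "zs' \<in> TR" using vv unfolding PT_carrier by blast
    have le: "vnorm ?V (\<lambda>\<phi>. v \<phi> + v' \<phi>) <= cost ys + cost ys'"
      if "ys \<in> TR" "T ys = v" "ys' \<in> TR" "T ys' = v'" for ys ys'
      using that norm_le_cost[of "ys @ ys'"] unfolding T_append by (auto simp: tensor_reps_def cost_def)
    have "vnorm ?V (\<lambda>\<phi>. v \<phi> + v' \<phi>) - cost ys' <= vnorm ?V v" if "ys' \<in> TR" "T ys' = v'" for ys'
      unfolding zs(1) using le that zs by (intro norm_ge_cost) (auto simp: algebra_simps)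
    hence "vnorm ?V (\<lambda>\<phi>. v \<phi> + v' \<phi>) - vnorm ?V v <= vnorm ?V v'"
      unfolding zs(2) using zs by (intro norm_ge_cost) (auto simp: algebra_simps)
    thus ?thesis by simp
  qed
  show "vnorm ?V (\<lambda>\<phi>. c * v \<phi>) <= norm c * vnorm ?V v" if v: "v \<in> carrier ?V" for v c
  proof -
    obtain zs where zs: "v = T zs" "zs \<in> TR" using v unfolding PT_carrier by blast
    have le: "vnorm ?V (\<lambda>\<phi>. c * v \<phi>) <= norm c * cost ys" if "ys \<in> TR" "T ys = v" for ys
      using norm_le_cost[OF sc_TR[OF that(1)], of c] cost_sc[OF that(1), of c] T_sc[OF that(1), of c] that(2) by simp
    show ?thesis
    proof (cases "c = 0")
      case True
      have "T [] = (\<lambda>_. 0)" "[] \<in> TR" by (auto simp: tensor_of_def tensor_reps_def)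
      hence "vnorm ?V (\<lambda>_. 0) <= 0" using norm_le_cost[of "[]"] by (simp add: cost_def)
      thus ?thesis using True by simp
    next
      case False
      have "vnorm ?V (\<lambda>\<phi>. c * v \<phi>) / norm c <= vnorm ?V v"
        unfolding zs(1) using le False zs by (intro norm_ge_cost) (auto simp: pos_divide_le_eq mult.commute)
      thus ?thesis using False by (simp add: pos_divide_le_eq mult.commute)
    qed
  qed
qed (simp_all add: projective_tensor_def)

lemma PT_norm_single:
  "x \<in> carrier X ==> y \<in> carrier Y ==> vnorm (projective_tensor X Y) (tensor_of X Y [(x, y)]) <= vnorm X x * vnorm Y y"
  using norm_le_cost[of "[(x, y)]"] by (simp add: tensor_reps_def cost_def)

lemma PT_bound:
  assumes \<phi>: "bilinear_form X Y \<phi>" "0 <= B"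
    "!!x y. x \<in> carrier X ==> y \<in> carrier Y ==> norm (\<phi> x y) <= B * vnorm X x * vnorm Y y"
    and v: "v \<in> carrier (projective_tensor X Y)"
  shows "norm (v \<phi>) <= B * vnorm (projective_tensor X Y) v"
proof -
  obtain zs where zs: "v = T zs" "zs \<in> TR" using v unfolding PT_carrier by blast
  have "norm (\<Sum>(x, y)\<leftarrow>ys. \<phi> x y) <= B * cost ys" if "ys \<in> TR" for ys
    using that
  proof (induction ys)
    case (Cons z ys)
    obtain x y where z: "z = (x, y)" by (cases z)
    have *: "ys \<in> TR" "x \<in> carrier X" "y \<in> carrier Y" using Cons.prems by (auto simp: tensor_reps_def z)
    show ?case
      using norm_triangle_mono[OF \<phi>(3)[OF *(2,3)] Cons.IH[OF *(1)]] by (simp add: z cost_def distrib_left mult.assoc)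
  qed (simp add: cost_def)
  hence le: "norm (v \<phi>) <= B * cost ys" if "ys \<in> TR" "T ys = v" for ys
    using that \<phi>(1) by (auto simp: tensor_of_def)
  show ?thesis
  proof (cases "B = 0")
    case True
    thus ?thesis using le[OF zs(2)] zs(1) by simp
  next
    case False
    hence "norm (v \<phi>) / B <= vnorm (projective_tensor X Y) v"
      unfolding zs(1) using le zs \<phi>(2) by (intro norm_ge_cost) (auto simp: pos_divide_le_eq mult.commute)
    thus ?thesis using False \<phi>(2) by (simp add: pos_divide_le_eq mult.commute)
  qed
qed

end

section \<open>Tensor products of spaces of continuous functions\<close>

lemma C0_space_simps:
  "f \<oplus>\<^bsub>C0_space \<theta>\<^esub> g = (\<lambda>x. f x + g x)" "c \<odot>\<^bsub>C0_space \<theta>\<^esub> f = (\<lambda>x. c * f x)"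
  "vnorm (C0_space \<theta>) f = (SUP x\<in>{..\<theta>}. norm (f x))"
  by (simp_all add: C0_space_def C_space_def)

context
  fixes \<theta> :: omega1 and f :: "omega1 => 'k::real_normed_field"
  assumes f: "f \<in> Sp (RB \<theta>)"
begin

lemma sbd_C0_norm: "sbd f (vnorm (C0_space \<theta>) f)"
  unfolding sbd_def
proof
  fix x
  obtain a where "sbd f a" using f fspace_Sp[of "RB \<theta>"] unfolding fspace_def by blast
  hence bdd: "bdd_above ((\<lambda>x. norm (f x)) ` {..\<theta>})" by (intro bdd_aboveI2[of _ _ a]) (simp add: sbd_def)
  have le: "norm (f y) <= vnorm (C0_space \<theta>) f" if "y <= \<theta>" for y
    unfolding C0_space_simps using that bdd by (intro cSUP_upper) auto
  show "norm (f x) <= vnorm (C0_space \<theta>) f"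
  proof (cases "x <= \<theta>")
    case False
    hence "f x = 0" using Sp_RB_outside[OF f] by simp
    thus ?thesis using order_trans[OF norm_ge_zero le[OF order_refl]] by simp
  qed (rule le)
qed

lemma C0_norm_nonneg: "0 <= vnorm (C0_space \<theta>) f"
  by (rule sbd_nonneg[OF sbd_C0_norm])

end

lemma C0_norm_le: "sbd f a ==> vnorm (C0_space \<theta>) f <= a"
  unfolding C0_space_simps sbd_def by (intro cSUP_least) auto

lemma (in fun_normed) fun_normed_completion_const_norm:
  assumes "v \<in> carrier V" shows "vnorm U (cl (\<lambda>_. v)) = N v"
  by (rule LIMSEQ_unique[OF U_norm[OF CS_const[OF assms]] tendsto_const])

locale C0_pair =
  fixes \<theta> \<theta>' :: omega1 and X Y :: "(omega1 => 'k::{real_normed_field,banach}) set" and X0 Y0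
  defines "X0 \<equiv> C0_space \<theta> :: ('k, omega1 => 'k) normed_module" and "Y0 \<equiv> C0_space \<theta>' :: ('k, omega1 => 'k) normed_module"
    and "X \<equiv> Sp (RB \<theta>)" and "Y \<equiv> Sp (RB \<theta>')"
  assumes pos: "0 < \<theta>" "0 < \<theta>'"
begin

lemma X0_carrier: "carrier X0 = X" and Y0_carrier: "carrier Y0 = Y"
  unfolding X0_def Y0_def X_def Y_def by (rule C0_space_carrier[OF pos(1)], rule C0_space_carrier[OF pos(2)])

lemma fspace_XY: "fspace X" "fspace Y"
  unfolding X_def Y_def by (rule fspace_Sp)+

lemma X0_norm: "x \<in> X ==> sbd x (vnorm X0 x)" "x \<in> X ==> 0 <= vnorm X0 x" "sbd x a ==> vnorm X0 x <= a"
  unfolding X0_def X_def by (rule sbd_C0_norm, assumption, rule C0_norm_nonneg, assumption, rule C0_norm_le)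

lemma Y0_norm: "x \<in> Y ==> sbd x (vnorm Y0 x)" "x \<in> Y ==> 0 <= vnorm Y0 x" "sbd x a ==> vnorm Y0 x <= a"
  unfolding Y0_def Y_def by (rule sbd_C0_norm, assumption, rule C0_norm_nonneg, assumption, rule C0_norm_le)

lemma X0_ops: "x \<oplus>\<^bsub>X0\<^esub> x' = (\<lambda>p. x p + x' p)" "c \<odot>\<^bsub>X0\<^esub> x = (\<lambda>p. c * x p)"
  and Y0_ops: "x \<oplus>\<^bsub>Y0\<^esub> x' = (\<lambda>p. x p + x' p)" "c \<odot>\<^bsub>Y0\<^esub> x = (\<lambda>p. c * x p)"
  unfolding X0_def Y0_def by (rule C0_space_simps)+

lemma bilinear_form_iff:
  "bilinear_form X0 Y0 \<phi> \<longleftrightarrow>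
    (\<forall>x\<in>X. (\<forall>y\<in>Y. \<forall>y'\<in>Y. \<phi> x (\<lambda>p. y p + y' p) = \<phi> x y + \<phi> x y') \<and> (\<forall>c. \<forall>y\<in>Y. \<phi> x (\<lambda>p. c * y p) = c * \<phi> x y)) \<and>
    (\<forall>y\<in>Y. (\<forall>x\<in>X. \<forall>x'\<in>X. \<phi> (\<lambda>p. x p + x' p) y = \<phi> x y + \<phi> x' y) \<and> (\<forall>c. \<forall>x\<in>X. \<phi> (\<lambda>p. c * x p) y = c * \<phi> x y))"
  unfolding bilinear_form_def linear_functional_def X0_carrier Y0_carrier X0_ops Y0_ops ..

lemma bilinear_formD:
  assumes "bilinear_form X0 Y0 \<phi>"
  shows "x \<in> X ==> x' \<in> X ==> y \<in> Y ==> \<phi> (\<lambda>p. x p + x' p) y = \<phi> x y + \<phi> x' y"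
    "x \<in> X ==> y \<in> Y ==> \<phi> (\<lambda>p. c * x p) y = c * \<phi> x y"
    "x \<in> X ==> y \<in> Y ==> y' \<in> Y ==> \<phi> x (\<lambda>p. y p + y' p) = \<phi> x y + \<phi> x y'"
    "x \<in> X ==> y \<in> Y ==> \<phi> x (\<lambda>p. c * y p) = c * \<phi> x y"
  using assms unfolding bilinear_form_iff by simp_all

lemma X0_smult:
  assumes "x \<in> carrier X0"
  shows "c \<odot>\<^bsub>X0\<^esub> x \<in> carrier X0" "vnorm X0 (c \<odot>\<^bsub>X0\<^esub> x) <= norm c * vnorm X0 x"
proof -
  have x: "x \<in> X" "c \<odot>\<^bsub>X0\<^esub> x = (\<lambda>y. c * x y)" using assms by (simp_all add: X0_carrier X0_ops)
  thus "c \<odot>\<^bsub>X0\<^esub> x \<in> carrier X0" using fspace_scale[OF fspace_XY(1) x(1)] by (simp add: X0_carrier)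
  have "sbd (\<lambda>y. c * x y) (norm c * vnorm X0 x)"
    using X0_norm(1)[OF x(1)] by (simp add: sbd_def norm_mult mult_left_mono)
  thus "vnorm X0 (c \<odot>\<^bsub>X0\<^esub> x) <= norm c * vnorm X0 x" unfolding x(2) by (rule X0_norm(3))
qed

lemma XY_norm_nonneg: "x \<in> carrier X0 ==> 0 <= vnorm X0 x" "y \<in> carrier Y0 ==> 0 <= vnorm Y0 y"
  by (simp_all add: X0_carrier Y0_carrier X0_norm(2) Y0_norm(2))

sublocale fun_normed "projective_tensor X0 Y0"
  by (rule fun_normed_projective_tensor[OF X0_smult XY_norm_nonneg])

lemma form_bilinear_form:
  assumes "form X Y \<phi> B" shows "bilinear_form X0 Y0 \<phi>"
  unfolding bilinear_form_iff using formD(2-5)[OF assms] by simp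

lemma form_eval_bound:
  assumes "form X Y \<phi> B" "v \<in> carrier (projective_tensor X0 Y0)"
  shows "norm (v \<phi>) <= B * vnorm (projective_tensor X0 Y0) v"
proof (rule PT_bound[OF X0_smult XY_norm_nonneg form_bilinear_form[OF assms(1)] formD(1)[OF assms(1)] _ assms(2)])
  fix x y assume "x \<in> carrier X0" "y \<in> carrier Y0"
  thus "norm (\<phi> x y) <= B * vnorm X0 x * vnorm Y0 y"
    unfolding X0_carrier Y0_carrier by (intro formD(6)[OF assms(1)] X0_norm(1) Y0_norm(1))
qed

text \<open>Restricting the functional to elementary tensors gives a form of norm at most 1. It
  determines the functional on finite tensors by linearity and on the completion by density, so
  testing with forms covers the whole dual ball.\<close>

lemma dual_ball_form:
  assumes f: "f \<in> dual_ball U"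
  obtains \<phi> where "form X Y \<phi> 1" "!!P. P \<in> carrier U ==> f P = lam \<phi> P"
proof -
  let ?V = "projective_tensor X0 Y0" and ?t = "tensor_of X0 Y0"
  have lin: "linear_functional U f" using f by (simp add: dual_ball_def dual_def)
  define g where "g v = f (cl (\<lambda>_. v))" for v
  have U: "cl (\<lambda>_. v) \<in> carrier U" if "v \<in> carrier ?V" for v using CS_const[OF that] by (auto simp: U_carrier)
  have g_add: "g (\<lambda>\<phi>. v \<phi> + v' \<phi>) = g v + g v'" if "v \<in> carrier ?V" "v' \<in> carrier ?V" for v v'
  proof -
    have "f (cl (\<lambda>_. v) \<oplus>\<^bsub>U\<^esub> cl (\<lambda>_. v')) = g v + g v'"
      using lin U[OF that(1)] U[OF that(2)] by (simp add: linear_functional_def g_def)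
    thus ?thesis unfolding U_add[OF CS_const[OF that(1)] CS_const[OF that(2)]] g_def .
  qed
  have g_scale: "g (\<lambda>\<phi>. c * v \<phi>) = c * g v" if "v \<in> carrier ?V" for v c
  proof -
    have "f (c \<odot>\<^bsub>U\<^esub> cl (\<lambda>_. v)) = c * g v"
      using lin U[OF that] by (simp add: linear_functional_def g_def)
    thus ?thesis unfolding U_smult[OF CS_const[OF that]] g_def .
  qed
  have g_bound: "norm (g v) <= vnorm ?V v" if "v \<in> carrier ?V" for v
    using dual_ball_bound[OF f U[OF that]] fun_normed_completion_const_norm[OF that] by (simp add: g_def)
  have tc: "?t [(x, y)] \<in> carrier ?V" if "x \<in> X" "y \<in> Y" for x y
    using that by (auto simp: projective_tensor_def tensor_reps_def X0_carrier Y0_carrier)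
  define \<phi> where "\<phi> x y = g (?t [(x, y)])" for x y
  have F: "form X Y \<phi> 1"
  proof (rule formI)
    fix x x' y assume x: "x \<in> X" "x' \<in> X" "y \<in> Y"
    have "?t [(\<lambda>p. x p + x' p, y)] = (\<lambda>\<psi>. ?t [(x, y)] \<psi> + ?t [(x', y)] \<psi>)"
      using bilinear_formD(1)[OF _ x] by (auto simp: tensor_of_def)
    thus "\<phi> (\<lambda>p. x p + x' p) y = \<phi> x y + \<phi> x' y" unfolding \<phi>_def using g_add[OF tc tc] x by simp
  next
    fix c x y assume x: "x \<in> X" "y \<in> Y"
    have "?t [(\<lambda>p. c * x p, y)] = (\<lambda>\<psi>. c * ?t [(x, y)] \<psi>)" "?t [(x, \<lambda>p. c * y p)] = (\<lambda>\<psi>. c * ?t [(x, y)] \<psi>)"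
      using bilinear_formD(2,4)[OF _ x] by (auto simp: tensor_of_def)
    thus "\<phi> (\<lambda>p. c * x p) y = c * \<phi> x y" "\<phi> x (\<lambda>p. c * y p) = c * \<phi> x y"
      unfolding \<phi>_def using g_scale[OF tc] x by simp_all
  next
    fix x y y' assume x: "x \<in> X" "y \<in> Y" "y' \<in> Y"
    have "?t [(x, \<lambda>p. y p + y' p)] = (\<lambda>\<psi>. ?t [(x, y)] \<psi> + ?t [(x, y')] \<psi>)"
      using bilinear_formD(3)[OF _ x] by (auto simp: tensor_of_def)
    thus "\<phi> x (\<lambda>p. y p + y' p) = \<phi> x y + \<phi> x y'" unfolding \<phi>_def using g_add[OF tc tc] x by simp
  next
    fix x y a b assume x: "x \<in> X" "y \<in> Y" and ab: "sbd x a" "sbd y b"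
    have "norm (\<phi> x y) <= vnorm ?V (?t [(x, y)])" unfolding \<phi>_def by (rule g_bound[OF tc[OF x]])
    also have "\<dots> <= vnorm X0 x * vnorm Y0 y"
      by (rule PT_norm_single[OF X0_smult XY_norm_nonneg]) (use x in \<open>simp_all add: X0_carrier Y0_carrier\<close>)
    also have "\<dots> <= a * b"
      using X0_norm(2)[OF x(1)] Y0_norm(2)[OF x(2)] X0_norm(3)[OF ab(1)] Y0_norm(3)[OF ab(2)] by (intro mult_mono) auto
    finally show "norm (\<phi> x y) <= 1 * a * b" by simp
  qed simp
  have gt: "g (?t zs) = (\<Sum>(x, y)\<leftarrow>zs. \<phi> x y)" if "set zs \<subseteq> X \<times> Y" for zs
    using that
  proof (induction zs)
    case Nil
    have "g (\<lambda>\<phi>. 0 * (\<lambda>_. 0) \<phi>) = 0 * g (\<lambda>_. 0)" by (rule g_scale[OF zero_carrier])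
    thus ?case by (simp add: tensor_of_def if_distrib cong: if_cong)
  next
    case (Cons z zs)
    obtain x y where z: "z = (x, y)" by (cases z)
    have xy: "x \<in> X" "y \<in> Y" "set zs \<subseteq> X \<times> Y" using Cons.prems by (auto simp: z)
    have zs: "?t zs \<in> carrier ?V" using xy(3) by (auto simp: projective_tensor_def tensor_reps_def X0_carrier Y0_carrier)
    have "?t (z # zs) = (\<lambda>\<psi>. ?t [(x, y)] \<psi> + ?t zs \<psi>)" by (auto simp: tensor_of_def z)
    thus ?case using g_add[OF tc[OF xy(1,2)] zs] Cons.IH[OF xy(3)] by (simp add: z \<phi>_def)
  qed
  have gv: "g v = v \<phi>" if v: "v \<in> carrier ?V" for v
  proof -
    obtain zs where "v = ?t zs" "set zs \<subseteq> X \<times> Y"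
      using v by (auto simp: projective_tensor_def tensor_reps_def X0_carrier Y0_carrier)
    thus ?thesis using gt form_bilinear_form[OF F] by (simp add: tensor_of_def)
  qed
  have "f P = lam \<phi> P" if P: "P \<in> carrier U" for P
  proof -
    obtain s where s: "P = cl s" "s \<in> CS" using P by (auto simp: U_carrier)
    have "(\<lambda>n. s n \<phi>) \<longlonglongrightarrow> f P"
      using dual_ball_limit[OF f s(2)] gv[OF CS_carrier[OF s(2)]] by (simp add: s(1) g_def)
    moreover have "(\<lambda>n. s n \<phi>) \<longlonglongrightarrow> lam \<phi> P"
      unfolding s(1) by (rule lam_limit[OF form_eval_bound[OF F] _ s(2)]) auto
    ultimately show ?thesis by (rule LIMSEQ_unique)
  qed
  with F show thesis by (rule that)
qed

text \<open>The functional of index E evaluates forms at \<open>u E\<close>. For a bounded form this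
  belongs to the dual in the variable \<open>u E\<close>, so weak nullness of the collection gives
  \<open>w_null\<close>.\<close>

lemma wfam_collection:
  assumes u: "u \<in> collections_in_ball U" "weakly_null_collection U u"
  shows "wfam X Y (\<lambda>E \<phi>. lam \<phi> (u E))"
proof
  show "fspace X" "fspace Y" by (rule fspace_XY)+
  have uE: "u E \<in> carrier U" "vnorm U (u E) <= 1" if "hist E" "E ~= {}" for E
    using u(1) that by (auto simp: collections_in_ball_def unit_ball_def hist_def fin_subsets_def)
  fix E and \<phi> :: "(omega1, 'k) bform" and B e :: real
  show "norm (lam \<phi> (u E)) <= B" if "hist E" "E ~= {}" and F: "form X Y \<phi> B"
  proof -
    have "norm (lam \<phi> (u E)) <= B * vnorm U (u E)"
      by (rule lam_bound[OF form_eval_bound[OF F] formD(1)[OF F] uE(1)[OF that(1,2)]])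
    also have "\<dots> <= B * 1" by (rule mult_left_mono[OF uE(2)[OF that(1,2)] formD(1)[OF F]])
    finally show ?thesis by simp
  qed
  show "(\<lambda>k. lam \<phi> (u (insert k E))) \<longlonglongrightarrow> 0" if "hist E" and F: "form X Y \<phi> B"
    using u(2) that(1) lam_dual[OF form_eval_bound[OF F] formD(1)[OF F]]
    by (simp add: weakly_null_collection_def hist_def fin_subsets_def)
  show "\<exists>zs. set zs \<subseteq> X \<times> Y \<and> (\<forall>\<phi> B. form X Y \<phi> B --> norm (lam \<phi> (u E) - (\<Sum>(x, y)\<leftarrow>zs. \<phi> x y)) <= e * B)"
    if E: "hist E" "E ~= {}" and e: "0 < e"
  proof -
    obtain v where v: "v \<in> carrier (projective_tensor X0 Y0)"
      "!!\<phi> B. (\<forall>x\<in>carrier (projective_tensor X0 Y0). norm (x \<phi>) <= B * vnorm (projective_tensor X0 Y0) x) ==> 0 <= B ==>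
        norm (lam \<phi> (u E) - v \<phi>) <= e * B"
      using lam_approx[OF uE(1)[OF E] e] by blast
    obtain zs where zs: "v = tensor_of X0 Y0 zs" "set zs \<subseteq> X \<times> Y"
      using v(1) by (auto simp: projective_tensor_def tensor_reps_def X0_carrier Y0_carrier)
    have "norm (lam \<phi> (u E) - (\<Sum>(x, y)\<leftarrow>zs. \<phi> x y)) <= e * B" if F: "form X Y \<phi> B" for \<phi> B
      using v(2)[OF ballI[OF form_eval_bound[OF F]] formD(1)[OF F]] form_bilinear_form[OF F]
      by (simp add: zs(1) tensor_of_def)
    thus ?thesis using zs(2) by blast
  qed
qed

end

section \<open>The two properties\<close>

text \<open>Elements of L are picked greedily, each beyond all earlier ones and beyond the values of
  g at all subsets of the earlier ones, of which there are finitely many.\<close>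

lemma sparse_subset_ex:
  fixes g :: "nat set => nat"
  assumes L: "L \<in> inf_subsets {1..}"
  obtains M where "M \<in> inf_subsets L" "!!k H. k \<in> M ==> H \<subseteq> M \<inter> {..<k} ==> g H <= k"
proof -
  define x where "x H = (SOME k. k \<in> L \<and> (\<forall>j\<in>H. j < k) \<and> (\<forall>K\<in>Pow H. g K <= k))" for H
  have x: "x H \<in> L \<and> (\<forall>j\<in>H. j < x H) \<and> (\<forall>K\<in>Pow H. g K <= x H)" if H: "finite H" for H
  proof -
    have "infinite L" using L by (simp add: inf_subsets_def)
    then obtain k where k: "Suc (Max (insert 0 H)) + Max (g ` Pow H) < k" "k \<in> L"
      using infinite_nat_iff_unbounded by blast
    have "j < k" if "j \<in> H" for j
    proof -
      have "j <= Max (insert 0 H)" using H that by (intro Max_ge) auto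
      thus ?thesis using k(1) by linarith
    qed
    moreover have "g K <= k" if "K \<in> Pow H" for K
    proof -
      have "g K <= Max (g ` Pow H)" using H that by (intro Max_ge) auto
      thus ?thesis using k(1) by linarith
    qed
    ultimately have "\<exists>k. k \<in> L \<and> (\<forall>j\<in>H. j < k) \<and> (\<forall>K\<in>Pow H. g K <= k)" using k(2) by blast
    thus ?thesis unfolding x_def by (rule someI_ex)
  qed
  define H where "H = rec_nat {} (\<lambda>_ h. insert (x h) h)"
  have H: "H 0 = {}" "H (Suc n) = insert (x (H n)) (H n)" for n by (simp_all add: H_def)
  have fin: "finite (H n)" for n by (induction n) (simp_all add: H)
  have Hm: "H m \<subseteq> H n" if "m <= n" for m n using that by (induction rule: dec_induct) (auto simp: H)
  have less: "x (H m) < x (H n)" if "m < n" for m n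
    using x[OF fin, of n] Hm[of "Suc m" n] that by (auto simp: H)
  define M where "M = range (\<lambda>n. x (H n))"
  have "inj (\<lambda>n. x (H n))" using less by (intro linorder_injI) (metis less_irrefl)
  hence "infinite M" unfolding M_def by (rule range_inj_infinite)
  moreover have "M \<subseteq> L" using x[OF fin] by (auto simp: M_def)
  ultimately have "M \<in> inf_subsets L" by (simp add: inf_subsets_def)
  moreover have "g K <= k" if k: "k \<in> M" "K \<subseteq> M \<inter> {..<k}" for k K
  proof -
    obtain n where n: "k = x (H n)" using k(1) by (auto simp: M_def)
    have "K \<subseteq> H n"
    proof
      fix j assume "j \<in> K"
      then obtain m where m: "j = x (H m)" "x (H m) < x (H n)" using k(2) n by (auto simp: M_def)
      hence "m < n" using less[of n m] by (metis less_asym linorder_neqE_nat)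
      thus "j \<in> H n" using Hm[of "Suc m" n] m(1) by (auto simp: H)
    qed
    thus ?thesis using x[OF fin[of n]] n by blast
  qed
  ultimately show thesis by (rule that)
qed

text \<open>This returns from the game to subsequences: a single M inside L meets the demands of g
  at every element, hence along all the blocks of its decomposition.\<close>

lemma (in schreier_hierarchy) decomp_sparse_ex:
  assumes L: "L \<in> inf_subsets {1..}"
  obtains M where "M \<in> inf_subsets L" "M \<in> inf_subsets {1..}"
    "!!n. vb g \<zeta> (\<Union>k\<in>{1..n}. decomp (S \<zeta>) M k) (decomp (S \<zeta>) M (Suc n))"
proof -
  obtain M where M: "M \<in> inf_subsets L" "!!k H. k \<in> M ==> H \<subseteq> M \<inter> {..<k} ==> g H <= k"
    using L by (rule sparse_subset_ex) (rule that)
  have M1: "M \<in> inf_subsets {1..}" using M(1) L by (auto simp: inf_subsets_def)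
  obtain D where D: "!!n. block \<zeta> (D (Suc n))" "!!n. set_less (\<Union>k\<in>{1..n}. D k) (D (Suc n))"
    "!!n. D (Suc n) \<subseteq> M" "decomp (S \<zeta>) M = D"
    using M1 by (rule decomp_ex[of M \<zeta>]) (rule that)
  have Dk: "finite (D k) \<and> D k \<subseteq> M \<and> D k \<subseteq> {1..}" if "1 <= k" for k
    using blkD[OF D(1)[of "k - 1"]] D(3)[of "k - 1"] that by simp
  have "vb g \<zeta> (\<Union>k\<in>{1..n}. D k) (D (Suc n))" for n
    unfolding vb_def
  proof (intro conjI D(1,2))
    show "hist (\<Union>k\<in>{1..n}. D k)" unfolding hist_def using Dk by (auto simp: subset_iff)
    have sub: "(\<Union>k\<in>{1..n}. D k) \<union> D (Suc n) \<subseteq> M" using Dk by (auto simp: subset_iff)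
    show "sparse g (\<Union>k\<in>{1..n}. D k) (D (Suc n))"
      unfolding sparse_def
    proof
      fix k assume "k \<in> D (Suc n)"
      thus "g (((\<Union>k\<in>{1..n}. D k) \<union> D (Suc n)) \<inter> {..<k}) <= k"
        by (intro M(2)) (use sub D(3) in blast)+
    qed
  qed
  thus thesis using that[OF M(1) M1] unfolding D(4) by blast
qed

lemma weakly_summing_norm_le:
  fixes V :: "('k::real_normed_field, 'v) normed_module"
  assumes p: "0 < p" and \<gamma>: "0 <= \<gamma>"
    and le: "!!f N. f \<in> dual_ball V ==> (\<Sum>i<N. norm (f (e (Suc i))) powr p) <= \<gamma> powr p"
  shows "weakly_summing_norm p V e <= ennreal \<gamma>"
  unfolding weakly_summing_norm_def
proof (rule SUP_least)
  fix f assume f: "f \<in> dual_ball V"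
  define s where "s = (\<Sum>i. ennreal (norm (f (e (Suc i))) powr p))"
  have "s <= ennreal (\<gamma> powr p)"
    unfolding s_def suminf_eq_SUP
  proof (rule SUP_least)
    fix N
    have "(\<Sum>i<N. ennreal (norm (f (e (Suc i))) powr p)) = ennreal (\<Sum>i<N. norm (f (e (Suc i))) powr p)"
      by (rule sum_ennreal) simp
    also have "\<dots> <= ennreal (\<gamma> powr p)" by (rule ennreal_leI[OF le[OF f]])
    finally show "(\<Sum>i<N. ennreal (norm (f (e (Suc i))) powr p)) <= ennreal (\<gamma> powr p)" .
  qed
  hence "s ~= \<infinity>" "enn2real s <= \<gamma> powr p" by (auto simp: enn2real_leI top_unique)
  moreover have "enn2real s powr (1 / p) <= \<gamma>"
  proof -
    have "enn2real s powr (1 / p) <= (\<gamma> powr p) powr (1 / p)" using p \<open>enn2real s <= \<gamma> powr p\<close> by (intro powr_mono2) auto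
    also have "\<dots> = \<gamma>" using p \<gamma> by (simp add: powr_powr)
    finally show ?thesis .
  qed
  ultimately show "(let s = \<Sum>i. ennreal (norm (f (e (Suc i))) powr p)
      in if s = \<infinity> then \<infinity> else ennreal (enn2real s powr (1 / p))) <= ennreal \<gamma>"
    unfolding Let_def s_def[symmetric] by (simp add: ennreal_leI)
qed

lemma segments_between_hist:
  assumes "finite B" "B \<subseteq> {1..}" "E \<in> segments_between A B" shows "hist E" "E ~= {}"
  using assms finite_subset unfolding segments_between_def init_seg_def hist_def by auto

lemma finite_segments_between: "finite B ==> finite (segments_between A B)"
  by (rule finite_subset[of _ "Pow B"]) (auto simp: segments_between_def init_seg_def)

context C0_pair
begin

lemma dual_average:
  fixes k :: "nat set => real"
  assumes f: "f \<in> dual_ball U" and u: "u \<in> collections_in_ball U" and \<phi>: "!!P. P \<in> carrier U ==> f P = lam \<phi> P"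
    and B: "finite B" "B \<subseteq> {1..}"
  shows "f (\<Oplus>\<^bsub>U\<^esub>E\<in>segments_between A B. of_real (k E) \<odot>\<^bsub>U\<^esub> u E) =
    (\<Sum>E\<in>segments_between A B. of_real (k E) * lam \<phi> (u E))"
proof -
  have fd: "f \<in> dual U" using f by (simp add: dual_ball_def)
  have uE: "u E \<in> carrier U" if "E \<in> segments_between A B" for E
    using u segments_between_hist[OF B that] by (auto simp: collections_in_ball_def unit_ball_def hist_def fin_subsets_def)
  have "f (\<Oplus>\<^bsub>U\<^esub>E\<in>segments_between A B. of_real (k E) \<odot>\<^bsub>U\<^esub> u E) =
      (\<Sum>E\<in>segments_between A B. f (of_real (k E) \<odot>\<^bsub>U\<^esub> u E))"
    by (rule dual_finsum[OF fd finite_segments_between[OF B(1)] U_smult_carrier[OF uE]])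
  also have "\<dots> = (\<Sum>E\<in>segments_between A B. of_real (k E) * lam \<phi> (u E))"
    using fd uE \<phi> by (intro sum.cong) (auto simp: dual_def linear_functional_def)
  finally show ?thesis .
qed

context
  fixes cs :: "omega1 => nat => omega1" and \<xi> :: omega1 and c \<kappa> :: real and \<A>'
  assumes cs: "characteristic_sequences cs" and gb: "grothendieck_bound TYPE('k) c" "0 <= c"
    and A': "\<A>' = RB \<theta>' \<and> \<kappa> = 2 \<or> \<A>' = {UNIV} \<and> \<kappa> = 1"
    and s: "!!D. D \<in> RB \<theta> ==> sm X \<xi> X (cut D)" and s': "!!D. D \<in> \<A>' ==> sm Y \<xi> Y (cut D)"
begin

lemma wgame_collection:
  assumes "u \<in> collections_in_ball U" "weakly_null_collection U u"
  shows "wgame X Y (\<lambda>E \<phi>. lam \<phi> (u E)) cs c"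
  by (intro wgame.intro wfam_collection assms wgame_axioms.intro cs gb)

lemma \<kappa>_nonneg': "0 <= \<kappa> * c" using gb(2) A' by auto

text \<open>g, and with it M, is fixed before the functional; the dual ball then enters through
  \<open>dual_ball_form\<close>, and \<open>S_sum\<close> holds for all forms of norm at most
  1.\<close>

lemma S_property_C0:
  assumes e: "0 < e" shows "S_property cs \<xi> U U id (\<kappa> * c + 3 * e)"
  unfolding S_property_def
proof (intro ballI impI)
  fix u L assume u: "u \<in> collections_in_ball U" "weakly_null_collection U u" and L: "L \<in> inf_subsets {1..}"
  interpret wgame X Y "\<lambda>E \<phi>. lam \<phi> (u E)" cs \<xi> c by (rule wgame_collection[OF u])
  obtain g where g: "!!D \<phi> N. (!!n. P.vb g \<xi> (\<Union>k\<in>{1..n}. D k) (D (Suc n))) ==> form X Y \<phi> 1 ==>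
    (\<Sum>n<N. (norm (P.wp \<phi> \<xi> (\<Union>k\<in>{1..n}. D k) (D (Suc n))))\<^sup>2) <= (\<kappa> * c + 3 * e)\<^sup>2"
    using S_sum[OF ring_RB[OF pos(1)] ring_RB[OF pos(2)] meta_eq_to_obj_eq[OF X_def] meta_eq_to_obj_eq[OF Y_def] A' s s' e] by blast
  obtain M where M: "M \<in> inf_subsets L" "M \<in> inf_subsets {1..}"
    "!!n. P.vb g \<xi> (\<Union>k\<in>{1..n}. decomp (schreier cs \<xi>) M k) (decomp (schreier cs \<xi>) M (Suc n))"
    using L by (rule P.decomp_sparse_ex) (rule that)
  let ?D = "decomp (schreier cs \<xi>) M"
  have "weakly_summing_norm 2 U (\<lambda>n. id (average cs \<xi> U M u n)) <= ennreal (\<kappa> * c + 3 * e)"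
  proof (rule weakly_summing_norm_le)
    show "0 <= \<kappa> * c + 3 * e" using \<kappa>_nonneg' e by simp
    fix f N assume f: "f \<in> dual_ball U"
    obtain \<phi> where \<phi>: "form X Y \<phi> 1" "!!P. P \<in> carrier U ==> f P = lam \<phi> P"
      using f by (rule dual_ball_form) (rule that)
    have "f (average cs \<xi> U M u (Suc n)) = P.wp \<phi> \<xi> (\<Union>k\<in>{1..n}. ?D k) (?D (Suc n))" for n
    proof -
      have h: "hist (\<Union>k\<in>{1..Suc n}. ?D k)" using P.vbD(1)[OF M(3)[of "Suc n"]] .
      have "f (average cs \<xi> U M u (Suc n)) = (\<Sum>E\<in>segments_between (\<Union>k\<in>{1..n}. ?D k) (\<Union>k\<in>{1..Suc n}. ?D k).
          of_real (p_weight cs \<xi> E) * lam \<phi> (u E))"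
        unfolding average_def decomp_upto_def diff_Suc_1
        by (rule dual_average[OF f u(1) \<phi>(2)]) (use h in \<open>simp_all add: hist_def\<close>)
      thus ?thesis
        using P.sum_segments_between[OF P.vbD(3,2)[OF M(3)], of "\<lambda>E. lam \<phi> (u E)" n] by (simp add: p_weight_def)
    qed
    hence "(\<Sum>n<N. norm (f (id (average cs \<xi> U M u (Suc n)))) powr 2) =
        (\<Sum>n<N. (norm (P.wp \<phi> \<xi> (\<Union>k\<in>{1..n}. ?D k) (?D (Suc n))))\<^sup>2)" by simp
    also have "\<dots> <= (\<kappa> * c + 3 * e)\<^sup>2" by (rule g[OF M(3) \<phi>(1)])
    finally show "(\<Sum>n<N. norm (f (id (average cs \<xi> U M u (Suc n)))) powr 2) <= (\<kappa> * c + 3 * e) powr 2"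
      using \<kappa>_nonneg' e by simp
  qed simp
  with M(1) show "\<exists>M\<in>inf_subsets L. weakly_summing_norm 2 U (\<lambda>n. id (average cs \<xi> U M u n)) <= ennreal (\<kappa> * c + 3 * e)"
    by blast
qed

text \<open>The nullness assumption speaks of all families w because the collection is introduced
  only inside the proof. \<open>game.null\<close> with these arguments is nullness in the second
  game, written out where no interpretation is at hand.\<close>

lemma G_property_C0:
  assumes e: "0 < e"
    and n: "!!w. wgame X Y w cs c ==>
      (\<forall>D'\<in>RB \<theta>'. game.null cs (blk cs atom \<xi>) (q_mem cs \<xi>) (p_weight cs \<xi>) \<zeta> (TV w X (\<lambda>x. x) Y (cut D'))) \<and>
      (\<forall>D\<in>RB \<theta>. game.null cs (blk cs atom \<xi>) (q_mem cs \<xi>) (p_weight cs \<xi>) \<zeta> (TV w X (cut D) Y (\<lambda>y. y)))"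
  shows "G_property cs \<xi> \<zeta> U U id (\<kappa> * c + 10 * e)"
  unfolding G_property_def
proof (intro ballI impI)
  fix u L assume u: "u \<in> collections_in_ball U" "weakly_null_collection U u" and L: "L \<in> inf_subsets {1..}"
  interpret wgame X Y "\<lambda>E \<phi>. lam \<phi> (u E)" cs \<xi> c by (rule wgame_collection[OF u])
  have n1: "Q.null \<zeta> (TV (\<lambda>E \<phi>. lam \<phi> (u E)) X (\<lambda>x. x) Y (cut D'))" if "D' \<in> RB \<theta>'" for D'
    using n[OF wgame_collection[OF u]] that by blast
  have n2: "Q.null \<zeta> (TV (\<lambda>E \<phi>. lam \<phi> (u E)) X (cut D) Y (\<lambda>y. y))" if "D \<in> RB \<theta>" for D
    using n[OF wgame_collection[OF u]] that by blast
  obtain g where g: "!!D \<phi> N. (!!n. Q.vb g \<zeta> (\<Union>k\<in>{1..n}. D k) (D (Suc n))) ==> form X Y \<phi> 1 ==>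
    (\<Sum>n<N. norm (Q.wp \<phi> \<zeta> (\<Union>k\<in>{1..n}. D k) (D (Suc n)))) <= \<kappa> * c + 10 * e"
    using G_sum[OF ring_RB[OF pos(1)] ring_RB[OF pos(2)] meta_eq_to_obj_eq[OF X_def] meta_eq_to_obj_eq[OF Y_def] A' s s' e n1 n2] by blast
  obtain M where M: "M \<in> inf_subsets L" "M \<in> inf_subsets {1..}"
    "!!n. Q.vb g \<zeta> (\<Union>k\<in>{1..n}. decomp (schreier2 cs \<xi> \<zeta>) M k) (decomp (schreier2 cs \<xi> \<zeta>) M (Suc n))"
    using L by (rule Q.decomp_sparse_ex) (rule that)
  let ?D = "decomp (schreier2 cs \<xi> \<zeta>) M"
  have "weakly_summing_norm 1 U (\<lambda>n. id (average2 cs \<xi> \<zeta> U M u n)) <= ennreal (\<kappa> * c + 10 * e)"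
  proof (rule weakly_summing_norm_le)
    show "0 <= \<kappa> * c + 10 * e" using \<kappa>_nonneg' e by simp
    fix f N assume f: "f \<in> dual_ball U"
    obtain \<phi> where \<phi>: "form X Y \<phi> 1" "!!P. P \<in> carrier U ==> f P = lam \<phi> P"
      using f by (rule dual_ball_form) (rule that)
    have "f (average2 cs \<xi> \<zeta> U M u (Suc n)) = Q.wp \<phi> \<zeta> (\<Union>k\<in>{1..n}. ?D k) (?D (Suc n))" for n
    proof -
      have h: "hist (\<Union>k\<in>{1..Suc n}. ?D k)" using Q.vbD(1)[OF M(3)[of "Suc n"]] .
      have "f (average2 cs \<xi> \<zeta> U M u (Suc n)) = (\<Sum>E\<in>segments_between (\<Union>k\<in>{1..n}. ?D k) (\<Union>k\<in>{1..Suc n}. ?D k).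
          of_real (q_weight cs \<xi> \<zeta> E * p_weight cs \<xi> E) * lam \<phi> (u E))"
        unfolding average2_def decomp_upto_def diff_Suc_1
        by (rule dual_average[OF f u(1) \<phi>(2)]) (use h in \<open>simp_all add: hist_def\<close>)
      thus ?thesis
        using Q.sum_segments_between[OF Q.vbD(3,2)[OF M(3)], of "\<lambda>E. lam \<phi> (u E)" n] by (simp add: q_weight_def)
    qed
    hence "(\<Sum>n<N. norm (f (id (average2 cs \<xi> \<zeta> U M u (Suc n)))) powr 1) =
        (\<Sum>n<N. norm (Q.wp \<phi> \<zeta> (\<Union>k\<in>{1..n}. ?D k) (?D (Suc n))))" by simp
    also have "\<dots> <= \<kappa> * c + 10 * e" by (rule g[OF M(3) \<phi>(1)])
    finally show "(\<Sum>n<N. norm (f (id (average2 cs \<xi> \<zeta> U M u (Suc n)))) powr 1) <= (\<kappa> * c + 10 * e) powr 1"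
      using \<kappa>_nonneg' e by simp
  qed simp
  with M(1) show "\<exists>M\<in>inf_subsets L. weakly_summing_norm 1 U (\<lambda>n. id (average2 cs \<xi> \<zeta> U M u n)) <= ennreal (\<kappa> * c + 10 * e)"
    by blast
qed

end

end

text \<open>D is bounded by some b below \<open>theta \<xi>\<close>, so cutting to D factors through
  C[0,b], and there every operator has level \<xi>.\<close>

lemma sm_cut_theta:
  fixes X :: "(omega1 => 'k::real_normed_field) set"
  assumes X: "X = Sp (RB (theta \<xi>))" and D: "D \<in> RB (theta \<xi>)"
  shows "sm X \<xi> X (cut D)"
proof -
  note R = ring_RB[OF theta_pos]
  obtain b where b: "b < theta \<xi>" "D \<subseteq> {..b}" using D by (auto simp: RB_def)
  have "op X (Sp (RB (osuc b))) (cut D) 1"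
  proof (rule op_cut)
    fix f assume "f \<in> X"
    hence "cut D f \<in> Sp {B \<in> RB (theta \<xi>). B \<subseteq> D}" unfolding X by (rule Sp_cut[OF R _ D])
    moreover have "{B \<in> RB (theta \<xi>). B \<subseteq> D} \<subseteq> RB (osuc b)" unfolding RB_osuc using b(2) by (auto simp: RB_def)
    ultimately show "cut D f \<in> Sp (RB (osuc b))" using Sp_mono by blast
  qed
  from goodD[OF good_below_theta[OF _ b(1)] this]
  have "sm X \<xi> (Sp (RB (osuc b))) (cut D)" using fspace_Sp X by blast
  moreover have "op (Sp (RB (osuc b))) X (\<lambda>f. f) 1"
    unfolding X RB_osuc using b(1) by (intro op_incl Sp_mono) (auto simp: RB_def)
  ultimately show ?thesis using sm.comp fspace_Sp unfolding X by blast
qed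

lemma (in wgame) Q_null_identity:
  assumes X: "X = Sp (RB (theta \<xi>))" and Y: "Y = Sp (RB (theta \<zeta>))" and "\<zeta> <= \<xi>" "D \<in> RB (theta \<zeta>)"
  shows "Q.null (1 + \<zeta>) (TV w X (\<lambda>x. x) Y (cut D))"
  using Q_null_right[OF ring_RB[OF theta_pos] _ _ sm_cut_theta[OF Y assms(4)] assms(3), of \<xi> "\<lambda>x. x" 1]
    op_id[of X] sm_cut_theta[OF X] by (simp add: X)

lemma properties_C0_tensor:
  fixes K :: "'k::{real_normed_field,banach} itself"
  assumes cs: "characteristic_sequences cs" and gb: "grothendieck_bound K c" "0 <= c"
    and \<kappa>: "\<zeta> < \<xi> \<and> \<kappa> = 1 \<or> \<zeta> = \<xi> \<and> \<kappa> = 2" and e: "0 < e"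
  shows "S_property cs \<xi> (C0_tensor K \<xi> \<zeta>) (C0_tensor K \<xi> \<zeta>) id (\<kappa> * c + 3 * e)"
    "G_property cs \<xi> (1 + \<zeta>) (C0_tensor K \<xi> \<zeta>) (C0_tensor K \<xi> \<zeta>) id (\<kappa> * c + 10 * e)"
proof -
  define X Y :: "'k fn set" where XR: "X = Sp (RB (theta \<xi>))" and YR: "Y = Sp (RB (theta \<zeta>))"
  interpret C0_pair "theta \<xi>" "theta \<zeta>" "Sp (RB (theta \<xi>)) :: 'k fn set" "Sp (RB (theta \<zeta>)) :: 'k fn set"
    "C0_space (theta \<xi>)" "C0_space (theta \<zeta>)"
    by unfold_locales (rule theta_pos)+
  have U: "C0_tensor K \<xi> \<zeta> = U"
    by (simp add: C0_tensor_def completed_projective_tensor_def theta_def)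
  have gb': "grothendieck_bound TYPE('k) c" using gb(1) by (simp add: grothendieck_bound_def)
  \<comment> \<open>For \<kappa> = 1 the second factor is left uncut, which removes its contribution
    c from the final bound.\<close>
  define \<A>' where "\<A>' = (if \<kappa> = 2 then RB (theta \<zeta>) else {UNIV})"
  have A': "\<A>' = RB (theta \<zeta>) \<and> \<kappa> = 2 \<or> \<A>' = {UNIV} \<and> \<kappa> = 1" using \<kappa> by (auto simp: \<A>'_def)
  \<comment> \<open>For \<zeta> < \<xi> the cuts of the second space have level \<zeta>, so the
    identity itself has level \<xi> by a single localisation. This is what makes the choice {UNIV}
    admissible.\<close>
  have id: "sm Y \<xi> Y (\<lambda>y. y)" if "\<zeta> < \<xi>"
    unfolding YR by (rule sm.loc[OF that ring_RB[OF theta_pos] op_id]) (rule sm_cut_theta[OF refl])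
  have s: "sm X \<xi> X (cut D)" if "D \<in> RB (theta \<xi>)" for D by (rule sm_cut_theta[OF XR that])
  have s': "sm Y \<xi> Y (cut D)" if "D \<in> \<A>'" for D
    using \<kappa>
  proof
    assume "\<zeta> = \<xi> \<and> \<kappa> = 2"
    thus ?thesis using sm_cut_theta[OF YR] that by (simp add: \<A>'_def)
  next
    assume k: "\<zeta> < \<xi> \<and> \<kappa> = 1"
    hence "cut D = (\<lambda>y :: omega1 => 'k. y)" using that by (auto simp: \<A>'_def cut_def fun_eq_iff)
    thus ?thesis using id k by simp
  qed
  show "S_property cs \<xi> (C0_tensor K \<xi> \<zeta>) (C0_tensor K \<xi> \<zeta>) id (\<kappa> * c + 3 * e)"
    unfolding U by (rule S_property_C0[OF cs gb' gb(2) A' s[unfolded XR] s'[unfolded YR] e])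
  have n: "(\<forall>D'\<in>RB (theta \<zeta>). game.null cs (blk cs atom \<xi>) (q_mem cs \<xi>) (p_weight cs \<xi>) (1 + \<zeta>) (TV w X (\<lambda>x. x) Y (cut D'))) \<and>
      (\<forall>D\<in>RB (theta \<xi>). game.null cs (blk cs atom \<xi>) (q_mem cs \<xi>) (p_weight cs \<xi>) (1 + \<zeta>) (TV w X (cut D) Y (\<lambda>y. y)))"
    if w: "wgame X Y w cs c" for w
  proof -
    interpret wgame X Y w cs \<xi> c by (rule w)
    have "Q.null (1 + \<zeta>) (TV w X (cut D) Y (\<lambda>y. y))" if D: "D \<in> RB (theta \<xi>)" for D
      using \<kappa>
    proof
      assume "\<zeta> < \<xi> \<and> \<kappa> = 1"
      thus ?thesis using Q_null[OF P_null[OF s[OF D] id]] by simp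
    next
      assume k: "\<zeta> = \<xi> \<and> \<kappa> = 2"
      \<comment> \<open>For \<zeta> = \<xi> the situation is symmetric, and this half is the other
        one with the factors exchanged.\<close>
      interpret F: wgame Y X "\<lambda>E \<phi>. w E (flip \<phi>)" cs \<xi> c by (rule wgame_flip)
      have "Q.null (1 + \<xi>) (TV (\<lambda>E \<phi>. w E (flip \<phi>)) Y (\<lambda>x. x) X (cut D))"
        by (rule F.Q_null_identity) (use XR YR D k in auto)
      thus ?thesis unfolding TV_flip using k by simp
    qed
    moreover have "Q.null (1 + \<zeta>) (TV w X (\<lambda>x. x) Y (cut D))" if "D \<in> RB (theta \<zeta>)" for D
      by (rule Q_null_identity[OF XR YR _ that]) (use \<kappa> in auto)
    ultimately show ?thesis by blast
  qed
  show "G_property cs \<xi> (1 + \<zeta>) (C0_tensor K \<xi> \<zeta>) (C0_tensor K \<xi> \<zeta>) id (\<kappa> * c + 10 * e)"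
    unfolding U by (rule G_property_C0[OF cs gb' gb(2) A' s[unfolded XR] s'[unfolded YR] e n[unfolded XR YR]])
qed

lemma Inf_ennreal_le:
  assumes "0 <= a" "0 < b" "!!e. 0 < e ==> P (a + b * e)"
  shows "Inf (ennreal ` {\<gamma>. 0 <= \<gamma> \<and> P \<gamma>}) <= ennreal a"
proof (rule ennreal_le_epsilon)
  fix e :: real assume "0 < e"
  hence "P (a + e)" using assms(3)[of "e / b"] assms(2) by simp
  hence "Inf (ennreal ` {\<gamma>. 0 <= \<gamma> \<and> P \<gamma>}) <= ennreal (a + e)" using assms(1) \<open>0 < e\<close> by (intro Inf_lower imageI) auto
  thus "Inf (ennreal ` {\<gamma>. 0 <= \<gamma> \<and> P \<gamma>}) <= ennreal a + ennreal e" using assms(1) \<open>0 < e\<close> by simp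
qed

lemma constants_C0_tensor:
  fixes K :: "'k::{real_normed_field,banach} itself"
  assumes cs: "characteristic_sequences cs" and \<kappa>: "\<zeta> < \<xi> \<and> \<kappa> = 1 \<or> \<zeta> = \<xi> \<and> \<kappa> = 2"
  shows "max (s_space cs \<xi> (C0_tensor K \<xi> \<zeta>)) (g_space cs \<xi> (1 + \<zeta>) (C0_tensor K \<xi> \<zeta>)) <= ennreal \<kappa> * k_G K"
proof -
  let ?m = "max (s_space cs \<xi> (C0_tensor K \<xi> \<zeta>)) (g_space cs \<xi> (1 + \<zeta>) (C0_tensor K \<xi> \<zeta>))"
  have k: "0 < \<kappa>" using \<kappa> by auto
  have le: "?m <= ennreal (\<kappa> * c)" if c: "0 <= c" "grothendieck_bound K c" for c
    unfolding max.bounded_iff s_space_def s_op_def g_space_def g_op_def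
    using properties_C0_tensor[OF cs c(2,1) \<kappa>] c(1) k
    by (intro conjI Inf_ennreal_le[where b = 3] Inf_ennreal_le[where b = 10]) auto
  \<comment> \<open>Dividing by \<kappa> first lets each admissible c be compared with the infimum
    that defines the constant.\<close>
  have "?m / ennreal \<kappa> <= k_G K"
    unfolding grothendieck_constant_def
  proof (rule Inf_greatest)
    fix x assume "x \<in> ennreal ` {c. 0 <= c \<and> grothendieck_bound K c}"
    then obtain c where c: "0 <= c" "grothendieck_bound K c" "x = ennreal c" by blast
    have "?m / ennreal \<kappa> <= ennreal (\<kappa> * c) / ennreal \<kappa>" by (rule divide_right_mono_ennreal[OF le[OF c(1,2)]])
    also have "\<dots> = x" using c(1,3) k by (simp add: divide_ennreal)
    finally show "?m / ennreal \<kappa> <= x" .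
  qed
  hence "ennreal \<kappa> * (?m / ennreal \<kappa>) <= ennreal \<kappa> * k_G K" by (rule mult_left_mono) simp
  moreover have "ennreal \<kappa> * (?m / ennreal \<kappa>) = ?m * ennreal \<kappa> / ennreal \<kappa>"
    by (simp add: ennreal_times_divide mult.commute)
  moreover have "\<dots> = ?m" using k by (intro mult_divide_eq_ennreal) auto
  ultimately show ?thesis by simp
qed

theorem theorem17p2:
  fixes cs :: "omega1 \<Rightarrow> nat \<Rightarrow> omega1"
  assumes "characteristic_sequences cs"
  shows "(\<forall>\<xi> \<zeta>. \<zeta> < \<xi> \<longrightarrow>
            max (s_space cs \<xi> (C0_tensor TYPE(real) \<xi> \<zeta>))
                (g_space cs \<xi> (1 + \<zeta>) (C0_tensor TYPE(real) \<xi> \<zeta>)) \<le> k_G TYPE(real)) \<and>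
         (\<forall>\<xi>. max (s_space cs \<xi> (C0_tensor TYPE(real) \<xi> \<xi>))
                (g_space cs \<xi> (1 + \<xi>) (C0_tensor TYPE(real) \<xi> \<xi>)) \<le> 2 * k_G TYPE(real)) \<and>
         (\<forall>\<xi> \<zeta>. \<zeta> < \<xi> \<longrightarrow>
            max (s_space cs \<xi> (C0_tensor TYPE(complex) \<xi> \<zeta>))
                (g_space cs \<xi> (1 + \<zeta>) (C0_tensor TYPE(complex) \<xi> \<zeta>)) \<le> k_G TYPE(complex)) \<and>
         (\<forall>\<xi>. max (s_space cs \<xi> (C0_tensor TYPE(complex) \<xi> \<xi>))
                (g_space cs \<xi> (1 + \<xi>) (C0_tensor TYPE(complex) \<xi> \<xi>)) \<le> 2 * k_G TYPE(complex))"
proof (intro conjI allI impI, goal_cases)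
  case (1 \<xi> \<zeta>)
  thus ?case using constants_C0_tensor[OF assms, of \<zeta> \<xi> 1 "TYPE(real)"] by simp
next
  case (2 \<xi>)
  thus ?case using constants_C0_tensor[OF assms, of \<xi> \<xi> 2 "TYPE(real)"] by simp
next
  case (3 \<xi> \<zeta>)
  thus ?case using constants_C0_tensor[OF assms, of \<zeta> \<xi> 1 "TYPE(complex)"] by simp
next
  case (4 \<xi>)
  thus ?case using constants_C0_tensor[OF assms, of \<xi> \<xi> 2 "TYPE(complex)"] by simp
qed

end
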